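(* (1) Let $X$ be a simple abelian variety over $\mathbb{C}$ such that $\mathrm{End}_{\mathbb{Q}}(X)$ is isomorphic to a totally real number field, a totally definite quaternion algebra, or a CM-field, and let $f\in\mathrm{End}(X)$ be a non-zero endomorphism. Then: (a) Suppose $\mathrm{End}_{\mathbb{Q}}(X)$ is a totally real number field. Then the function $n\mapsto \#\mathrm{Fix}(f^n)$ is periodic if $f=\pm\mathrm{id}_X$, and it grows exponentially otherwise. (b) Suppose $\mathrm{End}_{\mathbb{Q}}(X)$ is a totally definite quaternion algebra, i.e. it is of the form $F+iF+jF+ijF$ with $i^2=\alpha\in F\setminus\{0\}$, $j^2=\beta\in F\setminus\{0\}$ and $ij=-ji$, where $F$ is a totally real number field and $\mathrm{End}_{\mathbb{Q}}(X)\otimes_\sigma\mathbb{R}\simeq\mathbb{H}$ for every embedding $\sigma:F\hookrightarrow\mathbb{R}$. Write $f=a+bi+cj+dij$ with $a,b,c,d\in F$. Then $n\mapsto\#\mathrm{Fix}(f^n)$ is periodic if $|a+\sqrt{b^2\alpha+c^2\beta-d^2\alpha\beta}|=1$, and it grows exponentially otherwise. (c) Suppose $\mathrm{End}_{\mathbb{Q}}(X)$ is a CM-field. Then $n\mapsto\#\mathrm{Fix}(f^n)$ is periodic if $|f|=1$, and it grows exponentially otherwise. Moreover, in each of the cases (a), (b), (c): if $n\mapsto\#\mathrm{Fix}(f^n)$ is periodic, then all analytic eigenvalues of $f$ are roots of unity, and if it grows exponentially, then all analytic eigenvalues of $f$ are of absolute value $\neq 1$. (2) There exist simple abelian varieties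 $X$ over $\mathbb{C}$ with totally indefinite quaternion multiplication (i.e. $\mathrm{End}_{\mathbb{Q}}(X)$ is a totally indefinite quaternion algebra) possessing endomorphisms with analytic eigenvalues of absolute value $1$ which are not roots of unity.
   Context: For an abelian variety $X$ over $\mathbb{C}$, $\mathrm{End}_{\mathbb{Q}}(X)=\mathrm{End}(X)\otimes_{\mathbb{Z}}\mathbb{Q}$. The analytic eigenvalues of $f\in\mathrm{End}(X)$ are the eigenvalues of its analytic representation $\rho_a(f)\in \mathrm{M}_g(\mathbb{C})$, $g=\dim X$ (the induced linear map on the tangent space at $0$). $\#\mathrm{Fix}(f)$ is the number of fixed points of $f$, with the convention $\#\mathrm{Fix}(f)=0$ if $f$ has infinitely many fixed points; thus $\#\mathrm{Fix}(f^n)=\prod_{i=1}^g|1-\lambda_i^n|^2$, where $\lambda_1,\dots,\lambda_g$ are the analytic eigenvalues of $f$. The function $n\mapsto\#\mathrm{Fix}(f^n)$ ($n\ge 1$) is periodic if there is $p\ge1$ with $\#\mathrm{Fix}(f^{n+p})=\#\mathrm{Fix}(f^n)$ for all $n\geq 1$; it grows exponentially if there are real constants $A,B>1$ and an integer $N$ with $A^n\le\#\mathrm{Fix}(f^n)\le B^n$ for all $n\ge N$. A totally real number field is a number field $F$ with $\sigma(F)\subset\mathbb{R}$ for all embeddings $\sigma:F\hookrightarrow\mathbb{C}$ ($F=\mathbb{Q}$ is allowed). A CM-field is a totally imaginary quadratic extension of a totally real number field. A quaternion algebra $B$ over a totally real number field $F$ is totally definite if $B\otimes_\sigma\mathbb{R}\simeq\mathbb{H}$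 for every embedding $\sigma:F\hookrightarrow\mathbb{R}$, and totally indefinite if $B\otimes_\sigma\mathbb{R}\simeq \mathrm{M}_2(\mathbb{R})$ for every such $\sigma$. Absolute values of elements of a number field are taken with respect to an embedding into $\mathbb{C}$: in (c), $|f|=|\sigma(f)|$ for an embedding $\sigma$ of the CM-field $\mathrm{End}_{\mathbb{Q}}(X)$ into $\mathbb{C}$; in (b), $|a+\sqrt{t}|$ with $t=b^2\alpha+c^2\beta-d^2\alpha\beta\in F$ is $|\sigma(a)+\sqrt{\sigma(t)}|$ for an embedding $\sigma:F\hookrightarrow\mathbb{R}$, where $\sqrt{\sigma(t)}$ is a complex square root. In these situations, whether the absolute value equals $1$ does not depend on the choices made. *)

theory Defs
  imports
    "Jordan_Normal_Form.Char_Poly"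
    "Jordan_Normal_Form.VS_Connect"
    "HOL-Algebra.Embedded_Algebras"
    "HOL-Algebra.Generated_Fields"
    "HOL-Algebra.QuotRing"
    "HOL-Analysis.L2_Norm"
begin

section \<open>Complex tori and abelian varieties\<close>

text \<open>
  An abelian variety over the complex numbers is a complex torus \<open>\<complex>\<^sup>g / L\<close> that admits a
  polarization, i.e. a positive definite Hermitian form whose imaginary part is integral on the
  lattice \<open>L\<close>.  It is given here by the pair of \<open>g\<close> and \<open>L\<close>; vectors are those of
  \<open>Jordan_Normal_Form\<close>, so that the dimension \<open>g\<close> can be quantified over.
\<close>

text \<open>The columns of \<open>P\<close> are an \<open>\<real>\<close>-basis of \<open>W\<close> and a \<open>\<int>\<close>-basis of \<open>L\<close>.\<close>

definition lattice_in :: "nat \<Rightarrow> complex vec set \<Rightarrow> complex vec set \<Rightarrow> bool" where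
  "lattice_in g W L \<longleftrightarrow> (\<exists>n. \<exists>P \<in> carrier_mat g n.
     (\<forall>x \<in> carrier_vec n. P *\<^sub>v map_vec complex_of_real x = 0\<^sub>v g \<longrightarrow> x = 0\<^sub>v n) \<and>
     W = (\<lambda>x. P *\<^sub>v map_vec complex_of_real x) ` carrier_vec n \<and>
     L = (\<lambda>x. P *\<^sub>v map_vec complex_of_int x) ` carrier_vec n)"

definition herm_form :: "complex mat \<Rightarrow> complex vec \<Rightarrow> complex vec \<Rightarrow> complex" where
  "herm_form H v w = (H *\<^sub>v v) \<bullet>c w"

definition polarization :: "nat \<Rightarrow> complex vec set \<Rightarrow> complex mat \<Rightarrow> bool" where
  "polarization g L H \<longleftrightarrow> H \<in> carrier_mat g g \<and>
     (\<forall>v \<in> carrier_vec g. \<forall>w \<in> carrier_vec g. herm_form H w v = cnj (herm_form H v w)) \<and>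
     (\<forall>v \<in> carrier_vec g. v \<noteq> 0\<^sub>v g \<longrightarrow> Re (herm_form H v v) > 0) \<and>
     (\<forall>v \<in> L. \<forall>w \<in> L. Im (herm_form H v w) \<in> \<int>)"

definition abelian_variety :: "nat \<Rightarrow> complex vec set \<Rightarrow> bool" where
  "abelian_variety g L \<longleftrightarrow> lattice_in g (carrier_vec g) L \<and> (\<exists>H. polarization g L H)"

definition torus :: "nat \<Rightarrow> complex vec set \<Rightarrow> complex vec set monoid" where
  "torus g L = monoid_vec TYPE(complex) g Mod L"

definition torus_proj :: "nat \<Rightarrow> complex vec set \<Rightarrow> complex vec \<Rightarrow> complex vec set" where
  "torus_proj g L v = L #>\<^bsub>monoid_vec TYPE(complex) g\<^esub> v"

text \<open>
  The abelian subvarieties of \<open>\<complex>\<^sup>g / L\<close> are its subtori, that is, the images of those complex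
  subspaces \<open>W\<close> in which \<open>W \<inter> L\<close> is a lattice: a polarization restricts to every subtorus.
\<close>

definition abelian_subvariety :: "nat \<Rightarrow> complex vec set \<Rightarrow> complex vec set set \<Rightarrow> bool" where
  "abelian_subvariety g L Y \<longleftrightarrow> (\<exists>W. subspace class_ring W (module_vec TYPE(complex) g) \<and>
     lattice_in g W (W \<inter> L) \<and> Y = torus_proj g L ` W)"

definition simple_abelian_variety :: "nat \<Rightarrow> complex vec set \<Rightarrow> bool" where
  "simple_abelian_variety g L \<longleftrightarrow> abelian_variety g L \<and> g \<noteq> 0 \<and>
     (\<forall>Y. abelian_subvariety g L Y \<longrightarrow> Y = {\<one>\<^bsub>torus g L\<^esub>} \<or> Y = carrier (torus g L))"


section \<open>Endomorphisms and their analytic representation\<close>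

definition vnorm :: "complex vec \<Rightarrow> real" where
  "vnorm v = L2_set (\<lambda>i. cmod (v $ i)) {..<dim_vec v}"

definition has_complex_deriv ::
    "nat \<Rightarrow> (complex vec \<Rightarrow> complex vec) \<Rightarrow> complex vec \<Rightarrow> complex mat \<Rightarrow> bool" where
  "has_complex_deriv g F v A \<longleftrightarrow> A \<in> carrier_mat g g \<and>
     (\<forall>\<epsilon>>0. \<exists>\<delta>>0. \<forall>h \<in> carrier_vec g. vnorm h < \<delta> \<longrightarrow>
        vnorm (F (v + h) - F v - A *\<^sub>v h) \<le> \<epsilon> * vnorm h)"

text \<open>
  The charts of \<open>\<complex>\<^sup>g / L\<close> are the local inverses of the projection.  Hence \<open>f\<close> is holomorphic
  near the image of \<open>v\<close> iff it has a holomorphic (i.e. complex differentiable) lift \<open>F\<close> on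
  some ball around \<open>v\<close>.
\<close>

definition local_lift :: "nat \<Rightarrow> complex vec set \<Rightarrow> (complex vec set \<Rightarrow> complex vec set) \<Rightarrow>
    complex vec \<Rightarrow> (complex vec \<Rightarrow> complex vec) \<Rightarrow> bool" where
  "local_lift g L f v F \<longleftrightarrow> (\<exists>r>0. \<forall>w \<in> carrier_vec g. vnorm (w - v) < r \<longrightarrow>
     F w \<in> carrier_vec g \<and> (\<exists>A. has_complex_deriv g F w A) \<and>
     f (torus_proj g L w) = torus_proj g L (F w))"

definition holomorphic_map ::
    "nat \<Rightarrow> complex vec set \<Rightarrow> (complex vec set \<Rightarrow> complex vec set) \<Rightarrow> bool" where
  "holomorphic_map g L f \<longleftrightarrow> (\<forall>v \<in> carrier_vec g. \<exists>F. local_lift g L f v F)"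

definition End_ring ::
    "nat \<Rightarrow> complex vec set \<Rightarrow> (complex vec set \<Rightarrow> complex vec set) ring" where
  "End_ring g L = \<lparr>
     carrier = {f \<in> hom (torus g L) (torus g L) \<inter> extensional (carrier (torus g L)).
                  holomorphic_map g L f},
     mult = compose (carrier (torus g L)),
     one = (\<lambda>x \<in> carrier (torus g L). x),
     zero = (\<lambda>x \<in> carrier (torus g L). \<one>\<^bsub>torus g L\<^esub>),
     add = (\<lambda>f h. \<lambda>x \<in> carrier (torus g L). f x \<otimes>\<^bsub>torus g L\<^esub> h x)\<rparr>"

text \<open>
  The differential of \<open>f\<close> at \<open>0\<close> in the coordinates of the tangent space \<open>\<complex>\<^sup>g\<close>.  Two lifts of
  \<open>f\<close> near \<open>0\<close> differ by a constant in \<open>L\<close>, so it does not depend on the lift.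
\<close>

definition analytic_rep ::
    "nat \<Rightarrow> complex vec set \<Rightarrow> (complex vec set \<Rightarrow> complex vec set) \<Rightarrow> complex mat" where
  "analytic_rep g L f =
     (THE A. \<exists>F. local_lift g L f (0\<^sub>v g) F \<and> has_complex_deriv g F (0\<^sub>v g) A)"

text \<open>
  The algebra \<open>End(X) \<otimes> \<rat>\<close>, realized inside the complex \<open>g \<times> g\<close> matrices.  The analytic
  representation is an injective ring homomorphism and its target is a \<open>\<rat>\<close>-algebra, so it
  identifies \<open>End(X) \<otimes> \<rat>\<close>, all of whose elements are of the form \<open>f \<otimes> 1/n\<close>, with the
  \<open>\<rat>\<close>-span of its image.  The element of this algebra given by \<open>f\<close> is \<open>analytic_rep g L f\<close>.
\<close>

definition End_Q :: "nat \<Rightarrow> complex vec set \<Rightarrow> complex mat ring" where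
  "End_Q g L = ring_mat TYPE(complex) g ()
     \<lparr>carrier := {A \<in> carrier_mat g g. \<exists>f \<in> carrier (End_ring g L). \<exists>n::nat. n > 0 \<and>
                     of_nat n \<cdot>\<^sub>m A = analytic_rep g L f}\<rparr>"

abbreviation analytic_eigenvalue ::
    "nat \<Rightarrow> complex vec set \<Rightarrow> (complex vec set \<Rightarrow> complex vec set) \<Rightarrow> complex \<Rightarrow> bool" where
  "analytic_eigenvalue g L f z \<equiv> eigenvalue (analytic_rep g L f) z"


section \<open>Number fields and quaternion algebras\<close>

text \<open>The field generated by \<open>\<one>\<close> is the prime field, a copy of \<open>\<rat>\<close> in characteristic \<open>0\<close>.\<close>

definition number_field :: "'a ring \<Rightarrow> bool" where
  "number_field K \<longleftrightarrow> field K \<and> (\<forall>n::nat. n > 0 \<longrightarrow> [n] \<cdot>\<^bsub>K\<^esub> \<one>\<^bsub>K\<^esub> \<noteq> \<zero>\<^bsub>K\<^esub>) \<and>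
     (\<exists>d. ring.dimension K d (generate_field K {\<one>\<^bsub>K\<^esub>}) (carrier K))"

abbreviation complex_embeddings :: "'a ring \<Rightarrow> ('a \<Rightarrow> complex) set" where
  "complex_embeddings K \<equiv> ring_hom K class_ring"

abbreviation real_embeddings :: "'a ring \<Rightarrow> ('a \<Rightarrow> real) set" where
  "real_embeddings K \<equiv> ring_hom K class_ring"

definition totally_real_field :: "'a ring \<Rightarrow> bool" where
  "totally_real_field K \<longleftrightarrow> number_field K \<and>
     (\<forall>\<sigma> \<in> complex_embeddings K. \<sigma> ` carrier K \<subseteq> \<real>)"

definition CM_field :: "'a ring \<Rightarrow> bool" where
  "CM_field K \<longleftrightarrow> number_field K \<and>
     (\<forall>\<sigma> \<in> complex_embeddings K. \<not> \<sigma> ` carrier K \<subseteq> \<real>) \<and>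
     (\<exists>F. subfield F K \<and> totally_real_field (K\<lparr>carrier := F\<rparr>) \<and>
          ring.dimension K 2 F (carrier K))"

text \<open>\<open>B = F \<oplus> F i \<oplus> F j \<oplus> F i j\<close> with \<open>F\<close> central, \<open>i\<^sup>2, j\<^sup>2 \<in> F - {0}\<close> and \<open>i j = - j i\<close>.\<close>

definition quaternion_algebra :: "'a ring \<Rightarrow> 'a set \<Rightarrow> 'a \<Rightarrow> 'a \<Rightarrow> bool" where
  "quaternion_algebra B F i j \<longleftrightarrow> ring B \<and> subfield F B \<and>
     (\<forall>a \<in> F. \<forall>x \<in> carrier B. a \<otimes>\<^bsub>B\<^esub> x = x \<otimes>\<^bsub>B\<^esub> a) \<and>
     i \<in> carrier B \<and> j \<in> carrier B \<and>
     i \<otimes>\<^bsub>B\<^esub> i \<in> F - {\<zero>\<^bsub>B\<^esub>} \<and> j \<otimes>\<^bsub>B\<^esub> j \<in> F - {\<zero>\<^bsub>B\<^esub>} \<and>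
     i \<otimes>\<^bsub>B\<^esub> j = \<ominus>\<^bsub>B\<^esub> (j \<otimes>\<^bsub>B\<^esub> i) \<and>
     (\<forall>x \<in> carrier B. \<exists>!(a, b, c, d). a \<in> F \<and> b \<in> F \<and> c \<in> F \<and> d \<in> F \<and>
        x = a \<oplus>\<^bsub>B\<^esub> b \<otimes>\<^bsub>B\<^esub> i \<oplus>\<^bsub>B\<^esub> c \<otimes>\<^bsub>B\<^esub> j \<oplus>\<^bsub>B\<^esub> d \<otimes>\<^bsub>B\<^esub> (i \<otimes>\<^bsub>B\<^esub> j))"

text \<open>
  The real algebra with basis \<open>1, i, j, ij\<close> and \<open>i\<^sup>2 = \<alpha>\<close>, \<open>j\<^sup>2 = \<beta>\<close>, \<open>i j = - j i\<close>; the
  tuple \<open>(a, b, c, d)\<close> stands for \<open>a + b i + c j + d i j\<close>.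
\<close>

definition real_quat :: "real \<Rightarrow> real \<Rightarrow> (real \<times> real \<times> real \<times> real) ring" where
  "real_quat \<alpha> \<beta> = \<lparr>
     carrier = UNIV,
     mult = (\<lambda>(a, b, c, d) (a', b', c', d').
       (a * a' + \<alpha> * b * b' + \<beta> * c * c' - \<alpha> * \<beta> * d * d',
        a * b' + b * a' - \<beta> * c * d' + \<beta> * d * c',
        a * c' + c * a' + \<alpha> * b * d' - \<alpha> * d * b',
        a * d' + d * a' + b * c' - c * b')),
     one = (1, 0, 0, 0),
     zero = (0, 0, 0, 0),
     add = (\<lambda>(a, b, c, d) (a', b', c', d'). (a + a', b + b', c + c', d + d'))\<rparr>"

abbreviation hamilton_quaternions :: "(real \<times> real \<times> real \<times> real) ring" where
  "hamilton_quaternions \<equiv> real_quat (-1) (-1)"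

text \<open>
  The scalar extension of \<open>B\<close> along \<open>\<sigma>\<close> has the same basis \<open>1, i, j, ij\<close>, with the structure
  constants \<open>i\<^sup>2, j\<^sup>2 \<in> F\<close> replaced by their images under \<open>\<sigma>\<close>.  An isomorphism of rings to
  the quaternions or to the real \<open>2 \<times> 2\<close> matrices is automatically \<open>\<real>\<close>-linear, since it maps
  centre to centre and the field of real numbers has no nontrivial automorphism.
\<close>

definition scalar_extension ::
    "'a ring \<Rightarrow> 'a \<Rightarrow> 'a \<Rightarrow> ('a \<Rightarrow> real) \<Rightarrow> (real \<times> real \<times> real \<times> real) ring" where
  "scalar_extension B i j \<sigma> = real_quat (\<sigma> (i \<otimes>\<^bsub>B\<^esub> i)) (\<sigma> (j \<otimes>\<^bsub>B\<^esub> j))"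

definition totally_definite_quaternion_algebra ::
    "'a ring \<Rightarrow> 'a set \<Rightarrow> 'a \<Rightarrow> 'a \<Rightarrow> bool" where
  "totally_definite_quaternion_algebra B F i j \<longleftrightarrow>
     quaternion_algebra B F i j \<and> totally_real_field (B\<lparr>carrier := F\<rparr>) \<and>
     (\<forall>\<sigma> \<in> real_embeddings (B\<lparr>carrier := F\<rparr>).
        scalar_extension B i j \<sigma> \<simeq> hamilton_quaternions)"

definition totally_indefinite_quaternion_algebra ::
    "'a ring \<Rightarrow> 'a set \<Rightarrow> 'a \<Rightarrow> 'a \<Rightarrow> bool" where
  "totally_indefinite_quaternion_algebra B F i j \<longleftrightarrow>
     quaternion_algebra B F i j \<and> totally_real_field (B\<lparr>carrier := F\<rparr>) \<and>
     (\<forall>\<sigma> \<in> real_embeddings (B\<lparr>carrier := F\<rparr>).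
        scalar_extension B i j \<sigma> \<simeq> ring_mat TYPE(real) 2 ())"


section \<open>Fixed point numbers\<close>

text \<open>As \<open>card\<close> is \<open>0\<close> on infinite sets, infinitely many fixed points are counted as \<open>0\<close>.\<close>

definition num_fix :: "nat \<Rightarrow> complex vec set \<Rightarrow> (complex vec set \<Rightarrow> complex vec set) \<Rightarrow> nat" where
  "num_fix g L f = card {x \<in> carrier (torus g L). f x = x}"

definition fix_fun ::
    "nat \<Rightarrow> complex vec set \<Rightarrow> (complex vec set \<Rightarrow> complex vec set) \<Rightarrow> nat \<Rightarrow> nat" where
  "fix_fun g L f n = num_fix g L (f ^^ n)"

definition periodic_fun :: "(nat \<Rightarrow> nat) \<Rightarrow> bool" where
  "periodic_fun h \<longleftrightarrow> (\<exists>p\<ge>1. \<forall>n\<ge>1. h (n + p) = h n)"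

definition grows_exponentially :: "(nat \<Rightarrow> nat) \<Rightarrow> bool" where
  "grows_exponentially h \<longleftrightarrow> (\<exists>A B :: real. A > 1 \<and> B > 1 \<and>
     (\<exists>N. \<forall>n\<ge>N. A ^ n \<le> real (h n) \<and> real (h n) \<le> B ^ n))"

definition root_of_unity :: "complex \<Rightarrow> bool" where
  "root_of_unity z \<longleftrightarrow> (\<exists>k::nat. k \<ge> 1 \<and> z ^ k = 1)"

end

theory Submission
  imports Defs "Jordan_Normal_Form.Schur_Decomposition" "HOL-Algebra.Multiplicative_Group"
    "HOL-Analysis.Elementary_Metric_Spaces" "HOL-Analysis.Continuum_Not_Denumerable"
begin

text \<open>
  The algebra \<open>End_Q g L\<close> consists of the complex matrices that preserve \<open>L\<close> up to a denominator.
  Every nonzero integral one acts on \<open>L\<close> with nonzero determinant, and \<open>#Fix(f\<^sup>n)\<close>, the order of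
  the kernel of \<open>1 - f\<^sup>n\<close>, is bounded above and below in terms of \<open>\<bar>det(1 - M\<^sup>n)\<bar>\<close>, where \<open>M\<close> is
  the rational representation of \<open>f\<close>.  If all eigenvalues are off the unit circle, this grows
  exponentially.  If all are on it, a power of \<open>M\<close> is close enough to \<open>1\<close> to equal \<open>1\<close>, by
  Kronecker's argument.  That the eigenvalues are all on or all off the circle holds because each
  comes from an embedding of a commutative subfield into \<open>\<complex>\<close> by means of a common eigenvector:
  for totally real and CM-fields, complex conjugation commutes with all embeddings, and for totally
  definite quaternions the eigenvalues are \<open>\<sigma>(a) \<plusminus> \<surd>\<sigma>(t)\<close> with \<open>\<sigma>(t) \<le> 0\<close>.

  For the second part, the quaternion algebra \<open>(-1, 3 + \<surd>2)\<close> over \<open>\<rat>(\<surd>2)\<close> is a division algebra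
  that splits at both real places.  An order in it is a lattice in \<open>\<real>\<^sup>8\<close>; with a sufficiently
  generic complex structure at one place, the endomorphism algebra is not larger.  A unit of reduced
  norm \<open>1\<close> that is elliptic at one place and hyperbolic at the other is the required endomorphism.
\<close>

section \<open>Complex tori\<close>

text \<open>The modulus of an eigenvalue is not an algebraic quantity, so \<open>cmod z = 1\<close>
  has to be rewritten as an identity inside the endomorphism algebra before it can be carried from
  one embedding to all others: \<open>f = 1\<close> or \<open>f = -1\<close> for totally real
  fields, \<open>x y = 1\<close> with the conjugate \<open>y\<close> of \<open>x\<close> for
  CM-fields, \<open>a a = t + 1\<close> for quaternions. As embeddings are injective, one such
  identity decides all eigenvalues at once. In Kronecker's argument the division property enters
  after an integer determinant has been forced to vanish: a singular \<open>1 - A^k\<close> must be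
  the zero matrix. In the example the twist of the complex structure is unavoidable: with right
  multiplication by \<open>i\<close> as complex structure at both places, right multiplication by
  \<open>i\<close> would itself be an additional endomorphism. The number
  \<open>3 + \<surd>2\<close> is positive at both places, and it is a prime of norm 7 modulo which
  -1 is not a square, so the algebra splits at both real places without splitting globally.\<close>

lemma vnorm_ge_0: "0 \<le> vnorm v"
  by (simp add: vnorm_def L2_set_nonneg)

lemma vnorm_zero [simp]: "vnorm (0\<^sub>v g) = 0"
  by (simp add: vnorm_def L2_set_def)

lemma vnorm_triangle:
  assumes "v \<in> carrier_vec g" "w \<in> carrier_vec g"
  shows "vnorm (v + w) \<le> vnorm v + vnorm w"
proof -
  have "vnorm (v + w) \<le> L2_set (\<lambda>i. cmod (v $ i) + cmod (w $ i)) {..<g}"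
    using assms unfolding vnorm_def
    by (auto intro!: L2_set_mono norm_triangle_ineq)
  also have "\<dots> \<le> vnorm v + vnorm w"
    using assms unfolding vnorm_def by (auto intro!: L2_set_triangle_ineq)
  finally show ?thesis .
qed

lemma vnorm_smult: "vnorm (c \<cdot>\<^sub>v v) = cmod c * vnorm v"
proof -
  have "vnorm (c \<cdot>\<^sub>v v) = L2_set (\<lambda>i. cmod c * cmod (v $ i)) {..<dim_vec v}"
    unfolding vnorm_def by (intro L2_set_cong) (auto simp: norm_mult)
  then show ?thesis
    unfolding vnorm_def by (simp add: L2_set_right_distrib)
qed

lemma vnorm_uminus: "vnorm (- v) = vnorm v"
  unfolding vnorm_def by (auto intro!: L2_set_cong)

lemma vnorm_minus:
  assumes "v \<in> carrier_vec g" "w \<in> carrier_vec g"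
  shows "vnorm (v - w) \<le> vnorm v + vnorm w"
proof -
  have "v - w = v + - w" using assms by auto
  then show ?thesis using vnorm_triangle[of v g "- w"] assms by (simp add: vnorm_uminus)
qed

lemma index_le_vnorm:
  assumes "i < dim_vec v"
  shows "cmod (v $ i) \<le> vnorm v"
  using assms unfolding vnorm_def by (intro member_le_L2_set) auto

lemma vnorm_le_sum:
  assumes "v \<in> carrier_vec g"
  shows "vnorm v \<le> (\<Sum>i<g. cmod (v $ i))"
  using assms unfolding vnorm_def by (auto intro!: L2_set_le_sum)

lemma vnorm_mult_mat_le:
  assumes A: "A \<in> carrier_mat g g"
  obtains C where "C > 0" "\<And>v. v \<in> carrier_vec g \<Longrightarrow> vnorm (A *\<^sub>v v) \<le> C * vnorm v"
proof
  let ?C = "(\<Sum>i<g. \<Sum>j<g. cmod (A $$ (i, j))) + 1"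
  show "?C > 0" by (intro add_nonneg_pos sum_nonneg) auto
  fix v :: "complex vec" assume v: "v \<in> carrier_vec g"
  have "vnorm (A *\<^sub>v v) \<le> (\<Sum>i<g. cmod ((A *\<^sub>v v) $ i))"
    using A v by (intro vnorm_le_sum) auto
  also have "\<dots> \<le> (\<Sum>i<g. \<Sum>j<g. cmod (A $$ (i, j)) * vnorm v)"
  proof (rule sum_mono)
    fix i assume "i \<in> {..<g}"
    then have "(A *\<^sub>v v) $ i = (\<Sum>j<g. A $$ (i, j) * v $ j)"
      using A v by (auto simp: scalar_prod_def lessThan_atLeast0 intro!: sum.cong)
    also have "cmod \<dots> \<le> (\<Sum>j<g. cmod (A $$ (i, j)) * vnorm v)"
    proof (rule sum_norm_le)
      fix j assume "j \<in> {..<g}"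
      then show "cmod (A $$ (i, j) * v $ j) \<le> cmod (A $$ (i, j)) * vnorm v"
        using index_le_vnorm[of j v] v by (auto simp: norm_mult intro!: mult_left_mono)
    qed
    finally show "cmod ((A *\<^sub>v v) $ i) \<le> (\<Sum>j<g. cmod (A $$ (i, j)) * vnorm v)" .
  qed
  also have "\<dots> \<le> ?C * vnorm v"
    by (simp add: sum_distrib_right distrib_right vnorm_ge_0)
  finally show "vnorm (A *\<^sub>v v) \<le> ?C * vnorm v" .
qed

lemma has_complex_deriv_linear:
  assumes A: "A \<in> carrier_mat g g" and v: "v \<in> carrier_vec g"
  shows "has_complex_deriv g (\<lambda>v. A *\<^sub>v v) v A"
  unfolding has_complex_deriv_def
proof (intro conjI allI impI A)
  fix e :: real assume e: "e > 0"
  have "A *\<^sub>v (v + h) - A *\<^sub>v v - A *\<^sub>v h = 0\<^sub>v g" if "h \<in> carrier_vec g" for h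
    using that A v by (auto simp: mult_add_distrib_mat_vec)
  then show "\<exists>d>0. \<forall>h\<in>carrier_vec g. vnorm h < d \<longrightarrow>
      vnorm (A *\<^sub>v (v + h) - A *\<^sub>v v - A *\<^sub>v h) \<le> e * vnorm h"
    using e by (auto intro!: exI[of _ 1] simp: vnorm_ge_0)
qed

lemma mat_eqI_mult_vec:
  fixes A B :: "'a :: semiring_1 mat"
  assumes A: "A \<in> carrier_mat m n" and B: "B \<in> carrier_mat m n"
    and eq: "\<And>v. v \<in> carrier_vec n \<Longrightarrow> A *\<^sub>v v = B *\<^sub>v v"
  shows "A = B"
proof (rule eq_matI)
  fix i j assume "i < dim_row B" "j < dim_col B"
  then have ij: "i < m" "j < n" using B by auto
  have "(A *\<^sub>v unit_vec n j) $ i = (B *\<^sub>v unit_vec n j) $ i"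
    using eq by simp
  then show "A $$ (i, j) = B $$ (i, j)"
    using A B ij by simp
qed (use A B in auto)

lemma mult_mat_vec_minus:
  fixes A :: "'a :: comm_ring_1 mat"
  assumes "A \<in> carrier_mat m n" "v \<in> carrier_vec n" "w \<in> carrier_vec n"
  shows "A *\<^sub>v (v - w) = A *\<^sub>v v - A *\<^sub>v w"
  using assms by (intro eq_vecI) (auto simp: scalar_prod_minus_distrib[of _ n])

lemma mult_mat_vec_uminus:
  fixes A :: "'a :: comm_ring_1 mat"
  assumes "A \<in> carrier_mat m n" "v \<in> carrier_vec n"
  shows "A *\<^sub>v (- v) = - (A *\<^sub>v v)"
  using assms by (intro eq_vecI) auto

lemma mult_mat_zero_vec:
  fixes A :: "'a :: comm_ring_1 mat"
  assumes "A \<in> carrier_mat m n"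
  shows "A *\<^sub>v 0\<^sub>v n = 0\<^sub>v m"
  using assms by (intro eq_vecI) auto

section \<open>Lattices in complex space and the quotient torus as a group\<close>

text \<open>A chosen period matrix is fixed, since the coordinates of lattice points and the
  integral matrices of endomorphisms refer to it.\<close>

locale full_lattice =
  fixes g n :: nat and P :: "complex mat" and L :: "complex vec set"
  assumes P: "P \<in> carrier_mat g n"
    and inj: "\<And>x. x \<in> carrier_vec n \<Longrightarrow> P *\<^sub>v map_vec complex_of_real x = 0\<^sub>v g \<Longrightarrow> x = 0\<^sub>v n"
    and surj: "carrier_vec g = (\<lambda>x. P *\<^sub>v map_vec complex_of_real x) ` carrier_vec n"
    and L_eq: "L = (\<lambda>x. P *\<^sub>v map_vec complex_of_int x) ` carrier_vec n"
begin

abbreviation pt :: "complex vec \<Rightarrow> complex vec set" where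
  "pt \<equiv> torus_proj g L"

abbreviation "cvec x \<equiv> map_vec complex_of_int x"

lemma L_carrier: "v \<in> L \<Longrightarrow> v \<in> carrier_vec g"
  using P by (auto simp: L_eq)

lemma zero_L: "0\<^sub>v g \<in> L"
proof -
  have "P *\<^sub>v cvec (0\<^sub>v n) = 0\<^sub>v g"
    using P by (intro eq_vecI) (auto simp: scalar_prod_def)
  then show ?thesis unfolding L_eq by (metis imageI zero_carrier_vec)
qed

lemma add_L: assumes "v \<in> L" "w \<in> L" shows "v + w \<in> L"
proof -
  from assms obtain x y where x: "x \<in> carrier_vec n" "v = P *\<^sub>v cvec x"
    and y: "y \<in> carrier_vec n" "w = P *\<^sub>v cvec y" by (auto simp: L_eq)
  have "cvec (x + y) = cvec x + cvec y" using x y by auto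
  then have "v + w = P *\<^sub>v cvec (x + y)"
    using P x y by (simp add: mult_add_distrib_mat_vec)
  then show ?thesis using x y by (auto simp: L_eq)
qed

lemma smult_L: assumes "v \<in> L" shows "of_int k \<cdot>\<^sub>v v \<in> L"
proof -
  from assms obtain x where x: "x \<in> carrier_vec n" "v = P *\<^sub>v cvec x" by (auto simp: L_eq)
  have "cvec (k \<cdot>\<^sub>v x) = of_int k \<cdot>\<^sub>v cvec x" using x by auto
  then have "of_int k \<cdot>\<^sub>v v = P *\<^sub>v cvec (k \<cdot>\<^sub>v x)"
    using P x by (simp add: mult_mat_vec)
  then show ?thesis using x by (auto simp: L_eq)
qed

lemma uminus_L: assumes "v \<in> L" shows "- v \<in> L"
proof -
  have "- v = of_int (-1) \<cdot>\<^sub>v v" by (intro eq_vecI) auto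
  then show ?thesis using smult_L[OF assms, of "-1"] by argo
qed

lemma minus_L: assumes "v \<in> L" "w \<in> L" shows "v - w \<in> L"
proof -
  have "v - w = v + - w" using L_carrier assms by auto
  then show ?thesis using add_L uminus_L assms by metis
qed

lemma col_P_L: assumes "j < n" shows "P *\<^sub>v unit_vec n j \<in> L"
proof -
  have "cvec (unit_vec n j) = unit_vec n j"
    by (intro eq_vecI) (auto simp: unit_vec_def)
  then show ?thesis unfolding L_eq by (metis imageI unit_vec_carrier)
qed

interpretation V: comm_group "monoid_vec TYPE(complex) g"
  by (rule comm_group_vec)

lemma V_inv: "v \<in> carrier_vec g \<Longrightarrow> inv\<^bsub>monoid_vec TYPE(complex) g\<^esub> v = - v"
  by (rule V.inv_equality) (auto simp: monoid_vec_simps)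

lemma L_subgroup: "subgroup L (monoid_vec TYPE(complex) g)"
  by (rule V.subgroupI)
    (auto simp: monoid_vec_simps L_carrier V_inv uminus_L add_L intro: zero_L)

lemma L_normal: "normal L (monoid_vec TYPE(complex) g)"
  by (rule V.subgroup_imp_normal[OF L_subgroup])

lemma torus_comm_group: "comm_group (torus g L)"
  unfolding torus_def by (rule V.abelian_FactGroup[OF L_subgroup])

lemma carrier_torus: "carrier (torus g L) = pt ` carrier_vec g"
  unfolding torus_def carrier_FactGroup torus_proj_def by (simp add: monoid_vec_simps)

lemma pt_carrier: "v \<in> carrier_vec g \<Longrightarrow> pt v \<in> carrier (torus g L)"
  by (simp add: carrier_torus)

lemma pt_eq_iff:
  assumes v: "v \<in> carrier_vec g" and w: "w \<in> carrier_vec g"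
  shows "pt v = pt w \<longleftrightarrow> v - w \<in> L"
proof
  assume "pt v = pt w"
  then have "v \<in> L #>\<^bsub>monoid_vec TYPE(complex) g\<^esub> w"
    using V.rcos_self[OF _ L_subgroup, of v] v by (simp add: torus_proj_def monoid_vec_simps)
  then obtain l where "l \<in> L" "v = l + w" by (auto simp: r_coset_def monoid_vec_simps)
  moreover have "l + w - w = l" using L_carrier[OF \<open>l \<in> L\<close>] w by (intro eq_vecI) auto
  ultimately show "v - w \<in> L" by simp
next
  assume d: "v - w \<in> L"
  have "v = (v - w) + w" using v w by auto
  then have "v \<in> L #>\<^bsub>monoid_vec TYPE(complex) g\<^esub> w"
    unfolding r_coset_def using d by (auto simp: monoid_vec_simps)
  then show "pt v = pt w"
    unfolding torus_proj_def
    using V.repr_independence[OF _ _ L_subgroup, of v w] w by (simp add: monoid_vec_simps)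
qed

lemma one_torus: "\<one>\<^bsub>torus g L\<^esub> = pt (0\<^sub>v g)"
  unfolding torus_def torus_proj_def
  using V.coset_mult_one[of L] subgroup.subset[OF L_subgroup] by (simp add: monoid_vec_simps)

lemma mult_torus:
  assumes "v \<in> carrier_vec g" "w \<in> carrier_vec g"
  shows "pt v \<otimes>\<^bsub>torus g L\<^esub> pt w = pt (v + w)"
  unfolding torus_def torus_proj_def mult_FactGroup
  using normal.rcos_sum[OF L_normal, of v w] assms by (simp add: monoid_vec_simps)

lemma pt_eq_one_iff: "v \<in> carrier_vec g \<Longrightarrow> pt v = \<one>\<^bsub>torus g L\<^esub> \<longleftrightarrow> v \<in> L"
proof -
  assume v: "v \<in> carrier_vec g"
  have "v - 0\<^sub>v g = v" using v by auto
  then show ?thesis using v by (simp add: one_torus pt_eq_iff)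
qed

lemma pow_torus:
  assumes "v \<in> carrier_vec g"
  shows "pt v [^]\<^bsub>torus g L\<^esub> (k::nat) = pt (of_nat k \<cdot>\<^sub>v v)"
proof (induction k)
  interpret T: comm_group "torus g L" by (rule torus_comm_group)
  case 0
  have "of_nat 0 \<cdot>\<^sub>v v = 0\<^sub>v g" using assms by (intro eq_vecI) auto
  then show ?case by (simp add: one_torus)
next
  interpret T: comm_group "torus g L" by (rule torus_comm_group)
  case (Suc k)
  have "of_nat (Suc k) \<cdot>\<^sub>v v = of_nat k \<cdot>\<^sub>v v + v"
    using assms by (intro eq_vecI) (auto simp: algebra_simps)
  then show ?case using Suc assms by (simp add: mult_torus)
qed

text \<open>The inverse of the real isomorphism given by \<open>P\<close> is linear, hence bounded.
  It is assembled from the real coordinates of the vectors \<open>e_k\<close> and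
  \<open>i e_k\<close>, which span complex space over the reals.\<close>

lemma coord_bound:
  obtains C where "C > 0"
    "\<And>x i. x \<in> carrier_vec n \<Longrightarrow> i < n \<Longrightarrow> \<bar>x $ i\<bar> \<le> C * vnorm (P *\<^sub>v map_vec complex_of_real x)"
proof -
  have ex: "\<exists>q\<in>carrier_vec n. P *\<^sub>v map_vec complex_of_real q = v" if "v \<in> carrier_vec g" for v
    using that surj by auto
  define q where "q k = (SOME q. q \<in> carrier_vec n \<and> P *\<^sub>v map_vec complex_of_real q = unit_vec g k)" for k
  define r where "r k = (SOME q. q \<in> carrier_vec n \<and> P *\<^sub>v map_vec complex_of_real q = \<i> \<cdot>\<^sub>v unit_vec g k)" for k
  have q: "q k \<in> carrier_vec n" "P *\<^sub>v map_vec complex_of_real (q k) = unit_vec g k" for k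
    using someI_ex[of "\<lambda>q. q \<in> carrier_vec n \<and> P *\<^sub>v map_vec complex_of_real q = unit_vec g k"]
      ex[of "unit_vec g k"] by (auto simp: q_def)
  have r: "r k \<in> carrier_vec n" "P *\<^sub>v map_vec complex_of_real (r k) = \<i> \<cdot>\<^sub>v unit_vec g k" for k
    using someI_ex[of "\<lambda>q. q \<in> carrier_vec n \<and> P *\<^sub>v map_vec complex_of_real q = \<i> \<cdot>\<^sub>v unit_vec g k"]
      ex[of "\<i> \<cdot>\<^sub>v unit_vec g k"] by (auto simp: r_def)
  have qi: "(\<Sum>j<n. P $$ (l, j) * of_real (q k $ j)) = (if l = k then 1 else 0)" if "l < g" "k < g" for l k
  proof -
    have "(P *\<^sub>v map_vec complex_of_real (q k)) $ l = unit_vec g k $ l" using q by simp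
    moreover have "(P *\<^sub>v map_vec complex_of_real (q k)) $ l = (\<Sum>j<n. P $$ (l, j) * of_real (q k $ j))"
      using that P q(1)[of k] by (auto simp: scalar_prod_def lessThan_atLeast0 intro!: sum.cong)
    ultimately show ?thesis using that by simp
  qed
  have ri: "(\<Sum>j<n. P $$ (l, j) * of_real (r k $ j)) = (if l = k then \<i> else 0)" if "l < g" "k < g" for l k
  proof -
    have "(P *\<^sub>v map_vec complex_of_real (r k)) $ l = (\<i> \<cdot>\<^sub>v unit_vec g k) $ l" using r by simp
    moreover have "(P *\<^sub>v map_vec complex_of_real (r k)) $ l = (\<Sum>j<n. P $$ (l, j) * of_real (r k $ j))"
      using that P r(1)[of k] by (auto simp: scalar_prod_def lessThan_atLeast0 intro!: sum.cong)
    ultimately show ?thesis using that by (auto simp: unit_vec_def)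
  qed
  let ?C = "(\<Sum>i<n. \<Sum>k<g. \<bar>q k $ i\<bar> + \<bar>r k $ i\<bar>) + 1"
  show thesis
  proof
    show "?C > 0" by (intro add_nonneg_pos sum_nonneg) auto
    fix x :: "real vec" and i assume x: "x \<in> carrier_vec n" and i: "i < n"
    define v where "v = P *\<^sub>v map_vec complex_of_real x"
    \<comment> \<open>The coordinates that linearity predicts for \<open>v\<close>, from its real
      and imaginary parts; \<open>inj\<close> shows that they agree with \<open>x\<close>.\<close>
    define y where "y = vec n (\<lambda>j. \<Sum>k<g. Re (v $ k) * q k $ j + Im (v $ k) * r k $ j)"
    have vi: "v $ l = (\<Sum>j<n. P $$ (l, j) * of_real (x $ j))" if "l < g" for l
      using that P x by (auto simp: v_def scalar_prod_def lessThan_atLeast0 intro!: sum.cong)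
    have v: "v \<in> carrier_vec g" using P x by (auto simp: v_def)
    have "P *\<^sub>v map_vec complex_of_real (x - y) = 0\<^sub>v g"
    proof (intro eq_vecI)
      fix l assume "l < dim_vec (0\<^sub>v g)"
      then have l: "l < g" by simp
      have "(P *\<^sub>v map_vec complex_of_real (x - y)) $ l
          = (\<Sum>j<n. P $$ (l, j) * of_real (x $ j - y $ j))"
        using l P x by (auto simp: scalar_prod_def lessThan_atLeast0 y_def intro!: sum.cong)
      also have "\<dots> = v $ l - (\<Sum>j<n. P $$ (l, j) * of_real (y $ j))"
        by (simp add: vi[OF l] algebra_simps sum_subtractf)
      also have "(\<Sum>j<n. P $$ (l, j) * of_real (y $ j))
          = (\<Sum>j<n. \<Sum>k<g. of_real (Re (v $ k)) * (P $$ (l, j) * of_real (q k $ j))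
               + of_real (Im (v $ k)) * (P $$ (l, j) * of_real (r k $ j)))"
        by (intro sum.cong refl) (simp add: y_def sum_distrib_left algebra_simps)
      also have "\<dots> = (\<Sum>k<g. of_real (Re (v $ k)) * (\<Sum>j<n. P $$ (l, j) * of_real (q k $ j))
               + of_real (Im (v $ k)) * (\<Sum>j<n. P $$ (l, j) * of_real (r k $ j)))"
        by (subst sum.swap) (simp add: sum.distrib sum_distrib_left)
      also have "\<dots> = (\<Sum>k<g. if k = l then v $ l else 0)"
        by (intro sum.cong refl) (use qi ri l complex_eq in \<open>auto simp: algebra_simps\<close>)
      also have "\<dots> = v $ l" using l by simp
      finally show "(P *\<^sub>v map_vec complex_of_real (x - y)) $ l = 0\<^sub>v g $ l" using l by simp
    qed (use P in auto)
    then have "x - y = 0\<^sub>v n" using x by (intro inj) (auto simp: y_def)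
    then have "x $ i = y $ i" using i x by (metis (no_types, lifting) carrier_vecD
          diff_add_cancel dim_vec index_minus_vec(1) index_zero_vec(1) y_def add_0)
    also have "\<bar>y $ i\<bar> \<le> (\<Sum>k<g. \<bar>Re (v $ k) * q k $ i + Im (v $ k) * r k $ i\<bar>)"
      using i unfolding y_def by (simp only: index_vec) (rule sum_abs)
    also have "\<dots> \<le> (\<Sum>k<g. (\<bar>q k $ i\<bar> + \<bar>r k $ i\<bar>) * vnorm v)"
    proof (rule sum_mono)
      fix k assume "k \<in> {..<g}"
      then have c: "cmod (v $ k) \<le> vnorm v" using v by (intro index_le_vnorm) auto
      have "\<bar>Re (v $ k)\<bar> * \<bar>q k $ i\<bar> \<le> vnorm v * \<bar>q k $ i\<bar>"
        using abs_Re_le_cmod[of "v $ k"] c by (intro mult_right_mono) auto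
      moreover have "\<bar>Im (v $ k)\<bar> * \<bar>r k $ i\<bar> \<le> vnorm v * \<bar>r k $ i\<bar>"
        using abs_Im_le_cmod[of "v $ k"] c by (intro mult_right_mono) auto
      moreover have "\<bar>Re (v $ k) * q k $ i + Im (v $ k) * r k $ i\<bar>
          \<le> \<bar>Re (v $ k)\<bar> * \<bar>q k $ i\<bar> + \<bar>Im (v $ k)\<bar> * \<bar>r k $ i\<bar>"
        by (metis abs_mult abs_triangle_ineq)
      ultimately show "\<bar>Re (v $ k) * q k $ i + Im (v $ k) * r k $ i\<bar> \<le> (\<bar>q k $ i\<bar> + \<bar>r k $ i\<bar>) * vnorm v"
        by (simp add: algebra_simps)
    qed
    also have "\<dots> = (\<Sum>k<g. \<bar>q k $ i\<bar> + \<bar>r k $ i\<bar>) * vnorm v" by (rule sum_distrib_right[symmetric])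
    also have "\<dots> \<le> ?C * vnorm v"
    proof (rule mult_right_mono)
      have "(\<Sum>k<g. \<bar>q k $ i\<bar> + \<bar>r k $ i\<bar>) \<le> (\<Sum>i<n. \<Sum>k<g. \<bar>q k $ i\<bar> + \<bar>r k $ i\<bar>)"
        using i by (intro member_le_sum) (auto intro!: sum_nonneg)
      then show "(\<Sum>k<g. \<bar>q k $ i\<bar> + \<bar>r k $ i\<bar>) \<le> ?C" by simp
    qed (rule vnorm_ge_0)
    finally show "\<bar>x $ i\<bar> \<le> ?C * vnorm (P *\<^sub>v map_vec complex_of_real x)" by (simp add: v_def)
  qed
qed

text \<open>A nonzero lattice point has an integer coordinate of absolute value at least 1, and
  \<open>coord_bound\<close> then keeps its norm away from 0.\<close>

lemma L_discrete:
  obtains e where "e > 0" "\<And>v. v \<in> L \<Longrightarrow> vnorm v < e \<Longrightarrow> v = 0\<^sub>v g"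
proof -
  obtain C where C: "C > 0" and bd:
    "\<And>x i. x \<in> carrier_vec n \<Longrightarrow> i < n \<Longrightarrow> \<bar>x $ i\<bar> \<le> C * vnorm (P *\<^sub>v map_vec complex_of_real x)"
    by (rule coord_bound) blast
  show thesis
  proof
    show "1 / C > 0" using C by simp
    fix v assume "v \<in> L" and small: "vnorm v < 1 / C"
    then obtain x where x: "x \<in> carrier_vec n" and v: "v = P *\<^sub>v cvec x" by (auto simp: L_eq)
    let ?x = "map_vec real_of_int x"
    have e: "map_vec complex_of_real ?x = cvec x" using x by auto
    have "x = 0\<^sub>v n"
    proof (intro eq_vecI)
      fix i assume "i < dim_vec (0\<^sub>v n)"
      then have i: "i < n" by simp
      have "\<bar>?x $ i\<bar> \<le> C * vnorm v" using bd[of ?x i] x i by (simp add: e v)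
      also have "\<dots> < 1" using small C by (simp add: field_simps)
      finally show "x $ i = 0\<^sub>v n $ i" using i x by simp
    qed (use x in auto)
    then show "v = 0\<^sub>v g" using v P by (auto intro!: eq_vecI simp: scalar_prod_def)
  qed
qed

end

section \<open>Endomorphisms as complex matrices preserving the lattice\<close>

context full_lattice
begin

lemma vnorm_half_pow: "vnorm (complex_of_real (1 / 2 ^ k) \<cdot>\<^sub>v v) = vnorm v / 2 ^ k"
  unfolding vnorm_smult norm_of_real by simp

lemma ex_half_pow_less:
  assumes "(e::real) > 0" shows "\<exists>k. a / 2 ^ k < e"
proof -
  obtain k where "a / e < 2 ^ k" using real_arch_pow[of 2 "a / e"] by auto
  then show ?thesis using assms by (auto simp: field_simps intro!: exI[of _ k])
qed

text \<open>Halving an argument repeatedly makes its image small while keeping it in the discrete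
  set \<open>L\<close>, so the image is 0.\<close>

lemma mat_into_L_imp_zero:
  assumes A: "A \<in> carrier_mat g g" and AL: "\<And>v. v \<in> carrier_vec g \<Longrightarrow> A *\<^sub>v v \<in> L"
  shows "A = 0\<^sub>m g g"
proof (rule mat_eqI_mult_vec[OF A])
  fix v :: "complex vec" assume v: "v \<in> carrier_vec g"
  obtain e where e: "e > 0" "\<And>v. v \<in> L \<Longrightarrow> vnorm v < e \<Longrightarrow> v = 0\<^sub>v g"
    by (rule L_discrete) blast
  obtain k where k: "vnorm (A *\<^sub>v v) / 2 ^ k < e" using ex_half_pow_less[OF e(1)] by blast
  let ?c = "complex_of_real (1 / 2 ^ k)"
  have eq: "A *\<^sub>v (?c \<cdot>\<^sub>v v) = ?c \<cdot>\<^sub>v (A *\<^sub>v v)" using A v by (simp add: mult_mat_vec)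
  have "A *\<^sub>v (?c \<cdot>\<^sub>v v) \<in> L" using v by (intro AL) simp
  then have "?c \<cdot>\<^sub>v (A *\<^sub>v v) = 0\<^sub>v g" using e(2) k by (metis eq vnorm_half_pow)
  then have "?c * (A *\<^sub>v v) $ i = 0" if "i < g" for i
    using that A by (metis carrier_matD(1) dim_mult_mat_vec index_smult_vec(1) index_zero_vec(1))
  then show "A *\<^sub>v v = 0\<^sub>m g g *\<^sub>v v" using A v
    by (intro eq_vecI) (auto simp del: index_mult_mat_vec simp add: index_mult_mat_vec[of _ "0\<^sub>m g g"])
qed auto

lemma lattice_mat_eqI:
  assumes A: "A \<in> carrier_mat g g" and B: "B \<in> carrier_mat g g"
    and eq: "\<And>v. v \<in> carrier_vec g \<Longrightarrow> pt (A *\<^sub>v v) = pt (B *\<^sub>v v)"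
  shows "A = B"
proof -
  have "A - B = 0\<^sub>m g g"
  proof (rule mat_into_L_imp_zero)
    fix v :: "complex vec" assume v: "v \<in> carrier_vec g"
    have "(A - B) *\<^sub>v v = A *\<^sub>v v - B *\<^sub>v v" using A B v by (simp add: minus_mult_distrib_mat_vec)
    then show "(A - B) *\<^sub>v v \<in> L" using eq[OF v] pt_eq_iff A B v by auto
  qed (use A B in auto)
  then have "(A - B) $$ (i, j) = 0" if "i < g" "j < g" for i j using that by simp
  then show ?thesis using A B by (intro eq_matI) auto
qed

text \<open>
  A lift \<open>F\<close> of a homomorphism satisfies \<open>F (v + w) - F v - F w + F 0 \<in> L\<close>, and near \<open>0\<close> this
  vector is small, hence zero.  So \<open>F - F 0\<close> is additive near \<open>0\<close>, and an additive map that is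
  differentiable at \<open>0\<close> is linear.
\<close>

lemma lift_linear:
  assumes hom: "f \<in> hom (torus g L) (torus g L)"
    and lift: "local_lift g L f (0\<^sub>v g) F" and der: "has_complex_deriv g F (0\<^sub>v g) A"
    and v: "v \<in> carrier_vec g"
  shows "f (pt v) = pt (A *\<^sub>v v)"
proof -
  have A: "A \<in> carrier_mat g g" using der by (simp add: has_complex_deriv_def)
  obtain r where r: "r > 0" and F: "\<And>w. w \<in> carrier_vec g \<Longrightarrow> vnorm w < r \<Longrightarrow>
      F w \<in> carrier_vec g \<and> f (pt w) = pt (F w)"
  proof -
    have "w - 0\<^sub>v g = w" if "w \<in> carrier_vec g" for w :: "complex vec" using that by auto
    then show thesis using that lift unfolding local_lift_def by (metis (no_types, lifting))
  qed
  let ?z = "0\<^sub>v g :: complex vec"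
  have F0c: "F ?z \<in> carrier_vec g" using F[of ?z] r by simp
  have deriv: "\<exists>d>0. \<forall>h\<in>carrier_vec g. vnorm h < d \<longrightarrow> vnorm (F h - F ?z - A *\<^sub>v h) \<le> e * vnorm h"
    if "e > 0" for e
  proof -
    have "0\<^sub>v g + h = h" if "h \<in> carrier_vec g" for h :: "complex vec" using that by auto
    then show ?thesis using der that unfolding has_complex_deriv_def by (metis (no_types, lifting))
  qed
  obtain C where C: "C > 0" "\<And>v. v \<in> carrier_vec g \<Longrightarrow> vnorm (A *\<^sub>v v) \<le> C * vnorm v"
    by (rule vnorm_mult_mat_le[OF A]) blast
  obtain d where d: "d > 0"
    "\<And>h. h \<in> carrier_vec g \<Longrightarrow> vnorm h < d \<Longrightarrow> vnorm (F h - F ?z - A *\<^sub>v h) \<le> 1 * vnorm h"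
    using deriv[of 1] by auto
  obtain e where e: "e > 0" "\<And>v. v \<in> L \<Longrightarrow> vnorm v < e \<Longrightarrow> v = 0\<^sub>v g"
    by (rule L_discrete) blast
  \<comment> \<open>Subtracting \<open>F 0\<close>, a lattice vector, changes no point of the torus
    and makes the lift vanish at 0.\<close>
  define G where "G h = F h - F ?z" for h
  have G_bound: "vnorm (G h) \<le> (C + 1) * vnorm h" if "h \<in> carrier_vec g" "vnorm h < d" "vnorm h < r" for h
  proof -
    have Fh: "F h \<in> carrier_vec g" using F that by auto
    have "G h = (F h - F ?z - A *\<^sub>v h) + A *\<^sub>v h"
      using Fh F0c A that by (intro eq_vecI) (auto simp: G_def)
    then have "vnorm (G h) \<le> vnorm (F h - F ?z - A *\<^sub>v h) + vnorm (A *\<^sub>v h)"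
      using vnorm_triangle[of "F h - F ?z - A *\<^sub>v h" g "A *\<^sub>v h"] Fh F0c A that by simp
    also have "\<dots> \<le> 1 * vnorm h + C * vnorm h" by (intro add_mono d C that)
    finally show ?thesis by (simp add: algebra_simps)
  qed
  \<comment> \<open>For \<open>vnorm h < s\<close> both \<open>h\<close> and \<open>2 h\<close> are
    in reach of \<open>G_bound\<close>, and \<open>G (2 h) - 2 G h\<close> has norm at most
    \<open>4 (C + 1) vnorm h < e\<close>, too small for a nonzero lattice vector.\<close>
  define s where "s = min (min d r) (e / (C + 1)) / 4"
  have s: "s > 0" "4 * s \<le> d" "4 * s \<le> r" "4 * s * (C + 1) \<le> e"
  proof -
    show "s > 0" using d r e C by (simp add: s_def)
    show "4 * s \<le> d" "4 * s \<le> r" by (auto simp: s_def)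
    have "4 * s \<le> e / (C + 1)" by (auto simp: s_def)
    then show "4 * s * (C + 1) \<le> e" using C by (simp add: field_simps)
  qed
  have zero_in_L: "F ?z \<in> L"
  proof -
    interpret T: comm_group "torus g L" by (rule torus_comm_group)
    have "f (pt ?z) = \<one>\<^bsub>torus g L\<^esub>"
      using hom_one[OF hom T.is_group T.is_group] by (simp add: one_torus)
    then show ?thesis using F[of ?z] r F0c by (simp add: pt_eq_one_iff)
  qed
  have Gc: "G h \<in> carrier_vec g" if "h \<in> carrier_vec g" "vnorm h < r" for h
    using F[of h] F0c that by (simp add: G_def)
  have Gpt: "f (pt h) = pt (G h)" if "h \<in> carrier_vec g" "vnorm h < r" for h
  proof -
    have "F h - G h = F ?z" using F[OF that] F0c by (intro eq_vecI) (auto simp: G_def)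
    then have "pt (F h) = pt (G h)" using pt_eq_iff[of "F h" "G h"] F[OF that] Gc[OF that] zero_in_L by simp
    then show ?thesis using F[OF that] by simp
  qed
  \<comment> \<open>Doubling suffices in place of full additivity: iterated, it compares
    \<open>h\<close> with \<open>h / 2^k\<close>, where the derivative at 0 governs
    \<open>G\<close>.\<close>
  have double: "G (2 \<cdot>\<^sub>v h) = 2 \<cdot>\<^sub>v G h" if h: "h \<in> carrier_vec g" "vnorm h < s" for h
  proof -
    have two: "2 \<cdot>\<^sub>v w = w + w" if "w \<in> carrier_vec g" for w :: "complex vec"
      using that by (intro eq_vecI) auto
    have n2: "vnorm (2 \<cdot>\<^sub>v h) = 2 * vnorm h" by (simp add: vnorm_smult)
    have c: "2 \<cdot>\<^sub>v h \<in> carrier_vec g" "vnorm (2 \<cdot>\<^sub>v h) < r" "vnorm (2 \<cdot>\<^sub>v h) < d"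
      "vnorm h < r" "vnorm h < d"
      using h s by (auto simp: n2)
    note gc = Gc[OF c(1,2)] Gc[OF h(1) c(4)]
    have "pt (G (2 \<cdot>\<^sub>v h)) = f (pt h \<otimes>\<^bsub>torus g L\<^esub> pt h)"
      using Gpt[OF c(1,2)] h by (simp add: mult_torus two)
    also have "\<dots> = f (pt h) \<otimes>\<^bsub>torus g L\<^esub> f (pt h)"
      using hom_mult[OF hom] pt_carrier h by blast
    also have "\<dots> = pt (2 \<cdot>\<^sub>v G h)" using Gpt[OF h(1) c(4)] gc by (simp add: mult_torus two)
    finally have inL: "G (2 \<cdot>\<^sub>v h) - 2 \<cdot>\<^sub>v G h \<in> L" using gc by (simp add: pt_eq_iff)
    have "vnorm (G (2 \<cdot>\<^sub>v h) - 2 \<cdot>\<^sub>v G h) \<le> vnorm (G (2 \<cdot>\<^sub>v h)) + vnorm (2 \<cdot>\<^sub>v G h)"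
      using gc by (intro vnorm_minus[of _ g]) auto
    also have "\<dots> \<le> (C + 1) * (2 * vnorm h) + 2 * ((C + 1) * vnorm h)"
      using add_mono[OF G_bound[OF c(1,3,2)] mult_left_mono[OF G_bound[OF h(1) c(5,4)], of 2]]
      by (simp only: n2 vnorm_smult norm_numeral)
    also have "\<dots> = 4 * (C + 1) * vnorm h" by simp
    also have "\<dots> < 4 * (C + 1) * s" using h C by (intro mult_strict_left_mono) auto
    also have "\<dots> \<le> e" using s by (simp add: algebra_simps)
    finally have "G (2 \<cdot>\<^sub>v h) - 2 \<cdot>\<^sub>v G h = 0\<^sub>v g" using e inL by blast
    then have "(G (2 \<cdot>\<^sub>v h) - 2 \<cdot>\<^sub>v G h) $ i = 0" if "i < g" for i using that by simp
    then show ?thesis using gc by (intro eq_vecI) auto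
  qed
  have scale: "G h = 2 ^ k \<cdot>\<^sub>v G (complex_of_real (1 / 2 ^ k) \<cdot>\<^sub>v h)" (is "_ = _ \<cdot>\<^sub>v G (?h k)")
    if h: "h \<in> carrier_vec g" "vnorm h < s" for h k
  proof (induction k)
    case 0
    have "?h 0 = h" by simp
    then show ?case by simp
  next
    case (Suc k)
    have hk: "?h (Suc k) \<in> carrier_vec g" using h by simp
    have "vnorm (?h (Suc k)) \<le> vnorm h"
      unfolding vnorm_half_pow
      using divide_left_mono[of 1 "2 ^ Suc k" "vnorm h"] vnorm_ge_0[of h] two_realpow_ge_one[of "Suc k"]
      by simp
    then have sm: "vnorm (?h (Suc k)) < s" using h by simp
    have "?h k = 2 \<cdot>\<^sub>v ?h (Suc k)" by (intro eq_vecI) auto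
    then have "G (?h k) = 2 \<cdot>\<^sub>v G (?h (Suc k))" using double[OF hk sm] by simp
    then show ?case using Suc by (simp add: smult_smult_assoc mult.commute)
  qed
  have G_lin: "G h = A *\<^sub>v h" if h: "h \<in> carrier_vec g" "vnorm h < s" for h
  proof -
    have le: "vnorm (G h - A *\<^sub>v h) \<le> eps * vnorm h" if eps: "eps > 0" for eps
    proof -
      obtain d' where d': "d' > 0" "\<And>h. h \<in> carrier_vec g \<Longrightarrow> vnorm h < d' \<Longrightarrow>
          vnorm (F h - F ?z - A *\<^sub>v h) \<le> eps * vnorm h"
        using deriv[OF eps] by auto
      obtain k where k: "vnorm h / 2 ^ k < min d' r" using ex_half_pow_less[of "min d' r"] d' r by auto
      let ?h = "complex_of_real (1 / 2 ^ k) \<cdot>\<^sub>v h"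
      have hc: "?h \<in> carrier_vec g" "vnorm ?h < d'" "vnorm ?h < r" using h k by (auto simp only: vnorm_half_pow smult_carrier_vec)
      have gc: "G ?h \<in> carrier_vec g" by (rule Gc[OF hc(1,3)])
      have "A *\<^sub>v h = 2 ^ k \<cdot>\<^sub>v (A *\<^sub>v ?h)"
        using A h by (simp add: mult_mat_vec smult_smult_assoc)
      then have "G h - A *\<^sub>v h = 2 ^ k \<cdot>\<^sub>v (G ?h - A *\<^sub>v ?h)"
        using scale[OF h, of k] gc A hc by (intro eq_vecI) (auto simp: algebra_simps)
      then have "vnorm (G h - A *\<^sub>v h) = 2 ^ k * vnorm (F ?h - F ?z - A *\<^sub>v ?h)"
        by (simp only: vnorm_smult G_def) (simp add: norm_power)
      also have "\<dots> \<le> 2 ^ k * (eps * (vnorm h / 2 ^ k))"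
        using d'(2)[OF hc(1,2)] unfolding vnorm_half_pow by (intro mult_left_mono) auto
      finally show ?thesis by simp
    qed
    have "vnorm (G h - A *\<^sub>v h) \<le> 0"
    proof (rule field_le_epsilon)
      fix eps :: real assume "eps > 0"
      then have "vnorm (G h - A *\<^sub>v h) \<le> eps / (vnorm h + 1) * vnorm h"
        using vnorm_ge_0[of h] by (intro le) auto
      also have "\<dots> \<le> eps" using vnorm_ge_0[of h] \<open>eps > 0\<close> by (simp add: field_simps)
      finally show "vnorm (G h - A *\<^sub>v h) \<le> 0 + eps" by simp
    qed
    then have "cmod ((G h - A *\<^sub>v h) $ i) \<le> 0" if "i < g" for i
    proof -
      have "i < dim_vec (G h - A *\<^sub>v h)" using that A by simp
      from index_le_vnorm[OF this] show ?thesis using \<open>vnorm (G h - A *\<^sub>v h) \<le> 0\<close> by linarith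
    qed
    then show ?thesis using A Gc[OF h(1)] h s by (intro eq_vecI) auto
  qed
  have small: "f (pt h) = pt (A *\<^sub>v h)" if "h \<in> carrier_vec g" "vnorm h < s" for h
    using Gpt[of h] G_lin[OF that] that s by simp
  \<comment> \<open>An arbitrary \<open>v\<close> is halved into the small ball and doubled back;
    the homomorphism property carries the formula along.\<close>
  obtain k where k: "vnorm v / 2 ^ k < s" using ex_half_pow_less[OF s(1)] by blast
  have "f (pt (2 ^ j \<cdot>\<^sub>v h)) = pt (A *\<^sub>v (2 ^ j \<cdot>\<^sub>v h))"
    if h: "h \<in> carrier_vec g" "vnorm h < s" for h j
  proof (induction j)
    case 0
    then show ?case using small[OF h] by simp
  next
    case (Suc j)
    let ?w = "2 ^ j \<cdot>\<^sub>v h"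
    have w: "?w \<in> carrier_vec g" using h by simp
    have ww: "2 ^ Suc j \<cdot>\<^sub>v h = ?w + ?w" using h by (intro eq_vecI) auto
    have "f (pt (2 ^ Suc j \<cdot>\<^sub>v h)) = f (pt ?w \<otimes>\<^bsub>torus g L\<^esub> pt ?w)"
      unfolding ww using w by (simp add: mult_torus)
    also have "\<dots> = f (pt ?w) \<otimes>\<^bsub>torus g L\<^esub> f (pt ?w)"
      using hom_mult[OF hom] pt_carrier w by blast
    also have "\<dots> = pt (A *\<^sub>v ?w + A *\<^sub>v ?w)" using Suc w A by (simp add: mult_torus)
    also have "A *\<^sub>v ?w + A *\<^sub>v ?w = A *\<^sub>v (2 ^ Suc j \<cdot>\<^sub>v h)"
      unfolding ww using A w by (simp add: mult_add_distrib_mat_vec)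
    finally show ?case .
  qed
  from this[of "complex_of_real (1 / 2 ^ k) \<cdot>\<^sub>v v" k] k v show ?thesis
    by (simp only: vnorm_half_pow smult_carrier_vec smult_smult_assoc) simp
qed

text \<open>The representative of a point is arbitrary; the value is independent of it as soon as
  \<open>A\<close> preserves \<open>L\<close>.\<close>

definition endo :: "complex mat \<Rightarrow> complex vec set \<Rightarrow> complex vec set" where
  "endo A = (\<lambda>x\<in>carrier (torus g L). pt (A *\<^sub>v (SOME v. v \<in> carrier_vec g \<and> pt v = x)))"

text \<open>The image of the endomorphism ring under the analytic representation: here
  \<open>endo\<close> and \<open>analytic_rep\<close> are mutually inverse, so that later arguments
  can take place among matrices.\<close>

definition lattice_mats :: "complex mat set" where
  "lattice_mats = {A \<in> carrier_mat g g. \<forall>v\<in>L. A *\<^sub>v v \<in> L}"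

lemma lattice_mats_carrier: "A \<in> lattice_mats \<Longrightarrow> A \<in> carrier_mat g g"
  by (simp add: lattice_mats_def)

lemma endo_pt:
  assumes A: "A \<in> lattice_mats" and v: "v \<in> carrier_vec g"
  shows "endo A (pt v) = pt (A *\<^sub>v v)"
proof -
  define w where "w = (SOME w. w \<in> carrier_vec g \<and> pt w = pt v)"
  have w: "w \<in> carrier_vec g" "pt w = pt v"
    using someI[of "\<lambda>w. w \<in> carrier_vec g \<and> pt w = pt v" v] v by (auto simp: w_def)
  have Ac: "A \<in> carrier_mat g g" by (rule lattice_mats_carrier[OF A])
  have "A *\<^sub>v (w - v) \<in> L" using A w v pt_eq_iff[of w v] by (simp add: lattice_mats_def)
  then have "pt (A *\<^sub>v w) = pt (A *\<^sub>v v)"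
    using w v Ac by (simp add: pt_eq_iff mult_mat_vec_minus)
  then show ?thesis using pt_carrier[OF v] by (simp add: endo_def w_def)
qed

lemma torus_fun_eqI:
  assumes "f \<in> extensional (carrier (torus g L))" "h \<in> extensional (carrier (torus g L))"
    and "\<And>v. v \<in> carrier_vec g \<Longrightarrow> f (pt v) = h (pt v)"
  shows "f = h"
  using assms by (intro extensionalityI) (auto simp: carrier_torus)

lemma endo_extensional: "endo A \<in> extensional (carrier (torus g L))"
  by (simp add: endo_def)

lemma endo_local_lift:
  assumes A: "A \<in> lattice_mats"
  shows "local_lift g L (endo A) v (\<lambda>v. A *\<^sub>v v)"
  unfolding local_lift_def
proof (intro exI[of _ 1] conjI ballI impI)
  have Ac: "A \<in> carrier_mat g g" by (rule lattice_mats_carrier[OF A])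
  fix w :: "complex vec" assume w: "w \<in> carrier_vec g"
  show "A *\<^sub>v w \<in> carrier_vec g" using Ac w by simp
  show "\<exists>B. has_complex_deriv g ((*\<^sub>v) A) w B" using has_complex_deriv_linear[OF Ac w] by blast
  show "endo A (pt w) = pt (A *\<^sub>v w)" by (rule endo_pt[OF A w])
qed simp

lemma endo_End:
  assumes A: "A \<in> lattice_mats"
  shows "endo A \<in> carrier (End_ring g L)"
proof -
  have Ac: "A \<in> carrier_mat g g" by (rule lattice_mats_carrier[OF A])
  have "endo A \<in> hom (torus g L) (torus g L)"
    unfolding hom_def carrier_torus using Ac
    by (auto simp: endo_pt[OF A] mult_torus mult_add_distrib_mat_vec)
  then show ?thesis
    using endo_local_lift[OF A] by (auto simp: End_ring_def endo_extensional holomorphic_map_def)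
qed

lemma analytic_rep_endo:
  assumes A: "A \<in> lattice_mats"
  shows "analytic_rep g L (endo A) = A"
  unfolding analytic_rep_def
proof (rule the_equality)
  have Ac: "A \<in> carrier_mat g g" by (rule lattice_mats_carrier[OF A])
  show "\<exists>F. local_lift g L (endo A) (0\<^sub>v g) F \<and> has_complex_deriv g F (0\<^sub>v g) A"
    using endo_local_lift[OF A] has_complex_deriv_linear[OF Ac] zero_carrier_vec by blast
  fix B assume "\<exists>F. local_lift g L (endo A) (0\<^sub>v g) F \<and> has_complex_deriv g F (0\<^sub>v g) B"
  then obtain F where F: "local_lift g L (endo A) (0\<^sub>v g) F" "has_complex_deriv g F (0\<^sub>v g) B" by blast
  have "endo A \<in> hom (torus g L) (torus g L)" using endo_End[OF A] by (simp add: End_ring_def)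
  then have "endo A (pt v) = pt (B *\<^sub>v v)" if "v \<in> carrier_vec g" for v
    using lift_linear F that by blast
  then show "B = A" using F(2) Ac endo_pt[OF A]
    by (intro lattice_mat_eqI) (auto simp: has_complex_deriv_def)
qed

text \<open>The derivative at 0 of a local lift is the required matrix: by
  \<open>lift_linear\<close> it describes \<open>f\<close> on the whole torus, and it preserves
  \<open>L\<close> because \<open>f\<close> fixes the neutral element.\<close>

lemma End_cases:
  assumes f: "f \<in> carrier (End_ring g L)"
  obtains A where "A \<in> lattice_mats" "f = endo A"
proof -
  have hom: "f \<in> hom (torus g L) (torus g L)" and ext: "f \<in> extensional (carrier (torus g L))"
    and hol: "holomorphic_map g L f" using f by (auto simp: End_ring_def)
  obtain F where F: "local_lift g L f (0\<^sub>v g) F" using hol zero_carrier_vec unfolding holomorphic_map_def by blast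
  have "0\<^sub>v g - 0\<^sub>v g = (0\<^sub>v g :: complex vec)" by auto
  then obtain A where dA: "has_complex_deriv g F (0\<^sub>v g) A"
    using F zero_carrier_vec vnorm_zero unfolding local_lift_def by metis
  have A: "A \<in> carrier_mat g g" using dA by (simp add: has_complex_deriv_def)
  have fA: "f (pt v) = pt (A *\<^sub>v v)" if "v \<in> carrier_vec g" for v
    using lift_linear[OF hom F dA that] .
  interpret T: comm_group "torus g L" by (rule torus_comm_group)
  have "A *\<^sub>v v \<in> L" if "v \<in> L" for v
  proof -
    have v: "v \<in> carrier_vec g" using that by (rule L_carrier)
    have "f (pt v) = \<one>\<^bsub>torus g L\<^esub>"
      using that pt_eq_one_iff[OF v] hom_one[OF hom T.is_group T.is_group] by simp
    then show ?thesis using fA[OF v] A v by (simp add: pt_eq_one_iff)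
  qed
  then have AL: "A \<in> lattice_mats" using A by (simp add: lattice_mats_def)
  have "f = endo A" by (rule torus_fun_eqI[OF ext endo_extensional]) (simp add: fA endo_pt[OF AL])
  with AL show thesis by (rule that)
qed

lemma analytic_rep_lattice_mats: "f \<in> carrier (End_ring g L) \<Longrightarrow> analytic_rep g L f \<in> lattice_mats"
  by (erule End_cases) (simp add: analytic_rep_endo)

lemma endo_analytic_rep: "f \<in> carrier (End_ring g L) \<Longrightarrow> endo (analytic_rep g L f) = f"
  by (erule End_cases) (simp add: analytic_rep_endo)

lemma End_Q_carrier:
  "carrier (End_Q g L) = {A \<in> carrier_mat g g. \<exists>n::nat. n > 0 \<and> of_nat n \<cdot>\<^sub>m A \<in> lattice_mats}"
proof -
  have "(\<exists>f\<in>carrier (End_ring g L). B = analytic_rep g L f) \<longleftrightarrow> B \<in> lattice_mats" for B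
    using endo_End[of B] analytic_rep_endo[of B] analytic_rep_lattice_mats by metis
  then have "(\<exists>f\<in>carrier (End_ring g L). \<exists>n::nat. n > 0 \<and> of_nat n \<cdot>\<^sub>m A = analytic_rep g L f)
      \<longleftrightarrow> (\<exists>n::nat. n > 0 \<and> of_nat n \<cdot>\<^sub>m A \<in> lattice_mats)" for A
    by blast
  then show ?thesis unfolding End_Q_def by simp
qed

lemma End_Q_simps:
  "mult (End_Q g L) = (*)" "add (End_Q g L) = (+)" "one (End_Q g L) = 1\<^sub>m g" "zero (End_Q g L) = 0\<^sub>m g g"
  by (simp_all add: End_Q_def ring_mat_def)

lemma lattice_mats_End_Q: "A \<in> lattice_mats \<Longrightarrow> A \<in> carrier (End_Q g L)"
proof -
  assume A: "A \<in> lattice_mats"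
  have "of_nat 1 \<cdot>\<^sub>m A = A" by (intro eq_matI) auto
  then show ?thesis unfolding End_Q_carrier using A lattice_mats_carrier[OF A]
    by (intro CollectI conjI exI[of _ "1::nat"]) simp_all
qed

lemma one_lattice_mats: "1\<^sub>m g \<in> lattice_mats"
  using L_carrier by (auto simp: lattice_mats_def)

lemma zero_lattice_mats: "0\<^sub>m g g \<in> lattice_mats"
proof -
  have "0\<^sub>m g g *\<^sub>v v = 0\<^sub>v g" if "v \<in> L" for v using L_carrier[OF that] by auto
  then show ?thesis using zero_L by (auto simp: lattice_mats_def)
qed

lemma mult_lattice_mats: "A \<in> lattice_mats \<Longrightarrow> B \<in> lattice_mats \<Longrightarrow> A * B \<in> lattice_mats"
  unfolding lattice_mats_def by (auto simp: L_carrier assoc_mult_mat_vec[of _ g g _ g])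

lemma add_lattice_mats: "A \<in> lattice_mats \<Longrightarrow> B \<in> lattice_mats \<Longrightarrow> A + B \<in> lattice_mats"
  unfolding lattice_mats_def by (auto simp: L_carrier add_mult_distrib_mat_vec[of _ g g] add_L)

lemma minus_lattice_mats: "A \<in> lattice_mats \<Longrightarrow> B \<in> lattice_mats \<Longrightarrow> A - B \<in> lattice_mats"
  unfolding lattice_mats_def by (auto simp: L_carrier minus_mult_distrib_mat_vec[of _ g g] minus_L)

lemma smult_mult_mat_vec:
  assumes "A \<in> carrier_mat g g" "v \<in> carrier_vec g"
  shows "(c \<cdot>\<^sub>m A) *\<^sub>v v = c \<cdot>\<^sub>v (A *\<^sub>v (v :: complex vec))"
  using assms by (intro eq_vecI) auto

lemma smult_lattice_mats: "A \<in> lattice_mats \<Longrightarrow> of_int k \<cdot>\<^sub>m A \<in> lattice_mats"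
  unfolding lattice_mats_def by (auto simp: L_carrier smult_mult_mat_vec smult_L)

lemma pow_lattice_mats: "A \<in> lattice_mats \<Longrightarrow> A ^\<^sub>m k \<in> lattice_mats"
  using lattice_mats_carrier[of A]
  by (induction k) (auto simp: one_lattice_mats intro!: mult_lattice_mats)

lemma endo_funpow_pt:
  assumes A: "A \<in> lattice_mats" and v: "v \<in> carrier_vec g"
  shows "(endo A ^^ k) (pt v) = pt (A ^\<^sub>m k *\<^sub>v v)"
  using v
proof (induction k arbitrary: v)
  case 0
  then show ?case using lattice_mats_carrier[OF A] by simp
next
  case (Suc k)
  have Ac: "A \<in> carrier_mat g g" by (rule lattice_mats_carrier[OF A])
  have "(endo A ^^ Suc k) (pt v) = (endo A ^^ k) (pt (A *\<^sub>v v))"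
    using Suc.prems by (simp add: funpow_swap1 endo_pt[OF A])
  also have "\<dots> = pt (A ^\<^sub>m k *\<^sub>v (A *\<^sub>v v))" using Suc Ac by simp
  finally show ?case using Suc.prems Ac by (simp add: assoc_mult_mat_vec[of _ g g _ g])
qed

lemma endo_eq_iff:
  assumes "A \<in> lattice_mats" "B \<in> lattice_mats"
  shows "endo A = endo B \<longleftrightarrow> A = B"
  using assms analytic_rep_endo by metis

lemma End_one: "\<one>\<^bsub>End_ring g L\<^esub> = endo (1\<^sub>m g)"
  by (rule torus_fun_eqI[OF _ endo_extensional])
    (auto simp: End_ring_def endo_pt[OF one_lattice_mats] pt_carrier)

lemma End_zero: "\<zero>\<^bsub>End_ring g L\<^esub> = endo (0\<^sub>m g g)"
proof (rule torus_fun_eqI[OF _ endo_extensional])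
  fix v :: "complex vec" assume v: "v \<in> carrier_vec g"
  have "0\<^sub>m g g *\<^sub>v v = 0\<^sub>v g" using v by auto
  then show "\<zero>\<^bsub>End_ring g L\<^esub> (pt v) = endo (0\<^sub>m g g) (pt v)"
    using v by (simp add: End_ring_def endo_pt[OF zero_lattice_mats] pt_carrier one_torus)
qed (simp add: End_ring_def)

lemma End_add:
  assumes A: "A \<in> lattice_mats" and B: "B \<in> lattice_mats"
  shows "endo A \<oplus>\<^bsub>End_ring g L\<^esub> endo B = endo (A + B)"
proof (rule torus_fun_eqI[OF _ endo_extensional])
  fix v :: "complex vec" assume v: "v \<in> carrier_vec g"
  then show "(endo A \<oplus>\<^bsub>End_ring g L\<^esub> endo B) (pt v) = endo (A + B) (pt v)"
    using lattice_mats_carrier[OF A] lattice_mats_carrier[OF B]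
    by (simp add: End_ring_def endo_pt[OF A] endo_pt[OF B] endo_pt[OF add_lattice_mats[OF A B]]
        pt_carrier mult_torus add_mult_distrib_mat_vec)
qed (simp add: End_ring_def)

lemma End_uminus_one: "\<ominus>\<^bsub>End_ring g L\<^esub> \<one>\<^bsub>End_ring g L\<^esub> = endo (- 1\<^sub>m g)"
proof -
  have m1: "- 1\<^sub>m g \<in> lattice_mats"
  proof -
    have "- 1\<^sub>m g = 0\<^sub>m g g - (1\<^sub>m g :: complex mat)" by auto
    then show ?thesis using minus_lattice_mats[OF zero_lattice_mats one_lattice_mats] by metis
  qed
  have z: "1\<^sub>m g + - 1\<^sub>m g = (0\<^sub>m g g :: complex mat)" "- 1\<^sub>m g + 1\<^sub>m g = (0\<^sub>m g g :: complex mat)" by auto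
  show ?thesis
    \<comment> \<open>The negative is computed from its definite description, without ring axioms
      for \<open>End_ring\<close>; uniqueness is read off the matrices.\<close>
    unfolding a_inv_def m_inv_def
  proof (rule the_equality)
    show "endo (- 1\<^sub>m g) \<in> carrier (add_monoid (End_ring g L)) \<and>
        \<one>\<^bsub>End_ring g L\<^esub> \<otimes>\<^bsub>add_monoid (End_ring g L)\<^esub> endo (- 1\<^sub>m g) = \<one>\<^bsub>add_monoid (End_ring g L)\<^esub> \<and>
        endo (- 1\<^sub>m g) \<otimes>\<^bsub>add_monoid (End_ring g L)\<^esub> \<one>\<^bsub>End_ring g L\<^esub> = \<one>\<^bsub>add_monoid (End_ring g L)\<^esub>"
      using endo_End[OF m1] by (simp add: End_one End_zero End_add m1 one_lattice_mats z)
    fix h assume h: "h \<in> carrier (add_monoid (End_ring g L)) \<and>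
        \<one>\<^bsub>End_ring g L\<^esub> \<otimes>\<^bsub>add_monoid (End_ring g L)\<^esub> h = \<one>\<^bsub>add_monoid (End_ring g L)\<^esub> \<and>
        h \<otimes>\<^bsub>add_monoid (End_ring g L)\<^esub> \<one>\<^bsub>End_ring g L\<^esub> = \<one>\<^bsub>add_monoid (End_ring g L)\<^esub>"
    then obtain A where A: "A \<in> lattice_mats" "h = endo A" using End_cases[of h] by auto
    then have "endo (1\<^sub>m g + A) = endo (0\<^sub>m g g)"
      using h by (simp add: End_one End_zero End_add one_lattice_mats)
    then have e: "1\<^sub>m g + A = 0\<^sub>m g g" using A endo_eq_iff add_lattice_mats one_lattice_mats zero_lattice_mats by blast
    have "A = - 1\<^sub>m g"
    proof (rule eq_matI)
      fix i j assume "i < dim_row (- 1\<^sub>m g :: complex mat)" "j < dim_col (- 1\<^sub>m g :: complex mat)"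
      then have ij: "i < g" "j < g" by auto
      have "(1\<^sub>m g + A) $$ (i, j) = 0" using ij e by simp
      then show "A $$ (i, j) = (- 1\<^sub>m g) $$ (i, j)"
        using ij lattice_mats_carrier[OF A(1)] by (simp add: eq_neg_iff_add_eq_0 add.commute)
    qed (use lattice_mats_carrier[OF A(1)] in auto)
    then show "h = endo (- 1\<^sub>m g)" using A by simp
  qed
qed

end

section \<open>Fixed points of powers of an endomorphism\<close>

lemma upper_triangular_mult:
  fixes A B :: "'a :: comm_ring_1 mat"
  assumes A: "A \<in> carrier_mat n n" and B: "B \<in> carrier_mat n n"
    and uA: "upper_triangular A" and uB: "upper_triangular B"
  shows "upper_triangular (A * B)" "i < n \<Longrightarrow> (A * B) $$ (i, i) = A $$ (i, i) * B $$ (i, i)"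
proof -
  have eq: "(A * B) $$ (i, j) = (\<Sum>k<n. if k = i \<and> i = j then A $$ (i, i) * B $$ (i, i) else 0)"
    if "i < n" "j \<le> i" for i j
  proof -
    have "(A * B) $$ (i, j) = (\<Sum>k<n. A $$ (i, k) * B $$ (k, j))"
      using that A B by (auto simp: scalar_prod_def lessThan_atLeast0 intro!: sum.cong)
    also have "\<dots> = (\<Sum>k<n. if k = i \<and> i = j then A $$ (i, i) * B $$ (i, i) else 0)"
    proof (rule sum.cong[OF refl])
      fix k assume "k \<in> {..<n}"
      moreover have "A $$ (i, k) = 0" if "k < i" using upper_triangularD[OF uA that] \<open>i < n\<close> A by simp
      moreover have "B $$ (k, j) = 0" if "j < k" "k < n" using upper_triangularD[OF uB that(1)] that B by simp
      ultimately show "A $$ (i, k) * B $$ (k, j) = (if k = i \<and> i = j then A $$ (i, i) * B $$ (i, i) else 0)"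
        using \<open>j \<le> i\<close> by (cases "k < i"; cases "j < k"; cases "k = i \<and> i = j") auto
    qed
    finally show ?thesis .
  qed
  show "upper_triangular (A * B)"
    using eq A by (intro upper_triangularI) auto
  show "i < n \<Longrightarrow> (A * B) $$ (i, i) = A $$ (i, i) * B $$ (i, i)"
    using eq[of i i] by simp
qed

lemma upper_triangular_pow:
  fixes A :: "'a :: comm_ring_1 mat"
  assumes A: "A \<in> carrier_mat n n" and uA: "upper_triangular A"
  shows "upper_triangular (A ^\<^sub>m k)" "i < n \<Longrightarrow> (A ^\<^sub>m k) $$ (i, i) = A $$ (i, i) ^ k"
proof (induction k)
  case 0
  { case 1 then show ?case using A by auto }
  { case 2 then show ?case using A by auto }
next
  case (Suc k)
  have Ak: "A ^\<^sub>m k \<in> carrier_mat n n" using A by simp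
  { case 1 then show ?case using upper_triangular_mult(1)[OF Ak A _ uA] Suc by simp }
  { case 2 then show ?case using upper_triangular_mult(2)[OF Ak A _ uA] Suc by (simp add: mult.commute) }
qed

text \<open>A Schur form puts the eigenvalues, with multiplicity, on the diagonal of a triangular
  matrix \<open>B\<close>, and \<open>1 - M^k\<close> is similar to the triangular
  \<open>1 - B^k\<close>. The conjugating matrices do not depend on \<open>k\<close>, so one list
  serves all powers.\<close>

lemma eigenvalue_list:
  fixes M :: "complex mat"
  assumes M: "M \<in> carrier_mat n n"
  obtains es where "length es = n" "\<And>z. z \<in> set es \<Longrightarrow> eigenvalue M z" "det M = prod_list es"
    "\<And>k. det (1\<^sub>m n - M ^\<^sub>m k) = (\<Prod>z\<leftarrow>es. 1 - z ^ k)"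
proof -
  obtain es where es: "char_poly M = (\<Prod>z\<leftarrow>es. [:- z, 1:])" "length es = n"
    using char_poly_factorized[OF M] by blast
  obtain B P Q where BPQ: "schur_decomposition M es = (B, P, Q)" by (cases "schur_decomposition M es") auto
  have wit: "similar_mat_wit M B P Q" and uB: "upper_triangular B" and dB: "diag_mat B = es"
    using schur_decomposition[OF M es(1) BPQ] by auto
  note W = similar_mat_witD2[OF M wit]
  have B: "B \<in> carrier_mat n n" by (rule W)
  have e: "es ! i = B $$ (i, i)" if "i < n" for i using that dB B by (auto simp: diag_mat_def)
  show thesis
  proof
    show "length es = n" by (rule es)
    show "eigenvalue M z" if "z \<in> set es" for z
    proof -
      have "poly (char_poly M) z = 0"
        using that unfolding es by (simp add: poly_prod_list prod_list_zero_iff image_iff)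
      then show ?thesis using eigenvalue_root_char_poly[OF M] by simp
    qed
    have "similar_mat M B" using wit by (auto simp: similar_mat_def)
    then show "det M = prod_list es"
      using det_similar[of M B] det_upper_triangular[OF uB B] dB by simp
    fix k
    let ?D = "1\<^sub>m n - B ^\<^sub>m k"
    have Bk: "B ^\<^sub>m k \<in> carrier_mat n n" using B by simp
    have "M ^\<^sub>m k = P * B ^\<^sub>m k * Q" by (rule similar_mat_wit_pow_id[OF wit])
    then have "1\<^sub>m n - M ^\<^sub>m k = P * ?D * Q"
      using W(5-7) Bk W(1)
      by (simp add: mult_minus_distrib_mat[of _ n n _ n] minus_mult_distrib_mat[of _ n n _ _ n]
          assoc_mult_mat[of P n n "B ^\<^sub>m k" n Q n])
    then have "similar_mat_wit (1\<^sub>m n - M ^\<^sub>m k) ?D P Q"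
      using W Bk by (intro similar_mat_witI[of _ _ n]) auto
    then have "det (1\<^sub>m n - M ^\<^sub>m k) = det ?D" by (intro det_similar) (auto simp: similar_mat_def)
    also have "\<dots> = prod_list (diag_mat ?D)"
    proof (rule det_upper_triangular)
      show "upper_triangular ?D"
        using upper_triangularD[OF upper_triangular_pow(1)[OF B uB, of k]] Bk B
        by (intro upper_triangularI) auto
      show "?D \<in> carrier_mat n n" by (rule minus_carrier_mat[OF Bk])
    qed
    also have "diag_mat ?D = map (\<lambda>z. 1 - z ^ k) es"
    proof (rule nth_equalityI)
      have dims: "dim_row B = n" using B by simp
      show "length (diag_mat ?D) = length (map (\<lambda>z. 1 - z ^ k) es)"
        using es(2) dims by (simp add: diag_mat_def)
      fix i assume "i < length (diag_mat ?D)"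
      then have "i < n" using dims by (simp add: diag_mat_def)
      then show "diag_mat ?D ! i = map (\<lambda>z. 1 - z ^ k) es ! i"
        using carrier_matD[OF Bk] es(2) by (simp add: diag_mat_def upper_triangular_pow(2)[OF B uB] e)
    qed
    finally show "det (1\<^sub>m n - M ^\<^sub>m k) = (\<Prod>z\<leftarrow>es. 1 - z ^ k)" .
  qed
qed

lemma unit_circle_pow_near_one:
  fixes z :: complex
  assumes z: "cmod z = 1" and e: "e > 0"
  obtains k where "k \<ge> 1" "cmod (1 - z ^ k) < e"
proof -
  \<comment> \<open>The powers form a bounded sequence in the real plane and have a convergent
    subsequence. Two consecutive terms of it are close, and dividing by the smaller power leaves
    \<open>1 - z^k\<close>.\<close>
  let ?f = "\<lambda>n. (Re (z ^ n), Im (z ^ n))"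
  have "bounded (range ?f)"
    unfolding bounded_iff using z
    by (auto simp: norm_Pair norm_power simp flip: cmod_def intro!: exI[of _ 1])
  then obtain l r where r: "strict_mono (r :: nat \<Rightarrow> nat)" and "(?f \<circ> r) \<longlonglongrightarrow> l"
    using bounded_imp_convergent_subsequence by blast
  from tendsto_Complex[OF tendsto_fst[OF this(2)] tendsto_snd[OF this(2)]]
  have lim: "((\<lambda>n. z ^ n) \<circ> r) \<longlonglongrightarrow> Complex (fst l) (snd l)" by (simp add: comp_def)
  have "Cauchy ((\<lambda>n. z ^ n) \<circ> r)" using LIMSEQ_imp_Cauchy[OF lim] .
  then obtain N where "\<And>m n. m \<ge> N \<Longrightarrow> n \<ge> N \<Longrightarrow> norm (z ^ r m - z ^ r n) < e"
    using CauchyD[OF _ e] unfolding comp_def by blast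
  then have close: "norm (z ^ r N - z ^ r (Suc N)) < e" by simp
  have lt: "r N < r (Suc N)" using r by (simp add: strict_mono_def)
  define k where "k = r (Suc N) - r N"
  have "z ^ r N - z ^ r (Suc N) = z ^ r N * (1 - z ^ k)"
    using lt by (simp add: k_def right_diff_distrib flip: power_add)
  then have "norm (1 - z ^ k) < e" using close z by (simp add: norm_mult norm_power)
  moreover have "k \<ge> 1" using lt by (simp add: k_def)
  ultimately show thesis using that by blast
qed

text \<open>The product of the \<open>max 1 (cmod z)\<close> is the Mahler measure of the polynomial
  with roots \<open>es\<close>. Off the unit circle it is the exact growth rate of the left-hand
  side, by the lower bound that follows.\<close>

lemma prod_list_one_minus_pow_le:
  fixes es :: "complex list"
  shows "cmod (\<Prod>z\<leftarrow>es. 1 - z ^ k) \<le> 2 ^ length es * (\<Prod>z\<leftarrow>es. max 1 (cmod z)) ^ k"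
proof (induction es)
  case (Cons z es)
  have "cmod (1 - z ^ k) \<le> 1 + cmod z ^ k"
    by (metis norm_one norm_power norm_triangle_ineq4)
  also have "\<dots> \<le> max 1 (cmod z) ^ k + max 1 (cmod z) ^ k"
    by (intro add_mono power_mono one_le_power) auto
  finally have "cmod (1 - z ^ k) \<le> 2 * max 1 (cmod z) ^ k" by simp
  from mult_mono[OF this Cons] show ?case
    by (simp add: norm_mult power_mult_distrib mult_ac)
qed simp

text \<open>Off the unit circle each factor \<open>1 - z^k\<close> stays comparable to
  \<open>max 1 (cmod z) ^ k\<close>: with constant \<open>1 - cmod z\<close> inside the circle and
  \<open>1 - 1 / cmod z\<close> outside.\<close>

lemma prod_list_one_minus_pow_ge:
  fixes es :: "complex list"
  assumes "\<And>z. z \<in> set es \<Longrightarrow> cmod z \<noteq> 1"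
  shows "\<exists>c>0. \<forall>k\<ge>1. c * (\<Prod>z\<leftarrow>es. max 1 (cmod z)) ^ k \<le> cmod (\<Prod>z\<leftarrow>es. 1 - z ^ k)"
  using assms
proof (induction es)
  case (Cons z es)
  obtain c where c: "c > 0"
    "\<And>k. k \<ge> 1 \<Longrightarrow> c * (\<Prod>z\<leftarrow>es. max 1 (cmod z)) ^ k \<le> cmod (\<Prod>z\<leftarrow>es. 1 - z ^ k)"
    using Cons by auto
  have "\<exists>b>0. \<forall>k\<ge>1. b * max 1 (cmod z) ^ k \<le> cmod (1 - z ^ k)"
  proof (cases "cmod z < 1")
    case True
    have "1 - cmod z \<le> cmod (1 - z ^ k)" if "k \<ge> 1" for k
    proof -
      have "cmod z ^ k \<le> cmod z ^ 1" using True that by (intro power_decreasing) auto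
      then show ?thesis using norm_triangle_ineq2[of 1 "z ^ k"] by (simp add: norm_power)
    qed
    then show ?thesis using True by (intro exI[of _ "1 - cmod z"]) (auto simp: max_def)
  next
    case False
    then have gt: "cmod z > 1" using Cons.prems[of z] by auto
    have "(1 - 1 / cmod z) * cmod z ^ k \<le> cmod (1 - z ^ k)" if "k \<ge> 1" for k
    proof -
      have "cmod z ^ 1 \<le> cmod z ^ k" using gt that by (intro power_increasing) auto
      then have "(1 - 1 / cmod z) * cmod z ^ k \<le> cmod z ^ k - 1" using gt by (auto simp: left_diff_distrib le_divide_eq)
      also have "\<dots> \<le> cmod (1 - z ^ k)"
        using norm_triangle_ineq2[of "z ^ k" 1] by (simp add: norm_power norm_minus_commute)
      finally show ?thesis .
    qed
    then show ?thesis using gt by (intro exI[of _ "1 - 1 / cmod z"]) (auto simp: max_def divide_less_eq_1)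
  qed
  then obtain b where b: "b > 0" "\<And>k. k \<ge> 1 \<Longrightarrow> b * max 1 (cmod z) ^ k \<le> cmod (1 - z ^ k)" by blast
  show ?case
  proof (intro exI[of _ "b * c"] conjI allI impI)
    fix k :: nat assume k: "k \<ge> 1"
    have nn: "0 \<le> (\<Prod>z\<leftarrow>es. max 1 (cmod z))" by (intro prod_list_nonneg) auto
    have "(b * max 1 (cmod z) ^ k) * (c * (\<Prod>z\<leftarrow>es. max 1 (cmod z)) ^ k)
        \<le> cmod (1 - z ^ k) * cmod (\<Prod>z\<leftarrow>es. 1 - z ^ k)"
      using b(1) c(1) nn by (intro mult_mono b(2) c(2) k) auto
    then show "b * c * (\<Prod>z\<leftarrow>z # es. max 1 (cmod z)) ^ k \<le> cmod (\<Prod>z\<leftarrow>z # es. 1 - z ^ k)"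
      by (simp add: norm_mult power_mult_distrib mult_ac)
  qed (use b c in auto)
qed (auto intro!: exI[of _ 1])

text \<open>The Mahler measure bounds the modulus of the product of the roots. A head outside the
  circle contributes a factor above 1 itself; a head inside forces the product of the remaining
  roots above 1.\<close>

lemma prod_list_max_one_gt:
  fixes es :: "complex list"
  assumes ne: "es \<noteq> []" and n1: "\<And>z. z \<in> set es \<Longrightarrow> cmod z \<noteq> 1" and ge: "cmod (prod_list es) \<ge> 1"
  shows "(\<Prod>z\<leftarrow>es. max 1 (cmod z)) > 1"
proof -
  have *: "cmod (prod_list es) \<le> (\<Prod>z\<leftarrow>es. max 1 (cmod z)) \<and> 1 \<le> (\<Prod>z\<leftarrow>es. max 1 (cmod z))"
    for es :: "complex list"
  proof (induction es)
    case (Cons z es)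
    then have "cmod z * cmod (prod_list es) \<le> max 1 (cmod z) * (\<Prod>z\<leftarrow>es. max 1 (cmod z))"
      by (intro mult_mono) auto
    moreover have "1 * 1 \<le> max 1 (cmod z) * (\<Prod>z\<leftarrow>es. max 1 (cmod z))"
      using Cons by (intro mult_mono) auto
    ultimately show ?case by (simp add: norm_mult)
  qed simp
  obtain z fs where es: "es = z # fs" using ne by (cases es) auto
  have z1: "cmod z \<noteq> 1" using n1 es by simp
  show ?thesis
  proof (cases "cmod z > 1")
    case True
    have "1 * 1 < max 1 (cmod z) * (\<Prod>z\<leftarrow>fs. max 1 (cmod z))"
      using True *[of fs] by (intro mult_less_le_imp_less) auto
    then show ?thesis using es by simp
  next
    case False
    then have lt: "cmod z < 1" using z1 by simp
    have p: "cmod z * cmod (prod_list fs) \<ge> 1" using ge es by (simp add: norm_mult)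
    then have pos: "cmod (prod_list fs) > 0" by (metis mult_zero_right norm_le_zero_iff norm_zero not_less not_one_le_zero)
    have "cmod z * cmod (prod_list fs) < 1 * cmod (prod_list fs)"
      using lt pos by (intro mult_strict_right_mono) auto
    then have "1 < cmod (prod_list fs)" using p by simp
    then have "1 < (\<Prod>z\<leftarrow>fs. max 1 (cmod z))" using *[of fs] by linarith
    then show ?thesis using es lt by (simp add: max_def)
  qed
qed

text \<open>Along \<open>1 + k p\<close> the function is constant, while exponential growth is
  unbounded. This exclusion is what allows conclusions from the behaviour of the function back to
  the eigenvalues.\<close>

lemma periodic_not_exponential:
  assumes "periodic_fun h" "grows_exponentially h"
  shows False
proof -
  obtain p where p: "p \<ge> 1" "\<And>n. n \<ge> 1 \<Longrightarrow> h (n + p) = h n" using assms(1) by (auto simp: periodic_fun_def)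
  obtain A B N where A: "A > 1" "\<And>n. n \<ge> N \<Longrightarrow> A ^ n \<le> real (h n)"
    using assms(2) by (auto simp: grows_exponentially_def)
  have per: "h (1 + k * p) = h 1" for k
    using p(2)[of "1 + k * p" for k] by (induction k) (auto simp: algebra_simps)
  obtain m where m: "real (h 1) < A ^ m" using real_arch_pow[OF A(1)] by blast
  define k where "k = max m N"
  have le: "k \<le> 1 + k * p" using p(1) by (cases p) auto
  have "A ^ m \<le> A ^ (1 + k * p)" using A(1) le by (intro power_increasing) (auto simp: k_def)
  also have "\<dots> \<le> real (h (1 + k * p))" using le by (intro A) (auto simp: k_def)
  finally show False using m per by simp
qed

section \<open>The rational representation and the order of kernels\<close>

lemma finite_card_vec_box:
  fixes d :: int and n :: nat
  assumes "d \<ge> 0"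
  defines "S \<equiv> {x \<in> carrier_vec n. \<forall>i<n. 0 \<le> x $ i \<and> x $ i < d}"
  shows "finite S" "int (card S) \<le> d ^ n"
proof -
  let ?X = "{xs. set xs \<subseteq> {0..<d} \<and> length xs = n}"
  have sub: "S \<subseteq> vec_of_list ` ?X"
  proof
    fix x assume "x \<in> S"
    then have x: "x \<in> carrier_vec n" "\<forall>i<n. 0 \<le> x $ i \<and> x $ i < d" by (auto simp: S_def)
    have "list_of_vec x \<in> ?X"
      using x by (auto simp: set_list_of_vec vec_set_def)
    then show "x \<in> vec_of_list ` ?X" by (metis imageI vec_list)
  qed
  have fin: "finite ?X" by (rule finite_lists_length_eq) simp
  show "finite S" using finite_subset[OF sub] fin by simp
  have "card S \<le> card ?X" using fin sub by (rule surj_card_le)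
  also have "card ?X = nat d ^ n" using card_lists_length_eq[of "{0..<d}" n] by simp
  finally show "int (card S) \<le> d ^ n" using assms(1) by (metis int_nat_eq of_nat_le_iff of_nat_power)
qed

context full_lattice
begin

lemma L_coord:
  assumes "v \<in> L" obtains x where "x \<in> carrier_vec n" "v = P *\<^sub>v cvec x"
  using assms by (auto simp: L_eq)

lemma P_cvec_L: "x \<in> carrier_vec n \<Longrightarrow> P *\<^sub>v cvec x \<in> L"
  by (auto simp: L_eq)

lemma P_inj_int:
  assumes x: "x \<in> carrier_vec n" and y: "y \<in> carrier_vec n" and eq: "P *\<^sub>v cvec x = P *\<^sub>v cvec y"
  shows "x = y"
proof -
  let ?z = "map_vec real_of_int (x - y)"
  have "map_vec complex_of_real ?z = cvec x - cvec y" using x y by (intro eq_vecI) auto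
  then have "P *\<^sub>v map_vec complex_of_real ?z = 0\<^sub>v g"
    using P x y eq by (simp add: mult_mat_vec_minus[of _ g n])
  then have z: "?z = 0\<^sub>v n" using x y by (intro inj) auto
  show ?thesis
  proof (intro eq_vecI)
    fix i assume "i < dim_vec y"
    then have i: "i < n" using y by simp
    have "?z $ i = 0" using i z by simp
    then show "x $ i = y $ i" using i x y by simp
  qed (use x y in auto)
qed

text \<open>Column \<open>j\<close> of \<open>M\<close> holds the lattice coordinates of the image
  of the \<open>j\<close>-th basis vector of \<open>L\<close>.\<close>

lemma rational_rep:
  assumes A: "A \<in> lattice_mats"
  obtains M where "M \<in> carrier_mat n n" "A * P = P * map_mat complex_of_int M"
proof -
  have Ac: "A \<in> carrier_mat g g" by (rule lattice_mats_carrier[OF A])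
  have "\<exists>m. m \<in> carrier_vec n \<and> A *\<^sub>v (P *\<^sub>v unit_vec n j) = P *\<^sub>v cvec m" if "j < n" for j
    using A col_P_L[OF that] L_eq unfolding lattice_mats_def by blast
  then obtain m where m: "\<And>j. j < n \<Longrightarrow> m j \<in> carrier_vec n"
    "\<And>j. j < n \<Longrightarrow> A *\<^sub>v (P *\<^sub>v unit_vec n j) = P *\<^sub>v cvec (m j)"
    by metis
  define M where "M = mat n n (\<lambda>(i, j). m j $ i)"
  have M: "M \<in> carrier_mat n n" by (simp add: M_def)
  have "A * P = P * map_mat complex_of_int M"
  proof (rule eq_matI)
    fix i j assume "i < dim_row (P * map_mat complex_of_int M)" "j < dim_col (P * map_mat complex_of_int M)"
    then have ij: "i < g" "j < n" using P M by auto
    have c1: "col (A * P) j = A *\<^sub>v (P *\<^sub>v unit_vec n j)"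
    proof -
      have "P *\<^sub>v unit_vec n j = col P j" using ij P by (intro eq_vecI) auto
      then show ?thesis by (simp only: col_mult2[OF Ac P ij(2)])
    qed
    have c2: "col (P * map_mat complex_of_int M) j = P *\<^sub>v cvec (m j)"
    proof -
      have col_M: "col (map_mat complex_of_int M) j = cvec (m j)"
        using ij m(1)[of j] by (intro eq_vecI) (auto simp: M_def)
      have Mc: "map_mat complex_of_int M \<in> carrier_mat n n" using M by simp
      show ?thesis by (simp only: col_mult2[OF P Mc ij(2)] col_M)
    qed
    have "col (A * P) j $ i = col (P * map_mat complex_of_int M) j $ i" using c1 c2 m(2) ij by simp
    then show "(A * P) $$ (i, j) = (P * map_mat complex_of_int M) $$ (i, j)"
      using ij Ac P M by simp
  qed (use Ac P M in auto)
  with M show thesis by (rule that)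
qed

lemma rational_rep_pow:
  assumes A: "A \<in> carrier_mat g g" and M: "M \<in> carrier_mat n n"
    and AM: "A * P = P * map_mat complex_of_int M"
  shows "A ^\<^sub>m k * P = P * map_mat complex_of_int (M ^\<^sub>m k)"
proof (induction k)
  case 0
  then show ?case using A P M by (simp add: of_int_hom.mat_hom_one)
next
  case (Suc k)
  have "A ^\<^sub>m Suc k * P = A ^\<^sub>m k * (A * P)" using A P by (simp add: assoc_mult_mat[of _ g g _ g _ n])
  also have "\<dots> = (A ^\<^sub>m k * P) * map_mat complex_of_int M"
    unfolding AM using A P M by (simp add: assoc_mult_mat[of _ g g _ n _ n])
  also have "\<dots> = P * map_mat complex_of_int (M ^\<^sub>m Suc k)"
    unfolding Suc using P M by (simp add: assoc_mult_mat[of _ g n _ n _ n] of_int_hom.mat_hom_mult[of _ n n _ n])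
  finally show ?case .
qed

lemma rational_rep_one_minus:
  assumes A: "A \<in> carrier_mat g g" and M: "M \<in> carrier_mat n n"
    and AM: "A * P = P * map_mat complex_of_int M"
  shows "(1\<^sub>m g - A) * P = P * map_mat complex_of_int (1\<^sub>m n - M)"
proof -
  have "map_mat complex_of_int (1\<^sub>m n - M) = 1\<^sub>m n - map_mat complex_of_int M"
    using M by (intro eq_matI) auto
  then show ?thesis using A M P AM
    by (simp add: minus_mult_distrib_mat[of _ g g _ _ n] mult_minus_distrib_mat[of _ g n _ n])
qed

text \<open>
  The eigenvalues of the rational representation are those of the analytic one and their
  conjugates: \<open>P\<close> cannot kill both an eigenvector \<open>x\<close> and its conjugate.
\<close>

lemma eigenvalue_rational_rep:
  assumes A: "A \<in> carrier_mat g g" and M: "M \<in> carrier_mat n n"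
    and AM: "A * P = P * map_mat complex_of_int M"
    and z: "eigenvalue (map_mat complex_of_int M) z"
  shows "eigenvalue A z \<or> eigenvalue A (cnj z)"
proof -
  let ?M = "map_mat complex_of_int M"
  obtain x where x: "x \<in> carrier_vec n" "x \<noteq> 0\<^sub>v n" "?M *\<^sub>v x = z \<cdot>\<^sub>v x"
    using z M by (auto simp: eigenvalue_def eigenvector_def)
  have ev: "eigenvalue A w" if y: "y \<in> carrier_vec n" "?M *\<^sub>v y = w \<cdot>\<^sub>v y" "P *\<^sub>v y \<noteq> 0\<^sub>v g" for y w
  proof -
    have "A *\<^sub>v (P *\<^sub>v y) = (A * P) *\<^sub>v y" using A P y by simp
    also have "\<dots> = P *\<^sub>v (?M *\<^sub>v y)" unfolding AM using P M y by (simp add: assoc_mult_mat_vec[of _ g n _ n])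
    also have "\<dots> = w \<cdot>\<^sub>v (P *\<^sub>v y)" using P y by (simp add: mult_mat_vec)
    finally show ?thesis using y A P unfolding eigenvalue_def eigenvector_def
      by (intro exI[of _ "P *\<^sub>v y"]) auto
  qed
  let ?y = "map_vec cnj x"
  have y: "?y \<in> carrier_vec n" using x by simp
  have My: "?M *\<^sub>v ?y = cnj z \<cdot>\<^sub>v ?y"
  proof (intro eq_vecI)
    fix i assume "i < dim_vec (cnj z \<cdot>\<^sub>v ?y)"
    then have i: "i < n" using x by simp
    have "(?M *\<^sub>v ?y) $ i = cnj ((?M *\<^sub>v x) $ i)"
      using i M x(1) by (simp add: scalar_prod_def)
    then show "(?M *\<^sub>v ?y) $ i = (cnj z \<cdot>\<^sub>v ?y) $ i" using x i by simp
  qed (use M x in auto)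
  \<comment> \<open>Real and imaginary part of \<open>x\<close> are combinations of \<open>x\<close>
    and its conjugate; if \<open>P\<close> killed both, \<open>inj\<close> would make these real
    vectors zero.\<close>
  have "P *\<^sub>v x \<noteq> 0\<^sub>v g \<or> P *\<^sub>v ?y \<noteq> 0\<^sub>v g"
  proof (rule ccontr)
    assume "\<not> ?thesis"
    then have px: "P *\<^sub>v x = 0\<^sub>v g" and py: "P *\<^sub>v ?y = 0\<^sub>v g" by auto
    have re: "map_vec complex_of_real (map_vec Re x) = (1 / 2) \<cdot>\<^sub>v (x + ?y)"
      using x by (intro eq_vecI) (auto simp: complex_add_cnj)
    have im: "map_vec complex_of_real (map_vec Im x) = (1 / (2 * \<i>)) \<cdot>\<^sub>v (x - ?y)"
      using x by (intro eq_vecI) (auto simp: complex_eq_iff Re_divide Im_divide)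
    have "map_vec Re x = 0\<^sub>v n"
    proof (rule inj)
      have "P *\<^sub>v (x + ?y) = 0\<^sub>v g + 0\<^sub>v g" using P x px py by (simp add: mult_add_distrib_mat_vec)
      then have z0: "P *\<^sub>v (x + ?y) = 0\<^sub>v g" by simp
      show "P *\<^sub>v map_vec complex_of_real (map_vec Re x) = 0\<^sub>v g"
        unfolding re mult_mat_vec[OF P add_carrier_vec[OF x(1) y]] z0 by auto
    qed (use x in auto)
    moreover have "map_vec Im x = 0\<^sub>v n"
    proof (rule inj)
      have "P *\<^sub>v (x - ?y) = 0\<^sub>v g - 0\<^sub>v g" using P x px py by (simp add: mult_mat_vec_minus[of _ g n])
      then have z0: "P *\<^sub>v (x - ?y) = 0\<^sub>v g" by simp
      show "P *\<^sub>v map_vec complex_of_real (map_vec Im x) = 0\<^sub>v g"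
        unfolding im mult_mat_vec[OF P minus_carrier_vec[OF x(1) y]] z0 by auto
    qed (use x in auto)
    moreover have "x $ i = Complex (map_vec Re x $ i) (map_vec Im x $ i)" if "i < n" for i
      using x that by simp
    ultimately have "x = 0\<^sub>v n" using x by (intro eq_vecI) (auto simp: complex_eq_iff)
    then show False using x by simp
  qed
  then show ?thesis using ev[OF x(1,3)] ev[OF y My] by blast
qed

text \<open>A kernel vector of \<open>T\<close> is written in real lattice coordinates, where
  \<open>N\<close> annihilates it. This takes the place of the formula
  \<open>det N = |det T|^2\<close>.\<close>

lemma det_lattice_mat_nonzero:
  assumes T: "T \<in> carrier_mat g g" and N: "N \<in> carrier_mat n n" and TN: "T * P = P * map_mat complex_of_int N"
    and d: "det N \<noteq> 0"
  shows "det T \<noteq> 0"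
proof
  assume "det T = 0"
  then obtain v where v: "v \<in> carrier_vec g" "v \<noteq> 0\<^sub>v g" "T *\<^sub>v v = 0\<^sub>v g"
    using det_0_iff_vec_prod_zero[OF T] by blast
  obtain y where y: "y \<in> carrier_vec n" "v = P *\<^sub>v map_vec complex_of_real y" using v(1) surj by auto
  let ?N = "map_mat complex_of_int N" and ?R = "map_mat real_of_int N"
  have NR: "?N *\<^sub>v map_vec complex_of_real y = map_vec complex_of_real (?R *\<^sub>v y)"
    using N y(1) by (intro eq_vecI) (auto simp: scalar_prod_def)
  have "T *\<^sub>v v = (T * P) *\<^sub>v map_vec complex_of_real y" using T P y by simp
  also have "\<dots> = P *\<^sub>v map_vec complex_of_real (?R *\<^sub>v y)"
    unfolding TN NR[symmetric] using P N y by (simp add: assoc_mult_mat_vec[of _ g n _ n])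
  finally have "P *\<^sub>v map_vec complex_of_real (?R *\<^sub>v y) = 0\<^sub>v g" using v by simp
  then have "?R *\<^sub>v y = 0\<^sub>v n" using N y(1) by (intro inj) auto
  moreover have "det ?R \<noteq> 0" using d by simp
  ultimately have "y = 0\<^sub>v n" using det_0_iff_vec_prod_zero[of ?R n] N y by auto
  then show False using v y P by (auto intro!: eq_vecI simp: scalar_prod_def)
qed

text \<open>
  The index of \<open>N \<int>\<^sup>n\<close> in \<open>\<int>\<^sup>n\<close> is in fact \<open>\<bar>det N\<bar>\<close>.  The weaker two-sided bound suffices for
  exponential growth and needs no normal form: the index is at most \<open>\<bar>det N\<bar>\<^sup>n\<close> since
  \<open>det N \<int>\<^sup>n \<subseteq> N \<int>\<^sup>n\<close>, and an index \<open>k\<close> makes \<open>k N\<^sup>-\<^sup>1\<close> integral, so that \<open>det N\<close> divides \<open>k\<^sup>n\<close>.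
\<close>

lemma card_kernel_bounds:
  assumes T: "T \<in> lattice_mats" and N: "N \<in> carrier_mat n n" and TN: "T * P = P * map_mat complex_of_int N"
    and d: "det N \<noteq> 0"
  defines "K \<equiv> pt ` {v \<in> carrier_vec g. T *\<^sub>v v \<in> L}"
  shows "\<bar>det N\<bar> \<le> int (card K) ^ n" "int (card K) \<le> \<bar>det N\<bar> ^ n"
proof -
  have Tc: "T \<in> carrier_mat g g" by (rule lattice_mats_carrier[OF T])
  have dT: "det T \<noteq> 0" by (rule det_lattice_mat_nonzero[OF Tc N TN d])
  obtain S where S: "S \<in> carrier_mat g g" "T * S = 1\<^sub>m g" "S * T = 1\<^sub>m g"
    using det_non_zero_imp_unit[OF Tc dT, of "()"] by (auto simp: Units_def ring_mat_def)
  have ST: "S *\<^sub>v (T *\<^sub>v v) = v" if "v \<in> carrier_vec g" for v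
    using that S Tc by (simp flip: assoc_mult_mat_vec[of _ g g _ g])
  have TS: "T *\<^sub>v (S *\<^sub>v v) = v" if "v \<in> carrier_vec g" for v
    using that S Tc by (simp flip: assoc_mult_mat_vec[of _ g g _ g])
  have cN: "map_mat complex_of_int N *\<^sub>v cvec x = cvec (N *\<^sub>v x)" if "x \<in> carrier_vec n" for x
    using N that by (intro eq_vecI) (auto simp: scalar_prod_def)
  have TP: "T *\<^sub>v (P *\<^sub>v cvec x) = P *\<^sub>v cvec (N *\<^sub>v x)" if "x \<in> carrier_vec n" for x
  proof -
    have "T *\<^sub>v (P *\<^sub>v cvec x) = (T * P) *\<^sub>v cvec x" using Tc P that by simp
    then show ?thesis unfolding TN using P N that cN[OF that] by (simp add: assoc_mult_mat_vec[of _ g n _ n])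
  qed
  let ?d = "det N"
  note adj = adj_mat[OF N]
  \<comment> \<open>The adjugate solves \<open>N y = det N z\<close> over the integers, so the
    inverse \<open>S\<close> of \<open>T\<close> maps \<open>det N\<close> times the lattice into
    the lattice.\<close>
  have SPd: "S *\<^sub>v (P *\<^sub>v cvec (?d \<cdot>\<^sub>v z)) \<in> L" if z: "z \<in> carrier_vec n" for z
  proof -
    have "N *\<^sub>v (adj_mat N *\<^sub>v z) = ?d \<cdot>\<^sub>v z"
    proof -
      have "N *\<^sub>v (adj_mat N *\<^sub>v z) = (?d \<cdot>\<^sub>m 1\<^sub>m n) *\<^sub>v z"
        unfolding adj(2)[symmetric] using N adj(1) z by (simp add: assoc_mult_mat_vec[of _ n n _ n])
      then show ?thesis using z by (auto intro!: eq_vecI)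
    qed
    then have "T *\<^sub>v (P *\<^sub>v cvec (adj_mat N *\<^sub>v z)) = P *\<^sub>v cvec (?d \<cdot>\<^sub>v z)"
      using TP[of "adj_mat N *\<^sub>v z"] adj z by simp
    then have "S *\<^sub>v (P *\<^sub>v cvec (?d \<cdot>\<^sub>v z)) = P *\<^sub>v cvec (adj_mat N *\<^sub>v z)"
      using ST[of "P *\<^sub>v cvec (adj_mat N *\<^sub>v z)"] P adj z by simp
    then show ?thesis using P_cvec_L adj z by simp
  qed
  define X where "X = {x \<in> carrier_vec n. \<forall>i<n. 0 \<le> x $ i \<and> x $ i < \<bar>?d\<bar>}"
  have Xfin: "finite X" "int (card X) \<le> \<bar>?d\<bar> ^ n"
    unfolding X_def by (rule finite_card_vec_box; simp)+
  have sub: "K \<subseteq> (\<lambda>x. pt (S *\<^sub>v (P *\<^sub>v cvec x))) ` X"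
  proof
    fix k assume "k \<in> K"
    then obtain v where v: "v \<in> carrier_vec g" "T *\<^sub>v v \<in> L" "k = pt v" by (auto simp: K_def)
    obtain x where x: "x \<in> carrier_vec n" "T *\<^sub>v v = P *\<^sub>v cvec x" using v(2) by (rule L_coord)
    \<comment> \<open>Reducing the coordinates of \<open>T v\<close> modulo \<open>det N\<close>
      changes \<open>v\<close> only by a lattice vector. Remainders are taken modulo the absolute
      value, and \<open>sgn\<close> turns the quotient into one for \<open>det N\<close>.\<close>
    define x' where "x' = vec n (\<lambda>i. x $ i mod \<bar>?d\<bar>)"
    define z where "z = vec n (\<lambda>i. sgn ?d * (x $ i div \<bar>?d\<bar>))"
    have zc: "z \<in> carrier_vec n" and x'c: "x' \<in> carrier_vec n" by (auto simp: z_def x'_def)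
    have "x' \<in> X" using d by (auto simp: X_def x'_def)
    have "cvec x = cvec x' + cvec (?d \<cdot>\<^sub>v z)"
    proof (intro eq_vecI)
      fix i assume "i < dim_vec (cvec x' + cvec (?d \<cdot>\<^sub>v z))"
      then have i: "i < n" using zc by simp
      have "?d * (sgn ?d * (x $ i div \<bar>?d\<bar>)) = \<bar>?d\<bar> * (x $ i div \<bar>?d\<bar>)"
        by (simp add: abs_sgn mult.assoc)
      moreover have "x $ i = x $ i mod \<bar>?d\<bar> + \<bar>?d\<bar> * (x $ i div \<bar>?d\<bar>)" by simp
      ultimately have "x $ i = x $ i mod \<bar>?d\<bar> + ?d * (sgn ?d * (x $ i div \<bar>?d\<bar>))" by argo
      then have "x $ i = x' $ i + ?d * z $ i" using i unfolding x'_def z_def by (simp only: index_vec)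
      then have "complex_of_int (x $ i) = complex_of_int (x' $ i) + complex_of_int (?d * z $ i)"
        by (metis of_int_add)
      then show "cvec x $ i = (cvec x' + cvec (?d \<cdot>\<^sub>v z)) $ i" using i x zc x'c by simp
    qed (use x zc in auto)
    then have "S *\<^sub>v (P *\<^sub>v cvec x) = S *\<^sub>v (P *\<^sub>v cvec x') + S *\<^sub>v (P *\<^sub>v cvec (?d \<cdot>\<^sub>v z))"
      using S(1) P zc x'c by (simp add: mult_add_distrib_mat_vec[of _ g n] mult_add_distrib_mat_vec[of _ g g])
    then have "S *\<^sub>v (P *\<^sub>v cvec x) - S *\<^sub>v (P *\<^sub>v cvec x') = S *\<^sub>v (P *\<^sub>v cvec (?d \<cdot>\<^sub>v z))"
      using S(1) P zc x'c by (intro eq_vecI) auto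
    then have "pt (S *\<^sub>v (P *\<^sub>v cvec x)) = pt (S *\<^sub>v (P *\<^sub>v cvec x'))"
      using SPd[OF zc] S P x x'c by (simp add: pt_eq_iff)
    moreover have "S *\<^sub>v (P *\<^sub>v cvec x) = v" using ST[OF v(1)] x by simp
    ultimately show "k \<in> (\<lambda>x. pt (S *\<^sub>v (P *\<^sub>v cvec x))) ` X" using v \<open>x' \<in> X\<close> by auto
  qed
  have Kfin: "finite K" using finite_subset[OF sub] Xfin by simp
  have "card K \<le> card X" using Xfin(1) sub by (rule surj_card_le)
  then show "int (card K) \<le> \<bar>det N\<bar> ^ n" using Xfin(2) by linarith
  interpret Tor: comm_group "torus g L" by (rule torus_comm_group)
  have Ksub: "subgroup K (torus g L)"
  proof (rule Tor.subgroupI)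
    have "T *\<^sub>v 0\<^sub>v g = 0\<^sub>v g" using mult_mat_zero_vec[OF Tc] .
    then have "pt (0\<^sub>v g) \<in> K" using zero_L by (auto simp: K_def)
    then show "K \<noteq> {}" by blast
    show "K \<subseteq> carrier (torus g L)" by (auto simp: K_def pt_carrier)
    fix a assume "a \<in> K"
    then obtain v where v: "v \<in> carrier_vec g" "T *\<^sub>v v \<in> L" "a = pt v" by (auto simp: K_def)
    have "pt (- v) \<otimes>\<^bsub>torus g L\<^esub> pt v = \<one>\<^bsub>torus g L\<^esub>"
      using v by (simp add: mult_torus one_torus)
    then have "inv\<^bsub>torus g L\<^esub> a = pt (- v)" using v by (intro Tor.inv_equality) (auto simp: pt_carrier)
    then show "inv\<^bsub>torus g L\<^esub> a \<in> K"
      using v Tc uminus_L by (auto simp: K_def mult_mat_vec_uminus[OF Tc])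
    fix b assume "b \<in> K"
    then obtain w where w: "w \<in> carrier_vec g" "T *\<^sub>v w \<in> L" "b = pt w" by (auto simp: K_def)
    then show "a \<otimes>\<^bsub>torus g L\<^esub> b \<in> K"
      using v Tc add_L by (auto simp: K_def mult_torus mult_add_distrib_mat_vec[OF Tc])
  qed
  let ?G = "torus g L\<lparr>carrier := K\<rparr>"
  have grp: "group ?G" using Ksub Tor.subgroup_imp_group by blast
  define k where "k = card K"
  have k0: "k > 0" using Kfin subgroup.one_closed[OF Ksub] by (auto simp: k_def card_gt_0_iff)
  \<comment> \<open>Lagrange's theorem: the finite group \<open>K\<close> is annihilated by its
    order.\<close>
  have kL: "of_nat k \<cdot>\<^sub>v v \<in> L" if v: "v \<in> carrier_vec g" "T *\<^sub>v v \<in> L" for v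
  proof -
    have "pt v \<in> K" using v by (auto simp: K_def)
    then have "pt v [^]\<^bsub>?G\<^esub> k = \<one>\<^bsub>?G\<^esub>"
      using group.pow_order_eq_1[OF grp, of "pt v"] Kfin by (simp add: order_def k_def)
    then have "pt v [^]\<^bsub>torus g L\<^esub> k = \<one>\<^bsub>torus g L\<^esub>"
      using Tor.nat_pow_consistent[of "pt v" k K] by simp
    then show ?thesis using v by (simp add: pow_torus pt_eq_one_iff)
  qed
  \<comment> \<open>Applied to the preimages under \<open>T\<close> of the lattice basis, the
    annihilation by \<open>k\<close> produces the columns of an integral
    \<open>k N^-1\<close>.\<close>
  have "\<exists>z. z \<in> carrier_vec n \<and> N *\<^sub>v z = int k \<cdot>\<^sub>v unit_vec n j" if j: "j < n" for j
  proof -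
    let ?e = "unit_vec n j :: int vec"
    define v where "v = S *\<^sub>v (P *\<^sub>v cvec ?e)"
    have v: "v \<in> carrier_vec g" "T *\<^sub>v v = P *\<^sub>v cvec ?e" using S P TS by (auto simp: v_def)
    then have "of_nat k \<cdot>\<^sub>v v \<in> L" using P_cvec_L[of ?e] by (intro kL) auto
    then obtain z where z: "z \<in> carrier_vec n" "of_nat k \<cdot>\<^sub>v v = P *\<^sub>v cvec z" by (rule L_coord)
    have "P *\<^sub>v cvec (N *\<^sub>v z) = T *\<^sub>v (of_nat k \<cdot>\<^sub>v v)" using TP[OF z(1)] z(2) by simp
    also have "\<dots> = of_nat k \<cdot>\<^sub>v (P *\<^sub>v cvec ?e)" using v Tc by (simp add: mult_mat_vec)
    also have "\<dots> = P *\<^sub>v cvec (int k \<cdot>\<^sub>v ?e)"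
    proof -
      have "cvec (int k \<cdot>\<^sub>v ?e) = of_nat k \<cdot>\<^sub>v cvec ?e" by (intro eq_vecI) auto
      then show ?thesis using P by (simp add: mult_mat_vec[of _ g n])
    qed
    finally have "N *\<^sub>v z = int k \<cdot>\<^sub>v ?e" using N z by (intro P_inj_int) auto
    then show ?thesis using z by blast
  qed
  then obtain z where z: "\<And>j. j < n \<Longrightarrow> z j \<in> carrier_vec n"
    "\<And>j. j < n \<Longrightarrow> N *\<^sub>v z j = int k \<cdot>\<^sub>v unit_vec n j" by metis
  define Z where "Z = mat n n (\<lambda>(i, j). z j $ i)"
  have Z: "Z \<in> carrier_mat n n" by (simp add: Z_def)
  have "N * Z = int k \<cdot>\<^sub>m 1\<^sub>m n"
  proof (rule eq_matI)
    fix i j assume "i < dim_row (int k \<cdot>\<^sub>m 1\<^sub>m n)" "j < dim_col (int k \<cdot>\<^sub>m 1\<^sub>m n)"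
    then have ij: "i < n" "j < n" by auto
    have "col Z j = z j" using ij z(1)[of j] by (intro eq_vecI) (auto simp: Z_def)
    then have "(N * Z) $$ (i, j) = (N *\<^sub>v z j) $ i" using ij N Z by simp
    then show "(N * Z) $$ (i, j) = (int k \<cdot>\<^sub>m 1\<^sub>m n) $$ (i, j)" using ij z(2) by simp
  qed (use N Z in auto)
  then have "det N * det Z = int k ^ n" using det_mult[OF N Z] by simp
  moreover from this have "det Z \<noteq> 0" using k0 by auto
  ultimately show "\<bar>det N\<bar> \<le> int (card K) ^ n"
    using dvd_imp_le_int[of "int k ^ n" "det N"] k0 by (metis abs_of_nat dvd_triv_left k_def
        of_nat_0_less_iff less_irrefl power_abs zero_less_power)
qed

end

lemma map_of_int_one_minus:
  assumes M: "M \<in> carrier_mat n n"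
  shows "map_mat complex_of_int (1\<^sub>m n - M) = 1\<^sub>m n - map_mat complex_of_int M"
proof (rule eq_matI)
  fix i j assume "i < dim_row (1\<^sub>m n - map_mat complex_of_int M)"
    "j < dim_col (1\<^sub>m n - map_mat complex_of_int M)"
  then show "map_mat complex_of_int (1\<^sub>m n - M) $$ (i, j) = (1\<^sub>m n - map_mat complex_of_int M) $$ (i, j)"
    using M by (cases "i = j") auto
qed (use M in auto)

section \<open>Periodic and exponential behaviour of fixed point numbers\<close>

context full_lattice
begin

lemma rank_pos: assumes "g \<noteq> 0" shows "n \<noteq> 0"
proof
  assume n: "n = 0"
  have v: "v = 0\<^sub>v g" if "v \<in> carrier_vec g" for v :: "complex vec"
  proof -
    from that obtain x where x: "x \<in> carrier_vec n" "v = P *\<^sub>v map_vec complex_of_real x"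
      unfolding surj by (elim imageE)
    have "row P i \<bullet> map_vec complex_of_real x = 0" for i
      using x(1) n by (simp add: scalar_prod_def)
    then show ?thesis using P x(2) by (intro eq_vecI) auto
  qed
  have "unit_vec g 0 $ 0 = (0\<^sub>v g :: complex vec) $ 0" using v[of "unit_vec g 0"] by simp
  then show False using assms by simp
qed

lemma fix_fun_eq_kernel:
  assumes A: "A \<in> lattice_mats"
  shows "fix_fun g L (endo A) k = card (pt ` {v \<in> carrier_vec g. (1\<^sub>m g - A ^\<^sub>m k) *\<^sub>v v \<in> L})"
proof -
  have Ac: "A ^\<^sub>m k \<in> carrier_mat g g" using lattice_mats_carrier[OF A] by simp
  have iff: "(endo A ^^ k) (pt v) = pt v \<longleftrightarrow> (1\<^sub>m g - A ^\<^sub>m k) *\<^sub>v v \<in> L" if v: "v \<in> carrier_vec g" for v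
  proof -
    have "(endo A ^^ k) (pt v) = pt v \<longleftrightarrow> pt v = pt (A ^\<^sub>m k *\<^sub>v v)"
      using v by (auto simp: endo_funpow_pt[OF A])
    also have "\<dots> \<longleftrightarrow> v - A ^\<^sub>m k *\<^sub>v v \<in> L" using v Ac by (simp add: pt_eq_iff)
    also have "v - A ^\<^sub>m k *\<^sub>v v = (1\<^sub>m g - A ^\<^sub>m k) *\<^sub>v v"
      using v Ac by (simp add: minus_mult_distrib_mat_vec[of _ g g])
    finally show ?thesis .
  qed
  then have "{x \<in> carrier (torus g L). (endo A ^^ k) x = x}
      = pt ` {v \<in> carrier_vec g. (1\<^sub>m g - A ^\<^sub>m k) *\<^sub>v v \<in> L}"
    by (auto simp: carrier_torus)
  then show ?thesis by (simp add: fix_fun_def num_fix_def)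
qed

lemma periodic_if_pow_one:
  assumes A: "A \<in> lattice_mats" and p: "p \<ge> 1" and pow: "A ^\<^sub>m p = 1\<^sub>m g"
  shows "periodic_fun (fix_fun g L (endo A))"
  unfolding periodic_fun_def
proof (intro exI[of _ p] conjI allI impI p)
  fix k :: nat
  have Ac: "A \<in> carrier_mat g g" by (rule lattice_mats_carrier[OF A])
  have "A ^\<^sub>m (k + j) = A ^\<^sub>m k * A ^\<^sub>m j" for j
    by (induction j) (use Ac in \<open>simp_all add: assoc_mult_mat[of _ g g _ g _ g]\<close>)
  then have "A ^\<^sub>m (k + p) = A ^\<^sub>m k" using pow Ac by simp
  then show "fix_fun g L (endo A) (k + p) = fix_fun g L (endo A) k"
    by (simp add: fix_fun_eq_kernel[OF A])
qed

text \<open>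
  If all conjugates of an eigenvalue \<open>z\<close> lie on the unit circle, choose \<open>k\<close> with \<open>z\<^sup>k\<close> close
  to \<open>1\<close>.  The determinant of \<open>1 - M\<^sup>k\<close>, a product with one small factor and all others at most
  \<open>2\<close>, is then an integer of absolute value less than \<open>1\<close>.
\<close>

lemma pow_eq_one_if_unit_circle:
  assumes g: "g \<noteq> 0" and A: "A \<in> lattice_mats"
    and div: "\<And>B. B \<in> lattice_mats \<Longrightarrow> B \<noteq> 0\<^sub>m g g \<Longrightarrow> det B \<noteq> 0"
    and unit: "\<And>z. eigenvalue A z \<Longrightarrow> cmod z = 1"
  obtains p where "p \<ge> 1" "A ^\<^sub>m p = 1\<^sub>m g"
proof -
  have Ac: "A \<in> carrier_mat g g" by (rule lattice_mats_carrier[OF A])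
  obtain M where M: "M \<in> carrier_mat n n" and AM: "A * P = P * map_mat complex_of_int M"
    by (rule rational_rep[OF A])
  let ?M = "map_mat complex_of_int M"
  have Mc: "?M \<in> carrier_mat n n" using M by simp
  obtain es where es: "length es = n" "\<And>z. z \<in> set es \<Longrightarrow> eigenvalue ?M z" "det ?M = prod_list es"
    "\<And>k. det (1\<^sub>m n - ?M ^\<^sub>m k) = (\<Prod>z\<leftarrow>es. 1 - z ^ k)"
    by (rule eigenvalue_list[OF Mc]) blast
  have es1: "cmod z = 1" if "z \<in> set es" for z
    using eigenvalue_rational_rep[OF Ac M AM es(2)[OF that]] unit[of z] unit[of "cnj z"] by auto
  obtain z fs where zfs: "es = z # fs" using es(1) rank_pos[OF g] by (cases es) auto
  have "cmod z = 1" using es1 zfs by simp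
  \<comment> \<open>The other \<open>n - 1\<close> factors of the determinant have modulus at most
    2, so the tolerance \<open>1 / 2^n\<close> pushes the product below 1.\<close>
  from unit_circle_pow_near_one[OF this, of "1 / 2 ^ n"]
  obtain k where k: "k \<ge> 1" "cmod (1 - z ^ k) < 1 / 2 ^ n" by auto
  let ?N = "1\<^sub>m n - M ^\<^sub>m k"
  have Mk: "M ^\<^sub>m k \<in> carrier_mat n n" using M by simp
  have "map_mat complex_of_int ?N = 1\<^sub>m n - ?M ^\<^sub>m k"
  proof -
    show ?thesis by (simp only: map_of_int_one_minus[OF Mk] of_int_hom.mat_hom_pow[OF M])
  qed
  then have "det (map_mat complex_of_int ?N) = (\<Prod>z\<leftarrow>es. 1 - z ^ k)" by (simp only: es(4))
  then have dN: "complex_of_int (det ?N) = (\<Prod>z\<leftarrow>es. 1 - z ^ k)" unfolding of_int_hom.hom_det .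
  have "cmod (\<Prod>z\<leftarrow>fs. 1 - z ^ k) \<le> 2 ^ length fs * (\<Prod>z\<leftarrow>fs. max 1 (cmod z)) ^ k"
    by (rule prod_list_one_minus_pow_le)
  also have "(\<Prod>z\<leftarrow>fs. max 1 (cmod z)) = 1"
  proof -
    have "map (\<lambda>z. max 1 (cmod z)) fs = map (\<lambda>z. 1) fs" using es1 zfs by auto
    then show ?thesis by (simp only: map_replicate_const prod_list_replicate) simp
  qed
  finally have "cmod (\<Prod>z\<leftarrow>fs. 1 - z ^ k) \<le> 2 ^ length fs" by simp
  also have "\<dots> \<le> 2 ^ n" using es(1) zfs by (intro power_increasing) auto
  finally have "cmod (1 - z ^ k) * cmod (\<Prod>z\<leftarrow>fs. 1 - z ^ k) \<le> cmod (1 - z ^ k) * 2 ^ n"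
    by (intro mult_left_mono) auto
  also have "\<dots> < 1" using k(2) by (simp add: field_simps)
  finally have "cmod (complex_of_int (det ?N)) < 1" unfolding dN zfs by (simp add: norm_mult)
  then have "det ?N = 0" by simp
  then have "(\<Prod>z\<leftarrow>es. 1 - z ^ k) = 0" using dN by simp
  then obtain w where w: "w \<in> set es" "w ^ k = 1" by (auto simp: prod_list_zero_iff)
  \<comment> \<open>The vanishing factor gives an eigenvalue of \<open>M\<close> whose
    \<open>k\<close>-th power is 1; up to conjugation it is an eigenvalue of
    \<open>A\<close>.\<close>
  obtain u where u: "eigenvalue A u" "u ^ k = 1"
  proof (cases "eigenvalue A w")
    case False
    then have "eigenvalue A (cnj w)" using eigenvalue_rational_rep[OF Ac M AM es(2)[OF w(1)]] by simp
    moreover have "cnj w ^ k = 1" using w(2) by (metis complex_cnj_one complex_cnj_power)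
    ultimately show thesis by (rule that)
  qed (use w that in blast)
  obtain v where v: "eigenvector A v u" using u by (auto simp: eigenvalue_def)
  have vc: "v \<in> carrier_vec g" "v \<noteq> 0\<^sub>v g" using v Ac by (auto simp: eigenvector_def)
  have Ak: "A ^\<^sub>m k \<in> carrier_mat g g" using Ac by simp
  have "(1\<^sub>m g - A ^\<^sub>m k) *\<^sub>v v = 0\<^sub>v g"
    using eigenvector_pow[OF Ac v, of k] u(2) vc Ak by (simp add: minus_mult_distrib_mat_vec[of _ g g])
  then have "det (1\<^sub>m g - A ^\<^sub>m k) = 0"
    using vc det_0_iff_vec_prod_zero[OF minus_carrier_mat[OF Ak]] by blast
  \<comment> \<open>By \<open>div\<close> a singular element vanishes; a single eigenvalue that is a
    root of unity thus forces \<open>A^k = 1\<close>.\<close>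
  then have z: "1\<^sub>m g - A ^\<^sub>m k = 0\<^sub>m g g"
    using div[of "1\<^sub>m g - A ^\<^sub>m k"] minus_lattice_mats[OF one_lattice_mats pow_lattice_mats[OF A]] by blast
  have "A ^\<^sub>m k = 1\<^sub>m g"
  proof (rule eq_matI)
    fix i j assume "i < dim_row (1\<^sub>m g :: complex mat)" "j < dim_col (1\<^sub>m g :: complex mat)"
    then have ij: "i < g" "j < g" by auto
    have "(1\<^sub>m g - A ^\<^sub>m k) $$ (i, j) = 0" using z ij by simp
    then show "(A ^\<^sub>m k) $$ (i, j) = 1\<^sub>m g $$ (i, j)" using ij Ac by simp
  qed (use Ak in auto)
  with k(1) show thesis by (rule that)
qed

text \<open>With \<open>R\<close> the Mahler measure of the rational representation, the determinant
  of \<open>1 - M^k\<close> has modulus between \<open>c R^k\<close> and \<open>2^n R^k\<close>, and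
  passing to the kernel costs only an \<open>n\<close>-th power on either side. As
  \<open>det M\<close> is a nonzero integer, \<open>R > 1\<close>.\<close>

lemma exponential_if_off_unit_circle:
  assumes g: "g \<noteq> 0" and A: "A \<in> lattice_mats" and A0: "det A \<noteq> 0"
    and unit: "\<And>z. eigenvalue A z \<Longrightarrow> cmod z \<noteq> 1"
  shows "grows_exponentially (fix_fun g L (endo A))"
proof -
  have Ac: "A \<in> carrier_mat g g" by (rule lattice_mats_carrier[OF A])
  obtain M where M: "M \<in> carrier_mat n n" and AM: "A * P = P * map_mat complex_of_int M"
    by (rule rational_rep[OF A])
  let ?M = "map_mat complex_of_int M"
  have Mc: "?M \<in> carrier_mat n n" using M by simp
  obtain es where es: "length es = n" "\<And>z. z \<in> set es \<Longrightarrow> eigenvalue ?M z" "det ?M = prod_list es"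
    "\<And>k. det (1\<^sub>m n - ?M ^\<^sub>m k) = (\<Prod>z\<leftarrow>es. 1 - z ^ k)"
    by (rule eigenvalue_list[OF Mc]) blast
  have es1: "cmod z \<noteq> 1" if "z \<in> set es" for z
    using eigenvalue_rational_rep[OF Ac M AM es(2)[OF that]] unit[of z] unit[of "cnj z"] by auto
  have n: "n \<noteq> 0" by (rule rank_pos[OF g])
  have "0 \<notin> set es"
  proof
    assume "0 \<in> set es"
    then have "eigenvalue A 0" using eigenvalue_rational_rep[OF Ac M AM es(2)[of 0]] by auto
    then obtain v where "v \<in> carrier_vec g" "v \<noteq> 0\<^sub>v g" "A *\<^sub>v v = 0 \<cdot>\<^sub>v v"
      using Ac by (auto simp: eigenvalue_def eigenvector_def)
    moreover from this have "A *\<^sub>v v = 0\<^sub>v g" by auto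
    ultimately show False using A0 det_0_iff_vec_prod_zero[OF Ac] by blast
  qed
  then have "prod_list es \<noteq> 0" by (simp add: prod_list_zero_iff)
  then have dM: "det M \<noteq> 0" using es(3) by auto
  have "cmod (prod_list es) = cmod (complex_of_int (det M))" using es(3) by simp
  also have "\<dots> = \<bar>real_of_int (det M)\<bar>" by (rule norm_of_int)
  also have "\<dots> \<ge> 1" using dM by linarith
  finally have ge1: "cmod (prod_list es) \<ge> 1" .
  define R where "R = (\<Prod>z\<leftarrow>es. max 1 (cmod z))"
  have R: "R > 1" unfolding R_def using es(1) n by (intro prod_list_max_one_gt es1 ge1) auto
  obtain c where c: "c > 0" "\<And>k. k \<ge> 1 \<Longrightarrow> c * R ^ k \<le> cmod (\<Prod>z\<leftarrow>es. 1 - z ^ k)"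
    using prod_list_one_minus_pow_ge[of es] es1 unfolding R_def by blast
  let ?h = "fix_fun g L (endo A)"
  have main: "c * R ^ k \<le> real (?h k) ^ n" "real (?h k) \<le> (2 ^ n * R ^ k) ^ n" if k: "k \<ge> 1" for k
  proof -
    let ?N = "1\<^sub>m n - M ^\<^sub>m k"
    have Mk: "M ^\<^sub>m k \<in> carrier_mat n n" using M by simp
    have N: "?N \<in> carrier_mat n n" using Mk by (rule minus_carrier_mat)
    have "map_mat complex_of_int ?N = 1\<^sub>m n - ?M ^\<^sub>m k"
    proof -
      show ?thesis by (simp only: map_of_int_one_minus[OF Mk] of_int_hom.mat_hom_pow[OF M])
    qed
    then have "det (map_mat complex_of_int ?N) = (\<Prod>z\<leftarrow>es. 1 - z ^ k)" by (simp only: es(4))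
    then have "complex_of_int (det ?N) = (\<Prod>z\<leftarrow>es. 1 - z ^ k)" unfolding of_int_hom.hom_det .
    then have dN: "real_of_int \<bar>det ?N\<bar> = cmod (\<Prod>z\<leftarrow>es. 1 - z ^ k)"
      by (simp only: norm_of_int of_int_abs flip: \<open>complex_of_int (det ?N) = _\<close>)
    have "0 < c * R ^ k" using c R by simp
    then have N0: "det ?N \<noteq> 0" using c(2)[OF k] dN by auto
    have Ak: "A ^\<^sub>m k \<in> carrier_mat g g" using Ac by simp
    have TN: "(1\<^sub>m g - A ^\<^sub>m k) * P = P * map_mat complex_of_int ?N"
      by (rule rational_rep_one_minus[OF Ak Mk rational_rep_pow[OF Ac M AM]])
    have T: "1\<^sub>m g - A ^\<^sub>m k \<in> lattice_mats"
      by (rule minus_lattice_mats[OF one_lattice_mats pow_lattice_mats[OF A]])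
    note bd = card_kernel_bounds[OF T N TN N0, folded fix_fun_eq_kernel[OF A]]
    have "real_of_int \<bar>det ?N\<bar> \<le> real (?h k) ^ n"
      using bd(1) unfolding of_int_le_iff[symmetric, where ?'a = real] by simp
    then show "c * R ^ k \<le> real (?h k) ^ n" using c(2)[OF k] dN by simp
    have "real (?h k) \<le> real_of_int \<bar>det ?N\<bar> ^ n"
      using bd(2) unfolding of_int_le_iff[symmetric, where ?'a = real] by simp
    also have "\<dots> \<le> (2 ^ n * R ^ k) ^ n"
      using prod_list_one_minus_pow_le[of k es] unfolding dN R_def es(1)
      by (rule power_mono) simp
    finally show "real (?h k) \<le> (2 ^ n * R ^ k) ^ n" .
  qed
  \<comment> \<open>Of the two factors \<open>a^n\<close> of \<open>R\<close>, one outgrows the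
    constant \<open>1 / c\<close>, the other is what remains for the \<open>n\<close>-th
    root.\<close>
  define a where "a = root (2 * n) R"
  have n2: "0 < 2 * n" using n by simp
  have a1: "a > 1" unfolding a_def using R n2 by (simp only: real_root_gt_1_iff)
  have "a ^ (2 * n) = R" unfolding a_def using R by (intro real_root_pow_pos2[OF n2]) simp
  then have aa: "R = a ^ n * a ^ n" by (simp only: mult_2 power_add)
  have an: "a ^ n > 1" using n by (intro one_less_power[OF a1]) simp
  \<comment> \<open>For \<open>k \<ge> 1\<close> the constant \<open>2^n\<close> is at most
    \<open>(2^n)^k\<close> and can be absorbed into the base.\<close>
  define B where "B = (2 ^ n * R) ^ n"
  have p2: "(2::real) ^ n \<ge> 1" by simp
  have "1 * R \<le> 2 ^ n * R" using R by (intro mult_right_mono p2) simp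
  then have RR: "1 < 2 ^ n * R" using R by linarith
  have B: "B > 1" using n unfolding B_def by (intro one_less_power RR) auto
  obtain N where N: "1 / c < (a ^ n) ^ N" using real_arch_pow[OF an] by blast
  show ?thesis
    unfolding grows_exponentially_def
  proof (rule exI[of _ a], rule exI[of _ B], intro conjI a1 B exI[of _ "max N 1"] allI impI)
    fix k assume "k \<ge> max N 1"
    then have k: "k \<ge> 1" "k \<ge> N" by auto
    have "(a ^ n) ^ N \<le> (a ^ n) ^ k" using an k by (intro power_increasing) auto
    then have "1 / c < (a ^ n) ^ k" using N by simp
    then have "1 < c * (a ^ n) ^ k" using c(1) by (simp add: field_simps)
    then have "1 * (a ^ n) ^ k \<le> (c * (a ^ n) ^ k) * (a ^ n) ^ k" using an by (intro mult_right_mono) auto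
    also have "\<dots> = c * R ^ k" unfolding aa by (simp only: power_mult_distrib mult.assoc)
    also have "\<dots> \<le> real (?h k) ^ n" by (rule main(1)[OF k(1)])
    finally have "(a ^ k) ^ n \<le> real (?h k) ^ n" by (simp only: mult_1 power_mult[symmetric] mult.commute[of n k])
    then show "a ^ k \<le> real (?h k)" using power_mono_iff[of "a ^ k" "real (?h k)" n] a1 n by simp
    have "real (?h k) \<le> (2 ^ n * R ^ k) ^ n" by (rule main(2)[OF k(1)])
    also have "\<dots> \<le> ((2 ^ n * R) ^ k) ^ n"
    proof (rule power_mono)
      have "(2::real) ^ n \<le> (2 ^ n) ^ k" using k p2 by (intro self_le_power) auto
      then show "2 ^ n * R ^ k \<le> (2 ^ n * R) ^ k" using R by (simp add: power_mult_distrib mult_right_mono)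
    qed (use R in auto)
    also have "\<dots> = B ^ k" unfolding B_def by (simp only: power_mult[symmetric] mult.commute[of n k])
    finally show "real (?h k) \<le> B ^ k" .
  qed
qed

lemma eigenvalue_root_of_unity:
  assumes A: "A \<in> carrier_mat g g" and p: "p \<ge> 1" "A ^\<^sub>m p = 1\<^sub>m g" and z: "eigenvalue A z"
  shows "root_of_unity z"
proof -
  obtain v where v: "eigenvector A v z" using z by (auto simp: eigenvalue_def)
  have vc: "v \<in> carrier_vec g" "v \<noteq> 0\<^sub>v g" using v A by (auto simp: eigenvector_def)
  then obtain i where i: "i < g" "v $ i \<noteq> 0" by (metis carrier_vecD eq_vecI index_zero_vec(1) index_zero_vec(2))
  have "v = z ^ p \<cdot>\<^sub>v v" using eigenvector_pow[OF A v, of p] p vc by simp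
  then have "v $ i = z ^ p * v $ i" using i vc by (metis carrier_vecD index_smult_vec(1))
  then show ?thesis using i p(1) by (auto simp: root_of_unity_def)
qed

text \<open>\<open>u\<close> is the common truth value of \<open>cmod z = 1\<close> on the
  eigenvalues; each type of algebra only has to supply \<open>u\<close> and the nonvanishing of
  determinants. The last two claims invert the dichotomy by
  \<open>periodic_not_exponential\<close>.\<close>

lemma fix_fun_dichotomy:
  assumes g: "g \<noteq> 0" and f: "f \<in> carrier (End_ring g L)" "f \<noteq> \<zero>\<^bsub>End_ring g L\<^esub>"
    and div: "\<And>B. B \<in> carrier (End_Q g L) \<Longrightarrow> B \<noteq> 0\<^sub>m g g \<Longrightarrow> det B \<noteq> 0"
    and u: "\<And>z. analytic_eigenvalue g L f z \<Longrightarrow> cmod z = 1 \<longleftrightarrow> u"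
  shows "if u then periodic_fun (fix_fun g L f) else grows_exponentially (fix_fun g L f)"
    and "periodic_fun (fix_fun g L f) \<longrightarrow> (\<forall>z. analytic_eigenvalue g L f z \<longrightarrow> root_of_unity z)"
    and "grows_exponentially (fix_fun g L f) \<longrightarrow> (\<forall>z. analytic_eigenvalue g L f z \<longrightarrow> cmod z \<noteq> 1)"
proof -
  obtain A where A: "A \<in> lattice_mats" "f = endo A" using f(1) by (rule End_cases)
  have rep: "analytic_rep g L f = A" using A by (simp add: analytic_rep_endo)
  have "A \<noteq> 0\<^sub>m g g" using f(2) A End_zero by auto
  then have dA: "det A \<noteq> 0" using div lattice_mats_End_Q[OF A(1)] by blast
  have unit: "periodic_fun (fix_fun g L f) \<and> (\<forall>z. analytic_eigenvalue g L f z \<longrightarrow> root_of_unity z)" if u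
  proof -
    obtain p where p: "p \<ge> 1" "A ^\<^sub>m p = 1\<^sub>m g"
    proof (rule pow_eq_one_if_unit_circle[OF g A(1)])
      show "det B \<noteq> 0" if "B \<in> lattice_mats" "B \<noteq> 0\<^sub>m g g" for B
        using div[OF lattice_mats_End_Q] that by blast
      show "cmod z = 1" if "eigenvalue A z" for z using that u \<open>u\<close> rep by blast
    qed blast
    then show ?thesis
      using periodic_if_pow_one[OF A(1) p] eigenvalue_root_of_unity[OF lattice_mats_carrier[OF A(1)] p]
      by (simp add: A(2) rep[unfolded A(2)])
  qed
  have exp: "grows_exponentially (fix_fun g L f)" if "\<not> u"
    using that u exponential_if_off_unit_circle[OF g A(1) dA]
    by (simp add: A(2) rep[unfolded A(2)])
  show "if u then periodic_fun (fix_fun g L f) else grows_exponentially (fix_fun g L f)"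
    using unit exp by simp
  show "periodic_fun (fix_fun g L f) \<longrightarrow> (\<forall>z. analytic_eigenvalue g L f z \<longrightarrow> root_of_unity z)"
    using unit exp periodic_not_exponential by blast
  show "grows_exponentially (fix_fun g L f) \<longrightarrow> (\<forall>z. analytic_eigenvalue g L f z \<longrightarrow> cmod z \<noteq> 1)"
    using unit u periodic_not_exponential by blast
qed

end

section \<open>Embeddings of fields of matrices\<close>

lemma ring_hom_class_ring:
  fixes \<sigma> :: "'a \<Rightarrow> 'b :: field"
  assumes R: "ring R" and s: "\<sigma> \<in> ring_hom R class_ring"
  shows "x \<in> carrier R \<Longrightarrow> y \<in> carrier R \<Longrightarrow> \<sigma> (x \<otimes>\<^bsub>R\<^esub> y) = \<sigma> x * \<sigma> y"
    and "x \<in> carrier R \<Longrightarrow> y \<in> carrier R \<Longrightarrow> \<sigma> (x \<oplus>\<^bsub>R\<^esub> y) = \<sigma> x + \<sigma> y"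
    and "\<sigma> \<one>\<^bsub>R\<^esub> = 1" and "\<sigma> \<zero>\<^bsub>R\<^esub> = 0"
    and "x \<in> carrier R \<Longrightarrow> \<sigma> (\<ominus>\<^bsub>R\<^esub> x) = - \<sigma> x"
    and "x \<in> carrier R \<Longrightarrow> y \<in> carrier R \<Longrightarrow> \<sigma> (x \<ominus>\<^bsub>R\<^esub> y) = \<sigma> x - \<sigma> y"
proof -
  interpret R: ring R by (rule R)
  show m: "\<And>x y. x \<in> carrier R \<Longrightarrow> y \<in> carrier R \<Longrightarrow> \<sigma> (x \<otimes>\<^bsub>R\<^esub> y) = \<sigma> x * \<sigma> y"
    using ring_hom_mult[OF s] by simp
  show a: "\<And>x y. x \<in> carrier R \<Longrightarrow> y \<in> carrier R \<Longrightarrow> \<sigma> (x \<oplus>\<^bsub>R\<^esub> y) = \<sigma> x + \<sigma> y"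
    using ring_hom_add[OF s] by simp
  show "\<sigma> \<one>\<^bsub>R\<^esub> = 1" using ring_hom_one[OF s] by simp
  have "\<sigma> \<zero>\<^bsub>R\<^esub> + \<sigma> \<zero>\<^bsub>R\<^esub> = \<sigma> \<zero>\<^bsub>R\<^esub>" using a[of "\<zero>\<^bsub>R\<^esub>" "\<zero>\<^bsub>R\<^esub>"] by simp
  then show z: "\<sigma> \<zero>\<^bsub>R\<^esub> = 0" by (metis add_cancel_left_left)
  have n: "\<sigma> (\<ominus>\<^bsub>R\<^esub> x) = - \<sigma> x" if "x \<in> carrier R" for x
  proof -
    have "\<sigma> (\<ominus>\<^bsub>R\<^esub> x) + \<sigma> x = 0" using a[of "\<ominus>\<^bsub>R\<^esub> x" x] that z by (simp add: R.l_neg)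
    then show ?thesis by (simp add: eq_neg_iff_add_eq_0)
  qed
  show "x \<in> carrier R \<Longrightarrow> \<sigma> (\<ominus>\<^bsub>R\<^esub> x) = - \<sigma> x" by (rule n)
  show "x \<in> carrier R \<Longrightarrow> y \<in> carrier R \<Longrightarrow> \<sigma> (x \<ominus>\<^bsub>R\<^esub> y) = \<sigma> x - \<sigma> y"
    by (simp add: a_minus_def a n)
qed

text \<open>Injectivity moves an equation from one embedding into the field and from there to every
  other embedding.\<close>

lemma embedding_eq_iff:
  fixes \<sigma> :: "'a \<Rightarrow> 'b :: field"
  assumes R: "field R" and s: "\<sigma> \<in> ring_hom R class_ring" and x: "x \<in> carrier R" and y: "y \<in> carrier R"
  shows "\<sigma> x = \<sigma> y \<longleftrightarrow> x = y"
proof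
  interpret R: field R by (rule R)
  note h = ring_hom_class_ring[OF R.ring_axioms s]
  assume "\<sigma> x = \<sigma> y"
  then have z: "\<sigma> (x \<ominus>\<^bsub>R\<^esub> y) = 0" using x y by (simp add: h)
  show "x = y"
  proof (rule ccontr)
    assume "x \<noteq> y"
    then have "x \<ominus>\<^bsub>R\<^esub> y \<noteq> \<zero>\<^bsub>R\<^esub>" using x y R.r_right_minus_eq by simp
    then have "x \<ominus>\<^bsub>R\<^esub> y \<in> Units R" using x y R.field_Units by simp
    then have "\<sigma> (x \<ominus>\<^bsub>R\<^esub> y) * \<sigma> (inv\<^bsub>R\<^esub> (x \<ominus>\<^bsub>R\<^esub> y)) = 1"
      using h(1)[of "x \<ominus>\<^bsub>R\<^esub> y" "inv\<^bsub>R\<^esub> (x \<ominus>\<^bsub>R\<^esub> y)"] h(3) x y by simp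
    then show False using z by simp
  qed
qed simp

text \<open>In Schur coordinates, \<open>A - e\<close> with the matching diagonal entry
  \<open>e\<close> kills the last possibly nonzero coordinate. Repetition ends at zero, and the last
  nonzero vector is an eigenvector. Closure of \<open>S\<close> under these steps keeps it in
  \<open>S\<close>.\<close>

lemma invariant_set_eigenvector:
  fixes A :: "complex mat"
  assumes A: "A \<in> carrier_mat g g" and S: "S \<subseteq> carrier_vec g" and v: "v \<in> S" "v \<noteq> 0\<^sub>v g"
    and stable: "\<And>w c. w \<in> S \<Longrightarrow> A *\<^sub>v w - c \<cdot>\<^sub>v w \<in> S"
  obtains w c where "w \<in> S" "w \<noteq> 0\<^sub>v g" "A *\<^sub>v w = c \<cdot>\<^sub>v w"
proof -
  obtain es where es: "char_poly A = (\<Prod>z\<leftarrow>es. [:- z, 1:])" using char_poly_factorized[OF A] by blast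
  obtain B P Q where BPQ: "schur_decomposition A es = (B, P, Q)" by (cases "schur_decomposition A es") auto
  have wit: "similar_mat_wit A B P Q" and uB: "upper_triangular B"
    using schur_decomposition[OF A es BPQ] by auto
  note W = similar_mat_witD2[OF A wit]
  \<comment> \<open>\<open>k\<close> bounds the number of leading coordinates of \<open>Q v\<close>
    that may be nonzero.\<close>
  have "\<exists>w c. w \<in> S \<and> w \<noteq> 0\<^sub>v g \<and> A *\<^sub>v w = c \<cdot>\<^sub>v w"
    if "k \<le> g" "v \<in> S" "v \<noteq> 0\<^sub>v g" "\<forall>i<g. k \<le> i \<longrightarrow> (Q *\<^sub>v v) $ i = 0" for k v
    using that
  proof (induction k arbitrary: v)
    case 0
    then have v: "v \<in> carrier_vec g" using S by auto
    have "Q *\<^sub>v v = 0\<^sub>v g" using 0 W(7) by (intro eq_vecI) auto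
    then have "P *\<^sub>v (Q *\<^sub>v v) = 0\<^sub>v g" using mult_mat_zero_vec[OF W(6)] by simp
    then have "v = 0\<^sub>v g" using W v by (simp flip: assoc_mult_mat_vec[of _ g g _ g])
    then show ?case using 0 by simp
  next
    case (Suc k)
    have v: "v \<in> carrier_vec g" using Suc.prems S by auto
    define e where "e = B $$ (k, k)"
    define v' where "v' = A *\<^sub>v v - e \<cdot>\<^sub>v v"
    have v': "v' \<in> S" unfolding v'_def by (rule stable[OF Suc.prems(2)])
    show ?case
    proof (cases "v' = 0\<^sub>v g")
      case True
      have "A *\<^sub>v v = e \<cdot>\<^sub>v v"
      proof (intro eq_vecI)
        fix i assume "i < dim_vec (e \<cdot>\<^sub>v v)"
        then have i: "i < g" using v by simp
        have "v' $ i = 0" using True i by simp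
        then show "(A *\<^sub>v v) $ i = (e \<cdot>\<^sub>v v) $ i" using i v A by (simp add: v'_def)
      qed (use A v in auto)
      then show ?thesis using Suc.prems by blast
    next
      case False
      have y: "Q *\<^sub>v v \<in> carrier_vec g" using W(7) v by simp
      have QA: "Q *\<^sub>v v' = B *\<^sub>v (Q *\<^sub>v v) - e \<cdot>\<^sub>v (Q *\<^sub>v v)"
      proof -
        have "Q *\<^sub>v (A *\<^sub>v v) = (Q * A) *\<^sub>v v" using W(7) A v by (simp add: assoc_mult_mat_vec[of _ g g _ g])
        also have "Q * A = (Q * P) * (B * Q)" unfolding W(3) using W(5-7) by (simp add: assoc_mult_mat[of _ g g _ g _ g])
        also have "\<dots> = B * Q" unfolding W(2) using W(5-7) by simp
        also have "(B * Q) *\<^sub>v v = B *\<^sub>v (Q *\<^sub>v v)" using W(5-7) v by (simp add: assoc_mult_mat_vec[of _ g g _ g])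
        finally show ?thesis
          using mult_mat_vec_minus[OF W(7), of "A *\<^sub>v v" "e \<cdot>\<^sub>v v"] mult_mat_vec[OF W(7) v] A v
          by (simp add: v'_def)
      qed
      have "(Q *\<^sub>v v') $ i = 0" if i: "i < g" "k \<le> i" for i
      proof -
        have "(B *\<^sub>v y) $ i = (\<Sum>j<g. B $$ (i, j) * y $ j)" if "y \<in> carrier_vec g" for y
          using i W(5) that by (auto simp: scalar_prod_def lessThan_atLeast0 intro!: sum.cong)
        from this[OF y] have "(B *\<^sub>v (Q *\<^sub>v v)) $ i = (\<Sum>j<g. B $$ (i, j) * (Q *\<^sub>v v) $ j)" .
        also have "\<dots> = (\<Sum>j<g. if j = k \<and> i = k then e * (Q *\<^sub>v v) $ k else 0)"
        proof (rule sum.cong[OF refl])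
          fix j assume j: "j \<in> {..<g}"
          have "B $$ (i, j) = 0" if "j < i" using upper_triangularD[OF uB that] i W(5) by simp
          moreover have "(Q *\<^sub>v v) $ j = 0" if "Suc k \<le> j" using Suc.prems(4) j that by blast
          ultimately show "B $$ (i, j) * (Q *\<^sub>v v) $ j = (if j = k \<and> i = k then e * (Q *\<^sub>v v) $ k else 0)"
            using i by (cases "j < i"; cases "Suc k \<le> j"; cases "j = k \<and> i = k") (auto simp: e_def)
        qed
        also have "\<dots> = e * (Q *\<^sub>v v) $ i"
          using i Suc.prems(1,4) by (cases "i = k") auto
        finally show ?thesis using QA i y W(5,7) v by simp
      qed
      then show ?thesis using Suc.IH[of v'] Suc.prems(1) v' False by auto
    qed
  qed
  from this[of g v] v that show thesis by auto
qed

text \<open>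
  A number field consisting of complex matrices has a common eigenvector in every nonzero
  subspace that it stabilizes, and the eigenvalues on this vector form an embedding.
\<close>

locale matrix_number_field =
  fixes g :: nat and R :: "complex mat ring"
  assumes nf: "number_field R"
    and R_sub: "carrier R \<subseteq> carrier_mat g g"
    and R_mult: "mult R = (*)" and R_add: "add R = (+)"
    and R_one: "one R = 1\<^sub>m g" and R_zero: "zero R = 0\<^sub>m g g"
begin

lemma R_field: "field R"
  using nf by (simp add: number_field_def)

interpretation field R by (rule R_field)

text \<open>Coefficients from the prime field act on every vector by a scalar. Hence a vector that
  is an eigenvector of a basis is one of the whole span.\<close>

lemma prime_field_scalar:
  assumes "h \<in> generate_field R {\<one>\<^bsub>R\<^esub>}"
  shows "h \<in> carrier R \<and> (\<exists>c. h = c \<cdot>\<^sub>m 1\<^sub>m g)"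
  using assms
proof induction
  case one
  have "1\<^sub>m g = 1 \<cdot>\<^sub>m (1\<^sub>m g :: complex mat)" by (intro eq_matI) auto
  then show ?case using one_closed unfolding R_one by blast
next
  case (incl h)
  have "1\<^sub>m g = 1 \<cdot>\<^sub>m (1\<^sub>m g :: complex mat)" by (intro eq_matI) auto
  then show ?case using incl one_closed unfolding R_one by blast
next
  case (a_inv h)
  then obtain c where c: "h = c \<cdot>\<^sub>m 1\<^sub>m g" and h: "h \<in> carrier R" by blast
  have m: "\<ominus>\<^bsub>R\<^esub> h \<in> carrier_mat g g" using h R_sub by auto
  have "\<ominus>\<^bsub>R\<^esub> h + h = 0\<^sub>m g g" using l_neg[OF h] by (simp add: R_add R_zero)
  then have e: "(\<ominus>\<^bsub>R\<^esub> h + h) $$ (i, j) = 0" if "i < g" "j < g" for i j using that by simp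
  have "\<ominus>\<^bsub>R\<^esub> h = (- c) \<cdot>\<^sub>m 1\<^sub>m g"
  proof (rule eq_matI)
    fix i j assume "i < dim_row (- c \<cdot>\<^sub>m 1\<^sub>m g)" "j < dim_col (- c \<cdot>\<^sub>m 1\<^sub>m g)"
    then show "(\<ominus>\<^bsub>R\<^esub> h) $$ (i, j) = (- c \<cdot>\<^sub>m 1\<^sub>m g) $$ (i, j)"
      using e[of i j] m c by (auto simp: add_eq_0_iff)
  qed (use m in auto)
  then show ?case using h by blast
next
  case (m_inv h)
  then obtain c where c: "h = c \<cdot>\<^sub>m 1\<^sub>m g" and h: "h \<in> carrier R" "h \<noteq> \<zero>\<^bsub>R\<^esub>" by blast
  have hU: "h \<in> Units R" using h field_Units by simp
  then have ih: "inv\<^bsub>R\<^esub> h \<in> carrier R" by simp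
  then have m: "inv\<^bsub>R\<^esub> h \<in> carrier_mat g g" using R_sub by auto
  have "h * inv\<^bsub>R\<^esub> h = 1\<^sub>m g" using hU Units_r_inv[OF hU] by (simp add: R_mult R_one)
  moreover have "h * inv\<^bsub>R\<^esub> h = c \<cdot>\<^sub>m inv\<^bsub>R\<^esub> h"
    using mult_smult_assoc_mat[OF one_carrier_mat m, of c] m by (simp flip: c)
  ultimately have eq: "c \<cdot>\<^sub>m inv\<^bsub>R\<^esub> h = 1\<^sub>m g" by simp
  have c0: "c \<noteq> 0 \<or> g = 0"
  proof (rule ccontr)
    assume "\<not> ?thesis"
    then have "(c \<cdot>\<^sub>m inv\<^bsub>R\<^esub> h) $$ (0, 0) = 0" "(1\<^sub>m g :: complex mat) $$ (0, 0) = 1" using m by auto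
    then show False using eq by simp
  qed
  have "inv\<^bsub>R\<^esub> h = (1 / c) \<cdot>\<^sub>m 1\<^sub>m g"
    using c0 m by (intro eq_matI) (auto simp flip: eq)
  then show ?case using ih by blast
next
  case (eng_add h k)
  then obtain a b where ab: "h = a \<cdot>\<^sub>m 1\<^sub>m g" "k = b \<cdot>\<^sub>m 1\<^sub>m g" "h \<in> carrier R" "k \<in> carrier R" by blast
  have "h + k = (a + b) \<cdot>\<^sub>m 1\<^sub>m g" unfolding ab by (intro eq_matI) (auto simp: algebra_simps)
  then show ?case using ab a_closed[of h k] unfolding R_add by blast
next
  case (eng_mult h k)
  then obtain a b where ab: "h = a \<cdot>\<^sub>m 1\<^sub>m g" "k = b \<cdot>\<^sub>m 1\<^sub>m g" "h \<in> carrier R" "k \<in> carrier R" by blast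
  have "h * k = a \<cdot>\<^sub>m (1\<^sub>m g * (b \<cdot>\<^sub>m 1\<^sub>m g))" unfolding ab
    by (rule mult_smult_assoc_mat[of _ g g _ g]) auto
  also have "\<dots> = (a * b) \<cdot>\<^sub>m 1\<^sub>m g" by (intro eq_matI) auto
  finally have "h * k = (a * b) \<cdot>\<^sub>m 1\<^sub>m g" .
  then show ?case using ab m_closed[of h k] unfolding R_mult by blast
qed

text \<open>Induction along a basis: a new basis element \<open>u\<close> commutes with the old span
  \<open>E\<close>, hence preserves the simultaneous eigenspace \<open>T\<close> inside
  \<open>S\<close> and has an eigenvector there.\<close>

lemma common_eigenvector_subspace:
  assumes "dimension m K E" and "K = generate_field R {\<one>\<^bsub>R\<^esub>}"
    and "S \<subseteq> carrier_vec g" "v \<in> S" "v \<noteq> 0\<^sub>v g"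
    and "\<And>A w c. A \<in> carrier R \<Longrightarrow> w \<in> S \<Longrightarrow> A *\<^sub>v w - c \<cdot>\<^sub>v w \<in> S"
  shows "E \<subseteq> carrier R \<and> (\<exists>w\<in>S. w \<noteq> 0\<^sub>v g \<and> (\<forall>A\<in>E. \<exists>c. A *\<^sub>v w = c \<cdot>\<^sub>v w))"
  using assms
proof (induction)
  case (zero_dim K)
  have "v \<in> carrier_vec g" using zero_dim by auto
  then have "\<zero>\<^bsub>R\<^esub> *\<^sub>v v = 0 \<cdot>\<^sub>v v" unfolding R_zero by auto
  then show ?case using zero_dim by auto
next
  case (Suc_dim u E m K)
  obtain w where E: "E \<subseteq> carrier R" and w: "w \<in> S" "w \<noteq> 0\<^sub>v g" "\<forall>A\<in>E. \<exists>c. A *\<^sub>v w = c \<cdot>\<^sub>v w"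
    using Suc_dim by blast
  define c where "c A = (SOME c. A *\<^sub>v w = c \<cdot>\<^sub>v w)" for A
  have c: "A *\<^sub>v w = c A \<cdot>\<^sub>v w" if "A \<in> E" for A
    using w(3) that someI_ex[of "\<lambda>c. A *\<^sub>v w = c \<cdot>\<^sub>v w"] by (auto simp: c_def)
  define T where "T = {x \<in> S. \<forall>A\<in>E. A *\<^sub>v x = c A \<cdot>\<^sub>v x}"
  have um: "u \<in> carrier_mat g g" using Suc_dim R_sub by auto
  obtain x d where x: "x \<in> T" "x \<noteq> 0\<^sub>v g" "u *\<^sub>v x = d \<cdot>\<^sub>v x"
  proof (rule invariant_set_eigenvector[OF um])
    show "T \<subseteq> carrier_vec g" using Suc_dim by (auto simp: T_def)
    show "w \<in> T" using w c by (auto simp: T_def)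
    fix x e assume x: "x \<in> T"
    then have xc: "x \<in> carrier_vec g" using Suc_dim by (auto simp: T_def)
    show "u *\<^sub>v x - e \<cdot>\<^sub>v x \<in> T"
      unfolding T_def
    proof (intro CollectI conjI ballI)
      show "u *\<^sub>v x - e \<cdot>\<^sub>v x \<in> S" using Suc_dim x by (auto simp: T_def)
      fix A assume A: "A \<in> E"
      then have AR: "A \<in> carrier R" "A \<in> carrier_mat g g" using E R_sub by auto
      have Ax: "A *\<^sub>v x = c A \<cdot>\<^sub>v x" using x A by (auto simp: T_def)
      have "A * u = u * A" using m_comm[of A u] AR Suc_dim by (simp add: R_mult)
      then have "A *\<^sub>v (u *\<^sub>v x) = u *\<^sub>v (A *\<^sub>v x)"
        by (simp only: assoc_mult_mat_vec[OF AR(2) um xc, symmetric] assoc_mult_mat_vec[OF um AR(2) xc])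
      also have "\<dots> = c A \<cdot>\<^sub>v (u *\<^sub>v x)" unfolding Ax using um xc by (simp add: mult_mat_vec)
      finally have Au: "A *\<^sub>v (u *\<^sub>v x) = c A \<cdot>\<^sub>v (u *\<^sub>v x)" .
      have "A *\<^sub>v (u *\<^sub>v x - e \<cdot>\<^sub>v x) = c A \<cdot>\<^sub>v (u *\<^sub>v x) - e \<cdot>\<^sub>v (c A \<cdot>\<^sub>v x)"
        using mult_mat_vec_minus[OF AR(2), of "u *\<^sub>v x" "e \<cdot>\<^sub>v x"] um xc
        by (simp add: Au mult_mat_vec[OF AR(2) xc] Ax)
      also have "\<dots> = c A \<cdot>\<^sub>v (u *\<^sub>v x - e \<cdot>\<^sub>v x)"
        using um xc by (intro eq_vecI) (auto simp: algebra_simps)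
      finally show "A *\<^sub>v (u *\<^sub>v x - e \<cdot>\<^sub>v x) = c A \<cdot>\<^sub>v (u *\<^sub>v x - e \<cdot>\<^sub>v x)" .
    qed
  qed (use w in auto)
  have xS: "x \<in> S" "x \<in> carrier_vec g" using x Suc_dim by (auto simp: T_def)
  have "y \<in> carrier R \<and> (\<exists>c. y *\<^sub>v x = c \<cdot>\<^sub>v x)" if "y \<in> line_extension K u E" for y
  proof -
    from that obtain k e where ke: "k \<in> K" "e \<in> E" "y = k \<otimes>\<^bsub>R\<^esub> u \<oplus>\<^bsub>R\<^esub> e"
      using line_extension_mem_iff by blast
    obtain s where s: "k \<in> carrier R" "k = s \<cdot>\<^sub>m 1\<^sub>m g" using prime_field_scalar[of k] ke(1) Suc_dim by blast
    have km: "k \<in> carrier_mat g g" "e \<in> carrier_mat g g" using s ke E R_sub by auto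
    have "y *\<^sub>v x = k *\<^sub>v (u *\<^sub>v x) + e *\<^sub>v x"
      unfolding ke R_mult R_add using km um xS by (simp add: add_mult_distrib_mat_vec[of _ g g] assoc_mult_mat_vec[of _ g g _ g])
    also have "\<dots> = (s * d + c e) \<cdot>\<^sub>v x"
    proof -
      have "k *\<^sub>v (d \<cdot>\<^sub>v x) = (s * d) \<cdot>\<^sub>v x" unfolding s(2) using xS by (intro eq_vecI) auto
      moreover have "e *\<^sub>v x = c e \<cdot>\<^sub>v x" using x(1) ke(2) by (auto simp: T_def)
      ultimately show ?thesis using xS by (simp add: x(3) add_smult_distrib_vec)
    qed
    finally show ?thesis using ke s E Suc_dim by auto
  qed
  then show ?case using xS x by blast
qed

lemma embedding_on_eigenvector:
  assumes S: "S \<subseteq> carrier_vec g" "v \<in> S" "v \<noteq> 0\<^sub>v g"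
    and stable: "\<And>A w c. A \<in> carrier R \<Longrightarrow> w \<in> S \<Longrightarrow> A *\<^sub>v w - c \<cdot>\<^sub>v w \<in> S"
  obtains \<sigma> w where "\<sigma> \<in> complex_embeddings R" "w \<in> S" "w \<noteq> 0\<^sub>v g"
    "\<And>A. A \<in> carrier R \<Longrightarrow> A *\<^sub>v w = \<sigma> A \<cdot>\<^sub>v w"
proof -
  obtain m where m: "dimension m (generate_field R {\<one>\<^bsub>R\<^esub>}) (carrier R)"
    using nf by (auto simp: number_field_def)
  obtain w where w: "w \<in> S" "w \<noteq> 0\<^sub>v g" "\<forall>A\<in>carrier R. \<exists>c. A *\<^sub>v w = c \<cdot>\<^sub>v w"
    using common_eigenvector_subspace[OF m refl S stable] by blast
  have wc: "w \<in> carrier_vec g" using w S by auto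
  obtain i where i: "i < g" "w $ i \<noteq> 0" using w(2) wc by (metis carrier_vecD eq_vecI index_zero_vec(1) index_zero_vec(2))
  define \<sigma> where "\<sigma> A = (SOME c. A *\<^sub>v w = c \<cdot>\<^sub>v w)" for A
  have s: "A *\<^sub>v w = \<sigma> A \<cdot>\<^sub>v w" if "A \<in> carrier R" for A
    using w(3) that someI_ex[of "\<lambda>c. A *\<^sub>v w = c \<cdot>\<^sub>v w"] by (auto simp: \<sigma>_def)
  have uniq: "\<sigma> A = c" if "A \<in> carrier R" "A *\<^sub>v w = c \<cdot>\<^sub>v w" for A c
  proof -
    have "(\<sigma> A \<cdot>\<^sub>v w) $ i = (c \<cdot>\<^sub>v w) $ i" using s[OF that(1)] that(2) by simp
    then show ?thesis using i wc by simp
  qed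
  have "\<sigma> \<in> complex_embeddings R"
  proof (rule ring_hom_memI)
    fix A B assume AB: "A \<in> carrier R" "B \<in> carrier R"
    then have c: "A \<in> carrier_mat g g" "B \<in> carrier_mat g g" using R_sub by auto
    show "\<sigma> A \<in> carrier class_ring" by simp
    have "(A \<otimes>\<^bsub>R\<^esub> B) *\<^sub>v w = A *\<^sub>v (B *\<^sub>v w)" using c wc by (simp add: R_mult assoc_mult_mat_vec[of _ g g _ g])
    also have "\<dots> = (\<sigma> A * \<sigma> B) \<cdot>\<^sub>v w"
      unfolding s[OF AB(2)] mult_mat_vec[OF c(1) wc] s[OF AB(1)] by (simp add: smult_smult_assoc mult.commute)
    finally show "\<sigma> (A \<otimes>\<^bsub>R\<^esub> B) = \<sigma> A \<otimes>\<^bsub>class_ring\<^esub> \<sigma> B" using AB uniq by simp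
    have "(A \<oplus>\<^bsub>R\<^esub> B) *\<^sub>v w = (\<sigma> A + \<sigma> B) \<cdot>\<^sub>v w"
      using c wc by (simp add: R_add add_mult_distrib_mat_vec[of _ g g] s[OF AB(1)] s[OF AB(2)] add_smult_distrib_vec)
    then show "\<sigma> (A \<oplus>\<^bsub>R\<^esub> B) = \<sigma> A \<oplus>\<^bsub>class_ring\<^esub> \<sigma> B" using AB uniq by simp
  next
    have "\<one>\<^bsub>R\<^esub> *\<^sub>v w = 1 \<cdot>\<^sub>v w" using wc by (simp add: R_one)
    then show "\<sigma> \<one>\<^bsub>R\<^esub> = \<one>\<^bsub>class_ring\<^esub>" using uniq by simp
  qed
  from that[OF this w(1,2) s] show thesis by blast
qed

end

lemma abelian_variety_full_lattice:
  assumes "abelian_variety g L"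
  obtains n P where "full_lattice g n P L"
proof -
  obtain n P where "P \<in> carrier_mat g n"
    "\<forall>x\<in>carrier_vec n. P *\<^sub>v map_vec complex_of_real x = 0\<^sub>v g \<longrightarrow> x = 0\<^sub>v n"
    "carrier_vec g = (\<lambda>x. P *\<^sub>v map_vec complex_of_real x) ` carrier_vec n"
    "L = (\<lambda>x. P *\<^sub>v map_vec complex_of_int x) ` carrier_vec n"
    using assms unfolding abelian_variety_def lattice_in_def by blast
  then have "full_lattice g n P L" by unfold_locales blast+
  then show thesis by (rule that)
qed

section \<open>Eigenvalues of endomorphisms as values of embeddings\<close>

context full_lattice
begin

lemma End_Q_mat: "A \<in> carrier (End_Q g L) \<Longrightarrow> A \<in> carrier_mat g g"
  by (simp add: End_Q_carrier)

lemma field_End_Q_det: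
  assumes K: "field (End_Q g L)" and B: "B \<in> carrier (End_Q g L)" "B \<noteq> 0\<^sub>m g g"
  shows "det B \<noteq> 0"
proof
  interpret K: field "End_Q g L" by (rule K)
  have U: "B \<in> Units (End_Q g L)" using B K.field_Units by (simp add: End_Q_simps)
  let ?C = "inv\<^bsub>End_Q g L\<^esub> B"
  have C: "?C \<in> carrier_mat g g" using U End_Q_mat by blast
  have "B * ?C = 1\<^sub>m g" using K.Units_r_inv[OF U] by (simp add: End_Q_simps)
  then have "det B * det ?C = 1" using det_mult[OF End_Q_mat[OF B(1)] C] by simp
  moreover assume "det B = 0"
  ultimately show False by simp
qed

text \<open>The eigenspace of \<open>A\<close> for \<open>z\<close> is stable under everything
  commuting with \<open>A\<close>, so \<open>F\<close> has a common eigenvector inside it.\<close>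

lemma eigenvalue_embedding:
  assumes nf: "number_field (End_Q g L\<lparr>carrier := F\<rparr>)" and F: "F \<subseteq> carrier (End_Q g L)"
    and A: "A \<in> carrier_mat g g" and comm: "\<And>B. B \<in> F \<Longrightarrow> B * A = A * B"
    and z: "eigenvalue A z"
  obtains \<sigma> w where "\<sigma> \<in> complex_embeddings (End_Q g L\<lparr>carrier := F\<rparr>)" "w \<in> carrier_vec g" "w \<noteq> 0\<^sub>v g"
    "A *\<^sub>v w = z \<cdot>\<^sub>v w" "\<And>B. B \<in> F \<Longrightarrow> B *\<^sub>v w = \<sigma> B \<cdot>\<^sub>v w"
proof -
  interpret matrix_number_field g "End_Q g L\<lparr>carrier := F\<rparr>"
    using nf F End_Q_mat by unfold_locales (auto simp: End_Q_simps)
  define S where "S = {x \<in> carrier_vec g. A *\<^sub>v x = z \<cdot>\<^sub>v x}"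
  obtain v where v: "v \<in> S" "v \<noteq> 0\<^sub>v g"
    using z A by (auto simp: eigenvalue_def eigenvector_def S_def)
  have stable: "B *\<^sub>v w - c \<cdot>\<^sub>v w \<in> S" if B: "B \<in> carrier (End_Q g L\<lparr>carrier := F\<rparr>)" and w: "w \<in> S" for B w c
  proof -
    have Bm: "B \<in> carrier_mat g g" and BF: "B \<in> F" using B F End_Q_mat by auto
    have wc: "w \<in> carrier_vec g" and Aw: "A *\<^sub>v w = z \<cdot>\<^sub>v w" using w by (auto simp: S_def)
    have "A *\<^sub>v (B *\<^sub>v w) = B *\<^sub>v (A *\<^sub>v w)"
      by (simp only: assoc_mult_mat_vec[OF A Bm wc, symmetric] assoc_mult_mat_vec[OF Bm A wc, symmetric] comm[OF BF])
    also have "\<dots> = z \<cdot>\<^sub>v (B *\<^sub>v w)" unfolding Aw using Bm wc by (simp add: mult_mat_vec)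
    finally have AB: "A *\<^sub>v (B *\<^sub>v w) = z \<cdot>\<^sub>v (B *\<^sub>v w)" .
    have "A *\<^sub>v (B *\<^sub>v w - c \<cdot>\<^sub>v w) = z \<cdot>\<^sub>v (B *\<^sub>v w) - c \<cdot>\<^sub>v (z \<cdot>\<^sub>v w)"
      using mult_mat_vec_minus[OF A, of "B *\<^sub>v w" "c \<cdot>\<^sub>v w"] Bm wc
      by (simp add: AB mult_mat_vec[OF A wc] Aw)
    also have "\<dots> = z \<cdot>\<^sub>v (B *\<^sub>v w - c \<cdot>\<^sub>v w)"
      using Bm wc by (intro eq_vecI) (auto simp: algebra_simps)
    finally show ?thesis using Bm wc by (simp add: S_def)
  qed
  obtain \<sigma> w where "\<sigma> \<in> complex_embeddings (End_Q g L\<lparr>carrier := F\<rparr>)" "w \<in> S" "w \<noteq> 0\<^sub>v g"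
    "\<And>B. B \<in> carrier (End_Q g L\<lparr>carrier := F\<rparr>) \<Longrightarrow> B *\<^sub>v w = \<sigma> B \<cdot>\<^sub>v w"
    using embedding_on_eigenvector[OF _ v stable] by (auto simp: S_def)
  then show thesis by (intro that) (auto simp: S_def)
qed

text \<open>With the whole field in the role of \<open>F\<close>, the matrix \<open>A\<close> itself
  acts on the eigenvector by \<open>\<sigma> A\<close>.\<close>

lemma field_eigenvalue_embedding:
  assumes nf: "number_field (End_Q g L)" and A: "A \<in> carrier (End_Q g L)" and z: "eigenvalue A z"
  obtains \<sigma> where "\<sigma> \<in> complex_embeddings (End_Q g L)" "\<sigma> A = z"
proof -
  interpret K: field "End_Q g L" using nf by (simp add: number_field_def)
  have id: "End_Q g L\<lparr>carrier := carrier (End_Q g L)\<rparr> = End_Q g L" by simp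
  obtain \<sigma> w where s: "\<sigma> \<in> complex_embeddings (End_Q g L\<lparr>carrier := carrier (End_Q g L)\<rparr>)"
    and w: "w \<in> carrier_vec g" "w \<noteq> 0\<^sub>v g" "A *\<^sub>v w = z \<cdot>\<^sub>v w"
    "\<And>B. B \<in> carrier (End_Q g L) \<Longrightarrow> B *\<^sub>v w = \<sigma> B \<cdot>\<^sub>v w"
  proof (rule eigenvalue_embedding[OF _ subset_refl End_Q_mat[OF A] _ z])
    show "number_field (End_Q g L\<lparr>carrier := carrier (End_Q g L)\<rparr>)" unfolding id by (rule nf)
    show "B * A = A * B" if "B \<in> carrier (End_Q g L)" for B
      using K.m_comm[OF that A] by (simp add: End_Q_simps)
  qed blast
  obtain i where i: "i < g" "w $ i \<noteq> 0" using w by (metis carrier_vecD eq_vecI index_zero_vec(1) index_zero_vec(2))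
  have "(\<sigma> A \<cdot>\<^sub>v w) $ i = (z \<cdot>\<^sub>v w) $ i" using w(3) w(4)[OF A] by simp
  then have "\<sigma> A = z" using i w(1) by simp
  then show thesis using s that unfolding id by blast
qed

lemma End_eq_one_iff:
  assumes f: "f \<in> carrier (End_ring g L)"
  shows "f = \<one>\<^bsub>End_ring g L\<^esub> \<longleftrightarrow> analytic_rep g L f = 1\<^sub>m g"
    and "f = \<ominus>\<^bsub>End_ring g L\<^esub> \<one>\<^bsub>End_ring g L\<^esub> \<longleftrightarrow> analytic_rep g L f = - 1\<^sub>m g"
proof -
  have m1: "- 1\<^sub>m g \<in> lattice_mats"
  proof -
    have "- 1\<^sub>m g = 0\<^sub>m g g - (1\<^sub>m g :: complex mat)" by (intro eq_matI) auto
    then show ?thesis using minus_lattice_mats[OF zero_lattice_mats one_lattice_mats] by metis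
  qed
  show "f = \<one>\<^bsub>End_ring g L\<^esub> \<longleftrightarrow> analytic_rep g L f = 1\<^sub>m g"
    using endo_analytic_rep[OF f] analytic_rep_endo[OF one_lattice_mats] unfolding End_one by metis
  show "f = \<ominus>\<^bsub>End_ring g L\<^esub> \<one>\<^bsub>End_ring g L\<^esub> \<longleftrightarrow> analytic_rep g L f = - 1\<^sub>m g"
    using endo_analytic_rep[OF f] analytic_rep_endo[OF m1] unfolding End_uminus_one by metis
qed

text \<open>The conjugate \<open>z\<close> is real, so modulus 1 means 1 or -1, and an embedding
  takes these values only at the corresponding elements.\<close>

lemma totally_real_eigenvalue:
  assumes K: "totally_real_field (End_Q g L)" and f: "f \<in> carrier (End_ring g L)"
    and z: "analytic_eigenvalue g L f z"
  shows "cmod z = 1 \<longleftrightarrow> f = \<one>\<^bsub>End_ring g L\<^esub> \<or> f = \<ominus>\<^bsub>End_ring g L\<^esub> \<one>\<^bsub>End_ring g L\<^esub>"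
proof -
  have nf: "number_field (End_Q g L)" using K by (simp add: totally_real_field_def)
  then have fK: "field (End_Q g L)" by (simp add: number_field_def)
  interpret K: field "End_Q g L" by (rule fK)
  let ?A = "analytic_rep g L f"
  have A: "?A \<in> carrier (End_Q g L)" by (rule lattice_mats_End_Q[OF analytic_rep_lattice_mats[OF f]])
  obtain \<sigma> where s: "\<sigma> \<in> complex_embeddings (End_Q g L)" "\<sigma> ?A = z"
    by (rule field_eigenvalue_embedding[OF nf A z])
  note h = ring_hom_class_ring[OF K.ring_axioms s(1)]
  have "z \<in> \<real>" using K s A by (auto simp: totally_real_field_def)
  then obtain r where r: "z = of_real r" by (auto elim: Reals_cases)
  have neg: "\<ominus>\<^bsub>End_Q g L\<^esub> \<one>\<^bsub>End_Q g L\<^esub> = - 1\<^sub>m g"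
  proof -
    let ?B = "\<ominus>\<^bsub>End_Q g L\<^esub> \<one>\<^bsub>End_Q g L\<^esub>"
    have B: "?B \<in> carrier_mat g g" by (intro End_Q_mat) simp
    have "?B + 1\<^sub>m g = 0\<^sub>m g g" using K.l_neg[OF K.one_closed] by (simp add: End_Q_simps)
    then have e: "(?B + 1\<^sub>m g) $$ (i, j) = 0" if "i < g" "j < g" for i j using that by simp
    show ?thesis
    proof (rule eq_matI)
      fix i j assume "i < dim_row (- 1\<^sub>m g :: complex mat)" "j < dim_col (- 1\<^sub>m g :: complex mat)"
      then show "?B $$ (i, j) = (- 1\<^sub>m g) $$ (i, j)" using e[of i j] B by (simp add: add_eq_0_iff)
    qed (use B in auto)
  qed
  have "cmod z = 1 \<longleftrightarrow> \<sigma> ?A = \<sigma> \<one>\<^bsub>End_Q g L\<^esub> \<or> \<sigma> ?A = \<sigma> (\<ominus>\<^bsub>End_Q g L\<^esub> \<one>\<^bsub>End_Q g L\<^esub>)"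
    unfolding s(2) h(3) h(5)[OF K.one_closed] r by (auto simp: complex_eq_iff abs_if)
  also have "\<dots> \<longleftrightarrow> ?A = \<one>\<^bsub>End_Q g L\<^esub> \<or> ?A = \<ominus>\<^bsub>End_Q g L\<^esub> \<one>\<^bsub>End_Q g L\<^esub>"
    by (simp only: embedding_eq_iff[OF fK s(1) A] K.one_closed K.a_inv_closed)
  also have "\<dots> \<longleftrightarrow> ?A = 1\<^sub>m g \<or> ?A = - 1\<^sub>m g" 
    unfolding End_Q_simps(3) neg[unfolded End_Q_simps(3)] ..
  finally show ?thesis by (simp add: End_eq_one_iff[OF f])
qed

end

section \<open>Complex conjugation on a CM-field\<close>

text \<open>Outside \<open>F\<close>, the element \<open>x\<close> satisfies a quadratic equation
  over \<open>F\<close>. Its other root \<open>a - x\<close> is the complex conjugate under every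
  embedding, because embeddings map \<open>F\<close> to the reals but not \<open>x\<close>.\<close>

lemma CM_conjugate:
  assumes K: "CM_field K" and x: "x \<in> carrier K"
  shows "\<exists>y\<in>carrier K. \<forall>\<sigma>\<in>complex_embeddings K. \<sigma> y = cnj (\<sigma> x)"
proof -
  have fK: "field K" using K by (simp add: CM_field_def number_field_def)
  interpret K: field K by (rule fK)
  obtain F where F: "subfield F K" "totally_real_field (K\<lparr>carrier := F\<rparr>)" "K.dimension 2 F (carrier K)"
    using K by (auto simp: CM_field_def)
  have FK: "F \<subseteq> carrier K" using F(1) by (rule subfieldE(3))
  have real: "\<sigma> u \<in> \<real>" if "\<sigma> \<in> complex_embeddings K" "u \<in> F" for \<sigma> u
  proof -
    have "\<sigma> \<in> complex_embeddings (K\<lparr>carrier := F\<rparr>)"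
      using that(1) FK by (auto simp: ring_hom_def)
    then show ?thesis using F(2) that(2) by (auto simp: totally_real_field_def)
  qed
  show ?thesis
  proof (cases "x \<in> F")
    case True
    then show ?thesis using x real by (auto intro!: bexI[of _ x] simp: Reals_cnj_iff)
  next
    case False
    have one: "K.Span F [\<one>\<^bsub>K\<^esub>] \<subseteq> F"
      using FK by (auto simp: K.line_extension_mem_iff subset_iff)
    \<comment> \<open>\<open>x\<close> and 1 are independent, and a third independent vector would
      contradict dimension 2, so they span.\<close>
    have ind: "K.independent F [x, \<one>\<^bsub>K\<^esub>]"
      using False one x by (intro K.li_Cons) auto
    have span: "\<exists>a\<in>F. \<exists>b\<in>F. y = a \<otimes>\<^bsub>K\<^esub> x \<oplus>\<^bsub>K\<^esub> b" if y: "y \<in> carrier K" for y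
    proof -
      have "y \<in> K.Span F [x, \<one>\<^bsub>K\<^esub>]"
      proof (rule ccontr)
        assume "y \<notin> K.Span F [x, \<one>\<^bsub>K\<^esub>]"
        then have "K.independent F [y, x, \<one>\<^bsub>K\<^esub>]" by (rule K.li_Cons[OF y _ ind])
        then have "length [y, x, \<one>\<^bsub>K\<^esub>] \<le> 2"
          using K.independent_length_le_dimension[OF F(1,3)] x y by fastforce
        then show False by simp
      qed
      moreover have "K.Span F [x, \<one>\<^bsub>K\<^esub>] = K.line_extension F x (K.Span F [\<one>\<^bsub>K\<^esub>])" by simp
      ultimately obtain a v where "a \<in> F" "v \<in> K.Span F [\<one>\<^bsub>K\<^esub>]" "y = a \<otimes>\<^bsub>K\<^esub> x \<oplus>\<^bsub>K\<^esub> v"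
        using K.line_extension_mem_iff by blast
      then show ?thesis using one by blast
    qed
    obtain a b where ab: "a \<in> F" "b \<in> F" "x \<otimes>\<^bsub>K\<^esub> x = a \<otimes>\<^bsub>K\<^esub> x \<oplus>\<^bsub>K\<^esub> b"
      using span[of "x \<otimes>\<^bsub>K\<^esub> x"] x by auto
    have abK: "a \<in> carrier K" "b \<in> carrier K" using ab FK by auto
    have "\<sigma> (a \<ominus>\<^bsub>K\<^esub> x) = cnj (\<sigma> x)" if s: "\<sigma> \<in> complex_embeddings K" for \<sigma>
    proof -
      note h = ring_hom_class_ring[OF K.ring_axioms s]
      have nr: "\<sigma> x \<notin> \<real>"
      proof
        assume xr: "\<sigma> x \<in> \<real>"
        have "\<sigma> y \<in> \<real>" if "y \<in> carrier K" for y
        proof -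
          from span[OF that] obtain c d where cd: "c \<in> F" "d \<in> F" "y = c \<otimes>\<^bsub>K\<^esub> x \<oplus>\<^bsub>K\<^esub> d" by blast
          then have "\<sigma> y = \<sigma> c * \<sigma> x + \<sigma> d" using FK x h by (auto simp: subset_iff)
          then show ?thesis using xr real[OF s] cd by auto
        qed
        then show False using K s by (auto simp: CM_field_def)
      qed
      have quad: "\<sigma> x * \<sigma> x = \<sigma> a * \<sigma> x + \<sigma> b"
        using arg_cong[OF ab(3), of \<sigma>] abK x by (simp add: h)
      have "cnj (\<sigma> x * \<sigma> x) = cnj (\<sigma> a * \<sigma> x + \<sigma> b)" by (simp only: quad)
      then have "cnj (\<sigma> x) * cnj (\<sigma> x) = \<sigma> a * cnj (\<sigma> x) + \<sigma> b"
        using real[OF s ab(1)] real[OF s ab(2)] by (simp add: Reals_cnj_iff)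
      with quad have "(\<sigma> x - cnj (\<sigma> x)) * (\<sigma> x + cnj (\<sigma> x) - \<sigma> a) = 0" by (simp add: algebra_simps)
      moreover have "\<sigma> x - cnj (\<sigma> x) \<noteq> 0" using nr by (auto simp: Reals_cnj_iff)
      ultimately have "\<sigma> x + cnj (\<sigma> x) - \<sigma> a = 0" by (metis mult_eq_0_iff)
      then have "cnj (\<sigma> x) = \<sigma> a - \<sigma> x" by (simp add: algebra_simps)
      then show ?thesis using abK x by (simp add: h)
    qed
    then show ?thesis using abK x by (intro bexI[of _ "a \<ominus>\<^bsub>K\<^esub> x"]) auto
  qed
qed

text \<open>Modulus 1 under \<open>\<sigma>\<close> is the equation \<open>x y = 1\<close> with the
  conjugate \<open>y\<close>, which mentions no embedding.\<close>

lemma CM_norm_one_iff: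
  assumes K: "CM_field K" and x: "x \<in> carrier K"
    and s: "\<sigma> \<in> complex_embeddings K" and t: "\<tau> \<in> complex_embeddings K"
  shows "cmod (\<sigma> x) = 1 \<longleftrightarrow> cmod (\<tau> x) = 1"
proof -
  have fK: "field K" using K by (simp add: CM_field_def number_field_def)
  interpret K: field K by (rule fK)
  obtain y where y: "y \<in> carrier K" "\<And>\<sigma>. \<sigma> \<in> complex_embeddings K \<Longrightarrow> \<sigma> y = cnj (\<sigma> x)"
    using CM_conjugate[OF K x] by blast
  have "cmod (\<sigma> x) = 1 \<longleftrightarrow> x \<otimes>\<^bsub>K\<^esub> y = \<one>\<^bsub>K\<^esub>" if s: "\<sigma> \<in> complex_embeddings K" for \<sigma>
  proof -
    note h = ring_hom_class_ring[OF K.ring_axioms s]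
    have "\<sigma> (x \<otimes>\<^bsub>K\<^esub> y) = of_real ((cmod (\<sigma> x))\<^sup>2)"
      using x y s by (simp add: h complex_norm_square del: of_real_power)
    then have "\<sigma> (x \<otimes>\<^bsub>K\<^esub> y) = \<sigma> \<one>\<^bsub>K\<^esub> \<longleftrightarrow> (cmod (\<sigma> x))\<^sup>2 = 1"
      unfolding h(3) by (metis of_real_1 of_real_eq_iff)
    also have "\<dots> \<longleftrightarrow> cmod (\<sigma> x) = 1" by (simp add: power2_eq_1_iff) (metis norm_ge_zero not_one_le_zero neg_0_le_iff_le)
    finally show ?thesis using embedding_eq_iff[OF fK s] x y by simp
  qed
  from this[OF s] this[OF t] show ?thesis by simp
qed

lemma (in full_lattice) CM_eigenvalue:
  assumes K: "CM_field (End_Q g L)" and A: "A \<in> carrier (End_Q g L)" and z: "eigenvalue A z"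
    and s: "\<sigma> \<in> complex_embeddings (End_Q g L)"
  shows "cmod z = 1 \<longleftrightarrow> cmod (\<sigma> A) = 1"
proof -
  have "number_field (End_Q g L)" using K by (simp add: CM_field_def)
  then obtain \<tau> where "\<tau> \<in> complex_embeddings (End_Q g L)" "\<tau> A = z"
    by (rule field_eigenvalue_embedding[OF _ A z])
  then show ?thesis using CM_norm_one_iff[OF K A s] by metis
qed

section \<open>Totally definite quaternion algebras\<close>

lemma real_quat_simps:
  "carrier (real_quat \<alpha> \<beta>) = UNIV" "\<zero>\<^bsub>real_quat \<alpha> \<beta>\<^esub> = (0, 0, 0, 0)" "\<one>\<^bsub>real_quat \<alpha> \<beta>\<^esub> = (1, 0, 0, 0)"
  "(a, b, c, d) \<oplus>\<^bsub>real_quat \<alpha> \<beta>\<^esub> (a', b', c', d') = (a + a', b + b', c + c', d + d')"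
  "(a, b, c, d) \<otimes>\<^bsub>real_quat \<alpha> \<beta>\<^esub> (a', b', c', d') =
     (a * a' + \<alpha> * b * b' + \<beta> * c * c' - \<alpha> * \<beta> * d * d', a * b' + b * a' - \<beta> * c * d' + \<beta> * d * c',
      a * c' + c * a' + \<alpha> * b * d' - \<alpha> * d * b', a * d' + d * a' + b * c' - c * b')"
  by (simp_all add: real_quat_def)

text \<open>Euler's four-square identity: the norm of the product is the product of the
  norms.\<close>

lemma hamilton_no_zero_divisors:
  assumes "x \<otimes>\<^bsub>hamilton_quaternions\<^esub> y = \<zero>\<^bsub>hamilton_quaternions\<^esub>"
  shows "x = \<zero>\<^bsub>hamilton_quaternions\<^esub> \<or> y = \<zero>\<^bsub>hamilton_quaternions\<^esub>"
proof -
  obtain a b c d a' b' c' d' where xy: "x = (a, b, c, d)" "y = (a', b', c', d')" by (metis prod_cases4)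
  define p where "p = a * a' - b * b' - c * c' - d * d'"
  define q where "q = a * b' + b * a' + c * d' - d * c'"
  define r where "r = a * c' + c * a' - b * d' + d * b'"
  define s where "s = a * d' + d * a' + b * c' - c * b'"
  have z: "p = 0" "q = 0" "r = 0" "s = 0"
    using assms by (auto simp: xy real_quat_simps p_def q_def r_def s_def)
  have "(a\<^sup>2 + b\<^sup>2 + c\<^sup>2 + d\<^sup>2) * (a'\<^sup>2 + b'\<^sup>2 + c'\<^sup>2 + d'\<^sup>2) = p\<^sup>2 + q\<^sup>2 + r\<^sup>2 + s\<^sup>2"
    unfolding p_def q_def r_def s_def by (simp add: power2_eq_square algebra_simps)
  then have "a\<^sup>2 + b\<^sup>2 + c\<^sup>2 + d\<^sup>2 = 0 \<or> a'\<^sup>2 + b'\<^sup>2 + c'\<^sup>2 + d'\<^sup>2 = 0" using z by simp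
  then show ?thesis by (auto simp: xy real_quat_simps add_nonneg_eq_0_iff)
qed

text \<open>For \<open>\<alpha> \<ge> 0\<close> the equation
  \<open>(sqrt \<alpha> + i) (sqrt \<alpha> - i) = 0\<close> would exhibit zero divisors; similarly
  for \<open>\<beta>\<close> and \<open>j\<close>.\<close>

lemma real_quat_iso_hamilton_neg:
  assumes iso: "real_quat \<alpha> \<beta> \<simeq> hamilton_quaternions" and nz: "\<alpha> \<noteq> 0" "\<beta> \<noteq> 0"
  shows "\<alpha> < 0" "\<beta> < 0"
proof -
  obtain h where h: "h \<in> ring_hom (real_quat \<alpha> \<beta>) hamilton_quaternions" and "bij h"
    using iso by (auto simp: is_ring_iso_def ring_iso_def real_quat_simps)
  have inj: "inj h" using \<open>bij h\<close> by (rule bij_is_inj)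
  let ?z = "(0, 0, 0, 0) :: real \<times> real \<times> real \<times> real"
  have "h ?z = h ?z \<oplus>\<^bsub>hamilton_quaternions\<^esub> h ?z"
    using ring_hom_add[OF h, of ?z ?z] by (simp add: real_quat_simps)
  then have h0: "h ?z = ?z" by (cases "h ?z") (simp add: real_quat_simps)
  have zd: "x = ?z \<or> y = ?z" if "x \<otimes>\<^bsub>real_quat \<alpha> \<beta>\<^esub> y = ?z" for x y
  proof -
    have "h x \<otimes>\<^bsub>hamilton_quaternions\<^esub> h y = \<zero>\<^bsub>hamilton_quaternions\<^esub>"
      using ring_hom_mult[OF h, of x y] that h0 by (simp add: real_quat_simps)
    then have "h x = h ?z \<or> h y = h ?z"
      using hamilton_no_zero_divisors h0 by (simp add: real_quat_simps)
    then show ?thesis using inj by (auto dest: injD)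
  qed
  show "\<alpha> < 0"
  proof (rule ccontr)
    assume "\<not> \<alpha> < 0"
    then have "(sqrt \<alpha>, 1, 0, 0) \<otimes>\<^bsub>real_quat \<alpha> \<beta>\<^esub> (sqrt \<alpha>, -1, 0, 0) = ?z"
      by (simp add: real_quat_simps)
    then show False using zd by fastforce
  qed
  show "\<beta> < 0"
  proof (rule ccontr)
    assume "\<not> \<beta> < 0"
    then have "(sqrt \<beta>, 0, 1, 0) \<otimes>\<^bsub>real_quat \<alpha> \<beta>\<^esub> (sqrt \<beta>, 0, -1, 0) = ?z"
      by (simp add: real_quat_simps)
    then show False using zd by fastforce
  qed
qed

text \<open>The three summands of \<open>q\<close> anticommute pairwise, so all mixed terms of the
  square cancel.\<close>

lemma (in ring) pure_quaternion_square:
  assumes car: "b \<in> carrier R" "c \<in> carrier R" "d \<in> carrier R" "i \<in> carrier R" "j \<in> carrier R"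
    and central: "\<And>a x. a \<in> {b, c, d} \<Longrightarrow> x \<in> carrier R \<Longrightarrow> a \<otimes> x = x \<otimes> a"
    and ij: "i \<otimes> j = \<ominus> (j \<otimes> i)"
  defines "q \<equiv> b \<otimes> i \<oplus> c \<otimes> j \<oplus> d \<otimes> (i \<otimes> j)"
  shows "q \<otimes> q = b \<otimes> b \<otimes> (i \<otimes> i) \<oplus> c \<otimes> c \<otimes> (j \<otimes> j) \<ominus> d \<otimes> d \<otimes> (i \<otimes> i) \<otimes> (j \<otimes> j)"
proof -
  have prod: "(a \<otimes> x) \<otimes> (a' \<otimes> y) = (a \<otimes> a') \<otimes> (x \<otimes> y)"
    if "a \<in> {b, c, d}" "a' \<in> {b, c, d}" "x \<in> carrier R" "y \<in> carrier R" for a a' x y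
  proof -
    have ac: "a \<in> carrier R" "a' \<in> carrier R" using that car by auto
    have "(a \<otimes> x) \<otimes> (a' \<otimes> y) = a \<otimes> ((x \<otimes> a') \<otimes> y)" using ac that by (simp add: m_assoc)
    also have "x \<otimes> a' = a' \<otimes> x" using central[of a' x] that by simp
    finally show ?thesis using ac that by (simp add: m_assoc)
  qed
  have ji: "j \<otimes> i = \<ominus> (i \<otimes> j)" using ij car by simp
  define k where "k = i \<otimes> j"
  have k: "k \<in> carrier R" using car by (simp add: k_def)
  have ki: "k \<otimes> i = \<ominus> (i \<otimes> k)"
    unfolding k_def using car by (simp add: m_assoc ji r_minus)
  have jk: "j \<otimes> k = \<ominus> (k \<otimes> j)"
    unfolding k_def using car by (simp add: m_assoc[symmetric] ji l_minus)
  have kk: "k \<otimes> k = \<ominus> ((i \<otimes> i) \<otimes> (j \<otimes> j))"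
  proof -
    have "k \<otimes> k = i \<otimes> (j \<otimes> i) \<otimes> j" unfolding k_def using car by (simp add: m_assoc)
    also have "\<dots> = \<ominus> (i \<otimes> (i \<otimes> j) \<otimes> j)" unfolding ji using car by (simp add: r_minus l_minus)
    finally show ?thesis using car by (simp add: m_assoc)
  qed
  define x where "x = b \<otimes> i"
  define y where "y = c \<otimes> j"
  define z where "z = d \<otimes> k"
  have xyz: "x \<in> carrier R" "y \<in> carrier R" "z \<in> carrier R" using car k by (auto simp: x_def y_def z_def)
  have comm: "b \<otimes> c = c \<otimes> b" "b \<otimes> d = d \<otimes> b" "c \<otimes> d = d \<otimes> c" using central car by auto
  have yx: "y \<otimes> x = \<ominus> (x \<otimes> y)" unfolding x_def y_def using car by (simp add: prod ji comm r_minus)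
  have zx: "z \<otimes> x = \<ominus> (x \<otimes> z)" unfolding x_def z_def using car k by (simp add: prod ki comm r_minus)
  have zy: "y \<otimes> z = \<ominus> (z \<otimes> y)" unfolding y_def z_def using car k by (simp add: prod jk comm r_minus)
  have "q \<otimes> q = (x \<oplus> y \<oplus> z) \<otimes> (x \<oplus> y \<oplus> z)" by (simp add: q_def x_def y_def z_def k_def)
  also have "\<dots> = x \<otimes> x \<oplus> y \<otimes> y \<oplus> z \<otimes> z \<oplus> (x \<otimes> y \<oplus> y \<otimes> x) \<oplus> (x \<otimes> z \<oplus> z \<otimes> x) \<oplus> (y \<otimes> z \<oplus> z \<otimes> y)"
    using xyz by (simp add: l_distr r_distr a_ac)
  also have "\<dots> = x \<otimes> x \<oplus> y \<otimes> y \<oplus> z \<otimes> z"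
    using xyz by (simp add: yx zx zy r_neg l_neg)
  also have "x \<otimes> x = b \<otimes> b \<otimes> (i \<otimes> i)" unfolding x_def using car by (simp add: prod)
  also have "y \<otimes> y = c \<otimes> c \<otimes> (j \<otimes> j)" unfolding y_def using car by (simp add: prod)
  also have "z \<otimes> z = \<ominus> (d \<otimes> d \<otimes> (i \<otimes> i) \<otimes> (j \<otimes> j))"
  proof -
    have "z \<otimes> z = d \<otimes> d \<otimes> (k \<otimes> k)" unfolding z_def using k by (intro prod) auto
    then show ?thesis unfolding kk using car by (simp add: r_minus m_assoc)
  qed
  finally show ?thesis by (simp add: a_minus_def)
qed

text \<open>A square root of a nonpositive real number is purely imaginary, whichever root is
  chosen.\<close>

lemma cmod_add_sqrt_nonpos:
  assumes s: "s\<^sup>2 = complex_of_real t" and t: "t \<le> 0"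
  shows "(cmod (complex_of_real x + s))\<^sup>2 = x\<^sup>2 - t"
proof -
  have re: "(Re s)\<^sup>2 - (Im s)\<^sup>2 = t" and im: "Re s * Im s = 0"
    using s by (auto simp: complex_eq_iff power2_eq_square)
  have "Re s = 0"
  proof (rule ccontr)
    assume "Re s \<noteq> 0"
    then have "Im s = 0" using im by simp
    then have "(Re s)\<^sup>2 \<le> 0" using re t by simp
    then show False using \<open>Re s \<noteq> 0\<close> by simp
  qed
  then show ?thesis using re by (simp add: cmod_power2)
qed

context full_lattice
begin

text \<open>On a common eigenvector of \<open>A\<close> and \<open>F\<close> the pure part
  \<open>p\<close> of \<open>A\<close> acts by \<open>z - \<sigma> a\<close>, and
  \<open>p p = t\<close>. As \<open>\<sigma> t \<le> 0\<close>, the squared modulus of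
  \<open>z\<close> is the reduced norm \<open>(\<sigma> a)^2 - \<sigma> t\<close>, a sum of four
  nonnegative terms. It equals 1 exactly if \<open>a a = t + 1\<close>, and it is 0 only for
  \<open>A = 0\<close>.\<close>

lemma quaternion_eigenvalue:
  assumes Q: "totally_definite_quaternion_algebra (End_Q g L) F i j"
    and F: "a \<in> F" "b \<in> F" "c \<in> F" "d \<in> F"
    and A: "A = a \<oplus>\<^bsub>End_Q g L\<^esub> b \<otimes>\<^bsub>End_Q g L\<^esub> i \<oplus>\<^bsub>End_Q g L\<^esub> c \<otimes>\<^bsub>End_Q g L\<^esub> j
              \<oplus>\<^bsub>End_Q g L\<^esub> d \<otimes>\<^bsub>End_Q g L\<^esub> (i \<otimes>\<^bsub>End_Q g L\<^esub> j)"
  defines "t \<equiv> b \<otimes>\<^bsub>End_Q g L\<^esub> b \<otimes>\<^bsub>End_Q g L\<^esub> (i \<otimes>\<^bsub>End_Q g L\<^esub> i)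
                \<oplus>\<^bsub>End_Q g L\<^esub> c \<otimes>\<^bsub>End_Q g L\<^esub> c \<otimes>\<^bsub>End_Q g L\<^esub> (j \<otimes>\<^bsub>End_Q g L\<^esub> j)
                \<ominus>\<^bsub>End_Q g L\<^esub> d \<otimes>\<^bsub>End_Q g L\<^esub> d
                  \<otimes>\<^bsub>End_Q g L\<^esub> (i \<otimes>\<^bsub>End_Q g L\<^esub> i) \<otimes>\<^bsub>End_Q g L\<^esub> (j \<otimes>\<^bsub>End_Q g L\<^esub> j)"
  shows "t \<in> F"
    and "\<And>\<sigma> :: complex mat \<Rightarrow> real. \<sigma> \<in> real_embeddings (End_Q g L\<lparr>carrier := F\<rparr>) \<Longrightarrow> \<sigma> t \<le> 0"
    and "\<And>\<sigma> :: complex mat \<Rightarrow> real. \<sigma> \<in> real_embeddings (End_Q g L\<lparr>carrier := F\<rparr>) \<Longrightarrow>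
           (\<sigma> a)\<^sup>2 - \<sigma> t = 1 \<longleftrightarrow> a \<otimes>\<^bsub>End_Q g L\<^esub> a = t \<oplus>\<^bsub>End_Q g L\<^esub> \<one>\<^bsub>End_Q g L\<^esub>"
    and "\<And>z. eigenvalue A z \<Longrightarrow> \<exists>\<sigma> \<in> real_embeddings (End_Q g L\<lparr>carrier := F\<rparr>).
           (z - complex_of_real (\<sigma> a))\<^sup>2 = complex_of_real (\<sigma> t)"
    and "A \<noteq> 0\<^sub>m g g \<Longrightarrow> det A \<noteq> 0"
proof -
  let ?K = "End_Q g L" and ?R = "End_Q g L\<lparr>carrier := F\<rparr>"
  note q = Q[unfolded totally_definite_quaternion_algebra_def quaternion_algebra_def]
  have rK: "ring ?K" and sF: "subfield F ?K" and tr: "totally_real_field ?R" using q by auto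
  interpret K: ring ?K by (rule rK)
  have fR: "field ?R" by (rule K.subfield_iff(2)[OF sF])
  interpret R: field ?R by (rule fR)
  have FK: "F \<subseteq> carrier ?K" using subfieldE(3)[OF sF] .
  note sub = subringE[OF subfieldE(1)[OF sF]]
  have ijK: "i \<in> carrier ?K" "j \<in> carrier ?K" using q by auto
  have central: "\<And>a x. a \<in> F \<Longrightarrow> x \<in> carrier ?K \<Longrightarrow> a \<otimes>\<^bsub>?K\<^esub> x = x \<otimes>\<^bsub>?K\<^esub> a" using q by auto
  let ?\<alpha> = "i \<otimes>\<^bsub>?K\<^esub> i" and ?\<beta> = "j \<otimes>\<^bsub>?K\<^esub> j"
  have ab: "?\<alpha> \<in> F" "?\<beta> \<in> F" "?\<alpha> \<noteq> \<zero>\<^bsub>?K\<^esub>" "?\<beta> \<noteq> \<zero>\<^bsub>?K\<^esub>" using q by auto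
  have anti: "i \<otimes>\<^bsub>?K\<^esub> j = \<ominus>\<^bsub>?K\<^esub> (j \<otimes>\<^bsub>?K\<^esub> i)" using q by auto
  have FC: "a \<in> carrier ?K" "b \<in> carrier ?K" "c \<in> carrier ?K" "d \<in> carrier ?K" using F FK by auto
  show tF: "t \<in> F" unfolding t_def a_minus_def by (simp add: F ab sub(5-7))
  have teq: "t \<oplus>\<^bsub>?K\<^esub> d \<otimes>\<^bsub>?K\<^esub> d \<otimes>\<^bsub>?K\<^esub> ?\<alpha> \<otimes>\<^bsub>?K\<^esub> ?\<beta>
      = b \<otimes>\<^bsub>?K\<^esub> b \<otimes>\<^bsub>?K\<^esub> ?\<alpha> \<oplus>\<^bsub>?K\<^esub> c \<otimes>\<^bsub>?K\<^esub> c \<otimes>\<^bsub>?K\<^esub> ?\<beta>"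
    unfolding t_def a_minus_def using FC ijK by (simp add: K.a_assoc K.l_neg)
  have sval: "\<sigma> t = (\<sigma> b)\<^sup>2 * \<sigma> ?\<alpha> + (\<sigma> c)\<^sup>2 * \<sigma> ?\<beta> - (\<sigma> d)\<^sup>2 * \<sigma> ?\<alpha> * \<sigma> ?\<beta> \<and> \<sigma> ?\<alpha> < 0 \<and> \<sigma> ?\<beta> < 0"
    if s: "\<sigma> \<in> real_embeddings ?R" for \<sigma> :: "complex mat \<Rightarrow> real"
  proof -
    note h = ring_hom_class_ring[OF R.ring_axioms s]
    have "\<sigma> t + \<sigma> d * \<sigma> d * \<sigma> ?\<alpha> * \<sigma> ?\<beta> = \<sigma> b * \<sigma> b * \<sigma> ?\<alpha> + \<sigma> c * \<sigma> c * \<sigma> ?\<beta>"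
      using arg_cong[OF teq, of \<sigma>] h(1)[simplified] h(2)[simplified] F tF ab sub(6,7) by simp
    moreover have "\<sigma> ?\<alpha> < 0" "\<sigma> ?\<beta> < 0"
    proof -
      have "real_quat (\<sigma> ?\<alpha>) (\<sigma> ?\<beta>) \<simeq> hamilton_quaternions"
        using Q s by (simp add: totally_definite_quaternion_algebra_def scalar_extension_def)
      moreover have "\<sigma> ?\<alpha> \<noteq> 0" "\<sigma> ?\<beta> \<noteq> 0"
        using embedding_eq_iff[OF fR s, of ?\<alpha> "\<zero>\<^bsub>?K\<^esub>"] embedding_eq_iff[OF fR s, of ?\<beta> "\<zero>\<^bsub>?K\<^esub>"] ab h(4) sub(2)
        by auto
      ultimately show "\<sigma> ?\<alpha> < 0" "\<sigma> ?\<beta> < 0" by (rule real_quat_iso_hamilton_neg)+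
    qed
    ultimately show ?thesis by (simp add: power2_eq_square algebra_simps)
  qed
  show nonpos: "\<sigma> t \<le> 0" if "\<sigma> \<in> real_embeddings ?R" for \<sigma> :: "complex mat \<Rightarrow> real"
  proof -
    have "(\<sigma> b)\<^sup>2 * \<sigma> ?\<alpha> \<le> 0" "(\<sigma> c)\<^sup>2 * \<sigma> ?\<beta> \<le> 0" "0 \<le> (\<sigma> d)\<^sup>2 * (\<sigma> ?\<alpha> * \<sigma> ?\<beta>)"
      using sval[OF that] by (auto simp: mult_nonneg_nonpos mult_nonpos_nonpos)
    then show ?thesis using sval[OF that] by (simp add: mult.assoc)
  qed
  show "(\<sigma> a)\<^sup>2 - \<sigma> t = 1 \<longleftrightarrow> a \<otimes>\<^bsub>?K\<^esub> a = t \<oplus>\<^bsub>?K\<^esub> \<one>\<^bsub>?K\<^esub>"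
    if s: "\<sigma> \<in> real_embeddings ?R" for \<sigma> :: "complex mat \<Rightarrow> real"
  proof -
    note h = ring_hom_class_ring[OF R.ring_axioms s]
    have "\<sigma> (a \<otimes>\<^bsub>?K\<^esub> a) = (\<sigma> a)\<^sup>2" using h(1)[of a a] F by (simp add: power2_eq_square)
    moreover have "\<sigma> (t \<oplus>\<^bsub>?K\<^esub> \<one>\<^bsub>?K\<^esub>) = \<sigma> t + 1"
      using h(2)[of t "\<one>\<^bsub>?K\<^esub>"] h(3) tF sub(3) by simp
    ultimately have "(\<sigma> a)\<^sup>2 - \<sigma> t = 1 \<longleftrightarrow> \<sigma> (a \<otimes>\<^bsub>?K\<^esub> a) = \<sigma> (t \<oplus>\<^bsub>?K\<^esub> \<one>\<^bsub>?K\<^esub>)" by auto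
    also have "\<dots> \<longleftrightarrow> a \<otimes>\<^bsub>?K\<^esub> a = t \<oplus>\<^bsub>?K\<^esub> \<one>\<^bsub>?K\<^esub>"
      using embedding_eq_iff[OF fR s] F tF sub by simp
    finally show ?thesis .
  qed
  define p where "p = b \<otimes>\<^bsub>?K\<^esub> i \<oplus>\<^bsub>?K\<^esub> c \<otimes>\<^bsub>?K\<^esub> j \<oplus>\<^bsub>?K\<^esub> d \<otimes>\<^bsub>?K\<^esub> (i \<otimes>\<^bsub>?K\<^esub> j)"
  have pK: "p \<in> carrier ?K" using FC ijK by (simp add: p_def)
  have Ap: "A = a \<oplus>\<^bsub>?K\<^esub> p" unfolding A p_def using FC ijK by (simp add: K.a_assoc)
  have AK: "A \<in> carrier ?K" using Ap pK FC by simp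
  have pp: "p \<otimes>\<^bsub>?K\<^esub> p = t" unfolding p_def t_def
    using F FC ijK central anti by (intro K.pure_quaternion_square) auto
  show ev: "\<exists>\<sigma> \<in> real_embeddings ?R. (z - complex_of_real (\<sigma> a))\<^sup>2 = complex_of_real (\<sigma> t)"
    if z: "eigenvalue A z" for z
  proof -
    have "number_field ?R" using tr by (simp add: totally_real_field_def)
    then obtain \<sigma> w where s: "\<sigma> \<in> complex_embeddings ?R" and w: "w \<in> carrier_vec g" "w \<noteq> 0\<^sub>v g"
      "A *\<^sub>v w = z \<cdot>\<^sub>v w" "\<And>B. B \<in> F \<Longrightarrow> B *\<^sub>v w = \<sigma> B \<cdot>\<^sub>v w"
    proof (rule eigenvalue_embedding[OF _ FK End_Q_mat[OF AK] _ z])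
      show "B * A = A * B" if "B \<in> F" for B using central[OF that AK] by (simp add: End_Q_simps)
    qed blast
    have am: "a \<in> carrier_mat g g" and pm: "p \<in> carrier_mat g g" using End_Q_mat FC pK by auto
    have "p *\<^sub>v w = (z - \<sigma> a) \<cdot>\<^sub>v w"
    proof (rule eq_vecI)
      fix l assume "l < dim_vec ((z - \<sigma> a) \<cdot>\<^sub>v w)"
      then have l: "l < g" using w by simp
      have "A *\<^sub>v w = a *\<^sub>v w + p *\<^sub>v w"
        unfolding Ap End_Q_simps using am pm w(1) by (simp add: add_mult_distrib_mat_vec[of _ g g])
      then have "(z \<cdot>\<^sub>v w) $ l = (\<sigma> a \<cdot>\<^sub>v w + p *\<^sub>v w) $ l" using w F by simp
      then show "(p *\<^sub>v w) $ l = ((z - \<sigma> a) \<cdot>\<^sub>v w) $ l"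
        using l w(1) pm by (simp add: algebra_simps)
    qed (use pm w in auto)
    then have "p *\<^sub>v (p *\<^sub>v w) = ((z - \<sigma> a)\<^sup>2) \<cdot>\<^sub>v w"
      using pm w(1) by (simp add: mult_mat_vec smult_smult_assoc power2_eq_square)
    moreover have "p *\<^sub>v (p *\<^sub>v w) = \<sigma> t \<cdot>\<^sub>v w"
      using w(4)[OF tF] pm w(1) unfolding pp[symmetric] End_Q_simps by (simp add: assoc_mult_mat_vec[of _ g g _ g])
    ultimately have eq: "(z - \<sigma> a)\<^sup>2 \<cdot>\<^sub>v w = \<sigma> t \<cdot>\<^sub>v w" by simp
    obtain l where l: "l < g" "w $ l \<noteq> 0" using w by (metis carrier_vecD eq_vecI index_zero_vec(1) index_zero_vec(2))
    have "((z - \<sigma> a)\<^sup>2 \<cdot>\<^sub>v w) $ l = (\<sigma> t \<cdot>\<^sub>v w) $ l" by (simp only: eq)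
    then have zt: "(z - \<sigma> a)\<^sup>2 = \<sigma> t" using l w(1) by simp
    have real: "\<sigma> x = of_real (Re (\<sigma> x))" if "x \<in> F" for x
    proof -
      have "\<sigma> x \<in> \<real>" using tr s that unfolding totally_real_field_def by auto
      then show ?thesis by simp
    qed
    note h = ring_hom_class_ring[OF R.ring_axioms s]
    \<comment> \<open>Complex embeddings of \<open>F\<close> factor through the reals, which is the
      form in which definiteness is stated.\<close>
    have "(\<lambda>x. Re (\<sigma> x)) \<in> real_embeddings ?R"
    proof (rule ring_hom_memI)
      fix x y assume "x \<in> carrier ?R" "y \<in> carrier ?R"
      then have xy: "x \<in> F" "y \<in> F" by auto
      show "Re (\<sigma> x) \<in> carrier class_ring" by simp
      have "\<sigma> (x \<otimes>\<^bsub>?R\<^esub> y) = of_real (Re (\<sigma> x)) * of_real (Re (\<sigma> y))"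
        using h(1)[of x y] xy real by simp
      then show "Re (\<sigma> (x \<otimes>\<^bsub>?R\<^esub> y)) = Re (\<sigma> x) \<otimes>\<^bsub>class_ring\<^esub> Re (\<sigma> y)" by simp
      show "Re (\<sigma> (x \<oplus>\<^bsub>?R\<^esub> y)) = Re (\<sigma> x) \<oplus>\<^bsub>class_ring\<^esub> Re (\<sigma> y)" using h(2)[of x y] xy by simp
    next
      show "Re (\<sigma> \<one>\<^bsub>?R\<^esub>) = \<one>\<^bsub>class_ring\<^esub>" using h(3) by simp
    qed
    then show ?thesis using zt real[OF F(1)] real[OF tF] by (intro bexI[of _ "\<lambda>x. Re (\<sigma> x)"]) auto
  qed
  show "det A \<noteq> 0" if A0: "A \<noteq> 0\<^sub>m g g"
  proof
    assume "det A = 0"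
    then obtain v where v: "v \<in> carrier_vec g" "v \<noteq> 0\<^sub>v g" "A *\<^sub>v v = 0\<^sub>v g"
      using det_0_iff_vec_prod_zero[OF End_Q_mat[OF AK]] by blast
    moreover have "0 \<cdot>\<^sub>v v = 0\<^sub>v g" using v(1) by auto
    ultimately have "eigenvalue A 0" using End_Q_mat[OF AK]
      by (auto simp: eigenvalue_def eigenvector_def intro!: exI[of _ v])
    then obtain \<sigma> where s: "\<sigma> \<in> real_embeddings ?R" "(0 - complex_of_real (\<sigma> a))\<^sup>2 = complex_of_real (\<sigma> t)"
      using ev by blast
    have eq: "(\<sigma> a)\<^sup>2 = \<sigma> t"
    proof -
      have "complex_of_real ((\<sigma> a)\<^sup>2) = complex_of_real (\<sigma> t)" using s(2) by simp
      then show ?thesis by (simp only: of_real_eq_iff)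
    qed
    note sv = sval[OF s(1)]
    \<comment> \<open>In \<open>(\<sigma> a)^2 = \<sigma> t\<close> a nonnegative number equals a
      sum of nonpositive ones, so all terms vanish.\<close>
    have n: "(\<sigma> b)\<^sup>2 * \<sigma> ?\<alpha> \<le> 0" "(\<sigma> c)\<^sup>2 * \<sigma> ?\<beta> \<le> 0" "0 \<le> (\<sigma> d)\<^sup>2 * \<sigma> ?\<alpha> * \<sigma> ?\<beta>" "0 \<le> (\<sigma> a)\<^sup>2"
      using sv by (auto simp: mult_nonneg_nonpos mult_nonpos_nonpos mult.assoc)
    then have "(\<sigma> a)\<^sup>2 = 0" "(\<sigma> b)\<^sup>2 * \<sigma> ?\<alpha> = 0" "(\<sigma> c)\<^sup>2 * \<sigma> ?\<beta> = 0" "(\<sigma> d)\<^sup>2 * \<sigma> ?\<alpha> * \<sigma> ?\<beta> = 0"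
      using sv eq by linarith+
    then have "\<sigma> a = 0" "\<sigma> b = 0" "\<sigma> c = 0" "\<sigma> d = 0" using sv by auto
    then have "a = \<zero>\<^bsub>?K\<^esub>" "b = \<zero>\<^bsub>?K\<^esub>" "c = \<zero>\<^bsub>?K\<^esub>" "d = \<zero>\<^bsub>?K\<^esub>"
      using embedding_eq_iff[OF fR s(1), of _ "\<zero>\<^bsub>?K\<^esub>"] ring_hom_class_ring(4)[OF R.ring_axioms s(1)] F sub(2)
      by auto
    then have "A = \<zero>\<^bsub>?K\<^esub>" unfolding A using ijK by simp
    then show False using A0 by (simp add: End_Q_simps)
  qed
qed

end

section \<open>Combination of the three types of algebra\<close>

lemma quaternion_coords:
  assumes B: "quaternion_algebra B F i j" and x: "x \<in> carrier B"
  obtains a b c d where "a \<in> F" "b \<in> F" "c \<in> F" "d \<in> F"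
    "x = a \<oplus>\<^bsub>B\<^esub> b \<otimes>\<^bsub>B\<^esub> i \<oplus>\<^bsub>B\<^esub> c \<otimes>\<^bsub>B\<^esub> j \<oplus>\<^bsub>B\<^esub> d \<otimes>\<^bsub>B\<^esub> (i \<otimes>\<^bsub>B\<^esub> j)"
proof -
  have "\<forall>x \<in> carrier B. \<exists>!(a, b, c, d). a \<in> F \<and> b \<in> F \<and> c \<in> F \<and> d \<in> F \<and>
      x = a \<oplus>\<^bsub>B\<^esub> b \<otimes>\<^bsub>B\<^esub> i \<oplus>\<^bsub>B\<^esub> c \<otimes>\<^bsub>B\<^esub> j \<oplus>\<^bsub>B\<^esub> d \<otimes>\<^bsub>B\<^esub> (i \<otimes>\<^bsub>B\<^esub> j)"
    using B unfolding quaternion_algebra_def by (elim conjE)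
  from ex1_implies_ex[OF bspec[OF this x]] obtain p where
    p: "case p of (a, b, c, d) \<Rightarrow> a \<in> F \<and> b \<in> F \<and> c \<in> F \<and> d \<in> F \<and>
      x = a \<oplus>\<^bsub>B\<^esub> b \<otimes>\<^bsub>B\<^esub> i \<oplus>\<^bsub>B\<^esub> c \<otimes>\<^bsub>B\<^esub> j \<oplus>\<^bsub>B\<^esub> d \<otimes>\<^bsub>B\<^esub> (i \<otimes>\<^bsub>B\<^esub> j)" by (rule exE)
  obtain a b c d where "p = (a, b, c, d)" by (rule prod_cases4)
  then show thesis using p that[of a b c d] by simp
qed

text \<open>The alternative in \<open>fix_fun_dichotomy\<close> is decided by \<open>f = 1\<close>
  or \<open>f = -1\<close>, by \<open>a a = t + 1\<close>, and by
  \<open>cmod (\<sigma> A) = 1\<close>. The last two claims mention no type of algebra, so for them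
  some \<open>u\<close> is produced in each case.\<close>

lemma fix_fun_cases:
  assumes X: "simple_abelian_variety g L"
    and K: "totally_real_field (End_Q g L) \<or>
        (\<exists>F i j. totally_definite_quaternion_algebra (End_Q g L) F i j) \<or> CM_field (End_Q g L)"
    and f: "f \<in> carrier (End_ring g L)" "f \<noteq> \<zero>\<^bsub>End_ring g L\<^esub>"
  shows "totally_real_field (End_Q g L) \<longrightarrow>
          (if f = \<one>\<^bsub>End_ring g L\<^esub> \<or> f = \<ominus>\<^bsub>End_ring g L\<^esub> \<one>\<^bsub>End_ring g L\<^esub>
           then periodic_fun (fix_fun g L f) else grows_exponentially (fix_fun g L f))"
    and "\<And>F i j a b c d (\<sigma> :: complex mat \<Rightarrow> real) t s.
          totally_definite_quaternion_algebra (End_Q g L) F i j \<and>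
          a \<in> F \<and> b \<in> F \<and> c \<in> F \<and> d \<in> F \<and>
          analytic_rep g L f =
            a \<oplus>\<^bsub>End_Q g L\<^esub> b \<otimes>\<^bsub>End_Q g L\<^esub> i \<oplus>\<^bsub>End_Q g L\<^esub> c \<otimes>\<^bsub>End_Q g L\<^esub> j
              \<oplus>\<^bsub>End_Q g L\<^esub> d \<otimes>\<^bsub>End_Q g L\<^esub> (i \<otimes>\<^bsub>End_Q g L\<^esub> j) \<and>
          t = b [^]\<^bsub>End_Q g L\<^esub> (2::nat) \<otimes>\<^bsub>End_Q g L\<^esub> (i \<otimes>\<^bsub>End_Q g L\<^esub> i)
                \<oplus>\<^bsub>End_Q g L\<^esub> c [^]\<^bsub>End_Q g L\<^esub> (2::nat) \<otimes>\<^bsub>End_Q g L\<^esub> (j \<otimes>\<^bsub>End_Q g L\<^esub> j)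
                \<ominus>\<^bsub>End_Q g L\<^esub> d [^]\<^bsub>End_Q g L\<^esub> (2::nat)
                  \<otimes>\<^bsub>End_Q g L\<^esub> (i \<otimes>\<^bsub>End_Q g L\<^esub> i) \<otimes>\<^bsub>End_Q g L\<^esub> (j \<otimes>\<^bsub>End_Q g L\<^esub> j) \<and>
          \<sigma> \<in> real_embeddings (End_Q g L\<lparr>carrier := F\<rparr>) \<and>
          s ^ 2 = complex_of_real (\<sigma> t) \<Longrightarrow>
          (if cmod (complex_of_real (\<sigma> a) + s) = 1
           then periodic_fun (fix_fun g L f) else grows_exponentially (fix_fun g L f))"
    and "\<And>\<sigma>. CM_field (End_Q g L) \<and> \<sigma> \<in> complex_embeddings (End_Q g L) \<Longrightarrow>
          (if cmod (\<sigma> (analytic_rep g L f)) = 1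
           then periodic_fun (fix_fun g L f) else grows_exponentially (fix_fun g L f))"
    and "periodic_fun (fix_fun g L f) \<longrightarrow> (\<forall>z. analytic_eigenvalue g L f z \<longrightarrow> root_of_unity z)"
    and "grows_exponentially (fix_fun g L f) \<longrightarrow> (\<forall>z. analytic_eigenvalue g L f z \<longrightarrow> cmod z \<noteq> 1)"
proof -
  have g: "g \<noteq> 0" and av: "abelian_variety g L" using X by (auto simp: simple_abelian_variety_def)
  from abelian_variety_full_lattice[OF av] obtain n P where "full_lattice g n P L" by blast
  then interpret full_lattice g n P L .
  let ?K = "End_Q g L" and ?A = "analytic_rep g L f" and ?h = "fix_fun g L f"
  have AK: "?A \<in> carrier ?K" by (rule lattice_mats_End_Q[OF analytic_rep_lattice_mats[OF f(1)]])
  let ?concl = "\<lambda>u. (if u then periodic_fun ?h else grows_exponentially ?h) \<and>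
    (periodic_fun ?h \<longrightarrow> (\<forall>z. analytic_eigenvalue g L f z \<longrightarrow> root_of_unity z)) \<and>
    (grows_exponentially ?h \<longrightarrow> (\<forall>z. analytic_eigenvalue g L f z \<longrightarrow> cmod z \<noteq> 1))"
  have dich: "?concl u"
    if "\<And>B. B \<in> carrier ?K \<Longrightarrow> B \<noteq> 0\<^sub>m g g \<Longrightarrow> det B \<noteq> 0"
      "\<And>z. analytic_eigenvalue g L f z \<Longrightarrow> cmod z = 1 \<longleftrightarrow> u" for u
    using fix_fun_dichotomy[OF g f that] by blast
  have real: "?concl (f = \<one>\<^bsub>End_ring g L\<^esub> \<or> f = \<ominus>\<^bsub>End_ring g L\<^esub> \<one>\<^bsub>End_ring g L\<^esub>)"
    if K: "totally_real_field ?K"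
  proof (rule dich)
    have "field ?K" using K by (simp add: totally_real_field_def number_field_def)
    then show "det B \<noteq> 0" if "B \<in> carrier ?K" "B \<noteq> 0\<^sub>m g g" for B by (rule field_End_Q_det[OF _ that])
    show "cmod z = 1 \<longleftrightarrow> f = \<one>\<^bsub>End_ring g L\<^esub> \<or> f = \<ominus>\<^bsub>End_ring g L\<^esub> \<one>\<^bsub>End_ring g L\<^esub>"
      if "analytic_eigenvalue g L f z" for z by (rule totally_real_eigenvalue[OF K f(1) that])
  qed
  have cm: "?concl (cmod (\<sigma> ?A) = 1)" if K: "CM_field ?K" and s: "\<sigma> \<in> complex_embeddings ?K" for \<sigma>
  proof (rule dich)
    have "field ?K" using K by (simp add: CM_field_def number_field_def)
    then show "det B \<noteq> 0" if "B \<in> carrier ?K" "B \<noteq> 0\<^sub>m g g" for B by (rule field_End_Q_det[OF _ that])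
    show "cmod z = 1 \<longleftrightarrow> cmod (\<sigma> ?A) = 1"
      if "analytic_eigenvalue g L f z" for z by (rule CM_eigenvalue[OF K AK that s])
  qed
  let ?coords = "\<lambda>F i j B a b c d. a \<in> F \<and> b \<in> F \<and> c \<in> F \<and> d \<in> F \<and>
    B = a \<oplus>\<^bsub>?K\<^esub> b \<otimes>\<^bsub>?K\<^esub> i \<oplus>\<^bsub>?K\<^esub> c \<otimes>\<^bsub>?K\<^esub> j \<oplus>\<^bsub>?K\<^esub> d \<otimes>\<^bsub>?K\<^esub> (i \<otimes>\<^bsub>?K\<^esub> j)"
  let ?t = "\<lambda>i j b c d. b \<otimes>\<^bsub>?K\<^esub> b \<otimes>\<^bsub>?K\<^esub> (i \<otimes>\<^bsub>?K\<^esub> i) \<oplus>\<^bsub>?K\<^esub> c \<otimes>\<^bsub>?K\<^esub> c \<otimes>\<^bsub>?K\<^esub> (j \<otimes>\<^bsub>?K\<^esub> j)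
                \<ominus>\<^bsub>?K\<^esub> d \<otimes>\<^bsub>?K\<^esub> d \<otimes>\<^bsub>?K\<^esub> (i \<otimes>\<^bsub>?K\<^esub> i) \<otimes>\<^bsub>?K\<^esub> (j \<otimes>\<^bsub>?K\<^esub> j)"
  \<comment> \<open>The condition is free of \<open>\<sigma>\<close> and of the square root
    \<open>s\<close>, which makes the outcome the same for all choices of them.\<close>
  have quat: "?concl (a \<otimes>\<^bsub>?K\<^esub> a = ?t i j b c d \<oplus>\<^bsub>?K\<^esub> \<one>\<^bsub>?K\<^esub>)"
    if Q: "totally_definite_quaternion_algebra ?K F i j" and co: "?coords F i j ?A a b c d" for F i j a b c d
  proof (rule dich)
    show "det B \<noteq> 0" if B: "B \<in> carrier ?K" "B \<noteq> 0\<^sub>m g g" for B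
    proof -
      have "quaternion_algebra ?K F i j" using Q by (simp add: totally_definite_quaternion_algebra_def)
      from quaternion_coords[OF this B(1)] obtain a b c d where
        co: "a \<in> F" "b \<in> F" "c \<in> F" "d \<in> F"
        "B = a \<oplus>\<^bsub>?K\<^esub> b \<otimes>\<^bsub>?K\<^esub> i \<oplus>\<^bsub>?K\<^esub> c \<otimes>\<^bsub>?K\<^esub> j \<oplus>\<^bsub>?K\<^esub> d \<otimes>\<^bsub>?K\<^esub> (i \<otimes>\<^bsub>?K\<^esub> j)" .
      show ?thesis by (rule quaternion_eigenvalue(5)[OF Q co B(2)])
    qed
    show "cmod z = 1 \<longleftrightarrow> a \<otimes>\<^bsub>?K\<^esub> a = ?t i j b c d \<oplus>\<^bsub>?K\<^esub> \<one>\<^bsub>?K\<^esub>"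
      if z: "analytic_eigenvalue g L f z" for z
    proof -
      have co': "a \<in> F" "b \<in> F" "c \<in> F" "d \<in> F"
        "?A = a \<oplus>\<^bsub>?K\<^esub> b \<otimes>\<^bsub>?K\<^esub> i \<oplus>\<^bsub>?K\<^esub> c \<otimes>\<^bsub>?K\<^esub> j \<oplus>\<^bsub>?K\<^esub> d \<otimes>\<^bsub>?K\<^esub> (i \<otimes>\<^bsub>?K\<^esub> j)"
        using co by auto
      note qe = quaternion_eigenvalue[OF Q co']
      obtain \<sigma> where s: "\<sigma> \<in> real_embeddings (?K\<lparr>carrier := F\<rparr>)"
        "(z - complex_of_real (\<sigma> a))\<^sup>2 = complex_of_real (\<sigma> (?t i j b c d))" using qe(4)[OF z] by blast
      have "(cmod z)\<^sup>2 = (\<sigma> a)\<^sup>2 - \<sigma> (?t i j b c d)"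
        using cmod_add_sqrt_nonpos[OF s(2) qe(2)[OF s(1)], of "\<sigma> a"] by simp
      moreover have "cmod z = 1 \<longleftrightarrow> (cmod z)\<^sup>2 = 1"
        by (metis norm_ge_zero one_power2 power2_eq_iff_nonneg zero_le_one)
      ultimately show ?thesis using qe(3)[OF s(1)] by simp
    qed
  qed
  show "totally_real_field (End_Q g L) \<longrightarrow>
          (if f = \<one>\<^bsub>End_ring g L\<^esub> \<or> f = \<ominus>\<^bsub>End_ring g L\<^esub> \<one>\<^bsub>End_ring g L\<^esub>
           then periodic_fun (fix_fun g L f) else grows_exponentially (fix_fun g L f))"
    using real by simp
  show "(if cmod (\<sigma> (analytic_rep g L f)) = 1
           then periodic_fun (fix_fun g L f) else grows_exponentially (fix_fun g L f))"
    if "CM_field (End_Q g L) \<and> \<sigma> \<in> complex_embeddings (End_Q g L)" for \<sigma>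
    using cm[of \<sigma>] that by simp
  show "(if cmod (complex_of_real (\<sigma> a) + s) = 1
           then periodic_fun (fix_fun g L f) else grows_exponentially (fix_fun g L f))"
    if H: "totally_definite_quaternion_algebra (End_Q g L) F i j \<and>
          a \<in> F \<and> b \<in> F \<and> c \<in> F \<and> d \<in> F \<and>
          analytic_rep g L f =
            a \<oplus>\<^bsub>End_Q g L\<^esub> b \<otimes>\<^bsub>End_Q g L\<^esub> i \<oplus>\<^bsub>End_Q g L\<^esub> c \<otimes>\<^bsub>End_Q g L\<^esub> j
              \<oplus>\<^bsub>End_Q g L\<^esub> d \<otimes>\<^bsub>End_Q g L\<^esub> (i \<otimes>\<^bsub>End_Q g L\<^esub> j) \<and>
          t = b [^]\<^bsub>End_Q g L\<^esub> (2::nat) \<otimes>\<^bsub>End_Q g L\<^esub> (i \<otimes>\<^bsub>End_Q g L\<^esub> i)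
                \<oplus>\<^bsub>End_Q g L\<^esub> c [^]\<^bsub>End_Q g L\<^esub> (2::nat) \<otimes>\<^bsub>End_Q g L\<^esub> (j \<otimes>\<^bsub>End_Q g L\<^esub> j)
                \<ominus>\<^bsub>End_Q g L\<^esub> d [^]\<^bsub>End_Q g L\<^esub> (2::nat)
                  \<otimes>\<^bsub>End_Q g L\<^esub> (i \<otimes>\<^bsub>End_Q g L\<^esub> i) \<otimes>\<^bsub>End_Q g L\<^esub> (j \<otimes>\<^bsub>End_Q g L\<^esub> j) \<and>
          \<sigma> \<in> real_embeddings (End_Q g L\<lparr>carrier := F\<rparr>) \<and>
          s ^ 2 = complex_of_real (\<sigma> t)"
    for F i j a b c d and \<sigma> :: "complex mat \<Rightarrow> real" and t s
  proof -
    have Q: "totally_definite_quaternion_algebra ?K F i j" and co: "?coords F i j ?A a b c d"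
      and co': "a \<in> F" "b \<in> F" "c \<in> F" "d \<in> F"
        "?A = a \<oplus>\<^bsub>?K\<^esub> b \<otimes>\<^bsub>?K\<^esub> i \<oplus>\<^bsub>?K\<^esub> c \<otimes>\<^bsub>?K\<^esub> j \<oplus>\<^bsub>?K\<^esub> d \<otimes>\<^bsub>?K\<^esub> (i \<otimes>\<^bsub>?K\<^esub> j)"
      and s: "\<sigma> \<in> real_embeddings (?K\<lparr>carrier := F\<rparr>)" and st: "s ^ 2 = complex_of_real (\<sigma> t)"
      using H by auto
    have "ring ?K" "subfield F ?K"
      using Q by (auto simp: totally_definite_quaternion_algebra_def quaternion_algebra_def)
    then interpret K: ring ?K by simp
    have "F \<subseteq> carrier ?K" using subfieldE(3)[OF \<open>subfield F ?K\<close>] .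
    then have sq: "x [^]\<^bsub>?K\<^esub> (2::nat) = x \<otimes>\<^bsub>?K\<^esub> x" if "x \<in> F" for x
      using that by (auto simp: numeral_2_eq_2)
    have t: "t = ?t i j b c d" using H sq by simp
    note qe = quaternion_eigenvalue[OF Q co']
    have "(cmod (complex_of_real (\<sigma> a) + s))\<^sup>2 = (\<sigma> a)\<^sup>2 - \<sigma> t"
      by (rule cmod_add_sqrt_nonpos[OF st]) (use qe(2)[OF s] t in simp)
    moreover have "cmod w = 1 \<longleftrightarrow> (cmod w)\<^sup>2 = 1" for w
        by (metis norm_ge_zero one_power2 power2_eq_iff_nonneg zero_le_one)
    ultimately have "cmod (complex_of_real (\<sigma> a) + s) = 1 \<longleftrightarrow> a \<otimes>\<^bsub>?K\<^esub> a = ?t i j b c d \<oplus>\<^bsub>?K\<^esub> \<one>\<^bsub>?K\<^esub>"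
      using qe(3)[OF s] t by simp
    then show ?thesis using quat[OF Q co] by simp
  qed
  have "\<exists>u. ?concl u"
  proof -
    have "\<exists>u. ?concl u" if Q: "totally_definite_quaternion_algebra ?K F i j" for F i j
    proof -
      have "quaternion_algebra ?K F i j" using Q by (simp add: totally_definite_quaternion_algebra_def)
      from quaternion_coords[OF this AK] obtain a b c d where
        co: "a \<in> F" "b \<in> F" "c \<in> F" "d \<in> F"
        "?A = a \<oplus>\<^bsub>?K\<^esub> b \<otimes>\<^bsub>?K\<^esub> i \<oplus>\<^bsub>?K\<^esub> c \<otimes>\<^bsub>?K\<^esub> j \<oplus>\<^bsub>?K\<^esub> d \<otimes>\<^bsub>?K\<^esub> (i \<otimes>\<^bsub>?K\<^esub> j)" .
      have "?concl (a \<otimes>\<^bsub>?K\<^esub> a = ?t i j b c d \<oplus>\<^bsub>?K\<^esub> \<one>\<^bsub>?K\<^esub>)"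
        by (rule quat[OF Q]) (intro conjI co)
      then show ?thesis by (rule exI[where x = "a \<otimes>\<^bsub>?K\<^esub> a = ?t i j b c d \<oplus>\<^bsub>?K\<^esub> \<one>\<^bsub>?K\<^esub>"])
    qed
    moreover have "\<exists>u. ?concl u" if K: "CM_field ?K"
    proof -
      have nf: "number_field ?K" using K by (simp add: CM_field_def)
      \<comment> \<open>An embedding is needed to express the condition; an eigenvalue of
        \<open>?A\<close> supplies one.\<close>
      obtain z where "eigenvalue ?A z"
      proof -
        have Am: "?A \<in> carrier_mat g g" by (rule End_Q_mat[OF AK])
        have "(unit_vec g 0 :: complex vec) \<noteq> 0\<^sub>v g" using g by simp
        then obtain w c where "w \<in> carrier_vec g" "w \<noteq> 0\<^sub>v g" "?A *\<^sub>v w = c \<cdot>\<^sub>v w"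
          using invariant_set_eigenvector[OF Am subset_refl unit_vec_carrier, of 0] Am
          by (metis minus_carrier_vec mult_mat_vec_carrier smult_carrier_vec)
        then show thesis using that[of c] Am unfolding eigenvalue_def eigenvector_def by auto
      qed
      then obtain \<sigma> where "\<sigma> \<in> complex_embeddings ?K" by (rule field_eigenvalue_embedding[OF nf AK]) blast
      from cm[OF K this] show ?thesis by (rule exI[where x = "cmod (\<sigma> ?A) = 1"])
    qed
    moreover have "\<exists>u. ?concl u" if "totally_real_field ?K"
      using real[OF that] by (rule exI[where x = "f = \<one>\<^bsub>End_ring g L\<^esub> \<or> f = \<ominus>\<^bsub>End_ring g L\<^esub> \<one>\<^bsub>End_ring g L\<^esub>"])
    ultimately show ?thesis using K by (elim disjE exE)
  qed
  then obtain u where u: "?concl u" by (rule exE)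
  show "periodic_fun (fix_fun g L f) \<longrightarrow> (\<forall>z. analytic_eigenvalue g L f z \<longrightarrow> root_of_unity z)"
    by (rule conjunct1[OF conjunct2[OF u]])
  show "grows_exponentially (fix_fun g L f) \<longrightarrow> (\<forall>z. analytic_eigenvalue g L f z \<longrightarrow> cmod z \<noteq> 1)"
    by (rule conjunct2[OF conjunct2[OF u]])
qed

section \<open>Poincare reducibility\<close>

lemma herm_form_linear:
  assumes H: "H \<in> carrier_mat g g" and v: "v \<in> carrier_vec g" "v' \<in> carrier_vec g" and w: "w \<in> carrier_vec g" "w' \<in> carrier_vec g"
  shows "herm_form H (v + v') w = herm_form H v w + herm_form H v' w"
    and "herm_form H (c \<cdot>\<^sub>v v) w = c * herm_form H v w"
    and "herm_form H v (w + w') = herm_form H v w + herm_form H v w'"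
    and "herm_form H v (c \<cdot>\<^sub>v w) = cnj c * herm_form H v w"
proof -
  have Hv: "H *\<^sub>v v \<in> carrier_vec g" "H *\<^sub>v v' \<in> carrier_vec g" using H v by auto
  show "herm_form H (v + v') w = herm_form H v w + herm_form H v' w"
    unfolding herm_form_def mult_add_distrib_mat_vec[OF H v]
    using Hv w by (simp add: add_scalar_prod_distrib[of _ g])
  show "herm_form H (c \<cdot>\<^sub>v v) w = c * herm_form H v w"
    unfolding herm_form_def mult_mat_vec[OF H v(1)] using Hv w by simp
  show "herm_form H v (w + w') = herm_form H v w + herm_form H v w'"
    unfolding herm_form_def using Hv w
    by (simp add: conjugate_add_vec[of _ g] scalar_prod_add_distrib[of _ g])
  show "herm_form H v (c \<cdot>\<^sub>v w) = cnj c * herm_form H v w"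
    unfolding herm_form_def using Hv w by (simp add: conjugate_smult_vec)
qed

lemma index_mult_mat_vec_sum:
  fixes M :: "'a :: comm_semiring_1 mat"
  assumes M: "M \<in> carrier_mat r m" and x: "x \<in> carrier_vec m" and l: "l < r"
  shows "(M *\<^sub>v x) $ l = (\<Sum>k<m. M $$ (l, k) * x $ k)"
proof -
  have "(M *\<^sub>v x) $ l = row M l \<bullet> x" using M l by simp
  also have "\<dots> = (\<Sum>k<m. M $$ (l, k) * x $ k)"
    using M x l by (simp add: scalar_prod_def lessThan_atLeast0)
  finally show ?thesis .
qed

lemma herm_form_sum_left:
  assumes H: "H \<in> carrier_mat g g" and Q: "Q \<in> carrier_mat g m" and x: "x \<in> carrier_vec m" and w: "w \<in> carrier_vec g"
  shows "herm_form H (Q *\<^sub>v x) w = (\<Sum>k<m. x $ k * herm_form H (col Q k) w)"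
proof -
  have HQ: "H * Q \<in> carrier_mat g m" using H Q by simp
  have expand: "herm_form H v w = (\<Sum>l<g. (H *\<^sub>v v) $ l * cnj (w $ l))" if "v \<in> carrier_vec g" for v
  proof -
    have "dim_vec (conjugate w) = g" using w by simp
    then show ?thesis unfolding herm_form_def scalar_prod_def
      using w by (simp add: lessThan_atLeast0)
  qed
  have Qx: "Q *\<^sub>v x \<in> carrier_vec g" using Q x by simp
  have "herm_form H (Q *\<^sub>v x) w = (\<Sum>l<g. ((H * Q) *\<^sub>v x) $ l * cnj (w $ l))"
    unfolding expand[OF Qx] using H Q x by (simp add: assoc_mult_mat_vec[of _ g g _ m])
  also have "\<dots> = (\<Sum>l<g. (\<Sum>k<m. (H * Q) $$ (l, k) * x $ k) * cnj (w $ l))"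
    by (intro sum.cong refl) (simp add: index_mult_mat_vec_sum[OF HQ x])
  also have "\<dots> = (\<Sum>l<g. \<Sum>k<m. x $ k * ((H *\<^sub>v col Q k) $ l * cnj (w $ l)))"
    using H Q by (intro sum.cong refl) (simp add: sum_distrib_left mult_ac)
  also have "\<dots> = (\<Sum>k<m. x $ k * (\<Sum>l<g. (H *\<^sub>v col Q k) $ l * cnj (w $ l)))"
    by (subst sum.swap) (simp add: sum_distrib_left)
  also have "\<dots> = (\<Sum>k<m. x $ k * herm_form H (col Q k) w)"
    using Q by (intro sum.cong refl) (simp add: expand)
  finally show ?thesis .
qed

lemma linear_map_matrix:
  fixes p :: "complex vec \<Rightarrow> complex vec"
  assumes car: "\<And>v. v \<in> carrier_vec g \<Longrightarrow> p v \<in> carrier_vec g"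
    and add: "\<And>v w. v \<in> carrier_vec g \<Longrightarrow> w \<in> carrier_vec g \<Longrightarrow> p (v + w) = p v + p w"
    and smult: "\<And>c v. v \<in> carrier_vec g \<Longrightarrow> p (c \<cdot>\<^sub>v v) = c \<cdot>\<^sub>v p v"
  obtains A where "A \<in> carrier_mat g g" "\<And>v. v \<in> carrier_vec g \<Longrightarrow> A *\<^sub>v v = p v"
proof
  define A where "A = mat g g (\<lambda>(i, j). p (unit_vec g j) $ i)"
  show A: "A \<in> carrier_mat g g" by (simp add: A_def)
  fix v :: "complex vec" assume v: "v \<in> carrier_vec g"
  \<comment> \<open>Truncations of \<open>v\<close>, so that linearity is applied to one unit vector
    at a time.\<close>
  define t where "t k = vec g (\<lambda>i. if i < k then v $ i else 0)" for k
  have tc: "t k \<in> carrier_vec g" for k by (simp add: t_def)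
  have "A *\<^sub>v t k = p (t k)" if "k \<le> g" for k
    using that
  proof (induction k)
    case 0
    have z: "t 0 = 0 \<cdot>\<^sub>v t 0" by (intro eq_vecI) (auto simp: t_def)
    have "p (t 0) = 0 \<cdot>\<^sub>v p (t 0)" by (subst z) (rule smult[OF tc])
    moreover have "A *\<^sub>v t 0 = 0 \<cdot>\<^sub>v (A *\<^sub>v t 0)" by (subst z) (rule mult_mat_vec[OF A tc])
    moreover have "0 \<cdot>\<^sub>v w = 0\<^sub>v g" if "w \<in> carrier_vec g" for w :: "complex vec"
      using that by (intro eq_vecI) auto
    ultimately show ?case using car[OF tc] A tc by (metis mult_mat_vec_carrier)
  next
    case (Suc k)
    have s: "t (Suc k) = t k + v $ k \<cdot>\<^sub>v unit_vec g k"
      using Suc.prems by (intro eq_vecI) (auto simp: t_def unit_vec_def less_Suc_eq)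
    have "A *\<^sub>v unit_vec g k = p (unit_vec g k)"
    proof (rule eq_vecI)
      fix i assume "i < dim_vec (p (unit_vec g k))"
      then have "i < g" using car[of "unit_vec g k"] by auto
      then show "(A *\<^sub>v unit_vec g k) $ i = p (unit_vec g k) $ i" using Suc.prems A by (simp add: A_def)
    qed (use car[of "unit_vec g k"] A in auto)
    then have "A *\<^sub>v t (Suc k) = p (t k) + v $ k \<cdot>\<^sub>v p (unit_vec g k)"
      unfolding s using A tc Suc by (simp add: mult_add_distrib_mat_vec[of _ g g] mult_mat_vec[of _ g g])
    then show ?case unfolding s using tc by (simp add: add smult)
  qed
  moreover have "t g = v" using v by (intro eq_vecI) (auto simp: t_def)
  ultimately show "A *\<^sub>v v = p v" by (metis order_refl)
qed

text \<open>
  A polarization induces on every complex subtorus \<open>W\<close> a nondegenerate form with an integral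
  Gram matrix.  Hence the orthogonal projection onto \<open>W\<close> is rational, and by uniqueness it is
  complex linear.
\<close>

lemma (in full_lattice) orthogonal_projection:
  assumes pol: "polarization g L H" and W: "subspace class_ring W (module_vec TYPE(complex) g)"
    and WL: "lattice_in g W (W \<inter> L)"
  obtains A where "A \<in> carrier (End_Q g L)" "\<And>v. v \<in> carrier_vec g \<Longrightarrow> A *\<^sub>v v \<in> W"
    "\<And>w. w \<in> W \<Longrightarrow> A *\<^sub>v w = w"
proof -
  interpret W: submodule class_ring W "module_vec TYPE(complex) g"
    using W by (simp add: subspace_def)
  have Wc: "w \<in> carrier_vec g" if "w \<in> W" for w using W.subset that by (auto simp: module_vec_simps)
  have Wadd: "v + w \<in> W" if "v \<in> W" "w \<in> W" for v w
    using W.m_closed[of v w] that by (simp add: module_vec_simps)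
  have Wsm: "c \<cdot>\<^sub>v v \<in> W" if "v \<in> W" for c v
    using W.smult_closed[of c v] that by (simp add: module_vec_simps)
  have Wdiff: "v - w \<in> W" if "v \<in> W" "w \<in> W" for v w
  proof -
    have "v - w = v + (-1) \<cdot>\<^sub>v w" using Wc that by (intro eq_vecI) auto
    then show ?thesis using Wadd Wsm that by simp
  qed
  obtain m Q where Q: "Q \<in> carrier_mat g m"
    and Qinj: "\<And>x. x \<in> carrier_vec m \<Longrightarrow> Q *\<^sub>v map_vec complex_of_real x = 0\<^sub>v g \<Longrightarrow> x = 0\<^sub>v m"
    and QW: "W = (\<lambda>x. Q *\<^sub>v map_vec complex_of_real x) ` carrier_vec m"
    and QL: "W \<inter> L = (\<lambda>x. Q *\<^sub>v map_vec complex_of_int x) ` carrier_vec m"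
    using WL unfolding lattice_in_def by (elim exE bexE conjE) blast
  have H: "H \<in> carrier_mat g g"
    and Hsym: "\<And>v w. v \<in> carrier_vec g \<Longrightarrow> w \<in> carrier_vec g \<Longrightarrow> herm_form H w v = cnj (herm_form H v w)"
    and Hpos: "\<And>v. v \<in> carrier_vec g \<Longrightarrow> v \<noteq> 0\<^sub>v g \<Longrightarrow> Re (herm_form H v v) > 0"
    and Hint: "\<And>v w. v \<in> L \<Longrightarrow> w \<in> L \<Longrightarrow> Im (herm_form H v w) \<in> \<int>"
    using pol unfolding polarization_def by blast+
  note lin = herm_form_linear[OF H]
  let ?E = "\<lambda>v w. Im (herm_form H v w)"
  define q where "q k = col Q k" for k
  have qc: "q k \<in> carrier_vec g" if "k < m" for k using Q that by (simp add: q_def)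
  have qWL: "q k \<in> W \<inter> L" if "k < m" for k
  proof -
    have "Q *\<^sub>v map_vec complex_of_int (unit_vec m k) = q k"
    proof -
      have "map_vec complex_of_int (unit_vec m k) = unit_vec m k" by (intro eq_vecI) (auto simp: unit_vec_def)
      then show ?thesis using Q that by (intro eq_vecI) (auto simp: q_def)
    qed
    then show ?thesis unfolding QL by (metis imageI unit_vec_carrier)
  qed
  have Esum: "?E (Q *\<^sub>v map_vec complex_of_real x) w = (\<Sum>k<m. x $ k * ?E (q k) w)"
    if "x \<in> carrier_vec m" "w \<in> carrier_vec g" for x w
    using herm_form_sum_left[OF H Q, of "map_vec complex_of_real x" w] that by (simp add: q_def)
  have Eanti: "?E w v = - ?E v w" if "v \<in> carrier_vec g" "w \<in> carrier_vec g" for v w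
    using Hsym[OF that] by simp
  have Wrep: "\<exists>x\<in>carrier_vec m. w = Q *\<^sub>v map_vec complex_of_real x" if "w \<in> W" for w
    using that unfolding QW by blast
  have Ezero: "?E y w = 0" if y: "y \<in> carrier_vec g" "\<And>k. k < m \<Longrightarrow> ?E y (q k) = 0" and w: "w \<in> W" for y w
  proof -
    obtain x where x: "x \<in> carrier_vec m" "w = Q *\<^sub>v map_vec complex_of_real x" using Wrep[OF w] by blast
    have "?E w y = (\<Sum>k<m. x $ k * ?E (q k) y)" unfolding x(2) by (rule Esum[OF x(1) y(1)])
    also have "\<dots> = 0"
    proof (intro sum.neutral ballI)
      fix k assume "k \<in> {..<m}"
      then show "x $ k * ?E (q k) y = 0" using Eanti[OF y(1) qc[of k]] y(2)[of k] by simp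
    qed
    finally show ?thesis using Eanti[OF y(1) Wc[OF w]] by linarith
  qed
  \<comment> \<open>\<open>W\<close> is a complex subspace: pairing with \<open>\<i> w\<close>
    recovers the real part, so orthogonality for the imaginary part is orthogonality for the
    Hermitian form.\<close>
  have Hzero: "herm_form H y w = 0" if y: "y \<in> carrier_vec g" "\<And>k. k < m \<Longrightarrow> ?E y (q k) = 0" and w: "w \<in> W" for y w
  proof -
    have "?E y w = 0" by (rule Ezero[OF y w])
    moreover have "?E y (\<i> \<cdot>\<^sub>v w) = 0" by (rule Ezero[OF y Wsm[OF w]])
    then have "Re (herm_form H y w) = 0" using lin(4)[OF y(1) y(1) Wc[OF w] Wc[OF w], of \<i>] by simp
    ultimately show ?thesis by (simp add: complex_eq_iff)
  qed
  have nondeg: "u = 0\<^sub>v g" if u: "u \<in> W" "\<And>k. k < m \<Longrightarrow> ?E u (q k) = 0" for u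
  proof (rule ccontr)
    assume "u \<noteq> 0\<^sub>v g"
    then have "Re (herm_form H u u) > 0" using Hpos Wc u(1) by blast
    then show False using Hzero[OF Wc[OF u(1)] u(2) u(1)] by simp
  qed
  \<comment> \<open>The floor is exact, since the imaginary part of the form is integral on lattice
    vectors.\<close>
  define G where "G = mat m m (\<lambda>(k, l). \<lfloor>?E (q l) (q k)\<rfloor>)"
  have Gc: "G \<in> carrier_mat m m" by (simp add: G_def)
  have Gval: "real_of_int (G $$ (k, l)) = ?E (q l) (q k)" if "k < m" "l < m" for k l
    using Hint[of "q l" "q k"] qWL that by (auto simp: G_def elim: Ints_cases)
  let ?G = "map_mat real_of_int G"
  have GE: "(?G *\<^sub>v x) $ k = ?E (Q *\<^sub>v map_vec complex_of_real x) (q k)" if "x \<in> carrier_vec m" "k < m" for x k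
  proof -
    have "(?G *\<^sub>v x) $ k = (\<Sum>l<m. ?G $$ (k, l) * x $ l)" using Gc that by (intro index_mult_mat_vec_sum) auto
    then show ?thesis unfolding Esum[OF that(1) qc[OF that(2)]] using Gc that Gval by (auto intro!: sum.cong simp: mult.commute)
  qed
  have dG: "det G \<noteq> 0"
  proof
    assume "det G = 0"
    then have "det ?G = 0" by simp
    then obtain x where x: "x \<in> carrier_vec m" "x \<noteq> 0\<^sub>v m" "?G *\<^sub>v x = 0\<^sub>v m"
      using det_0_iff_vec_prod_zero[of ?G m] Gc by auto
    let ?u = "Q *\<^sub>v map_vec complex_of_real x"
    have "?u = 0\<^sub>v g"
    proof (rule nondeg)
      show "?u \<in> W" unfolding QW using x by blast
      show "?E ?u (q k) = 0" if "k < m" for k using GE[OF x(1) that] x(3) that by simp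
    qed
    then show False using Qinj[OF x(1)] x(2) by simp
  qed
  let ?d = "det G"
  note adj = adj_mat[OF Gc]
  define e where "e z = vec m (\<lambda>k. ?E z (q k))" for z
  \<comment> \<open>Cramer's rule: the coordinates in \<open>W\<close> that reproduce the pairings
    \<open>e z\<close>, with denominator \<open>det G\<close>.\<close>
  define co where "co z = (1 / real_of_int ?d) \<cdot>\<^sub>v (map_mat real_of_int (adj_mat G) *\<^sub>v e z)" for z
  define p where "p z = Q *\<^sub>v map_vec complex_of_real (co z)" for z
  have ec: "e z \<in> carrier_vec m" for z by (simp add: e_def)
  have coc: "co z \<in> carrier_vec m" for z using adj(1) ec by (simp add: co_def)
  have pW: "p z \<in> W" for z unfolding QW p_def using coc by blast
  have Gco: "?G *\<^sub>v co z = e z" for z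
  proof -
    have "?G * map_mat real_of_int (adj_mat G) = map_mat real_of_int (G * adj_mat G)"
      by (rule of_int_hom.mat_hom_mult[OF Gc adj(1), symmetric])
    also have "\<dots> = real_of_int ?d \<cdot>\<^sub>m 1\<^sub>m m" unfolding adj(2) by (intro eq_matI) auto
    finally have GA: "?G * map_mat real_of_int (adj_mat G) = real_of_int ?d \<cdot>\<^sub>m 1\<^sub>m m" .
    have "?G *\<^sub>v co z = (1 / real_of_int ?d) \<cdot>\<^sub>v (?G *\<^sub>v (map_mat real_of_int (adj_mat G) *\<^sub>v e z))"
      unfolding co_def using Gc adj(1) ec by (intro mult_mat_vec) auto
    also have "?G *\<^sub>v (map_mat real_of_int (adj_mat G) *\<^sub>v e z) = (?G * map_mat real_of_int (adj_mat G)) *\<^sub>v e z"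
      using Gc adj(1) ec by (intro assoc_mult_mat_vec[symmetric]) auto
    also have "\<dots> = real_of_int ?d \<cdot>\<^sub>v e z" unfolding GA using ec[of z] by (intro eq_vecI) auto
    finally show ?thesis using dG by (simp add: smult_smult_assoc)
  qed
  have pE: "?E (p z) (q k) = ?E z (q k)" if "k < m" for z k
    using GE[OF coc that, of z] Gco[of z] that by (simp add: p_def e_def)
  \<comment> \<open>\<open>p z\<close> is the only vector of \<open>W\<close> with the pairings of
    \<open>z\<close>; both linearity properties of \<open>p\<close> follow by comparing
    pairings.\<close>
  have uniq: "u = p z" if z: "z \<in> carrier_vec g" and u: "u \<in> W" "\<And>k. k < m \<Longrightarrow> ?E u (q k) = ?E z (q k)" for u z
  proof -
    have "u - p z = 0\<^sub>v g"
    proof (rule nondeg)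
      show "u - p z \<in> W" by (rule Wdiff[OF u(1) pW])
      fix k assume k: "k < m"
      have "u = (u - p z) + p z" using Wc[OF u(1)] Wc[OF pW[of z]] by (intro eq_vecI) auto
      then have "herm_form H u (q k) = herm_form H (u - p z) (q k) + herm_form H (p z) (q k)"
        using lin(1)[of "u - p z" "p z" "q k" "q k"] Wc u(1) pW qc[OF k] Wdiff by metis
      then show "?E (u - p z) (q k) = 0" using u(2)[OF k] pE[OF k, of z] by simp
    qed
    then have "(u - p z) $ i = 0" if "i < g" for i using that by simp
    then show ?thesis using Wc[OF u(1)] Wc[OF pW[of z]] by (intro eq_vecI) auto
  qed
  obtain A where A: "A \<in> carrier_mat g g" "\<And>v. v \<in> carrier_vec g \<Longrightarrow> A *\<^sub>v v = p v"
  proof (rule linear_map_matrix)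
    fix v :: "complex vec" assume v: "v \<in> carrier_vec g"
    show pc: "p v \<in> carrier_vec g" by (rule Wc[OF pW])
    fix w :: "complex vec" assume w: "w \<in> carrier_vec g"
    show "p (v + w) = p v + p w"
    proof (rule uniq[symmetric])
      show "p v + p w \<in> W" by (rule Wadd[OF pW pW])
      show "?E (p v + p w) (q k) = ?E (v + w) (q k)" if k: "k < m" for k
        using lin(1)[OF pc Wc[OF pW[of w]] qc[OF k] qc[OF k]] lin(1)[OF v w qc[OF k] qc[OF k]] pE[OF k] by simp
    qed (use v w in simp)
  next
    fix c and v :: "complex vec" assume v: "v \<in> carrier_vec g"
    have pc: "p v \<in> carrier_vec g" by (rule Wc[OF pW])
    show "p (c \<cdot>\<^sub>v v) = c \<cdot>\<^sub>v p v"
    proof (rule uniq[symmetric])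
      show "c \<cdot>\<^sub>v p v \<in> W" by (rule Wsm[OF pW])
      fix k assume k: "k < m"
      let ?y = "v - p v"
      have y: "?y \<in> carrier_vec g" using v pc by simp
      have vy: "v = ?y + p v" using v pc by (intro eq_vecI) auto
      have split: "herm_form H v (q l) = herm_form H ?y (q l) + herm_form H (p v) (q l)" if "l < m" for l
        using lin(1)[OF y pc qc[OF that] qc[OF that]] vy by simp
      \<comment> \<open>\<open>v - p v\<close> is orthogonal to \<open>W\<close> for the full
        Hermitian form, and this survives multiplication by the complex number
        \<open>c\<close>.\<close>
      have "herm_form H ?y (q k) = 0"
      proof (rule Hzero[OF y])
        fix l assume l: "l < m"
        have "?E v (q l) = ?E ?y (q l) + ?E (p v) (q l)"
          using arg_cong[OF split[OF l], of Im] by (simp only: plus_complex.sel)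
        then show "?E ?y (q l) = 0" using pE[OF l, of v] by linarith
      qed (use qWL[OF k] in auto)
      then have "herm_form H v (q k) = herm_form H (p v) (q k)" using split[OF k] by simp
      then show "?E (c \<cdot>\<^sub>v p v) (q k) = ?E (c \<cdot>\<^sub>v v) (q k)"
        using lin(2)[OF pc pc qc[OF k] qc[OF k], of c] lin(2)[OF v v qc[OF k] qc[OF k], of c] by simp
    qed (use v in simp)
  qed blast
  have dL: "of_int ?d \<cdot>\<^sub>m A \<in> lattice_mats"
    unfolding lattice_mats_def
  proof (intro CollectI conjI ballI)
    fix z assume z: "z \<in> L"
    have zc: "z \<in> carrier_vec g" by (rule L_carrier[OF z])
    define f where "f = vec m (\<lambda>k. \<lfloor>?E z (q k)\<rfloor>)"
    have fc: "f \<in> carrier_vec m" by (simp add: f_def)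
    have ef: "e z = map_vec real_of_int f"
      using Hint[OF z] qWL by (intro eq_vecI) (auto simp: e_def f_def elim!: Ints_cases)
    have "map_vec complex_of_real (co z) = (1 / of_int ?d) \<cdot>\<^sub>v map_vec complex_of_int (adj_mat G *\<^sub>v f)"
    proof (rule eq_vecI)
      fix i assume "i < dim_vec ((1 / complex_of_int ?d) \<cdot>\<^sub>v map_vec complex_of_int (adj_mat G *\<^sub>v f))"
      then have i: "i < m" using adj(1) by simp
      have "map_mat real_of_int (adj_mat G) *\<^sub>v map_vec real_of_int f = map_vec real_of_int (adj_mat G *\<^sub>v f)"
        by (rule of_int_hom.mult_mat_vec_hom[OF adj(1) fc, symmetric])
      then have "(map_mat real_of_int (adj_mat G) *\<^sub>v e z) $ i = real_of_int ((adj_mat G *\<^sub>v f) $ i)"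
        unfolding ef using i adj(1) by simp
      then have "co z $ i = (1 / real_of_int ?d) * real_of_int ((adj_mat G *\<^sub>v f) $ i)"
        unfolding co_def using i adj(1) by (simp del: index_mult_mat_vec)
      then show "map_vec complex_of_real (co z) $ i
          = ((1 / complex_of_int ?d) \<cdot>\<^sub>v map_vec complex_of_int (adj_mat G *\<^sub>v f)) $ i"
        using i adj(1) carrier_vecD[OF coc[of z]] by (simp del: index_mult_mat_vec)
    qed (use coc[of z] adj(1) in auto)
    then have "p z = (1 / of_int ?d) \<cdot>\<^sub>v (Q *\<^sub>v map_vec complex_of_int (adj_mat G *\<^sub>v f))"
      unfolding p_def using Q adj(1) fc by (simp add: mult_mat_vec[of _ g m])
    then have "of_int ?d \<cdot>\<^sub>v p z = Q *\<^sub>v map_vec complex_of_int (adj_mat G *\<^sub>v f)"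
      using dG by (simp add: smult_smult_assoc)
    also have "\<dots> \<in> W \<inter> L" unfolding QL using adj(1) fc by (intro imageI) auto
    finally show "(of_int ?d \<cdot>\<^sub>m A) *\<^sub>v z \<in> L"
      using A zc by (simp add: smult_mult_mat_vec)
  qed (use A in auto)
  have "A \<in> carrier (End_Q g L)"
  proof -
    have "of_nat (nat \<bar>?d\<bar>) \<cdot>\<^sub>m A \<in> lattice_mats"
    proof -
      have "of_int (sgn ?d) \<cdot>\<^sub>m (of_int ?d \<cdot>\<^sub>m A) = of_int (sgn ?d * ?d) \<cdot>\<^sub>m A"
        by (intro eq_matI) (auto simp: mult.assoc)
      moreover have "sgn ?d * ?d = int (nat \<bar>?d\<bar>)" by (simp add: sgn_if)
      ultimately show ?thesis using smult_lattice_mats[OF dL, of "sgn ?d"] by (metis of_int_of_nat_eq)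
    qed
    then show ?thesis unfolding End_Q_carrier using A dG by (intro CollectI conjI exI[of _ "nat \<bar>?d\<bar>"]) auto
  qed
  moreover have "A *\<^sub>v w = w" if "w \<in> W" for w
    using A(2)[OF Wc[OF that]] uniq[OF Wc[OF that] that] by simp
  ultimately show thesis using that A(2) pW by metis
qed

text \<open>The orthogonal projection onto a subtorus is an idempotent of the endomorphism algebra;
  if it is 0 or 1, the subtorus is trivial or everything.\<close>

lemma (in full_lattice) simple_if_no_idempotents:
  assumes pol: "polarization g L H" and g: "g \<noteq> 0"
    and idem: "\<And>A. A \<in> carrier (End_Q g L) \<Longrightarrow> A * A = A \<Longrightarrow> A = 0\<^sub>m g g \<or> A = 1\<^sub>m g"
  shows "simple_abelian_variety g L"
  unfolding simple_abelian_variety_def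
proof (intro conjI allI impI g)
  have "lattice_in g (carrier_vec g) L"
    unfolding lattice_in_def by (intro exI[of _ n] bexI[of _ P] conjI ballI impI inj surj L_eq P) auto
  then show "abelian_variety g L" using pol by (auto simp: abelian_variety_def)
  fix Y assume "abelian_subvariety g L Y"
  then obtain W where W: "subspace class_ring W (module_vec TYPE(complex) g)" "lattice_in g W (W \<inter> L)"
    and Y: "Y = pt ` W" unfolding abelian_subvariety_def by blast
  have subm: "submodule class_ring W (module_vec TYPE(complex) g)" using W(1) by (simp add: subspace_def)
  have Wc: "w \<in> carrier_vec g" if "w \<in> W" for w
    using submodule.subset[OF subm] that by (auto simp: module_vec_simps)
  have zW: "0\<^sub>v g \<in> W" using submodule.zero_closed[OF subm] by (simp add: module_vec_simps)
  obtain A where A: "A \<in> carrier (End_Q g L)" "\<And>v. v \<in> carrier_vec g \<Longrightarrow> A *\<^sub>v v \<in> W"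
    "\<And>w. w \<in> W \<Longrightarrow> A *\<^sub>v w = w"
    by (rule orthogonal_projection[OF pol W]) blast
  have Am: "A \<in> carrier_mat g g" by (rule End_Q_mat[OF A(1)])
  have "A * A = A"
  proof (rule mat_eqI_mult_vec)
    fix v :: "complex vec" assume v: "v \<in> carrier_vec g"
    have "(A * A) *\<^sub>v v = A *\<^sub>v (A *\<^sub>v v)" using Am v by (intro assoc_mult_mat_vec) auto
    then show "(A * A) *\<^sub>v v = A *\<^sub>v v" using A v by simp
  qed (use Am in auto)
  then consider "A = 0\<^sub>m g g" | "A = 1\<^sub>m g" using idem[OF A(1)] by blast
  then show "Y = {\<one>\<^bsub>torus g L\<^esub>} \<or> Y = carrier (torus g L)"
  proof cases
    case 1
    have "w = 0\<^sub>v g" if "w \<in> W" for w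
    proof -
      have "w = 0\<^sub>m g g *\<^sub>v w" using A(3)[OF that] 1 by simp
      also have "\<dots> = 0\<^sub>v g" using Wc[OF that] by auto
      finally show ?thesis .
    qed
    then have "W = {0\<^sub>v g}" using zW by blast
    then show ?thesis using Y by (simp add: one_torus)
  next
    case 2
    have "v \<in> W" if "v \<in> carrier_vec g" for v using A(2)[OF that] that 2 by simp
    then have "W = carrier_vec g" using Wc by blast
    then show ?thesis using Y by (simp add: carrier_torus)
  qed
qed

section \<open>The quadratic field of the example\<close>

text \<open>
  Elements of \<open>\<rat>(\<surd>2)\<close> are represented by the pair of their two real conjugates.  The
  coefficient set \<open>R\<close> is \<open>\<rat>\<close> for the field and \<open>\<int>\<close> for its ring of integers.
\<close>

definition quad :: "real set \<Rightarrow> (real \<times> real) set" where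
  "quad R = {(p + q * sqrt 2, p - q * sqrt 2) | p q. p \<in> R \<and> q \<in> R}"

text \<open>Conjugate pairs from \<rat>(\<surd>2, i), or from \<int>[\<surd>2, i], for the
  automorphism that changes the sign of \<surd>2 and fixes i.\<close>

definition gauss :: "real set \<Rightarrow> (complex \<times> complex) set" where
  "gauss R = {(z, w). (Re z, Re w) \<in> quad R \<and> (Im z, Im w) \<in> quad R}"

lemma quadI: "p \<in> R \<Longrightarrow> q \<in> R \<Longrightarrow> (p + q * sqrt 2, p - q * sqrt 2) \<in> quad R"
  by (auto simp: quad_def)

lemma quad_memI:
  assumes "p \<in> R" "q \<in> R" "x = p + q * sqrt 2" "y = p - q * sqrt 2"
  shows "(x, y) \<in> quad R"
  using assms by (auto simp: quad_def)

lemma quadE: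
  assumes "(x, y) \<in> quad R"
  obtains p q where "p \<in> R" "q \<in> R" "x = p + q * sqrt 2" "y = p - q * sqrt 2"
  using assms by (auto simp: quad_def)

lemma quad_closed:
  assumes R: "R = \<int> \<or> R = \<rat>" and x: "(x, x') \<in> quad R" and y: "(y, y') \<in> quad R"
  shows "(x + y, x' + y') \<in> quad R" "(x - y, x' - y') \<in> quad R" "(- x, - x') \<in> quad R"
    "(x * y, x' * y') \<in> quad R"
proof -
  obtain p q where p: "p \<in> R" "q \<in> R" "x = p + q * sqrt 2" "x' = p - q * sqrt 2" using x by (rule quadE)
  obtain a b where a: "a \<in> R" "b \<in> R" "y = a + b * sqrt 2" "y' = a - b * sqrt 2" using y by (rule quadE)
  have cl: "u + v \<in> R" "u - v \<in> R" "u * v \<in> R" "- u \<in> R" "2 * u \<in> R" if "u \<in> R" "v \<in> R" for u v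
    using R that by auto
  show "(x + y, x' + y') \<in> quad R"
    by (rule quad_memI[of "p + a" R "q + b"]) (use p a cl in \<open>auto simp: algebra_simps\<close>)
  show "(x - y, x' - y') \<in> quad R"
    by (rule quad_memI[of "p - a" R "q - b"]) (use p a cl in \<open>auto simp: algebra_simps\<close>)
  show "(- x, - x') \<in> quad R"
    by (rule quad_memI[of "- p" R "- q"]) (use p a cl in \<open>auto simp: algebra_simps\<close>)
  show "(x * y, x' * y') \<in> quad R"
    by (rule quad_memI[of "p * a + 2 * (q * b)" R "p * b + q * a"])
      (use p a cl in \<open>auto simp: algebra_simps\<close>)
qed

lemma quad_const: "r \<in> R \<Longrightarrow> 0 \<in> R \<Longrightarrow> (r, r) \<in> quad R"
  using quadI[of r R 0] by simp

lemma quad_sqrt2: "0 \<in> R \<Longrightarrow> 1 \<in> R \<Longrightarrow> (sqrt 2, - sqrt 2) \<in> quad R"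
  using quadI[of 0 R 1] by simp

text \<open>Irrationality of \<surd>2 by infinite descent: both numbers are even, and halving them
  gives a smaller solution.\<close>

lemma int_sq_eq_two_sq:
  fixes a b :: int
  assumes "a\<^sup>2 = 2 * b\<^sup>2" shows "a = 0 \<and> b = 0"
  using assms
proof (induction "nat \<bar>a\<bar>" arbitrary: a b rule: less_induct)
  case less
  have "even (a\<^sup>2)" using less.prems by simp
  then obtain c where c: "a = 2 * c" by auto
  then have e: "b\<^sup>2 = 2 * c\<^sup>2" using less.prems by (simp add: power2_eq_square)
  show ?case
  proof (cases "a = 0")
    case False
    have "even (b\<^sup>2)" using e by simp
    then obtain d where d: "b = 2 * d" by auto
    then have eq: "c\<^sup>2 = 2 * d\<^sup>2" using e by (simp add: power2_eq_square)
    have "c \<noteq> 0" using c False by simp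
    then have "nat \<bar>c\<bar> < nat \<bar>a\<bar>" unfolding c abs_mult by linarith
    from less.hyps[OF this eq] show ?thesis unfolding c d by simp
  qed (use less.prems in simp)
qed

lemma rational_clear_denominator:
  assumes "(r::real) \<in> \<rat>" obtains k :: nat where "k > 0" "of_nat k * r \<in> \<int>"
proof -
  obtain a b :: int where ab: "r = of_int a / of_int b" "b > 0" using assms by (rule Rats_cases') auto
  have "of_nat (nat b) * r = of_int a" using ab by simp
  then show thesis using that[of "nat b"] ab(2) by (metis Ints_of_int zero_less_nat_eq)
qed

lemma rational_combination_zero:
  assumes "p \<in> \<rat>" "q \<in> \<rat>" "p + q * sqrt 2 = 0" shows "p = 0 \<and> q = 0"
proof -
  obtain k where k: "k > 0" "of_nat k * p \<in> \<int>" by (rule rational_clear_denominator[OF assms(1)]) blast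
  obtain l where l: "l > 0" "of_nat l * q \<in> \<int>" by (rule rational_clear_denominator[OF assms(2)]) blast
  obtain a where a: "of_nat k * p = of_int a" using k(2) by (auto elim: Ints_cases)
  obtain b where b: "of_nat l * q = of_int b" using l(2) by (auto elim: Ints_cases)
  have sq: "p\<^sup>2 = 2 * q\<^sup>2"
  proof -
    have "p = - q * sqrt 2" using assms(3) by simp
    then show ?thesis by (simp add: power_mult_distrib)
  qed
  have "real_of_int ((int l * a)\<^sup>2) = real_of_int (2 * (int k * b)\<^sup>2)"
  proof -
    have "real_of_int ((int l * a)\<^sup>2) = (of_nat l)\<^sup>2 * (of_nat k)\<^sup>2 * p\<^sup>2"
      by (simp add: power_mult_distrib flip: a)
    also have "\<dots> = real_of_int (2 * (int k * b)\<^sup>2)"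
      unfolding sq by (simp add: power_mult_distrib flip: b)
    finally show ?thesis .
  qed
  then have "(int l * a)\<^sup>2 = 2 * (int k * b)\<^sup>2" by (simp only: of_int_eq_iff)
  then have "int l * a = 0 \<and> int k * b = 0" by (rule int_sq_eq_two_sq)
  then have "a = 0" "b = 0" using k(1) l(1) by auto
  then show ?thesis using a b k(1) l(1) by auto
qed

lemma quad_zero_iff:
  assumes "(x, y) \<in> quad \<rat>" shows "x = 0 \<longleftrightarrow> y = 0"
proof -
  obtain p q where p: "p \<in> \<rat>" "q \<in> \<rat>" "x = p + q * sqrt 2" "y = p - q * sqrt 2" using assms by (rule quadE)
  have "p = 0 \<and> q = 0" if "x = 0" using rational_combination_zero[of p q] p that by simp
  moreover have "p = 0 \<and> - q = 0" if "y = 0" using rational_combination_zero[of p "- q"] p that by simp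
  ultimately show ?thesis using p by auto
qed

lemma quad_inverse:
  assumes xy: "(x, y) \<in> quad \<rat>" and x: "x \<noteq> 0"
  shows "(1 / x, 1 / y) \<in> quad \<rat>"
proof -
  obtain p q where p: "p \<in> \<rat>" "q \<in> \<rat>" "x = p + q * sqrt 2" "y = p - q * sqrt 2" using xy by (rule quadE)
  have y: "y \<noteq> 0" using quad_zero_iff[OF xy] x by simp
  have n: "x * y = p\<^sup>2 - 2 * q\<^sup>2" unfolding p(3,4) by (simp add: power2_eq_square algebra_simps)
  have c: "x * y \<noteq> 0" using x y by simp
  have "(p / (x * y)) + (- q / (x * y)) * sqrt 2 = 1 / x" "(p / (x * y)) - (- q / (x * y)) * sqrt 2 = 1 / y"
  proof -
    have "(p / (x * y)) + (- q / (x * y)) * sqrt 2 = y / (x * y)" by (simp add: p(4) diff_divide_distrib)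
    then show "(p / (x * y)) + (- q / (x * y)) * sqrt 2 = 1 / x" using c by simp
    have "(p / (x * y)) - (- q / (x * y)) * sqrt 2 = x / (x * y)" by (simp add: p(3) add_divide_distrib)
    then show "(p / (x * y)) - (- q / (x * y)) * sqrt 2 = 1 / y" using c by simp
  qed
  moreover have "p / (x * y) \<in> \<rat>" "- q / (x * y) \<in> \<rat>" unfolding n using p by auto
  ultimately show ?thesis using quadI[of "p / (x * y)" \<rat> "- q / (x * y)"] by simp
qed

lemma quad_clear_denominator:
  assumes "(x, y) \<in> quad \<rat>" obtains k :: nat where "k > 0" "(of_nat k * x, of_nat k * y) \<in> quad \<int>"
proof -
  obtain p q where p: "p \<in> \<rat>" "q \<in> \<rat>" "x = p + q * sqrt 2" "y = p - q * sqrt 2" using assms by (rule quadE)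
  obtain k where k: "k > 0" "of_nat k * p \<in> \<int>" by (rule rational_clear_denominator[OF p(1)]) blast
  obtain l where l: "l > 0" "of_nat l * q \<in> \<int>" by (rule rational_clear_denominator[OF p(2)]) blast
  have "of_nat (k * l) * p \<in> \<int>" "of_nat (k * l) * q \<in> \<int>"
    using Ints_mult[OF Ints_of_nat[of l] k(2)] Ints_mult[OF Ints_of_nat[of k] l(2)] by (auto simp: mult_ac)
  from quadI[OF this] have "(of_nat (k * l) * x, of_nat (k * l) * y) \<in> quad \<int>"
    unfolding p(3,4) by (simp add: algebra_simps)
  then show thesis using that[of "k * l"] k l by simp
qed

lemma quad_int_subset: "quad \<int> \<subseteq> quad \<rat>"
  using Ints_subset_Rats by (auto simp: quad_def)

lemma gauss_closed:
  assumes R: "R = \<int> \<or> R = \<rat>" and x: "(x, x') \<in> gauss R" and y: "(y, y') \<in> gauss R"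
  shows "(x + y, x' + y') \<in> gauss R" "(x - y, x' - y') \<in> gauss R" "(- x, - x') \<in> gauss R"
    "(x * y, x' * y') \<in> gauss R" "(cnj x, cnj x') \<in> gauss R"
  using assms by (auto simp: gauss_def intro!: quad_closed)

lemma gauss_of_real: "R = \<int> \<or> R = \<rat> \<Longrightarrow> (x, y) \<in> quad R \<Longrightarrow> (complex_of_real x, complex_of_real y) \<in> gauss R"
  using quad_const[of 0 R] by (auto simp: gauss_def)

lemma gauss_const: "R = \<int> \<or> R = \<rat> \<Longrightarrow> (0, 0) \<in> gauss R \<and> (1, 1) \<in> gauss R \<and> (\<i>, \<i>) \<in> gauss R"
  using quad_const[of 0 R] quad_const[of 1 R] by (auto simp: gauss_def)

lemma gauss_clear_denominator:
  assumes "(z, w) \<in> gauss \<rat>" obtains k :: nat where "k > 0" "(of_nat k * z, of_nat k * w) \<in> gauss \<int>"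
proof -
  have zw: "(Re z, Re w) \<in> quad \<rat>" "(Im z, Im w) \<in> quad \<rat>" using assms by (auto simp: gauss_def)
  obtain k where k: "k > 0" "(of_nat k * Re z, of_nat k * Re w) \<in> quad \<int>" by (rule quad_clear_denominator[OF zw(1)]) blast
  obtain l where l: "l > 0" "(of_nat l * Im z, of_nat l * Im w) \<in> quad \<int>" by (rule quad_clear_denominator[OF zw(2)]) blast
  have c: "(of_nat m, of_nat m) \<in> quad \<int>" for m by (rule quad_const) auto
  have "(of_nat (k * l) * z, of_nat (k * l) * w) \<in> gauss \<int>"
    using quad_closed(4)[OF _ c[of l] k(2)] quad_closed(4)[OF _ c[of k] l(2)]
    by (auto simp: gauss_def mult_ac)
  then show thesis using that[of "k * l"] k l by simp
qed

lemma gauss_int_subset: "gauss \<int> \<subseteq> gauss \<rat>"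
  using quad_int_subset by (auto simp: gauss_def)

lemma gauss_int_scale: "(z, w) \<in> gauss \<int> \<Longrightarrow> (of_nat k * z, of_nat k * w) \<in> gauss \<int>"
  using gauss_closed(4)[of \<int> "of_nat k" "of_nat k" z w] gauss_of_real[of \<int> "of_nat k" "of_nat k"]
    quad_const[of "of_nat k" \<int>] by simp

lemma gauss_zero_iff: "(z, w) \<in> gauss \<rat> \<Longrightarrow> z = 0 \<longleftrightarrow> w = 0"
  using quad_zero_iff by (auto simp: gauss_def complex_eq_iff)

text \<open>
  The prime \<open>3 + \<surd>2\<close> has residue field \<open>\<int>/7\<close>, in which \<open>\<surd>2\<close> becomes \<open>-3\<close> and \<open>-1\<close> is not a
  square.  So \<open>3 + \<surd>2\<close> divides \<open>x\<close> and \<open>y\<close> whenever it divides \<open>x\<^sup>2 + y\<^sup>2\<close>, and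
  \<open>x\<^sup>2 + y\<^sup>2 = (3 + \<surd>2)(z\<^sup>2 + w\<^sup>2)\<close> descends to the same equation for \<open>(z, w; x', y')\<close> with
  \<open>x = (3 + \<surd>2) x'\<close> and \<open>y = (3 + \<surd>2) y'\<close>.
\<close>

lemma sum_squares_mod_7:
  fixes a b :: int
  assumes "7 dvd a\<^sup>2 + b\<^sup>2" shows "7 dvd a"
proof -
  have sq: "x\<^sup>2 mod 7 = (x mod 7)\<^sup>2 mod 7" for x :: int by (simp add: power_mod)
  have r: "x mod 7 \<in> {0, 1, 2, 3, 4, 5, 6}" for x :: int
    using pos_mod_bound[of 7 x] pos_mod_sign[of 7 x] by (simp add: insert_iff) presburger
  then have c: "x\<^sup>2 mod 7 \<in> {0, 1, 2, 4} \<and> (x\<^sup>2 mod 7 = 0 \<longrightarrow> x mod 7 = 0)" for x :: int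
    unfolding sq[of x] using r[of x] by (elim insertE emptyE) simp_all
  have "(a\<^sup>2 mod 7 + b\<^sup>2 mod 7) mod 7 = 0" using assms by (simp add: mod_add_eq dvd_eq_mod_eq_0)
  then have "a\<^sup>2 mod 7 = 0" using c[of a] c[of b] by auto
  then show ?thesis using c[of a] by (simp add: dvd_eq_mod_eq_0)
qed

lemma anisotropic_int:
  fixes x0 x1 y0 y1 z0 z1 w0 w1 :: int
  assumes "x0\<^sup>2 + 2 * x1\<^sup>2 + y0\<^sup>2 + 2 * y1\<^sup>2
      = 3 * (z0\<^sup>2 + 2 * z1\<^sup>2 + w0\<^sup>2 + 2 * w1\<^sup>2) + 2 * (2 * z0 * z1 + 2 * w0 * w1)"
    and "2 * x0 * x1 + 2 * y0 * y1
      = (z0\<^sup>2 + 2 * z1\<^sup>2 + w0\<^sup>2 + 2 * w1\<^sup>2) + 3 * (2 * z0 * z1 + 2 * w0 * w1)"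
  shows "x0 = 0 \<and> x1 = 0 \<and> y0 = 0 \<and> y1 = 0 \<and> z0 = 0 \<and> z1 = 0 \<and> w0 = 0 \<and> w1 = 0"
  using assms
proof (induction "nat (\<bar>x0\<^sup>2 - 2 * x1\<^sup>2\<bar> + \<bar>y0\<^sup>2 - 2 * y1\<^sup>2\<bar> + \<bar>z0\<^sup>2 - 2 * z1\<^sup>2\<bar> + \<bar>w0\<^sup>2 - 2 * w1\<^sup>2\<bar>)"
    arbitrary: x0 x1 y0 y1 z0 z1 w0 w1 rule: less_induct)
  case less
  define m where "m = z0\<^sup>2 + 2 * z1\<^sup>2 + w0\<^sup>2 + 2 * w1\<^sup>2"
  define k where "k = 2 * z0 * z1 + 2 * w0 * w1"
  have e1: "x0\<^sup>2 + 2 * x1\<^sup>2 + y0\<^sup>2 + 2 * y1\<^sup>2 = 3 * m + 2 * k"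
    and e2: "2 * x0 * x1 + 2 * y0 * y1 = m + 3 * k"
    using less.prems by (simp_all add: m_def k_def)
  \<comment> \<open>\<open>x0 - 3 x1\<close> is the residue of \<open>x0 + x1 \<surd>2\<close>
    modulo \<open>3 + \<surd>2\<close>, where \<surd>2 becomes -3.\<close>
  have "(x0 - 3 * x1)\<^sup>2 + (y0 - 3 * y1)\<^sup>2
      = (x0\<^sup>2 + 2 * x1\<^sup>2 + y0\<^sup>2 + 2 * y1\<^sup>2) - 3 * (2 * x0 * x1 + 2 * y0 * y1) + 7 * (x1\<^sup>2 + y1\<^sup>2)"
    by (simp add: power2_eq_square algebra_simps)
  also have "\<dots> = 7 * (x1\<^sup>2 + y1\<^sup>2 - k)" unfolding e1 e2 by simp
  finally have h: "(x0 - 3 * x1)\<^sup>2 + (y0 - 3 * y1)\<^sup>2 = 7 * (x1\<^sup>2 + y1\<^sup>2 - k)" .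
  have "7 dvd x0 - 3 * x1" using sum_squares_mod_7[of "x0 - 3 * x1" "y0 - 3 * y1"] h by simp
  then obtain a where a: "x0 - 3 * x1 = 7 * a" by auto
  have "7 dvd y0 - 3 * y1" using sum_squares_mod_7[of "y0 - 3 * y1" "x0 - 3 * x1"] h by (simp add: add.commute)
  then obtain b where b: "y0 - 3 * y1 = 7 * b" by auto
  \<comment> \<open>\<open>p0 + p1 \<surd>2\<close> and \<open>q0 + q1 \<surd>2\<close> are the
    quotients of \<open>x0 + x1 \<surd>2\<close> and \<open>y0 + y1 \<surd>2\<close> by
    \<open>3 + \<surd>2\<close>.\<close>
  define p0 where "p0 = x1 + 3 * a"
  define p1 where "p1 = - a"
  define q0 where "q0 = y1 + 3 * b"
  define q1 where "q1 = - b"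
  have x: "x0 = 3 * p0 + 2 * p1" "x1 = p0 + 3 * p1" using a by (auto simp: p0_def p1_def)
  have y: "y0 = 3 * q0 + 2 * q1" "y1 = q0 + 3 * q1" using b by (auto simp: q0_def q1_def)
  define m' where "m' = p0\<^sup>2 + 2 * p1\<^sup>2 + q0\<^sup>2 + 2 * q1\<^sup>2"
  define k' where "k' = 2 * p0 * p1 + 2 * q0 * q1"
  have "11 * m' + 12 * k' = 3 * m + 2 * k"
    using e1 unfolding x y m'_def k'_def by (simp add: power2_eq_square algebra_simps)
  moreover have "6 * m' + 11 * k' = m + 3 * k"
    using e2 unfolding x y m'_def k'_def by (simp add: power2_eq_square algebra_simps)
  \<comment> \<open>Dividing the equation once by \<open>3 + \<surd>2\<close>, whose square is
    \<open>11 + 6 \<surd>2\<close>, exchanges the roles of the two sides.\<close>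
  ultimately have n: "m = 3 * m' + 2 * k'" "k = m' + 3 * k'" by linarith+
  have nx: "x0\<^sup>2 - 2 * x1\<^sup>2 = 7 * (p0\<^sup>2 - 2 * p1\<^sup>2)" unfolding x by (simp add: power2_eq_square algebra_simps)
  have ny: "y0\<^sup>2 - 2 * y1\<^sup>2 = 7 * (q0\<^sup>2 - 2 * q1\<^sup>2)" unfolding y by (simp add: power2_eq_square algebra_simps)
  show ?case
  proof (cases "p0\<^sup>2 - 2 * p1\<^sup>2 = 0 \<and> q0\<^sup>2 - 2 * q1\<^sup>2 = 0")
    case True
    then have "p0 = 0 \<and> p1 = 0" "q0 = 0 \<and> q1 = 0" using int_sq_eq_two_sq[of p0 p1] int_sq_eq_two_sq[of q0 q1] by auto
    then have 0: "x0 = 0" "x1 = 0" "y0 = 0" "y1 = 0" and "m = 0" using x y n by (auto simp: m'_def k'_def)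
    then have "z0\<^sup>2 = 0" "z1\<^sup>2 = 0" "w0\<^sup>2 = 0" "w1\<^sup>2 = 0"
      unfolding m_def using zero_le_power2[of z0] zero_le_power2[of z1] zero_le_power2[of w0] zero_le_power2[of w1] by linarith+
    then show ?thesis using 0 by simp
  next
    case False
    \<comment> \<open>\<open>3 + \<surd>2\<close> has norm 7, so passing to the quotients divides
      two of the four norms by 7; the sum drops, as these two are not both 0.\<close>
    have "\<bar>z0\<^sup>2 - 2 * z1\<^sup>2\<bar> + \<bar>w0\<^sup>2 - 2 * w1\<^sup>2\<bar> + \<bar>p0\<^sup>2 - 2 * p1\<^sup>2\<bar> + \<bar>q0\<^sup>2 - 2 * q1\<^sup>2\<bar>
        < \<bar>x0\<^sup>2 - 2 * x1\<^sup>2\<bar> + \<bar>y0\<^sup>2 - 2 * y1\<^sup>2\<bar> + \<bar>z0\<^sup>2 - 2 * z1\<^sup>2\<bar> + \<bar>w0\<^sup>2 - 2 * w1\<^sup>2\<bar>"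
      unfolding nx ny using False by (auto simp: abs_mult)
    then have "z0 = 0 \<and> z1 = 0 \<and> w0 = 0 \<and> w1 = 0 \<and> p0 = 0 \<and> p1 = 0 \<and> q0 = 0 \<and> q1 = 0"
      using n unfolding m_def k_def m'_def k'_def by (intro less.hyps) auto
    then show ?thesis using x y by simp
  qed
qed

text \<open>The reduced norm of \<open>u + j v\<close> has no nontrivial zero, which makes the
  quaternion algebra a division algebra. After clearing denominators, comparing the coefficients of
  1 and \<surd>2 gives the two equations of \<open>anisotropic_int\<close>.\<close>

lemma anisotropic:
  assumes us: "(u, s) \<in> gauss \<rat>" and vt: "(v, t) \<in> gauss \<rat>"
    and eq: "(cmod u)\<^sup>2 = (3 + sqrt 2) * (cmod v)\<^sup>2"
  shows "u = 0 \<and> v = 0"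
proof -
  obtain k where k: "k > 0" "(of_nat k * u, of_nat k * s) \<in> gauss \<int>" by (rule gauss_clear_denominator[OF us]) blast
  obtain l where l: "l > 0" "(of_nat l * v, of_nat l * t) \<in> gauss \<int>" by (rule gauss_clear_denominator[OF vt]) blast
  define U where "U = of_nat (k * l) * u"
  define V where "V = of_nat (k * l) * v"
  have U: "(U, of_nat (k * l) * s) \<in> gauss \<int>" using gauss_int_scale[OF k(2), of l] by (simp add: U_def mult_ac)
  have V: "(V, of_nat (k * l) * t) \<in> gauss \<int>" using gauss_int_scale[OF l(2), of k] by (simp add: V_def mult_ac)
  have EQ: "(cmod U)\<^sup>2 = (3 + sqrt 2) * (cmod V)\<^sup>2" unfolding U_def V_def norm_mult power_mult_distrib eq by simp
  obtain x0 x1 where x: "Re U = of_int x0 + of_int x1 * sqrt 2" using U by (auto simp: gauss_def elim!: quadE Ints_cases)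
  obtain y0 y1 where y: "Im U = of_int y0 + of_int y1 * sqrt 2" using U by (auto simp: gauss_def elim!: quadE Ints_cases)
  obtain z0 z1 where z: "Re V = of_int z0 + of_int z1 * sqrt 2" using V by (auto simp: gauss_def elim!: quadE Ints_cases)
  obtain w0 w1 where w: "Im V = of_int w0 + of_int w1 * sqrt 2" using V by (auto simp: gauss_def elim!: quadE Ints_cases)
  define m where "m = z0\<^sup>2 + 2 * z1\<^sup>2 + w0\<^sup>2 + 2 * w1\<^sup>2"
  define n where "n = 2 * z0 * z1 + 2 * w0 * w1"
  define m' where "m' = x0\<^sup>2 + 2 * x1\<^sup>2 + y0\<^sup>2 + 2 * y1\<^sup>2"
  define n' where "n' = 2 * x0 * x1 + 2 * y0 * y1"
  have cV: "(cmod V)\<^sup>2 = of_int m + of_int n * sqrt 2"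
    unfolding cmod_power2 z w m_def n_def by (simp add: power2_sum power_mult_distrib algebra_simps)
  have cU: "(cmod U)\<^sup>2 = of_int m' + of_int n' * sqrt 2"
    unfolding cmod_power2 x y m'_def n'_def by (simp add: power2_sum power_mult_distrib algebra_simps)
  have "of_int (m' - (3 * m + 2 * n)) + of_int (n' - (m + 3 * n)) * sqrt 2 = 0"
    using EQ unfolding cU cV by (simp add: algebra_simps)
  then have "of_int (m' - (3 * m + 2 * n)) = (0::real) \<and> of_int (n' - (m + 3 * n)) = (0::real)"
    by (intro rational_combination_zero) auto
  then have "m' - (3 * m + 2 * n) = 0" "n' - (m + 3 * n) = 0" by (simp_all only: of_int_eq_0_iff)
  then have "m' = 3 * m + 2 * n" "n' = m + 3 * n" by auto
  from anisotropic_int[OF this[unfolded m'_def n'_def m_def n_def]]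
  have "U = 0 \<and> V = 0" using x y z w by (simp add: complex_eq_iff)
  then show ?thesis using k(1) l(1) by (simp add: U_def V_def)
qed

text \<open>The roots of nonzero polynomials over \<rat>(\<surd>2) are countable in number and
  cannot fill an interval. The exponents 1, 2, 4 are those produced by \<open>\<tau>\<close> and its
  squared modulus, and the bound 1/2 will keep \<open>\<delta>\<close> positive.\<close>

lemma exists_generic_parameter:
  obtains x :: real where "0 < x" "x < 1 / 2"
    "\<And>a b c d. a \<in> fst ` quad \<rat> \<Longrightarrow> b \<in> fst ` quad \<rat> \<Longrightarrow> c \<in> fst ` quad \<rat> \<Longrightarrow> d \<in> fst ` quad \<rat> \<Longrightarrow>
       a + b * x + c * x ^ 2 + d * x ^ 4 = 0 \<Longrightarrow> a = 0 \<and> b = 0 \<and> c = 0 \<and> d = 0"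
proof -
  let ?F = "fst ` quad \<rat>"
  have "?F = (\<lambda>(p, q). p + q * sqrt 2) ` (\<rat> \<times> \<rat>)" by (force simp: quad_def image_iff)
  then have F: "countable ?F" by (simp only:) (intro countable_image countable_SIGMA countable_rat)
  define bad where "bad = (\<Union>(a, b, c, d) \<in> ?F \<times> ?F \<times> ?F \<times> ?F - {(0, 0, 0, 0)}. {x. poly [:a, b, c, 0, d:] x = 0})"
  have "countable bad"
    unfolding bad_def
  proof (intro countable_UN)
    show "countable (?F \<times> ?F \<times> ?F \<times> ?F - {(0, 0, 0, 0)})"
      by (intro countable_Diff countable_SIGMA F)
    fix p assume "p \<in> ?F \<times> ?F \<times> ?F \<times> ?F - {(0, 0, 0, 0)}"
    moreover obtain a b c d where p: "p = (a, b, c, d)" by (rule prod_cases4)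
    ultimately have "[:a, b, c, 0, d:] \<noteq> 0" by auto
    then have "finite {x. poly [:a, b, c, 0, d:] x = 0}" by (rule poly_roots_finite)
    then show "countable (case p of (a, b, c, d) \<Rightarrow> {x. poly [:a, b, c, 0, d:] x = 0})"
      unfolding p by (simp add: countable_finite)
  qed
  moreover have "uncountable {0<..<1 / 2 :: real}" by (simp add: uncountable_open_interval)
  ultimately have "\<not> {0<..<1 / 2 :: real} \<subseteq> bad" using countable_subset by blast
  then obtain x where "x \<in> {0<..<1 / 2}" "x \<notin> bad" by blast
  then have x: "0 < x" "x < 1 / 2" "x \<notin> bad" by auto
  show thesis
  proof (rule that[OF x(1,2)])
    fix a b c d assume abcd: "a \<in> ?F" "b \<in> ?F" "c \<in> ?F" "d \<in> ?F" and z: "a + b * x + c * x ^ 2 + d * x ^ 4 = 0"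
    have "poly [:a, b, c, 0, d:] x = 0" using z by (simp add: algebra_simps power2_eq_square power4_eq_xxxx)
    then have "(a, b, c, d) = (0, 0, 0, 0)" using x(3) abcd unfolding bad_def by blast
    then show "a = 0 \<and> b = 0 \<and> c = 0 \<and> d = 0" by simp
  qed
qed

section \<open>A quaternionic abelian fourfold\<close>

definition vec4 :: "complex \<Rightarrow> complex \<Rightarrow> complex \<Rightarrow> complex \<Rightarrow> complex vec" where
  "vec4 a b c d = vec 4 (\<lambda>i. [a, b, c, d] ! i)"

lemma vec4_carrier [simp]: "vec4 a b c d \<in> carrier_vec 4"
  by (simp add: vec4_def)

lemma less_4_cases: "i < (4::nat) \<Longrightarrow> i = 0 \<or> i = 1 \<or> i = 2 \<or> i = 3"
  by auto

lemma less_8_cases: "i < (8::nat) \<Longrightarrow> i = 0 \<or> i = 1 \<or> i = 2 \<or> i = 3 \<or> i = 4 \<or> i = 5 \<or> i = 6 \<or> i = 7"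
  by auto

lemma sum_4: "(\<Sum>k<(4::nat). f k) = f 0 + f 1 + f 2 + (f 3 :: 'a :: comm_monoid_add)"
proof -
  have "{..<4::nat} = {0, 1, 2, 3}" by auto
  then show ?thesis by (simp add: add.assoc)
qed

lemma sum_8: "(\<Sum>k<(8::nat). f k) = f 0 + f 1 + f 2 + f 3 + f 4 + f 5 + f 6 + (f 7 :: 'a :: comm_monoid_add)"
proof -
  have "{..<8::nat} = {0, 1, 2, 3, 4, 5, 6, 7}" by auto
  then show ?thesis by (simp add: add.assoc)
qed

lemma vec4_index [simp]:
  "vec4 a b c d $ 0 = a" "vec4 a b c d $ Suc 0 = b" "vec4 a b c d $ 2 = c" "vec4 a b c d $ 3 = d"
  by (simp_all add: vec4_def)

lemma vec4_eq_iff: "vec4 a b c d = vec4 a' b' c' d' \<longleftrightarrow> a = a' \<and> b = b' \<and> c = c' \<and> d = d'"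
proof
  assume "vec4 a b c d = vec4 a' b' c' d'"
  then have "vec4 a b c d $ i = vec4 a' b' c' d' $ i" for i by simp
  from this[of 0] this[of "Suc 0"] this[of 2] this[of 3]
  show "a = a' \<and> b = b' \<and> c = c' \<and> d = d'" by simp
qed simp

lemma vec4_cases:
  assumes "v \<in> carrier_vec 4" obtains a b c d where "v = vec4 a b c d"
proof
  show "v = vec4 (v $ 0) (v $ 1) (v $ 2) (v $ 3)"
    using assms by (intro eq_vecI) (auto simp: vec4_def dest!: less_4_cases)
qed

lemma vec4_add: "vec4 a b c d + vec4 a' b' c' d' = vec4 (a + a') (b + b') (c + c') (d + d')"
  by (intro eq_vecI) (auto simp: vec4_def dest!: less_4_cases)

lemma vec4_minus: "vec4 a b c d - vec4 a' b' c' d' = vec4 (a - a') (b - b') (c - c') (d - d')"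
  by (intro eq_vecI) (auto simp: vec4_def dest!: less_4_cases)

lemma vec4_smult: "r \<cdot>\<^sub>v vec4 a b c d = vec4 (r * a) (r * b) (r * c) (r * d)"
  by (intro eq_vecI) (auto simp: vec4_def dest!: less_4_cases)

lemma vec4_zero: "0\<^sub>v 4 = vec4 0 0 0 0"
  by (intro eq_vecI) (auto simp: vec4_def dest!: less_4_cases)

definition \<beta>1 :: real where "\<beta>1 = 3 + sqrt 2"
definition \<beta>2 :: real where "\<beta>2 = 3 - sqrt 2"

lemma sqrt_2_bounds: "1 < sqrt 2" "sqrt 2 < 2"
  using real_sqrt_less_mono[of 1 2] real_sqrt_less_mono[of 2 4] by auto

lemma \<beta>_pos: "0 < \<beta>1" "0 < \<beta>2" "\<beta>2 < 2"
  using sqrt_2_bounds unfolding \<beta>1_def \<beta>2_def by linarith+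

lemma \<beta>_quad: "(\<beta>1, \<beta>2) \<in> quad \<int>"
  using quadI[of 3 \<int> 1] by (simp add: \<beta>1_def \<beta>2_def)

lemma \<beta>_gauss: "R = \<int> \<or> R = \<rat> \<Longrightarrow> (complex_of_real \<beta>1, complex_of_real \<beta>2) \<in> gauss R"
  using gauss_of_real[of \<int>, OF _ \<beta>_quad] gauss_int_subset by auto

text \<open>
  The two real places of the quaternion algebra \<open>(-1, 3 + \<surd>2)\<close> over \<open>\<rat>(\<surd>2)\<close>.  An element
  \<open>u + j v\<close> with \<open>u, v\<close> in \<open>\<rat>(\<surd>2, i)\<close> acts on \<open>z + j w\<close> by left multiplication; \<open>s, t\<close> are
  the conjugates of \<open>u, v\<close>.
\<close>

definition rho :: "complex \<Rightarrow> complex \<Rightarrow> complex \<Rightarrow> complex \<Rightarrow> complex mat" where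
  "rho u v s t = mat 4 4 (\<lambda>(i, j).
     [[u, of_real \<beta>1 * cnj v, 0, 0], [v, cnj u, 0, 0],
      [0, 0, s, of_real \<beta>2 * cnj t], [0, 0, t, cnj s]] ! i ! j)"

lemma rho_carrier [simp]: "rho u v s t \<in> carrier_mat 4 4"
  by (simp add: rho_def)

lemma rho_vec4: "rho u v s t *\<^sub>v vec4 a b c d
    = vec4 (u * a + of_real \<beta>1 * cnj v * b) (v * a + cnj u * b)
        (s * c + of_real \<beta>2 * cnj t * d) (t * c + cnj s * d)" (is "?l = ?r")
proof (rule eq_vecI)
  fix i assume "i < dim_vec ?r"
  then have i: "i < 4" by (simp add: vec4_def)
  have "?l $ i = (\<Sum>k<4. rho u v s t $$ (i, k) * vec4 a b c d $ k)"
    by (rule index_mult_mat_vec_sum[OF rho_carrier vec4_carrier i])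
  then show "?l $ i = ?r $ i"
    unfolding sum_4 using less_4_cases[OF i] by (elim disjE) (simp_all add: rho_def vec4_def)
qed (simp add: vec4_def rho_def)

lemma rho_eq_iff: "rho u v s t = rho u' v' s' t' \<longleftrightarrow> u = u' \<and> v = v' \<and> s = s' \<and> t = t'"
proof
  assume "rho u v s t = rho u' v' s' t'"
  then have "rho u v s t *\<^sub>v vec4 1 0 1 0 = rho u' v' s' t' *\<^sub>v vec4 1 0 1 0" by simp
  then show "u = u' \<and> v = v' \<and> s = s' \<and> t = t'" by (simp add: rho_vec4 vec4_eq_iff)
qed simp

lemma mat4_eqI:
  assumes "A \<in> carrier_mat 4 4" "B \<in> carrier_mat 4 4"
    and "\<And>a b c d. A *\<^sub>v vec4 a b c d = B *\<^sub>v vec4 a b c d"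
  shows "A = (B :: complex mat)"
  using assms by (intro mat_eqI_mult_vec[OF assms(1,2)]) (metis vec4_cases)

lemma rho_mult: "rho u v s t * rho u' v' s' t'
    = rho (u * u' + of_real \<beta>1 * cnj v * v') (v * u' + cnj u * v')
        (s * s' + of_real \<beta>2 * cnj t * t') (t * s' + cnj s * t')"
proof (rule mat4_eqI)
  fix a b c d
  have "(rho u v s t * rho u' v' s' t') *\<^sub>v vec4 a b c d = rho u v s t *\<^sub>v (rho u' v' s' t' *\<^sub>v vec4 a b c d)"
    by (rule assoc_mult_mat_vec[OF rho_carrier rho_carrier vec4_carrier])
  then show "(rho u v s t * rho u' v' s' t') *\<^sub>v vec4 a b c d
      = rho (u * u' + of_real \<beta>1 * cnj v * v') (v * u' + cnj u * v')
        (s * s' + of_real \<beta>2 * cnj t * t') (t * s' + cnj s * t') *\<^sub>v vec4 a b c d"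
    unfolding rho_vec4 by (simp add: vec4_eq_iff algebra_simps)
qed (rule mult_carrier_mat[OF rho_carrier rho_carrier], rule rho_carrier)

lemma rho_add: "rho u v s t + rho u' v' s' t' = rho (u + u') (v + v') (s + s') (t + t')"
  by (rule mat4_eqI)
    (auto simp: rho_vec4 vec4_add vec4_eq_iff algebra_simps
      add_mult_distrib_mat_vec[OF rho_carrier rho_carrier vec4_carrier])

lemma rho_minus: "rho u v s t - rho u' v' s' t' = rho (u - u') (v - v') (s - s') (t - t')"
  by (rule mat4_eqI)
    (auto simp: rho_vec4 vec4_minus vec4_eq_iff algebra_simps minus_carrier_mat
      minus_mult_distrib_mat_vec[OF rho_carrier rho_carrier vec4_carrier])

lemma rho_smult_real: "complex_of_real r \<cdot>\<^sub>m rho u v s t = rho (r * u) (r * v) (r * s) (r * t)"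
  by (rule eq_matI) (auto simp: rho_def dest!: less_4_cases)

lemma rho_one: "rho 1 0 1 0 = 1\<^sub>m 4"
  by (rule mat4_eqI) (auto simp: rho_vec4)

lemma rho_zero: "rho 0 0 0 0 = 0\<^sub>m 4 4"
proof (rule mat4_eqI)
  fix a b c d
  have "0\<^sub>m 4 4 *\<^sub>v vec4 a b c d = 0\<^sub>v 4" using vec4_carrier[of a b c d] by auto
  then show "rho 0 0 0 0 *\<^sub>v vec4 a b c d = 0\<^sub>m 4 4 *\<^sub>v vec4 a b c d" by (simp add: rho_vec4 vec4_zero)
qed auto

text \<open>An order of the algebra for \<open>R = \<int>\<close>, the algebra itself for
  \<open>R = \<rat>\<close>.\<close>

definition quaternions :: "real set \<Rightarrow> complex mat set" where
  "quaternions R = {rho u v s t | u v s t. (u, s) \<in> gauss R \<and> (v, t) \<in> gauss R}"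

lemma quaternionsI: "(u, s) \<in> gauss R \<Longrightarrow> (v, t) \<in> gauss R \<Longrightarrow> rho u v s t \<in> quaternions R"
  by (auto simp: quaternions_def)

lemma quaternionsE:
  assumes "A \<in> quaternions R"
  obtains u v s t where "A = rho u v s t" "(u, s) \<in> gauss R" "(v, t) \<in> gauss R"
  using assms by (auto simp: quaternions_def)

lemma quaternions_closed:
  assumes R: "R = \<int> \<or> R = \<rat>" and A: "A \<in> quaternions R" and B: "B \<in> quaternions R"
  shows "A + B \<in> quaternions R" "A - B \<in> quaternions R" "A * B \<in> quaternions R"
proof -
  obtain u v s t where a: "A = rho u v s t" "(u, s) \<in> gauss R" "(v, t) \<in> gauss R" using A by (rule quaternionsE)
  obtain u' v' s' t' where b: "B = rho u' v' s' t'" "(u', s') \<in> gauss R" "(v', t') \<in> gauss R" using B by (rule quaternionsE)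
  show "A + B \<in> quaternions R" unfolding a b rho_add using a b by (intro quaternionsI gauss_closed[OF R])
  show "A - B \<in> quaternions R" unfolding a b rho_minus using a b by (intro quaternionsI gauss_closed[OF R])
  show "A * B \<in> quaternions R" unfolding a b rho_mult
    using a b by (intro quaternionsI gauss_closed(1)[OF R] gauss_closed(4)[OF R] gauss_closed(5)[OF R] \<beta>_gauss[OF R])
qed

text \<open>Anisotropy gives the first place; the norm at the second place is the conjugate number
  and vanishes only simultaneously.\<close>

lemma norm_nonzero:
  assumes us: "(u, s) \<in> gauss \<rat>" and vt: "(v, t) \<in> gauss \<rat>" and nz: "rho u v s t \<noteq> 0\<^sub>m 4 4"
  shows "(cmod u)\<^sup>2 - \<beta>1 * (cmod v)\<^sup>2 \<noteq> 0" "(cmod s)\<^sup>2 - \<beta>2 * (cmod t)\<^sup>2 \<noteq> 0"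
proof -
  show n1: "(cmod u)\<^sup>2 - \<beta>1 * (cmod v)\<^sup>2 \<noteq> 0"
  proof
    assume "(cmod u)\<^sup>2 - \<beta>1 * (cmod v)\<^sup>2 = 0"
    then have "u = 0 \<and> v = 0" using anisotropic[OF us vt] by (simp add: \<beta>1_def)
    then have "s = 0" "t = 0" using gauss_zero_iff us vt by auto
    then show False using nz \<open>u = 0 \<and> v = 0\<close> rho_zero by simp
  qed
  have sq: "((cmod z)\<^sup>2, (cmod w)\<^sup>2) \<in> quad \<rat>" if "(z, w) \<in> gauss \<rat>" for z w
    unfolding cmod_power2 unfolding power2_eq_square using that by (auto simp: gauss_def intro!: quad_closed)
  have "(\<beta>1, \<beta>2) \<in> quad \<rat>" using \<beta>_quad quad_int_subset by auto
  then have "((cmod u)\<^sup>2 - \<beta>1 * (cmod v)\<^sup>2, (cmod s)\<^sup>2 - \<beta>2 * (cmod t)\<^sup>2) \<in> quad \<rat>"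
    using sq[OF us] sq[OF vt] by (intro quad_closed) auto
  then show "(cmod s)\<^sup>2 - \<beta>2 * (cmod t)\<^sup>2 \<noteq> 0" using quad_zero_iff n1 by blast
qed

text \<open>The left factor is the quaternion conjugate, so the product is the reduced norm at both
  places.\<close>

lemma rho_adjoint_mult: "rho (cnj u) (- v) (cnj s) (- t) * rho u v s t
    = rho (of_real ((cmod u)\<^sup>2 - \<beta>1 * (cmod v)\<^sup>2)) 0 (of_real ((cmod s)\<^sup>2 - \<beta>2 * (cmod t)\<^sup>2)) 0"
  unfolding rho_mult rho_eq_iff of_real_diff of_real_mult complex_norm_square by (simp add: mult_ac)

lemma quaternion_left_inverse:
  assumes A: "A \<in> quaternions \<rat>" and nz: "A \<noteq> 0\<^sub>m 4 4"
  obtains B where "B \<in> carrier_mat 4 4" "B * A = 1\<^sub>m 4"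
proof -
  obtain u v s t where a: "A = rho u v s t" "(u, s) \<in> gauss \<rat>" "(v, t) \<in> gauss \<rat>" using A by (rule quaternionsE)
  define N where "N = (cmod u)\<^sup>2 - \<beta>1 * (cmod v)\<^sup>2"
  define N' where "N' = (cmod s)\<^sup>2 - \<beta>2 * (cmod t)\<^sup>2"
  have n: "N \<noteq> 0" "N' \<noteq> 0" using norm_nonzero[OF a(2,3)] nz a(1) by (auto simp: N_def N'_def)
  let ?I = "rho (of_real (1 / N)) 0 (of_real (1 / N')) 0"
  have "?I * (rho (cnj u) (- v) (cnj s) (- t) * A) = rho 1 0 1 0"
    unfolding a unfolding rho_adjoint_mult unfolding N_def[symmetric] N'_def[symmetric] rho_mult
    using n by simp
  then have "(?I * rho (cnj u) (- v) (cnj s) (- t)) * A = 1\<^sub>m 4"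
    unfolding rho_one a using assoc_mult_mat[OF rho_carrier rho_carrier rho_carrier] by simp
  then show thesis using that[of "?I * rho (cnj u) (- v) (cnj s) (- t)"] mult_carrier_mat[OF rho_carrier rho_carrier] by blast
qed

lemma quaternion_kernel:
  assumes A: "A \<in> quaternions \<rat>" "A \<noteq> 0\<^sub>m 4 4" and w: "w \<in> carrier_vec 4" "A *\<^sub>v w = 0\<^sub>v 4"
  shows "w = 0\<^sub>v 4"
proof -
  obtain B where B: "B \<in> carrier_mat 4 4" "B * A = 1\<^sub>m 4" using A by (rule quaternion_left_inverse)
  have Am: "A \<in> carrier_mat 4 4" using A(1) by (auto elim: quaternionsE)
  have "w = (B * A) *\<^sub>v w" using B w by simp
  also have "\<dots> = B *\<^sub>v (A *\<^sub>v w)" by (rule assoc_mult_mat_vec[OF B(1) Am w(1)])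
  also have "\<dots> = 0\<^sub>v 4" unfolding w(2) by (rule mult_mat_zero_vec[OF B(1)])
  finally show ?thesis .
qed

lemma quaternion_idempotent:
  assumes A: "A \<in> quaternions \<rat>" and idem: "A * A = A"
  shows "A = 0\<^sub>m 4 4 \<or> A = 1\<^sub>m 4"
proof (rule disjCI)
  assume "A \<noteq> 1\<^sub>m 4"
  show "A = 0\<^sub>m 4 4"
  proof (rule ccontr)
    assume nz: "A \<noteq> 0\<^sub>m 4 4"
    obtain B where B: "B \<in> carrier_mat 4 4" "B * A = 1\<^sub>m 4" by (rule quaternion_left_inverse[OF A nz])
    have Am: "A \<in> carrier_mat 4 4" using A by (auto elim: quaternionsE)
    have "1\<^sub>m 4 = B * (A * A)" using B idem by simp
    also have "\<dots> = (B * A) * A" by (rule assoc_mult_mat[symmetric, OF B(1) Am Am])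
    also have "\<dots> = A" using B Am by simp
    finally show False using \<open>A \<noteq> 1\<^sub>m 4\<close> by simp
  qed
qed

lemma rho_quaternions_iff: "rho u v s t \<in> quaternions R \<longleftrightarrow> (u, s) \<in> gauss R \<and> (v, t) \<in> gauss R"
  unfolding quaternions_def by (auto simp: rho_eq_iff)

section \<open>The lattice with its generic complex structure\<close>

locale quaternionic_lattice =
  fixes \<xi> :: real
  assumes xi: "0 < \<xi>" "\<xi> < 1 / 2"
    and generic: "\<And>a b c d. a \<in> fst ` quad \<rat> \<Longrightarrow> b \<in> fst ` quad \<rat> \<Longrightarrow> c \<in> fst ` quad \<rat> \<Longrightarrow> d \<in> fst ` quad \<rat> \<Longrightarrow>
       a + b * \<xi> + c * \<xi> ^ 2 + d * \<xi> ^ 4 = 0 \<Longrightarrow> a = 0 \<and> b = 0 \<and> c = 0 \<and> d = 0"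
begin

text \<open>Real and imaginary part are different powers of \<open>\<xi>\<close>, so that they stay
  independent of each other and of the squared modulus \<open>\<xi>^2 + \<xi>^4\<close> over
  \<rat>(\<surd>2).\<close>

definition \<tau> :: complex where "\<tau> = Complex \<xi> (\<xi>\<^sup>2)"
definition nt :: real where "nt = \<xi>\<^sup>2 + \<xi> ^ 4"
text \<open>The reduced norm of \<open>1 + j \<tau>\<close> at the second place. Its positivity
  makes right multiplication by this quaternion invertible and preserves the sign of the
  form.\<close>

definition \<delta> :: real where "\<delta> = 1 - \<beta>2 * nt"

lemma tau_cnj: "\<tau> * cnj \<tau> = of_real nt"
  by (simp add: \<tau>_def nt_def complex_eq_iff power2_eq_square power4_eq_xxxx)

lemma nt_bounds: "0 < nt" "nt < 1 / 2"
proof -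
  show "0 < nt" using xi by (simp add: nt_def add_pos_pos)
  have "\<xi>\<^sup>2 \<le> (1 / 2)\<^sup>2" "\<xi> ^ 4 \<le> (1 / 2) ^ 4" using xi by (auto intro!: power_mono)
  then show "nt < 1 / 2" by (simp add: nt_def power2_eq_square power4_eq_xxxx)
qed

lemma \<delta>_pos: "\<delta> > 0"
proof -
  have "\<beta>2 * nt < 2 * (1 / 2)" using nt_bounds \<beta>_pos by (intro mult_strict_mono) auto
  then show ?thesis by (simp add: \<delta>_def)
qed

text \<open>
  The image of \<open>(u + j v, s + j t)\<close> under right multiplication by \<open>1 + j \<tau>\<close> at the second
  place: the complex structure on the second factor is the conjugate of \<open>i\<close> by \<open>1 + j \<tau>\<close>.
\<close>

definition Lam :: "complex \<Rightarrow> complex \<Rightarrow> complex \<Rightarrow> complex \<Rightarrow> complex vec" where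
  "Lam u v s t = vec4 u v (s + of_real \<beta>2 * cnj t * \<tau>) (t + cnj s * \<tau>)"

text \<open>Left multiplication by a quaternion commutes with the right multiplication by
  \<open>1 + j \<tau>\<close> that is built into \<open>Lam\<close>.\<close>

lemma rho_Lam: "rho u v s t *\<^sub>v Lam u' v' s' t'
    = Lam (u * u' + of_real \<beta>1 * cnj v * v') (v * u' + cnj u * v')
        (s * s' + of_real \<beta>2 * cnj t * t') (t * s' + cnj s * t')"
  unfolding Lam_def rho_vec4 by (simp add: vec4_eq_iff algebra_simps)

lemma Lam_eq_rho: "Lam u v s t = rho u v s t *\<^sub>v Lam 1 0 1 0"
  by (simp add: rho_Lam)

text \<open>Coordinates with respect to 1, \<surd>2, i, i\<surd>2 and their left multiples by j;
  \<open>S\<close> and \<open>T\<close> carry the conjugates of \<open>U\<close> and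
  \<open>V\<close>. Integer vectors yield exactly the order, real vectors all quadruples of complex
  numbers.\<close>

definition U :: "real vec \<Rightarrow> complex" where "U x = Complex (x $ 0 + x $ 1 * sqrt 2) (x $ 2 + x $ 3 * sqrt 2)"
definition S :: "real vec \<Rightarrow> complex" where "S x = Complex (x $ 0 - x $ 1 * sqrt 2) (x $ 2 - x $ 3 * sqrt 2)"
definition V :: "real vec \<Rightarrow> complex" where "V x = Complex (x $ 4 + x $ 5 * sqrt 2) (x $ 6 + x $ 7 * sqrt 2)"
definition T :: "real vec \<Rightarrow> complex" where "T x = Complex (x $ 4 - x $ 5 * sqrt 2) (x $ 6 - x $ 7 * sqrt 2)"

definition P :: "complex mat" where
  "P = mat 4 8 (\<lambda>(i, j). let r = complex_of_real (sqrt 2); b = of_real \<beta>2 * \<tau> in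
     [[1, r, \<i>, \<i> * r, 0, 0, 0, 0],
      [0, 0, 0, 0, 1, r, \<i>, \<i> * r],
      [1, - r, \<i>, - (\<i> * r), b, - (b * r), - (b * \<i>), b * \<i> * r],
      [\<tau>, - (\<tau> * r), - (\<tau> * \<i>), \<tau> * \<i> * r, 1, - r, \<i>, - (\<i> * r)]] ! i ! j)"

lemma P_carrier: "P \<in> carrier_mat 4 8"
  by (simp add: P_def)

lemma P_vec:
  assumes x: "x \<in> carrier_vec 8"
  shows "P *\<^sub>v map_vec complex_of_real x = Lam (U x) (V x) (S x) (T x)" (is "?l = ?r")
proof (rule eq_vecI)
  fix i assume "i < dim_vec ?r"
  then have i: "i < 4" by (simp add: Lam_def vec4_def)
  have xc: "map_vec complex_of_real x \<in> carrier_vec 8" using x by simp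
  have l: "?l $ i = (\<Sum>k<8. P $$ (i, k) * map_vec complex_of_real x $ k)"
    by (rule index_mult_mat_vec_sum[OF P_carrier xc i])
  have xi: "map_vec complex_of_real x $ k = of_real (x $ k)" if "k < 8" for k using x that by simp
  show "?l $ i = ?r $ i"
    unfolding l sum_8 using less_4_cases[OF i]
    by (elim disjE)
      (simp_all add: xi P_def Lam_def vec4_def Let_def U_def V_def S_def T_def Complex_eq algebra_simps)
qed (simp add: P_def Lam_def vec4_def)

text \<open>Right multiplication by \<open>1 + j \<tau>\<close> is injective because its norm
  \<open>\<delta>\<close> is nonzero.\<close>

lemma Lam_zero:
  assumes "Lam u v s t = 0\<^sub>v 4" shows "u = 0" "v = 0" "s = 0" "t = 0"
proof -
  have uv: "u = 0" "v = 0" and a: "s + of_real \<beta>2 * cnj t * \<tau> = 0" and b: "t + cnj s * \<tau> = 0"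
    using assms by (auto simp: Lam_def vec4_zero vec4_eq_iff)
  show "u = 0" "v = 0" by (fact uv)+
  have t: "t = - (cnj s * \<tau>)" using b by (simp add: eq_neg_iff_add_eq_0)
  have "s * of_real \<delta> = s - of_real \<beta>2 * (s * (\<tau> * cnj \<tau>))"
    unfolding tau_cnj \<delta>_def by (simp add: algebra_simps)
  also have "\<dots> = s + of_real \<beta>2 * cnj t * \<tau>" unfolding t by (simp add: algebra_simps)
  finally have "s * of_real \<delta> = 0" using a by simp
  then show "s = 0" using \<delta>_pos by simp
  then show "t = 0" using t by simp
qed

lemma coordinates_zero:
  assumes x: "x \<in> carrier_vec 8" and z: "U x = 0" "V x = 0" "S x = 0" "T x = 0"
  shows "x = 0\<^sub>v 8"
proof -
  have r: "sqrt 2 \<noteq> 0" by simp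
  have lin: "a = 0 \<and> b = 0" if "a + b * sqrt 2 = 0" "a - b * sqrt 2 = 0" for a b :: real
  proof -
    have "a = 0" using that by linarith
    then show ?thesis using that r by simp
  qed
  have "x $ 0 = 0 \<and> x $ 1 = 0" "x $ 2 = 0 \<and> x $ 3 = 0" "x $ 4 = 0 \<and> x $ 5 = 0" "x $ 6 = 0 \<and> x $ 7 = 0"
    using z by (intro lin; simp add: U_def V_def S_def T_def complex_eq_iff)+
  then show ?thesis using x by (intro eq_vecI) (auto dest!: less_8_cases)
qed

lemma P_inj:
  assumes x: "x \<in> carrier_vec 8" and z: "P *\<^sub>v map_vec complex_of_real x = 0\<^sub>v 4"
  shows "x = 0\<^sub>v 8"
  using Lam_zero[OF z[unfolded P_vec[OF x]]] coordinates_zero[OF x] by blast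

lemma real_coordinates:
  fixes u v s t :: complex
  obtains x where "x \<in> carrier_vec 8" "U x = u" "V x = v" "S x = s" "T x = t"
proof
  define h where "h a b = (a - b) / (2 * sqrt 2)" for a b :: real
  let ?x = "vec 8 (\<lambda>i. [(Re u + Re s) / 2, h (Re u) (Re s), (Im u + Im s) / 2, h (Im u) (Im s),
    (Re v + Re t) / 2, h (Re v) (Re t), (Im v + Im t) / 2, h (Im v) (Im t)] ! i)"
  have h: "(a + b) / 2 + h a b * sqrt 2 = a" "(a + b) / 2 - h a b * sqrt 2 = b" for a b
    by (simp_all add: h_def field_simps)
  show "?x \<in> carrier_vec 8" by simp
  show "U ?x = u" "V ?x = v" "S ?x = s" "T ?x = t"
    by (simp_all add: U_def V_def S_def T_def h complex_eq_iff)
qed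

lemma P_surj: "carrier_vec 4 = (\<lambda>x. P *\<^sub>v map_vec complex_of_real x) ` carrier_vec 8"
proof (intro equalityI subsetI)
  fix z :: "complex vec" assume "z \<in> carrier_vec 4"
  then obtain a b c d where z: "z = vec4 a b c d" by (rule vec4_cases)
  \<comment> \<open>First component of \<open>(c + j d) (1 - j \<tau>) / \<delta>\<close>, the
    preimage under right multiplication by \<open>1 + j \<tau>\<close>.\<close>
  define s where "s = (c - of_real \<beta>2 * \<tau> * cnj d) / of_real \<delta>"
  define t where "t = d - cnj s * \<tau>"
  obtain x where x: "x \<in> carrier_vec 8" "U x = a" "V x = b" "S x = s" "T x = t" by (rule real_coordinates)
  have "s + of_real \<beta>2 * cnj t * \<tau> = s - of_real \<beta>2 * s * (\<tau> * cnj \<tau>) + of_real \<beta>2 * \<tau> * cnj d"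
    unfolding t_def by (simp add: algebra_simps)
  also have "\<dots> = s * of_real \<delta> + of_real \<beta>2 * \<tau> * cnj d"
    unfolding tau_cnj \<delta>_def by (simp add: algebra_simps)
  also have "\<dots> = c" using \<delta>_pos by (simp add: s_def)
  finally have "z = P *\<^sub>v map_vec complex_of_real x"
    unfolding P_vec[OF x(1)] x(2-5) z Lam_def by (simp add: vec4_eq_iff t_def)
  then show "z \<in> (\<lambda>x. P *\<^sub>v map_vec complex_of_real x) ` carrier_vec 8" using x(1) by blast
next
  fix z assume "z \<in> (\<lambda>x. P *\<^sub>v map_vec complex_of_real x) ` carrier_vec 8"
  then obtain x where x: "x \<in> carrier_vec 8" "z = P *\<^sub>v map_vec complex_of_real x" by blast
  then show "z \<in> carrier_vec 4" using P_carrier by (auto intro!: mult_mat_vec_carrier)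
qed

definition L :: "complex vec set" where
  "L = (\<lambda>x. P *\<^sub>v map_vec complex_of_int x) ` carrier_vec 8"

sublocale full_lattice 4 8 P L
  using P_carrier P_inj P_surj L_def by unfold_locales

lemma L_iff: "z \<in> L \<longleftrightarrow> (\<exists>u v s t. z = Lam u v s t \<and> (u, s) \<in> gauss \<int> \<and> (v, t) \<in> gauss \<int>)"
proof
  assume "z \<in> L"
  then obtain x :: "int vec" where x: "x \<in> carrier_vec 8" "z = P *\<^sub>v map_vec complex_of_int x" by (auto simp: L_def)
  let ?x = "map_vec real_of_int x"
  have "map_vec complex_of_int x = map_vec complex_of_real ?x" by (intro eq_vecI) auto
  then have "z = Lam (U ?x) (V ?x) (S ?x) (T ?x)" using x P_vec[of ?x] by simp
  moreover have "(U ?x, S ?x) \<in> gauss \<int>" "(V ?x, T ?x) \<in> gauss \<int>"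
    using x(1) by (auto simp: gauss_def U_def V_def S_def T_def intro!: quadI)
  ultimately show "\<exists>u v s t. z = Lam u v s t \<and> (u, s) \<in> gauss \<int> \<and> (v, t) \<in> gauss \<int>" by blast
next
  assume "\<exists>u v s t. z = Lam u v s t \<and> (u, s) \<in> gauss \<int> \<and> (v, t) \<in> gauss \<int>"
  then obtain u v s t where z: "z = Lam u v s t" and us: "(u, s) \<in> gauss \<int>" and vt: "(v, t) \<in> gauss \<int>" by blast
  have int: "\<exists>p q. x = of_int p + of_int q * sqrt 2 \<and> y = of_int p - of_int q * sqrt 2" if "(x, y) \<in> quad \<int>" for x y
    using that by (elim quadE Ints_cases) auto
  obtain p0 p1 where p: "Re u = of_int p0 + of_int p1 * sqrt 2" "Re s = of_int p0 - of_int p1 * sqrt 2"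
    using int[of "Re u" "Re s"] us by (auto simp: gauss_def)
  obtain p2 p3 where p': "Im u = of_int p2 + of_int p3 * sqrt 2" "Im s = of_int p2 - of_int p3 * sqrt 2"
    using int[of "Im u" "Im s"] us by (auto simp: gauss_def)
  obtain p4 p5 where q: "Re v = of_int p4 + of_int p5 * sqrt 2" "Re t = of_int p4 - of_int p5 * sqrt 2"
    using int[of "Re v" "Re t"] vt by (auto simp: gauss_def)
  obtain p6 p7 where q': "Im v = of_int p6 + of_int p7 * sqrt 2" "Im t = of_int p6 - of_int p7 * sqrt 2"
    using int[of "Im v" "Im t"] vt by (auto simp: gauss_def)
  define x where "x = vec 8 (\<lambda>i. [p0, p1, p2, p3, p4, p5, p6, p7] ! i)"
  let ?x = "map_vec real_of_int x"
  have x: "x \<in> carrier_vec 8" by (simp add: x_def)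
  have "U ?x = u" "V ?x = v" "S ?x = s" "T ?x = t"
    by (simp_all add: U_def V_def S_def T_def x_def complex_eq_iff p p' q q')
  moreover have "map_vec complex_of_int x = map_vec complex_of_real ?x" by (intro eq_vecI) auto
  ultimately have "P *\<^sub>v map_vec complex_of_int x = z" using P_vec[of ?x] x z by simp
  then show "z \<in> L" unfolding L_def using x by blast
qed

lemma quaternions_int_lattice_mats: "quaternions \<int> \<subseteq> lattice_mats"
proof
  fix A assume "A \<in> quaternions \<int>"
  then obtain u v s t where a: "A = rho u v s t" "(u, s) \<in> gauss \<int>" "(v, t) \<in> gauss \<int>" by (rule quaternionsE)
  have R: "\<int> = \<int> \<or> \<int> = \<rat>" by simp
  have "A *\<^sub>v z \<in> L" if "z \<in> L" for z
  proof -
    from that obtain u' v' s' t' where z: "z = Lam u' v' s' t'" "(u', s') \<in> gauss \<int>" "(v', t') \<in> gauss \<int>"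
      unfolding L_iff by blast
    have "(u * u' + of_real \<beta>1 * cnj v * v', s * s' + of_real \<beta>2 * cnj t * t') \<in> gauss \<int>"
      "(v * u' + cnj u * v', t * s' + cnj s * t') \<in> gauss \<int>"
      using quaternions_closed(3)[OF R quaternionsI[OF a(2,3)] quaternionsI[OF z(2,3)]]
      unfolding rho_mult rho_quaternions_iff by blast+
    then show ?thesis unfolding L_iff a(1) z(1) rho_Lam by blast
  qed
  then show "A \<in> lattice_mats" using a(1) by (simp add: lattice_mats_def)
qed

lemma quaternions_rat_End_Q:
  assumes A: "A \<in> quaternions \<rat>" shows "A \<in> carrier (End_Q 4 L)"
proof -
  obtain u v s t where a: "A = rho u v s t" "(u, s) \<in> gauss \<rat>" "(v, t) \<in> gauss \<rat>" using A by (rule quaternionsE)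
  obtain k where k: "k > 0" "(of_nat k * u, of_nat k * s) \<in> gauss \<int>" by (rule gauss_clear_denominator[OF a(2)]) blast
  obtain l where l: "l > 0" "(of_nat l * v, of_nat l * t) \<in> gauss \<int>" by (rule gauss_clear_denominator[OF a(3)]) blast
  let ?n = "k * l"
  have "(of_nat ?n * u, of_nat ?n * s) \<in> gauss \<int>" "(of_nat ?n * v, of_nat ?n * t) \<in> gauss \<int>"
    using gauss_int_scale[OF k(2), of l] gauss_int_scale[OF l(2), of k] by (auto simp: mult_ac)
  moreover have "of_nat ?n \<cdot>\<^sub>m A = rho (of_nat ?n * u) (of_nat ?n * v) (of_nat ?n * s) (of_nat ?n * t)"
    using rho_smult_real[of "of_nat ?n" u v s t] by (simp add: a(1))
  ultimately have "of_nat ?n \<cdot>\<^sub>m A \<in> quaternions \<int>" by (auto intro!: quaternionsI)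
  then have "of_nat ?n \<cdot>\<^sub>m A \<in> lattice_mats" using quaternions_int_lattice_mats by blast
  moreover have "?n > 0" using k l by simp
  moreover have "A \<in> carrier_mat 4 4" unfolding a(1) by (rule rho_carrier)
  ultimately show ?thesis unfolding End_Q_carrier by blast
qed

section \<open>The endomorphism algebra is not larger than the quaternion algebra\<close>

text \<open>Sorted by powers of \<open>\<xi>\<close>, all coefficients lie in \<rat>(\<surd>2), so
  each vanishes. The fourth power occurs only in \<open>nt\<close> and isolates \<open>m 3\<close>;
  the other coefficients then split by the independence of 1 and \<surd>2.\<close>

lemma generic_int:
  fixes m :: "nat \<Rightarrow> int"
  assumes eq: "m 2 - m 3 * (\<beta>2 * nt / sqrt 2) - m 4 * \<xi>\<^sup>2 + m 5 * (\<xi>\<^sup>2 / sqrt 2) + m 6 * \<xi> - m 7 * (\<xi> / sqrt 2) = 0"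
  shows "m 2 = 0" "m 3 = 0" "m 4 = 0" "m 5 = 0" "m 6 = 0" "m 7 = 0"
proof -
  let ?F = "fst ` quad \<rat>"
  have cl: "x + y \<in> ?F" "x - y \<in> ?F" "x * y \<in> ?F" "- x \<in> ?F" if "x \<in> ?F" "y \<in> ?F" for x y
  proof -
    from that obtain x' y' where "(x, x') \<in> quad \<rat>" "(y, y') \<in> quad \<rat>" by force
    from quad_closed[OF _ this] show "x + y \<in> ?F" "x - y \<in> ?F" "x * y \<in> ?F" "- x \<in> ?F" by (force intro: rev_image_eqI)+
  qed
  have int: "real_of_int k \<in> ?F" for k using quad_const[of "real_of_int k" \<rat>] by (force intro: rev_image_eqI)
  have inv: "1 / sqrt 2 \<in> ?F"
  proof -
    have "(0 + 1 / 2 * sqrt 2, 0 - 1 / 2 * sqrt 2) \<in> quad \<rat>" by (rule quadI) auto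
    moreover have "1 / sqrt 2 = 1 / 2 * sqrt 2" by (simp add: real_div_sqrt field_simps)
    ultimately show ?thesis by (force intro: rev_image_eqI)
  qed
  have b: "\<beta>2 \<in> ?F" using quadI[of 3 \<rat> "-1"] by (force simp: \<beta>2_def intro: rev_image_eqI)
  define d where "d = - m 3 * (\<beta>2 * (1 / sqrt 2))"
  define c where "c = d - m 4 + m 5 * (1 / sqrt 2)"
  define e where "e = m 6 - m 7 * (1 / sqrt 2)"
  have "d \<in> ?F" unfolding d_def by (intro cl int b inv)
  moreover from this have "c \<in> ?F" unfolding c_def by (intro cl int inv)
  moreover have "e \<in> ?F" unfolding e_def by (intro cl int inv)
  moreover have "m 2 + e * \<xi> + c * \<xi> ^ 2 + d * \<xi> ^ 4 = 0"
    using eq by (simp add: c_def d_def e_def nt_def algebra_simps add_divide_distrib)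
  ultimately have z: "real_of_int (m 2) = 0" "e = 0" "c = 0" "d = 0" using generic[OF int[of "m 2"]] by blast+
  show "m 2 = 0" using z(1) by simp
  show m3: "m 3 = 0" using z(4) \<beta>_pos by (simp add: d_def)
  have r: "x * (1 / sqrt 2) = x / 2 * sqrt 2" for x :: real by (simp add: real_div_sqrt field_simps)
  have "- m 4 + m 5 / 2 * sqrt 2 = 0" using z(3,4) r[of "m 5"] by (simp add: c_def)
  then have "- real_of_int (m 4) = 0 \<and> m 5 / 2 = 0" by (intro rational_combination_zero) auto
  then show "m 4 = 0" "m 5 = 0" by auto
  have "m 6 + (- m 7 / 2) * sqrt 2 = 0" using z(2) r[of "m 7"] by (simp add: e_def)
  then have "real_of_int (m 6) = 0 \<and> - m 7 / 2 = 0" by (intro rational_combination_zero) auto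
  then show "m 6 = 0" "m 7 = 0" by auto
qed

definition vec8 :: "real list \<Rightarrow> real vec" where "vec8 xs = vec 8 (\<lambda>i. xs ! i)"

text \<open>
  The real coordinates of \<open>\<i> \<cdot> \<Lambda>(1)\<close> are, apart from the vanishing first two, linearly independent
  over \<open>\<rat>\<close>.  So an endomorphism that kills \<open>\<Lambda>(1)\<close>, hence \<open>\<i> \<cdot> \<Lambda>(1)\<close>, kills all pure
  quaternions, and by the same relation multiplied by \<open>i\<close> it kills \<open>\<surd>2\<close> as well.
\<close>

lemma lattice_mat_zero_if_kills_one:
  assumes C: "C \<in> lattice_mats" and z: "C *\<^sub>v Lam 1 0 1 0 = 0\<^sub>v 4"
  shows "C = 0\<^sub>m 4 4"
proof -
  have Cc: "C \<in> carrier_mat 4 4" by (rule lattice_mats_carrier[OF C])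
  obtain M where M: "M \<in> carrier_mat 8 8" and CM: "C * P = P * map_mat complex_of_int M" by (rule rational_rep[OF C])
  let ?R = "map_mat real_of_int M"
  have MR: "?R \<in> carrier_mat 8 8" using M by simp
  have app: "C *\<^sub>v (P *\<^sub>v map_vec complex_of_real x) = P *\<^sub>v map_vec complex_of_real (?R *\<^sub>v x)"
    if x: "x \<in> carrier_vec 8" for x
  proof -
    have xc: "map_vec complex_of_real x \<in> carrier_vec 8" using x by simp
    have Mc: "map_mat complex_of_int M \<in> carrier_mat 8 8" using M by simp
    have "C *\<^sub>v (P *\<^sub>v map_vec complex_of_real x) = (C * P) *\<^sub>v map_vec complex_of_real x"
      by (rule assoc_mult_mat_vec[symmetric, OF Cc P_carrier xc])
    also have "\<dots> = P *\<^sub>v (map_mat complex_of_int M *\<^sub>v map_vec complex_of_real x)"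
      unfolding CM by (rule assoc_mult_mat_vec[OF P_carrier Mc xc])
    also have "map_mat complex_of_int M *\<^sub>v map_vec complex_of_real x = map_vec complex_of_real (?R *\<^sub>v x)"
      using M x by (intro eq_vecI) (auto simp: scalar_prod_def)
    finally show ?thesis .
  qed
  have kill: "(\<Sum>k<8. M $$ (i, k) * x $ k) = 0"
    if x: "x \<in> carrier_vec 8" "C *\<^sub>v Lam (U x) (V x) (S x) (T x) = 0\<^sub>v 4" and i: "i < 8" for x i
  proof -
    have "P *\<^sub>v map_vec complex_of_real (?R *\<^sub>v x) = 0\<^sub>v 4" using app[OF x(1)] x P_vec[OF x(1)] by simp
    then have "?R *\<^sub>v x = 0\<^sub>v 8" using MR x(1) by (intro P_inj) auto
    then have "(?R *\<^sub>v x) $ i = 0" using i by simp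
    then show ?thesis using index_mult_mat_vec_sum[OF MR x(1) i] M i by simp
  qed
  have smult_kill: "C *\<^sub>v (c \<cdot>\<^sub>v w) = 0\<^sub>v 4" if "w \<in> carrier_vec 4" "C *\<^sub>v w = 0\<^sub>v 4" for c w
    using mult_mat_vec[OF Cc that(1), of c] that(2) by auto
  have Lc: "Lam u v s t \<in> carrier_vec 4" for u v s t by (simp add: Lam_def)
  have i0: "M $$ (i, 0) = 0" if i: "i < 8" for i
  proof -
    have "(\<Sum>k<8. M $$ (i, k) * vec8 [1,0,0,0,0,0,0,0] $ k) = 0"
    proof (rule kill[OF _ _ i])
      have "U (vec8 [1,0,0,0,0,0,0,0]) = 1" "V (vec8 [1,0,0,0,0,0,0,0]) = 0"
        "S (vec8 [1,0,0,0,0,0,0,0]) = 1" "T (vec8 [1,0,0,0,0,0,0,0]) = 0"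
        by (simp_all add: U_def V_def S_def T_def vec8_def complex_eq_iff)
      then show "C *\<^sub>v Lam (U (vec8 [1,0,0,0,0,0,0,0])) (V (vec8 [1,0,0,0,0,0,0,0]))
          (S (vec8 [1,0,0,0,0,0,0,0])) (T (vec8 [1,0,0,0,0,0,0,0])) = 0\<^sub>v 4"
        using z by simp
    qed (simp add: vec8_def)
    then show ?thesis unfolding sum_8 by (simp add: vec8_def)
  qed
  have half: "a / sqrt 2 * sqrt 2 = a" for a :: real by simp
  have pure: "M $$ (i, 2) = 0 \<and> M $$ (i, 3) = 0 \<and> M $$ (i, 4) = 0 \<and> M $$ (i, 5) = 0 \<and> M $$ (i, 6) = 0 \<and> M $$ (i, 7) = 0"
    if i: "i < 8" for i
  proof -
    \<comment> \<open>Coordinates of \<open>\<delta> \<i>\<close> times \<open>Lam 1 0 1 0\<close>: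
      at the second place the quaternion is \<open>(1 + j \<tau>) i (1 - j \<tau>)\<close>. The
      factor \<open>\<delta>\<close> clears the inverse of \<open>1 + j \<tau>\<close> and makes the
      coordinate of i equal to 1.\<close>
    define x where "x = vec8 [0, 0, 1, - (\<beta>2 * nt / sqrt 2), - \<xi>\<^sup>2, \<xi>\<^sup>2 / sqrt 2, \<xi>, - (\<xi> / sqrt 2)]"
    have xv: "U x = of_real \<delta> * \<i>" "V x = 0" "S x = of_real (1 + \<beta>2 * nt) * \<i>" "T x = 2 * \<i> * \<tau>"
      by (simp_all add: U_def V_def S_def T_def x_def vec8_def complex_eq_iff half \<delta>_def \<tau>_def)
    have "Lam (U x) (V x) (S x) (T x) = (of_real \<delta> * \<i>) \<cdot>\<^sub>v Lam 1 0 1 0"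
    proof -
      have "of_real (1 + \<beta>2 * nt) * \<i> + of_real \<beta>2 * cnj (2 * \<i> * \<tau>) * \<tau>
          = of_real (1 + \<beta>2 * nt) * \<i> - of_real \<beta>2 * (2 * \<i>) * (\<tau> * cnj \<tau>)" by (simp add: algebra_simps)
      also have "\<dots> = of_real \<delta> * \<i>" unfolding tau_cnj \<delta>_def by (simp add: algebra_simps)
      finally have a: "of_real (1 + \<beta>2 * nt) * \<i> + of_real \<beta>2 * cnj (2 * \<i> * \<tau>) * \<tau> = of_real \<delta> * \<i>" .
      have b: "2 * \<i> * \<tau> + cnj (of_real (1 + \<beta>2 * nt) * \<i>) * \<tau> = of_real \<delta> * \<i> * \<tau>"
        by (simp add: \<delta>_def algebra_simps)
      show ?thesis unfolding xv Lam_def vec4_smult a b by simp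
    qed
    then have "C *\<^sub>v Lam (U x) (V x) (S x) (T x) = 0\<^sub>v 4" using smult_kill[OF Lc z] by simp
    then have "(\<Sum>k<8. M $$ (i, k) * x $ k) = 0" by (intro kill[OF _ _ i]) (simp_all add: x_def vec8_def)
    then have "M $$ (i, 2) - M $$ (i, 3) * (\<beta>2 * nt / sqrt 2) - M $$ (i, 4) * \<xi>\<^sup>2 + M $$ (i, 5) * (\<xi>\<^sup>2 / sqrt 2)
        + M $$ (i, 6) * \<xi> - M $$ (i, 7) * (\<xi> / sqrt 2) = 0"
      unfolding sum_8 by (simp add: x_def vec8_def)
    from generic_int[OF this] show ?thesis by blast
  qed
  have i1: "M $$ (i, 1) = 0" if i: "i < 8" for i
  proof -
    \<comment> \<open>The previous quaternion multiplied by i on the left. As the columns of 1 and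
      of the pure quaternions vanish, only the column of \<surd>2 remains.\<close>
    define x where "x = vec8 [-1, \<beta>2 * nt / sqrt 2, 0, 0, \<xi>, - (\<xi> / sqrt 2), \<xi>\<^sup>2, - (\<xi>\<^sup>2 / sqrt 2)]"
    have xv: "U x = - of_real \<delta>" "V x = 0" "S x = - of_real (1 + \<beta>2 * nt)" "T x = 2 * \<tau>"
      by (simp_all add: U_def V_def S_def T_def x_def vec8_def complex_eq_iff half \<delta>_def \<tau>_def)
    have k2: "C *\<^sub>v Lam \<i> 0 \<i> 0 = 0\<^sub>v 4"
    proof -
      let ?y = "vec8 [0,0,1,0,0,0,0,0]"
      have y: "?y \<in> carrier_vec 8" by (simp add: vec8_def)
      have "U ?y = \<i>" "V ?y = 0" "S ?y = \<i>" "T ?y = 0"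
        by (simp_all add: U_def V_def S_def T_def vec8_def complex_eq_iff)
      then have "C *\<^sub>v Lam \<i> 0 \<i> 0 = P *\<^sub>v map_vec complex_of_real (?R *\<^sub>v ?y)"
        using app[OF y] P_vec[OF y] by simp
      also have "?R *\<^sub>v ?y = 0\<^sub>v 8"
      proof (rule eq_vecI)
        fix l assume "l < dim_vec (0\<^sub>v 8 :: real vec)"
        then have l: "l < 8" by simp
        have "(?R *\<^sub>v ?y) $ l = (\<Sum>k<8. ?R $$ (l, k) * ?y $ k)" by (rule index_mult_mat_vec_sum[OF MR y l])
        then show "(?R *\<^sub>v ?y) $ l = 0\<^sub>v 8 $ l" unfolding sum_8 using pure[OF l] l M by (simp add: vec8_def)
      qed (use M in simp)
      also have "P *\<^sub>v map_vec complex_of_real (0\<^sub>v 8) = 0\<^sub>v 4"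
        using mult_mat_zero_vec[OF P_carrier] by (simp add: of_real_hom.vec_hom_zero)
      finally show ?thesis .
    qed
    have "Lam (U x) (V x) (S x) (T x) = (of_real \<delta> * \<i>) \<cdot>\<^sub>v Lam \<i> 0 \<i> 0"
    proof -
      have "- of_real (1 + \<beta>2 * nt) + of_real \<beta>2 * cnj (2 * \<tau>) * \<tau>
          = - of_real (1 + \<beta>2 * nt) + of_real \<beta>2 * 2 * (\<tau> * cnj \<tau>)" by (simp add: algebra_simps)
      also have "\<dots> = - of_real \<delta>" unfolding tau_cnj \<delta>_def by (simp add: algebra_simps)
      finally have a: "- of_real (1 + \<beta>2 * nt) + of_real \<beta>2 * cnj (2 * \<tau>) * \<tau> = - of_real \<delta>" .
      have b: "2 * \<tau> + cnj (- of_real (1 + \<beta>2 * nt)) * \<tau> = of_real \<delta> * \<tau>"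
        by (simp add: \<delta>_def algebra_simps)
      show ?thesis unfolding xv Lam_def vec4_smult a b by (simp add: mult.assoc)
    qed
    then have "C *\<^sub>v Lam (U x) (V x) (S x) (T x) = 0\<^sub>v 4" using smult_kill[OF Lc k2] by simp
    then have "(\<Sum>k<8. M $$ (i, k) * x $ k) = 0" by (intro kill[OF _ _ i]) (simp_all add: x_def vec8_def)
    then have "M $$ (i, 1) * (\<beta>2 * nt / sqrt 2) = 0"
      unfolding sum_8 using i0[OF i] pure[OF i] by (simp add: x_def vec8_def)
    moreover have "\<beta>2 * nt / sqrt 2 \<noteq> 0" using \<beta>_pos nt_bounds by simp
    ultimately show ?thesis by simp
  qed
  have M0: "M $$ (i, k) = 0" if "i < 8" "k < 8" for i k
    using less_8_cases[OF that(2)] i0[OF that(1)] i1[OF that(1)] pure[OF that(1)] by (elim disjE) simp_all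
  show ?thesis
  proof (rule mat_eqI_mult_vec[OF Cc])
    fix v :: "complex vec" assume v: "v \<in> carrier_vec 4"
    obtain x where x: "x \<in> carrier_vec 8" "v = P *\<^sub>v map_vec complex_of_real x" using v P_surj by blast
    have "?R *\<^sub>v x = 0\<^sub>v 8" using M x M0 by (intro eq_vecI) (auto simp: scalar_prod_def)
    then have "C *\<^sub>v v = 0\<^sub>v 4" unfolding x(2) app[OF x(1)]
      using mult_mat_zero_vec[OF P_carrier] by (simp add: of_real_hom.vec_hom_zero)
    then show "C *\<^sub>v v = 0\<^sub>m 4 4 *\<^sub>v v" using v by auto
  qed simp
qed

text \<open>An endomorphism agrees on \<open>Lam 1 0 1 0\<close> with left multiplication by the
  quaternion that represents its image there, so the difference kills this vector.\<close>

lemma lattice_mats_quaternions: "lattice_mats \<subseteq> quaternions \<int>"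
proof
  fix A assume A: "A \<in> lattice_mats"
  have "Lam 1 0 1 0 \<in> L" unfolding L_iff using gauss_const[of \<int>] by blast
  then have "A *\<^sub>v Lam 1 0 1 0 \<in> L" using A by (simp add: lattice_mats_def)
  then obtain u v s t where e: "A *\<^sub>v Lam 1 0 1 0 = Lam u v s t" and us: "(u, s) \<in> gauss \<int>" "(v, t) \<in> gauss \<int>"
    unfolding L_iff by blast
  let ?B = "rho u v s t"
  have B: "?B \<in> quaternions \<int>" using us by (rule quaternionsI)
  have Ac: "A \<in> carrier_mat 4 4" by (rule lattice_mats_carrier[OF A])
  have "A - ?B = 0\<^sub>m 4 4"
  proof (rule lattice_mat_zero_if_kills_one)
    show "A - ?B \<in> lattice_mats" using minus_lattice_mats[OF A] B quaternions_int_lattice_mats by blast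
    have Lc: "Lam 1 0 1 0 \<in> carrier_vec 4" by (simp add: Lam_def)
    have "(A - ?B) *\<^sub>v Lam 1 0 1 0 = A *\<^sub>v Lam 1 0 1 0 - ?B *\<^sub>v Lam 1 0 1 0"
      by (rule minus_mult_distrib_mat_vec[OF Ac rho_carrier Lc])
    also have "\<dots> = Lam u v s t - Lam u v s t" unfolding e Lam_eq_rho[symmetric] ..
    also have "\<dots> = 0\<^sub>v 4" by (simp add: Lam_def)
    finally show "(A - ?B) *\<^sub>v Lam 1 0 1 0 = 0\<^sub>v 4" .
  qed
  have "A = ?B"
  proof (rule eq_matI)
    fix i j assume "i < dim_row ?B" "j < dim_col ?B"
    then have ij: "i < 4" "j < 4" by (auto simp: rho_def)
    have "(A - ?B) $$ (i, j) = 0" using \<open>A - ?B = 0\<^sub>m 4 4\<close> ij by simp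
    then show "A $$ (i, j) = ?B $$ (i, j)" using ij Ac carrier_matD[OF rho_carrier[of u v s t]] by simp
  qed (use Ac carrier_matD[OF rho_carrier[of u v s t]] in auto)
  then show "A \<in> quaternions \<int>" using B by simp
qed

lemma End_Q_eq: "carrier (End_Q 4 L) = quaternions \<rat>"
proof (intro equalityI subsetI)
  fix A assume "A \<in> carrier (End_Q 4 L)"
  then obtain n :: nat where A: "A \<in> carrier_mat 4 4" "n > 0" "of_nat n \<cdot>\<^sub>m A \<in> lattice_mats"
    unfolding End_Q_carrier by blast
  then have "of_nat n \<cdot>\<^sub>m A \<in> quaternions \<int>" using lattice_mats_quaternions by blast
  then obtain u v s t where e: "of_nat n \<cdot>\<^sub>m A = rho u v s t" "(u, s) \<in> gauss \<int>" "(v, t) \<in> gauss \<int>"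
    by (rule quaternionsE)
  have "A = complex_of_real (1 / n) \<cdot>\<^sub>m (of_nat n \<cdot>\<^sub>m A)" using A(2) by (intro eq_matI) auto
  also have "\<dots> = rho (of_real (1 / n) * u) (of_real (1 / n) * v) (of_real (1 / n) * s) (of_real (1 / n) * t)"
    unfolding e(1) by (rule rho_smult_real)
  finally have a: "A = rho (of_real (1 / n) * u) (of_real (1 / n) * v) (of_real (1 / n) * s) (of_real (1 / n) * t)" .
  have "(complex_of_real (1 / n), complex_of_real (1 / n)) \<in> gauss \<rat>"
    by (intro gauss_of_real quad_const) auto
  moreover have "(u, s) \<in> gauss \<rat>" "(v, t) \<in> gauss \<rat>" using e gauss_int_subset by auto
  ultimately show "A \<in> quaternions \<rat>" unfolding a by (intro quaternionsI gauss_closed(4)) auto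
qed (rule quaternions_rat_End_Q)

end

section \<open>The quaternion structure and its real places\<close>

lemma ring_of_matrices:
  fixes C :: "complex mat set"
  assumes C: "C \<subseteq> carrier_mat g g" "1\<^sub>m g \<in> C" "0\<^sub>m g g \<in> C"
    and closed: "\<And>A B. A \<in> C \<Longrightarrow> B \<in> C \<Longrightarrow> A + B \<in> C" "\<And>A B. A \<in> C \<Longrightarrow> B \<in> C \<Longrightarrow> A - B \<in> C"
      "\<And>A B. A \<in> C \<Longrightarrow> B \<in> C \<Longrightarrow> A * B \<in> C"
    and R: "carrier R = C" "mult R = (*)" "add R = (+)" "one R = 1\<^sub>m g" "zero R = 0\<^sub>m g g"
  shows "ring R"
proof -
  have car: "A \<in> carrier_mat g g" if "A \<in> C" for A using C(1) that by blast
  show ?thesis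
  proof (rule ringI)
  show "abelian_group R"
  proof (rule abelian_groupI)
    fix A assume A: "A \<in> carrier R"
    then have Ac: "A \<in> carrier_mat g g" using car R by simp
    show "\<exists>B\<in>carrier R. B \<oplus>\<^bsub>R\<^esub> A = \<zero>\<^bsub>R\<^esub>"
    proof (rule bexI)
      show "(0\<^sub>m g g - A) \<oplus>\<^bsub>R\<^esub> A = \<zero>\<^bsub>R\<^esub>" unfolding R using Ac by (intro eq_matI) auto
      show "0\<^sub>m g g - A \<in> carrier R" using A C closed R by simp
    qed
  qed (use car closed C in \<open>auto simp: R intro: comm_add_mat[of _ g g] assoc_add_mat[of _ g g]\<close>)
  show "monoid R"
    by (rule monoidI) (use car closed C in \<open>auto simp: R left_mult_one_mat[of _ g g] right_mult_one_mat[of _ g g]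
      intro: assoc_mult_mat[of _ g g _ g _ g]\<close>)
qed (use car C in \<open>auto simp: R intro: add_mult_distrib_mat[of _ g g _ _ g] mult_add_distrib_mat[of _ g g _ g]\<close>)
qed

text \<open>i goes to the rotation by a right angle and j to \<open>s\<close> times the reflection
  \<open>diag(1, -1)\<close>, where \<open>s\<close> is the square root of
  \<open>\<gamma>\<close>.\<close>

lemma real_quat_split:
  fixes \<gamma> :: real
  assumes \<gamma>: "\<gamma> > 0"
  shows "real_quat (-1) \<gamma> \<simeq> ring_mat TYPE(real) 2 ()"
proof -
  obtain s where s: "s > 0" "\<gamma> = s * s" using \<gamma> real_sqrt_gt_zero[of \<gamma>] real_sqrt_mult_self[of \<gamma>] by fastforce
  define h :: "real \<times> real \<times> real \<times> real \<Rightarrow> real mat" where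
    "h = (\<lambda>(a, b, c, d). mat 2 2 (\<lambda>(i, j).
      [[a + s * c, s * d - b], [b + s * d, a - s * c]] ! i ! j))"
  have less2: "i < (2::nat) \<Longrightarrow> i = 0 \<or> i = 1" for i by auto
  have hc: "h x \<in> carrier_mat 2 2" for x by (cases x) (simp add: h_def)
  have hi: "h (a, b, c, d) $$ (0, 0) = a + s * c" "h (a, b, c, d) $$ (0, Suc 0) = s * d - b"
    "h (a, b, c, d) $$ (Suc 0, 0) = b + s * d" "h (a, b, c, d) $$ (Suc 0, Suc 0) = a - s * c" for a b c d
    by (simp_all add: h_def)
  have eqI: "A = B" if "A \<in> carrier_mat 2 2" "B \<in> carrier_mat 2 2" "A $$ (0, 0) = B $$ (0, 0)"
    "A $$ (0, Suc 0) = B $$ (0, Suc 0)" "A $$ (Suc 0, 0) = B $$ (Suc 0, 0)" "A $$ (Suc 0, Suc 0) = B $$ (Suc 0, Suc 0)"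
    for A B :: "real mat"
    using that by (intro eq_matI) (auto dest!: less2)
  have mult2: "(A * B) $$ (i, j) = A $$ (i, 0) * B $$ (0, j) + A $$ (i, Suc 0) * B $$ (Suc 0, j)"
    if "A \<in> carrier_mat 2 2" "B \<in> carrier_mat 2 2" "i < 2" "j < 2" for A B :: "real mat" and i j
    using that by (simp add: scalar_prod_def numeral_2_eq_2)
  have add2: "(A + B) $$ (i, j) = A $$ (i, j) + B $$ (i, j)"
    if "A \<in> carrier_mat 2 2" "B \<in> carrier_mat 2 2" "i < 2" "j < 2" for A B :: "real mat" and i j
    using that by simp
  have "h \<in> ring_hom (real_quat (-1) (s * s)) (ring_mat TYPE(real) 2 ())"
  proof (rule ring_hom_memI)
    fix x y :: "real \<times> real \<times> real \<times> real"
    obtain a b c d where x: "x = (a, b, c, d)" by (rule prod_cases4)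
    obtain a' b' c' d' where y: "y = (a', b', c', d')" by (rule prod_cases4)
    show "h x \<in> carrier (ring_mat TYPE(real) 2 ())" using hc by (simp add: ring_mat_def)
    have "h (x \<otimes>\<^bsub>real_quat (-1) (s * s)\<^esub> y) = h x * h y"
    proof (rule eqI)
      show "h x * h y \<in> carrier_mat 2 2" by (rule mult_carrier_mat[OF hc hc])
      show "(h (x \<otimes>\<^bsub>real_quat (-1) (s * s)\<^esub> y)) $$ (0, 0) = (h x * h y) $$ (0, 0)"
        "(h (x \<otimes>\<^bsub>real_quat (-1) (s * s)\<^esub> y)) $$ (0, Suc 0) = (h x * h y) $$ (0, Suc 0)"
        "(h (x \<otimes>\<^bsub>real_quat (-1) (s * s)\<^esub> y)) $$ (Suc 0, 0) = (h x * h y) $$ (Suc 0, 0)"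
        "(h (x \<otimes>\<^bsub>real_quat (-1) (s * s)\<^esub> y)) $$ (Suc 0, Suc 0) = (h x * h y) $$ (Suc 0, Suc 0)"
        by (simp_all add: mult2[OF hc hc] del: index_mult_mat) (simp_all add: x y real_quat_simps hi, simp_all add: algebra_simps)
    qed (rule hc)
    then show "h (x \<otimes>\<^bsub>real_quat (-1) (s * s)\<^esub> y) = h x \<otimes>\<^bsub>ring_mat TYPE(real) 2 ()\<^esub> h y"
      by (simp add: ring_mat_def)
    have "h (x \<oplus>\<^bsub>real_quat (-1) (s * s)\<^esub> y) = h x + h y"
    proof (rule eqI)
      show "h x + h y \<in> carrier_mat 2 2" by (rule add_carrier_mat[OF hc])
    qed (simp_all add: hc add2[OF hc hc] del: index_add_mat, simp_all add: x y real_quat_simps hi algebra_simps)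
    then show "h (x \<oplus>\<^bsub>real_quat (-1) (s * s)\<^esub> y) = h x \<oplus>\<^bsub>ring_mat TYPE(real) 2 ()\<^esub> h y"
      by (simp add: ring_mat_def)
  next
    have "h \<one>\<^bsub>real_quat (-1) (s * s)\<^esub> = 1\<^sub>m 2"
      by (rule eqI) (simp_all add: hc, simp_all add: real_quat_simps hi)
    then show "h \<one>\<^bsub>real_quat (-1) (s * s)\<^esub> = \<one>\<^bsub>ring_mat TYPE(real) 2 ()\<^esub>" by (simp add: ring_mat_def)
  qed
  moreover have "bij_betw h (carrier (real_quat (-1) (s * s))) (carrier (ring_mat TYPE(real) 2 ()))"
  proof (rule bij_betwI)
    let ?k = "\<lambda>A :: real mat. ((A $$ (0, 0) + A $$ (Suc 0, Suc 0)) / 2, (A $$ (Suc 0, 0) - A $$ (0, Suc 0)) / 2,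
      (A $$ (0, 0) - A $$ (Suc 0, Suc 0)) / (2 * s), (A $$ (Suc 0, 0) + A $$ (0, Suc 0)) / (2 * s))"
    have sg: "s \<noteq> 0" using s by simp
    show "h \<in> carrier (real_quat (-1) (s * s)) \<rightarrow> carrier (ring_mat TYPE(real) 2 ())"
      using hc by (simp add: ring_mat_def)
    show "?k \<in> carrier (ring_mat TYPE(real) 2 ()) \<rightarrow> carrier (real_quat (-1) (s * s))"
      by (simp add: real_quat_simps)
    show "?k (h x) = x" for x
    proof -
      obtain a b c d where x: "x = (a, b, c, d)" by (rule prod_cases4)
      show ?thesis unfolding x hi using sg by simp
    qed
    show "h (?k A) = A" if "A \<in> carrier (ring_mat TYPE(real) 2 ())" for A
      using that sg by (intro eqI) (auto simp: hc ring_mat_def hi field_simps)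
  qed
  ultimately show ?thesis unfolding s(2) by (auto simp: is_ring_iso_def ring_iso_def)
qed

context quaternionic_lattice
begin

abbreviation K :: "complex mat ring" where "K \<equiv> End_Q 4 L"

lemma rat_or: "\<int> = (\<int> :: real set) \<or> \<int> = (\<rat> :: real set)" "\<rat> = (\<int> :: real set) \<or> \<rat> = (\<rat> :: real set)"
  by auto

definition phi :: "real \<Rightarrow> real \<Rightarrow> complex mat" where
  "phi x y = rho (of_real x) 0 (of_real y) 0"

definition centre :: "complex mat set" where
  "centre = {phi x y | x y. (x, y) \<in> quad \<rat>}"

lemma phi_add: "phi x y + phi x' y' = phi (x + x') (y + y')"
  by (simp add: phi_def rho_add)

lemma phi_minus: "phi x y - phi x' y' = phi (x - x') (y - y')"
  by (simp add: phi_def rho_minus)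

lemma phi_rho: "phi x y * rho u v s t = rho (of_real x * u) (of_real x * v) (of_real y * s) (of_real y * t)"
  by (simp add: phi_def rho_mult)

lemma rho_phi: "rho u v s t * phi x y = rho (of_real x * u) (of_real x * v) (of_real y * s) (of_real y * t)"
  by (simp add: phi_def rho_mult mult_ac)

lemma phi_mult: "phi x y * phi x' y' = phi (x * x') (y * y')"
  by (simp add: phi_def rho_mult)

lemma phi_one: "phi 1 1 = 1\<^sub>m 4"
  by (simp add: phi_def rho_one)

lemma phi_zero: "phi 0 0 = 0\<^sub>m 4 4"
  by (simp add: phi_def rho_zero)

lemma phi_eq_iff: "phi x y = phi x' y' \<longleftrightarrow> x = x' \<and> y = y'"
  by (simp add: phi_def rho_eq_iff)

lemma phi_centre: "(x, y) \<in> quad \<rat> \<Longrightarrow> phi x y \<in> centre"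
  by (auto simp: centre_def)

lemma centreE:
  assumes "A \<in> centre" obtains x y where "A = phi x y" "(x, y) \<in> quad \<rat>"
  using assms by (auto simp: centre_def)

lemma rat_quad: "r \<in> \<rat> \<Longrightarrow> (r, r) \<in> quad \<rat>"
  by (rule quad_const) auto

lemma centre_sub: "centre \<subseteq> carrier K"
proof
  fix A assume "A \<in> centre"
  then obtain x y where A: "A = phi x y" "(x, y) \<in> quad \<rat>" by (rule centreE)
  show "A \<in> carrier K" unfolding A End_Q_eq phi_def rho_quaternions_iff
    using gauss_of_real[OF rat_or(2) A(2)] gauss_const[OF rat_or(2)] by simp
qed

lemma K_simps: "mult K = (*)" "add K = (+)" "one K = 1\<^sub>m 4" "zero K = 0\<^sub>m 4 4"
  by (rule End_Q_simps)+

lemma ring_K: "ring K"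
proof (rule ring_of_matrices[OF _ _ _ _ _ _ End_Q_eq K_simps])
  show "quaternions \<rat> \<subseteq> carrier_mat 4 4" by (auto simp: quaternions_def)
  show "1\<^sub>m 4 \<in> quaternions \<rat>" "0\<^sub>m 4 4 \<in> quaternions \<rat>"
    unfolding rho_one[symmetric] rho_zero[symmetric] rho_quaternions_iff
    using gauss_const[OF rat_or(2)] by auto
qed (use quaternions_closed[OF rat_or(2)] in auto)

abbreviation F :: "complex mat ring" where "F \<equiv> K\<lparr>carrier := centre\<rparr>"

lemma ring_F: "ring F"
proof (rule ring_of_matrices[where C = centre and g = 4])
  show "centre \<subseteq> carrier_mat 4 4" using centre_sub End_Q_mat by blast
  show "1\<^sub>m 4 \<in> centre" "0\<^sub>m 4 4 \<in> centre"
    unfolding phi_one[symmetric] phi_zero[symmetric] by (intro phi_centre rat_quad; simp)+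
  fix A B assume "A \<in> centre" "B \<in> centre"
  then obtain x y x' y' where "A = phi x y" "(x, y) \<in> quad \<rat>" "B = phi x' y'" "(x', y') \<in> quad \<rat>"
    by (elim centreE) blast
  then show "A + B \<in> centre" "A - B \<in> centre" "A * B \<in> centre"
    by (auto simp: phi_add phi_minus phi_mult intro!: phi_centre quad_closed)
qed (simp_all add: K_simps)

lemma field_F: "field F"
proof -
  interpret F: ring F by (rule ring_F)
  have comm: "A * B = B * A" if "A \<in> centre" "B \<in> centre" for A B
    using that by (elim centreE) (simp add: phi_mult mult.commute)
  interpret F: cring F
    by unfold_locales (simp add: K_simps comm)
  show ?thesis
  proof (rule F.cring_fieldI2)
    show "\<zero>\<^bsub>F\<^esub> \<noteq> \<one>\<^bsub>F\<^esub>"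
      using phi_eq_iff[of 0 0 1 1] by (simp add: K_simps phi_one phi_zero)
    fix A assume A: "A \<in> carrier F" "A \<noteq> \<zero>\<^bsub>F\<^esub>"
    then obtain x y where xy: "A = phi x y" "(x, y) \<in> quad \<rat>" by (auto elim: centreE)
    have x: "x \<noteq> 0" using A xy quad_zero_iff[OF xy(2)] phi_zero by (auto simp: K_simps)
    then have y: "y \<noteq> 0" using quad_zero_iff[OF xy(2)] by simp
    show "\<exists>B\<in>carrier F. A \<otimes>\<^bsub>F\<^esub> B = \<one>\<^bsub>F\<^esub>"
    proof (rule bexI)
      show "A \<otimes>\<^bsub>F\<^esub> phi (1 / x) (1 / y) = \<one>\<^bsub>F\<^esub>" using x y by (simp add: xy K_simps phi_mult phi_one)
      show "phi (1 / x) (1 / y) \<in> carrier F" using quad_inverse[OF xy(2) x] by (simp add: phi_centre)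
    qed
  qed
qed

interpretation F: field F by (rule field_F)

abbreviation prime_field :: "complex mat set" where "prime_field \<equiv> generate_field F {\<one>\<^bsub>F\<^esub>}"

lemma one_F: "\<one>\<^bsub>F\<^esub> = phi 1 1" "\<one>\<^bsub>K\<^esub> = phi 1 1" and zero_F: "\<zero>\<^bsub>F\<^esub> = phi 0 0" "\<zero>\<^bsub>K\<^esub> = phi 0 0"
  by (simp_all add: K_simps phi_one phi_zero)

lemma F_ops: "phi x y \<otimes>\<^bsub>F\<^esub> phi x' y' = phi (x * x') (y * y')" "phi x y \<oplus>\<^bsub>F\<^esub> phi x' y' = phi (x + x') (y + y')"
  "phi x y \<otimes>\<^bsub>K\<^esub> phi x' y' = phi (x * x') (y * y')" "phi x y \<oplus>\<^bsub>K\<^esub> phi x' y' = phi (x + x') (y + y')"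
  by (simp_all add: K_simps phi_mult phi_add)

lemma prime_field_sub:
  assumes "A \<in> prime_field" shows "\<exists>r\<in>\<rat>. A = phi r r"
  using assms
proof induction
  case one
  then show ?case unfolding one_F by (intro bexI[of _ 1]) auto
next
  case (incl h)
  then show ?case unfolding one_F by (intro bexI[of _ 1]) auto
next
  case (a_inv h)
  then obtain r where r: "r \<in> \<rat>" "h = phi r r" by blast
  have "\<ominus>\<^bsub>F\<^esub> h = phi (- r) (- r)"
    by (rule F.minus_equality) (use r in \<open>auto simp: F_ops zero_F intro!: phi_centre rat_quad\<close>)
  then show ?case using r by (intro bexI[of _ "- r"]) auto
next
  case (m_inv h)
  then obtain r where r: "r \<in> \<rat>" "h = phi r r" by blast
  then have r0: "r \<noteq> 0" using m_inv zero_F by auto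
  have "inv\<^bsub>F\<^esub> h = phi (1 / r) (1 / r)"
    by (rule F.comm_inv_char) (use r r0 in \<open>auto simp: F_ops one_F intro!: phi_centre rat_quad\<close>)
  then show ?case using r by (intro bexI[of _ "1 / r"]) auto
next
  case (eng_add h k)
  then obtain r s where "r \<in> \<rat>" "h = phi r r" "s \<in> \<rat>" "k = phi s s" by blast
  then show ?case by (intro bexI[of _ "r + s"]) (auto simp: F_ops)
next
  case (eng_mult h k)
  then obtain r s where "r \<in> \<rat>" "h = phi r r" "s \<in> \<rat>" "k = phi s s" by blast
  then show ?case by (intro bexI[of _ "r * s"]) (auto simp: F_ops)
qed

lemma prime_field_nat: "phi (of_nat n) (of_nat n) \<in> prime_field"
proof (induction n)
  case 0
  have "\<ominus>\<^bsub>F\<^esub> \<one>\<^bsub>F\<^esub> \<in> prime_field" by (intro generate_field.a_inv generate_field.one)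
  then have "\<one>\<^bsub>F\<^esub> \<oplus>\<^bsub>F\<^esub> \<ominus>\<^bsub>F\<^esub> \<one>\<^bsub>F\<^esub> \<in> prime_field" by (intro generate_field.eng_add generate_field.one)
  then show ?case unfolding F.r_neg[OF F.one_closed] unfolding zero_F by simp
next
  case (Suc n)
  have "phi (of_nat n) (of_nat n) \<oplus>\<^bsub>F\<^esub> \<one>\<^bsub>F\<^esub> \<in> prime_field" by (intro generate_field.eng_add generate_field.one Suc)
  then show ?case unfolding one_F F_ops by (simp add: add.commute)
qed

text \<open>The degree in \<open>number_field\<close> is taken over the generated prime field, which
  therefore has to be known explicitly.\<close>

lemma prime_field_eq: "prime_field = {phi r r | r. r \<in> \<rat>}"
proof (intro equalityI subsetI)
  fix A assume "A \<in> {phi r r | r. r \<in> \<rat>}"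
  then obtain r where r: "A = phi r r" "r \<in> \<rat>" by blast
  obtain a b :: int where ab: "r = of_int a / of_int b" "b > 0" using r(2) by (rule Rats_cases') auto
  have int: "phi (of_int k) (of_int k) \<in> prime_field" for k
  proof (cases "k \<ge> 0")
    case True
    then show ?thesis using prime_field_nat[of "nat k"] by simp
  next
    case False
    have "\<ominus>\<^bsub>F\<^esub> phi (of_nat (nat (- k))) (of_nat (nat (- k))) = phi (of_int k) (of_int k)"
      by (rule F.minus_equality) (use False in \<open>auto simp: F_ops zero_F intro!: phi_centre rat_quad\<close>)
    then show ?thesis using generate_field.a_inv[OF prime_field_nat[of "nat (- k)"]] by simp
  qed
  have "phi (of_int b) (of_int b) \<noteq> \<zero>\<^bsub>F\<^esub>" using ab(2) by (simp add: zero_F phi_eq_iff)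
  from generate_field.m_inv[OF int this] have "inv\<^bsub>F\<^esub> phi (of_int b) (of_int b) \<in> prime_field" .
  moreover have "inv\<^bsub>F\<^esub> phi (of_int b) (of_int b) = phi (1 / of_int b) (1 / of_int b)"
    by (rule F.comm_inv_char) (use ab in \<open>auto simp: F_ops one_F intro!: phi_centre rat_quad\<close>)
  ultimately have "phi (of_int a) (of_int a) \<otimes>\<^bsub>F\<^esub> phi (1 / of_int b) (1 / of_int b) \<in> prime_field"
    using generate_field.eng_mult[OF int] by metis
  then show "A \<in> prime_field" unfolding r ab F_ops by simp
qed (use prime_field_sub in blast)

lemma number_field_F: "number_field F"
  unfolding number_field_def
proof (intro conjI allI impI field_F)
  fix n :: nat assume n: "n > 0"
  have "[n] \<cdot>\<^bsub>F\<^esub> \<one>\<^bsub>F\<^esub> = phi (of_nat n) (of_nat n)"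
  proof (induction n)
    case 0
    then show ?case by (simp add: add_pow_def zero_F)
  next
    case (Suc n)
    have "[Suc n] \<cdot>\<^bsub>F\<^esub> \<one>\<^bsub>F\<^esub> = [n] \<cdot>\<^bsub>F\<^esub> \<one>\<^bsub>F\<^esub> \<oplus>\<^bsub>F\<^esub> \<one>\<^bsub>F\<^esub>" by (simp add: add_pow_def)
    then show ?case unfolding Suc unfolding one_F F_ops by (simp add: add.commute)
  qed
  then show "[n] \<cdot>\<^bsub>F\<^esub> \<one>\<^bsub>F\<^esub> \<noteq> \<zero>\<^bsub>F\<^esub>" using n by (simp add: zero_F phi_eq_iff)
next
  let ?w = "phi (sqrt 2) (- sqrt 2)"
  have w: "?w \<in> carrier F" using quad_sqrt2[of \<rat>] by (simp add: phi_centre)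
  \<comment> \<open>The basis 1, \<surd>2 is adjoined to the zero space one vector at a
    time.\<close>
  let ?E1 = "F.line_extension prime_field \<one>\<^bsub>F\<^esub> {\<zero>\<^bsub>F\<^esub>}"
  let ?E2 = "F.line_extension prime_field ?w ?E1"
  have E1: "?E1 = {phi r r | r. r \<in> \<rat>}"
  proof -
    have "A \<in> ?E1 \<longleftrightarrow> (\<exists>r\<in>\<rat>. A = phi r r)" for A
      unfolding F.line_extension_mem_iff prime_field_eq unfolding one_F zero_F by (auto simp: F_ops)
    then show ?thesis by blast
  qed
  have E2: "?E2 = carrier F"
  proof (intro equalityI subsetI)
    fix A assume "A \<in> ?E2"
    then obtain p q where pq: "p \<in> \<rat>" "q \<in> \<rat>" "A = phi p p \<otimes>\<^bsub>F\<^esub> ?w \<oplus>\<^bsub>F\<^esub> phi q q"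
      unfolding E1 unfolding F.line_extension_mem_iff prime_field_eq by auto
    have "(q + p * sqrt 2, q - p * sqrt 2) \<in> quad \<rat>" by (rule quadI[OF pq(2,1)])
    then show "A \<in> carrier F" unfolding pq(3) F_ops using phi_centre by (simp add: add.commute)
  next
    fix A assume "A \<in> carrier F"
    then obtain x y where xy: "A = phi x y" "(x, y) \<in> quad \<rat>" by (auto elim: centreE)
    obtain p q where pq: "p \<in> \<rat>" "q \<in> \<rat>" "x = p + q * sqrt 2" "y = p - q * sqrt 2" using xy(2) by (rule quadE)
    have "A = phi q q \<otimes>\<^bsub>F\<^esub> ?w \<oplus>\<^bsub>F\<^esub> phi p p" unfolding xy F_ops by (simp add: pq add.commute)
    then show "A \<in> ?E2" unfolding E1 unfolding F.line_extension_mem_iff prime_field_eq using pq by blast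
  qed
  have "F.dimension (Suc (Suc 0)) prime_field ?E2"
  proof (intro F.Suc_dim F.zero_dim w F.one_closed)
    show "\<one>\<^bsub>F\<^esub> \<notin> {\<zero>\<^bsub>F\<^esub>}" using F.one_not_zero by simp
    show "?w \<notin> ?E1" unfolding E1 by (auto simp: phi_eq_iff)
  qed
  then show "\<exists>d. F.dimension d prime_field (carrier F)" unfolding E2 by blast
qed

lemma embedding_nat:
  fixes \<sigma> :: "complex mat \<Rightarrow> 'b :: field"
  assumes "\<sigma> \<in> ring_hom F class_ring" shows "\<sigma> (phi (of_nat n) (of_nat n)) = of_nat n"
proof (induction n)
  case 0
  then show ?case using ring_hom_class_ring(4)[OF ring_F assms] by (simp add: zero_F)
next
  case (Suc n)
  have "phi (of_nat (Suc n)) (of_nat (Suc n)) = phi (of_nat n) (of_nat n) \<oplus>\<^bsub>F\<^esub> \<one>\<^bsub>F\<^esub>"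
    unfolding one_F F_ops by (simp add: add.commute)
  then show ?case using ring_hom_class_ring(2)[OF ring_F assms, of "phi (of_nat n) (of_nat n)" "\<one>\<^bsub>F\<^esub>"]
      ring_hom_class_ring(3)[OF ring_F assms] Suc
    by (simp add: phi_centre rat_quad add.commute one_F)
qed

lemma embedding_sqrt2:
  fixes \<sigma> :: "complex mat \<Rightarrow> 'b :: field"
  assumes "\<sigma> \<in> ring_hom F class_ring" shows "(\<sigma> (phi (sqrt 2) (- sqrt 2)))\<^sup>2 = 2"
proof -
  let ?w = "phi (sqrt 2) (- sqrt 2)"
  have w: "?w \<in> carrier F" using quad_sqrt2[of \<rat>] by (simp add: phi_centre)
  have "?w \<otimes>\<^bsub>F\<^esub> ?w = phi (of_nat 2) (of_nat 2)" unfolding F_ops by simp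
  then show ?thesis
    using ring_hom_class_ring(1)[OF ring_F assms w w] embedding_nat[OF assms, of 2] by (simp add: power2_eq_square)
qed

text \<open>An embedding fixes the rational numbers and sends \<surd>2 to a complex square root of
  2, which is real.\<close>

lemma totally_real_F: "totally_real_field F"
  unfolding totally_real_field_def
proof (intro conjI ballI subsetI number_field_F)
  fix \<sigma> z assume s: "\<sigma> \<in> complex_embeddings F" and "z \<in> \<sigma> ` carrier F"
  then obtain x y where xy: "z = \<sigma> (phi x y)" "(x, y) \<in> quad \<rat>" by (auto elim: centreE)
  obtain p q where pq: "p \<in> \<rat>" "q \<in> \<rat>" "x = p + q * sqrt 2" "y = p - q * sqrt 2" using xy(2) by (rule quadE)
  note h = ring_hom_class_ring[OF ring_F s]
  have rat: "\<sigma> (phi r r) \<in> \<real>" if r: "r \<in> \<rat>" for r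
  proof -
    obtain a b :: int where ab: "r = of_int a / of_int b" "b > 0" using r by (rule Rats_cases') auto
    have c: "phi (of_int k) (of_int k) \<in> carrier F" for k by (simp add: phi_centre rat_quad)
    have int: "\<sigma> (phi (of_int k) (of_int k)) = of_int k" for k
    proof (cases "k \<ge> 0")
      case True
      then show ?thesis using embedding_nat[OF s, of "nat k"] by simp
    next
      case False
      have "\<sigma> (phi (of_int k) (of_int k) \<oplus>\<^bsub>F\<^esub> phi (of_nat (nat (- k))) (of_nat (nat (- k)))) = 0"
        unfolding F_ops using False h(4) by (simp add: zero_F)
      then have "\<sigma> (phi (of_int k) (of_int k)) + of_nat (nat (- k)) = 0"
        using h(2)[OF c, of "phi (of_nat (nat (- k))) (of_nat (nat (- k)))"] embedding_nat[OF s, of "nat (- k)"]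
        by (simp add: phi_centre rat_quad)
      then show ?thesis using False by (simp add: add_eq_0_iff2)
    qed
    have "phi r r \<otimes>\<^bsub>F\<^esub> phi (of_int b) (of_int b) = phi (of_int a) (of_int a)" unfolding F_ops using ab by simp
    then have "\<sigma> (phi r r) * of_int b = of_int a"
      using h(1)[of "phi r r" "phi (of_int b) (of_int b)"] c int r by (simp add: phi_centre rat_quad)
    then have "\<sigma> (phi r r) = of_int a / of_int b" using ab(2) by (simp add: field_simps)
    then show ?thesis by simp
  qed
  let ?w = "phi (sqrt 2) (- sqrt 2)"
  have w: "?w \<in> carrier F" using quad_sqrt2[of \<rat>] by (simp add: phi_centre)
  have "\<sigma> ?w \<in> \<real>"
  proof -
    have "(\<sigma> ?w)\<^sup>2 = (complex_of_real (sqrt 2))\<^sup>2" using embedding_sqrt2[OF s] by (simp flip: of_real_power)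
    then have "\<sigma> ?w = complex_of_real (sqrt 2) \<or> \<sigma> ?w = - complex_of_real (sqrt 2)" by (simp only: power2_eq_iff)
    then show ?thesis by auto
  qed
  moreover have "phi x y = phi q q \<otimes>\<^bsub>F\<^esub> ?w \<oplus>\<^bsub>F\<^esub> phi p p" unfolding F_ops by (simp add: pq add.commute)
  then have "z = \<sigma> (phi q q) * \<sigma> ?w + \<sigma> (phi p p)"
    using h(1)[of "phi q q" ?w] h(2)[of "phi q q \<otimes>\<^bsub>F\<^esub> ?w" "phi p p"] w pq F.m_closed[of "phi q q" ?w] unfolding xy
    by (simp add: phi_centre rat_quad)
  ultimately show "z \<in> \<real>" using rat pq by simp
qed

abbreviation qi :: "complex mat" where "qi \<equiv> rho \<i> 0 \<i> 0"
abbreviation qj :: "complex mat" where "qj \<equiv> rho 0 1 0 1"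

lemma squares: "qi * qi = phi (-1) (-1)" "qj * qj = phi \<beta>1 \<beta>2" "qi * qj = rho 0 (- \<i>) 0 (- \<i>)" "qj * qi = rho 0 \<i> 0 \<i>"
  by (simp_all add: rho_mult phi_def)

lemma quaternion_algebra_K: "quaternion_algebra K centre qi qj"
  unfolding quaternion_algebra_def
proof (intro conjI ballI)
  interpret K: ring K by (rule ring_K)
  show "ring K" by (rule ring_K)
  show "subfield centre K" by (rule K.subfield_iff(1)[OF field_F centre_sub])
  show ij: "qi \<in> carrier K" "qj \<in> carrier K"
    unfolding End_Q_eq rho_quaternions_iff using gauss_const[OF rat_or(2)] by auto
  show "a \<otimes>\<^bsub>K\<^esub> x = x \<otimes>\<^bsub>K\<^esub> a" if "a \<in> centre" "x \<in> carrier K" for a x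
    using that unfolding End_Q_eq by (elim centreE quaternionsE) (simp add: K_simps phi_rho rho_phi)
  have "(\<beta>1, \<beta>2) \<in> quad \<rat>" using \<beta>_quad quad_int_subset by auto
  then show "qi \<otimes>\<^bsub>K\<^esub> qi \<in> centre - {\<zero>\<^bsub>K\<^esub>}" "qj \<otimes>\<^bsub>K\<^esub> qj \<in> centre - {\<zero>\<^bsub>K\<^esub>}"
    using \<beta>_pos rat_quad[of "-1"] by (auto simp: K_simps squares phi_zero[symmetric] phi_eq_iff phi_centre)
  show "qi \<otimes>\<^bsub>K\<^esub> qj = \<ominus>\<^bsub>K\<^esub> (qj \<otimes>\<^bsub>K\<^esub> qi)"
  proof (rule K.minus_equality[symmetric])
    show "qi \<otimes>\<^bsub>K\<^esub> qj \<oplus>\<^bsub>K\<^esub> qj \<otimes>\<^bsub>K\<^esub> qi = \<zero>\<^bsub>K\<^esub>"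
      by (simp add: K_simps squares rho_add rho_zero)
  qed (use ij in auto)
  fix x assume "x \<in> carrier K"
  then obtain u v s t where x: "x = rho u v s t" and us: "(u, s) \<in> gauss \<rat>" and vt: "(v, t) \<in> gauss \<rat>"
    unfolding End_Q_eq by (rule quaternionsE)
  \<comment> \<open>The minus sign comes from \<open>i j = - j i\<close>: in the form
    \<open>u + j v\<close> the element \<open>d i j\<close> has \<open>v = - d \<i>\<close>.\<close>
  have comb: "phi a a' \<oplus>\<^bsub>K\<^esub> phi b b' \<otimes>\<^bsub>K\<^esub> qi \<oplus>\<^bsub>K\<^esub> phi c c' \<otimes>\<^bsub>K\<^esub> qj \<oplus>\<^bsub>K\<^esub> phi d d' \<otimes>\<^bsub>K\<^esub> (qi \<otimes>\<^bsub>K\<^esub> qj)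
      = rho (Complex a b) (Complex c (- d)) (Complex a' b') (Complex c' (- d'))" for a a' b b' c c' d d'
    by (simp add: K_simps squares phi_rho) (simp add: phi_def rho_add rho_eq_iff Complex_eq algebra_simps)
  let ?P = "\<lambda>(a, b, c, d). a \<in> centre \<and> b \<in> centre \<and> c \<in> centre \<and> d \<in> centre \<and>
        x = a \<oplus>\<^bsub>K\<^esub> b \<otimes>\<^bsub>K\<^esub> qi \<oplus>\<^bsub>K\<^esub> c \<otimes>\<^bsub>K\<^esub> qj \<oplus>\<^bsub>K\<^esub> d \<otimes>\<^bsub>K\<^esub> (qi \<otimes>\<^bsub>K\<^esub> qj)"
  show "\<exists>!p. ?P p"
  proof (rule ex1I[of _ "(phi (Re u) (Re s), phi (Im u) (Im s), phi (Re v) (Re t), phi (- Im v) (- Im t))"])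
    have "x = rho (Complex (Re u) (Im u)) (Complex (Re v) (- (- Im v))) (Complex (Re s) (Im s)) (Complex (Re t) (- (- Im t)))"
      unfolding x by simp
    then show "?P (phi (Re u) (Re s), phi (Im u) (Im s), phi (Re v) (Re t), phi (- Im v) (- Im t))"
      unfolding comb[symmetric] prod.case using us vt quad_closed(3)[OF rat_or(2)]
      by (auto simp: gauss_def intro!: phi_centre)
    fix p assume p: "?P p"
    obtain a b c d where abcd: "p = (a, b, c, d)" by (rule prod_cases4)
    obtain a1 a2 where a: "a = phi a1 a2" using p unfolding abcd by (auto elim: centreE)
    obtain b1 b2 where b: "b = phi b1 b2" using p unfolding abcd by (auto elim: centreE)
    obtain c1 c2 where c: "c = phi c1 c2" using p unfolding abcd by (auto elim: centreE)
    obtain d1 d2 where d: "d = phi d1 d2" using p unfolding abcd by (auto elim: centreE)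
    have "rho u v s t = rho (Complex a1 b1) (Complex c1 (- d1)) (Complex a2 b2) (Complex c2 (- d2))"
      using p unfolding abcd x prod.case a b c d comb by blast
    then show "p = (phi (Re u) (Re s), phi (Im u) (Im s), phi (Re v) (Re t), phi (- Im v) (- Im t))"
      unfolding rho_eq_iff abcd a b c d by simp
  qed
qed

text \<open>Every real embedding sends \<open>i i\<close> to -1 and \<open>j j\<close> to 3 plus a
  square root of 2, which is positive; so \<open>real_quat_split\<close> applies.\<close>

lemma totally_indefinite_K: "totally_indefinite_quaternion_algebra K centre qi qj"
  unfolding totally_indefinite_quaternion_algebra_def
proof (intro conjI ballI quaternion_algebra_K totally_real_F)
  fix \<sigma> :: "complex mat \<Rightarrow> real" assume s: "\<sigma> \<in> real_embeddings F"
  note h = ring_hom_class_ring[OF ring_F s]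
  have "\<sigma> (phi (-1) (-1)) = -1"
  proof -
    have "\<sigma> (phi (-1) (-1) \<oplus>\<^bsub>F\<^esub> \<one>\<^bsub>F\<^esub>) = \<sigma> (phi (-1) (-1)) + 1"
      using h(2)[of "phi (-1) (-1)" "\<one>\<^bsub>F\<^esub>"] h(3) rat_quad[of "-1"] by (simp add: phi_centre rat_quad one_F)
    moreover have "phi (-1) (-1) \<oplus>\<^bsub>F\<^esub> \<one>\<^bsub>F\<^esub> = \<zero>\<^bsub>F\<^esub>" unfolding one_F zero_F F_ops by simp
    ultimately show ?thesis using h(4) by simp
  qed
  moreover have "\<sigma> (phi \<beta>1 \<beta>2) > 0"
  proof -
    let ?w = "phi (sqrt 2) (- sqrt 2)"
    have "phi \<beta>1 \<beta>2 = phi (of_nat 3) (of_nat 3) \<oplus>\<^bsub>F\<^esub> ?w" unfolding F_ops by (simp add: \<beta>1_def \<beta>2_def)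
    then have "\<sigma> (phi \<beta>1 \<beta>2) = 3 + \<sigma> ?w"
      using h(2)[of "phi (of_nat 3) (of_nat 3)" ?w] embedding_nat[OF s, of 3] quad_sqrt2[of \<rat>]
      by (simp add: phi_centre rat_quad)
    moreover have "\<bar>\<sigma> ?w\<bar> < 3"
    proof (rule ccontr)
      assume "\<not> ?thesis"
      then have "3\<^sup>2 \<le> \<bar>\<sigma> ?w\<bar>\<^sup>2" by (intro power_mono) auto
      then show False using embedding_sqrt2[OF s] by simp
    qed
    ultimately show ?thesis by linarith
  qed
  ultimately show "scalar_extension K qi qj \<sigma> \<simeq> ring_mat TYPE(real) 2 ()"
    unfolding scalar_extension_def K_simps squares using real_quat_split by simp
qed

section \<open>The polarization\<close>

text \<open>The weights make the imaginary part on \<open>L\<close> the trace to \<rat> of the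
  imaginary part of \<open>u cnj u' + \<beta> v cnj v'\<close>, hence integral; the factor
  \<open>1 / \<delta>\<close> compensates the twist by \<open>1 + j \<tau>\<close>.\<close>

definition H :: "complex mat" where
  "H = mat 4 4 (\<lambda>(i, j). if i = j then of_real ([1, \<beta>1, 1 / \<delta>, \<beta>2 / \<delta>] ! i) else 0)"

lemma herm_form_vec4: "herm_form H (vec4 a b c d) (vec4 a' b' c' d')
    = a * cnj a' + of_real \<beta>1 * (b * cnj b') + of_real (1 / \<delta>) * (c * cnj c' + of_real \<beta>2 * (d * cnj d'))"
proof -
  have Hv: "H *\<^sub>v vec4 a b c d = vec4 a (of_real \<beta>1 * b) (of_real (1 / \<delta>) * c) (of_real (\<beta>2 / \<delta>) * d)" (is "?l = ?r")
  proof (rule eq_vecI)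
    fix i assume "i < dim_vec ?r"
    then have i: "i < 4" by (simp add: vec4_def)
    have Hc: "H \<in> carrier_mat 4 4" by (simp add: H_def)
    have "?l $ i = (\<Sum>k<4. H $$ (i, k) * vec4 a b c d $ k)" by (rule index_mult_mat_vec_sum[OF Hc vec4_carrier i])
    then show "?l $ i = ?r $ i"
      unfolding sum_4 using less_4_cases[OF i] by (elim disjE) (simp_all add: H_def vec4_def)
  qed (simp add: H_def vec4_def)
  have sp: "vec4 x y z w \<bullet>c vec4 a' b' c' d' = x * cnj a' + y * cnj b' + z * cnj c' + w * cnj d'" for x y z w
  proof -
    have d: "dim_vec (conjugate (vec4 a' b' c' d')) = 4" by (simp add: vec4_def)
    have "vec4 x y z w \<bullet>c vec4 a' b' c' d' = (\<Sum>k<4. vec4 x y z w $ k * cnj (vec4 a' b' c' d' $ k))"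
      unfolding scalar_prod_def d lessThan_atLeast0 by (intro sum.cong refl) (simp add: vec4_def)
    then show ?thesis unfolding sum_4 by (simp add: vec4_def)
  qed
  show ?thesis unfolding herm_form_def Hv sp by (simp add: algebra_simps add_divide_distrib)
qed

text \<open>Right multiplication by \<open>1 + j \<tau>\<close> scales the alternating form by its
  reduced norm.\<close>

lemma second_place_form:
  "Im ((s + of_real \<beta>2 * cnj t * \<tau>) * cnj (s' + of_real \<beta>2 * cnj t' * \<tau>)
      + of_real \<beta>2 * ((t + cnj s * \<tau>) * cnj (t' + cnj s' * \<tau>)))
    = \<delta> * Im (s * cnj s' + of_real \<beta>2 * (t * cnj t'))" (is "Im ?X = _")
proof -
  define Z where "Z = s * cnj s' + of_real \<beta>2 * (t * cnj t')"
  define Y where "Y = s * t' * cnj \<tau> + cnj t * cnj s' * \<tau>"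
  \<comment> \<open>The terms with \<open>Y\<close> are real, and conjugating \<open>Z\<close>
    changes the sign of its imaginary part; this leaves the factor
    \<open>1 - \<beta>2 nt\<close>.\<close>
  have "?X = Z + of_real \<beta>2 * (\<tau> * cnj \<tau>) * cnj Z + of_real \<beta>2 * (Y + cnj Y)"
    by (simp add: Z_def Y_def algebra_simps)
  then have "Im ?X = Im (Z + of_real \<beta>2 * of_real nt * cnj Z + of_real \<beta>2 * (Y + cnj Y))"
    unfolding tau_cnj by simp
  also have "\<dots> = \<delta> * Im Z" unfolding \<delta>_def complex_add_cnj by (simp add: algebra_simps)
  finally show ?thesis unfolding Z_def .
qed

lemma polarization_H: "polarization 4 L H"
  unfolding polarization_def
proof (intro conjI ballI impI)
  show "H \<in> carrier_mat 4 4" by (simp add: H_def)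
  fix v :: "complex vec" assume "v \<in> carrier_vec 4"
  then obtain a b c d where v: "v = vec4 a b c d" by (rule vec4_cases)
  show "Re (herm_form H v v) > 0" if "v \<noteq> 0\<^sub>v 4"
  proof -
    have "Re (herm_form H v v) = (cmod a)\<^sup>2 + \<beta>1 * (cmod b)\<^sup>2 + 1 / \<delta> * ((cmod c)\<^sup>2 + \<beta>2 * (cmod d)\<^sup>2)"
      unfolding v herm_form_vec4 complex_norm_square[symmetric]
      by (simp flip: of_real_add of_real_mult of_real_power of_real_divide)
    moreover have "a \<noteq> 0 \<or> b \<noteq> 0 \<or> c \<noteq> 0 \<or> d \<noteq> 0" using that by (auto simp: v vec4_zero)
    moreover have "0 \<le> (cmod a)\<^sup>2" "0 \<le> \<beta>1 * (cmod b)\<^sup>2" "0 \<le> 1 / \<delta> * (cmod c)\<^sup>2" "0 \<le> 1 / \<delta> * (\<beta>2 * (cmod d)\<^sup>2)"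
      using \<beta>_pos \<delta>_pos by auto
    moreover have "a \<noteq> 0 \<Longrightarrow> 0 < (cmod a)\<^sup>2" "b \<noteq> 0 \<Longrightarrow> 0 < \<beta>1 * (cmod b)\<^sup>2"
      "c \<noteq> 0 \<Longrightarrow> 0 < 1 / \<delta> * (cmod c)\<^sup>2" "d \<noteq> 0 \<Longrightarrow> 0 < 1 / \<delta> * (\<beta>2 * (cmod d)\<^sup>2)"
      using \<beta>_pos \<delta>_pos by auto
    ultimately show ?thesis unfolding distrib_left by linarith
  qed
  fix w :: "complex vec" assume "w \<in> carrier_vec 4"
  then obtain a' b' c' d' where w: "w = vec4 a' b' c' d'" by (rule vec4_cases)
  show "herm_form H w v = cnj (herm_form H v w)"
    unfolding v w herm_form_vec4 by (simp add: algebra_simps)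
next
  fix v w assume "v \<in> L" "w \<in> L"
  then obtain u1 v1 s1 t1 u2 v2 s2 t2 where v: "v = Lam u1 v1 s1 t1" "(u1, s1) \<in> gauss \<int>" "(v1, t1) \<in> gauss \<int>"
    and w: "w = Lam u2 v2 s2 t2" "(u2, s2) \<in> gauss \<int>" "(v2, t2) \<in> gauss \<int>"
    unfolding L_iff by blast
  note R = rat_or(1)
  have Im_mult: "Im (complex_of_real r * z) = r * Im z" for r z by simp
  let ?Z1 = "u1 * cnj u2 + of_real \<beta>1 * (v1 * cnj v2)" and ?Z2 = "s1 * cnj s2 + of_real \<beta>2 * (t1 * cnj t2)"
  have "(?Z1, ?Z2) \<in> gauss \<int>"
  proof -
    have a: "(u1 * cnj u2, s1 * cnj s2) \<in> gauss \<int>" by (rule gauss_closed(4)[OF R v(2) gauss_closed(5)[OF R w(2) w(2)]])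
    have b: "(v1 * cnj v2, t1 * cnj t2) \<in> gauss \<int>" by (rule gauss_closed(4)[OF R v(3) gauss_closed(5)[OF R w(3) w(3)]])
    show ?thesis by (rule gauss_closed(1)[OF R a gauss_closed(4)[OF R \<beta>_gauss[OF R] b]])
  qed
  then obtain p q where pq: "p \<in> \<int>" "Im ?Z1 = p + q * sqrt 2" "Im ?Z2 = p - q * sqrt 2"
    unfolding gauss_def by (auto elim: quadE)
  have "Im (herm_form H v w) = Im ?Z1 + 1 / \<delta> * Im ((s1 + of_real \<beta>2 * cnj t1 * \<tau>) * cnj (s2 + of_real \<beta>2 * cnj t2 * \<tau>)
      + of_real \<beta>2 * ((t1 + cnj s1 * \<tau>) * cnj (t2 + cnj s2 * \<tau>)))"
    unfolding v(1) w(1) Lam_def herm_form_vec4 plus_complex.sel(2) Im_mult ..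
  also have "\<dots> = Im ?Z1 + Im ?Z2" unfolding second_place_form using \<delta>_pos by simp
  also have "\<dots> = 2 * p" unfolding pq by simp
  finally show "Im (herm_form H v w) \<in> \<int>" using pq(1) by simp
qed

lemma simple_variety: "simple_abelian_variety 4 L"
  by (rule simple_if_no_idempotents[OF polarization_H]) (use quaternion_idempotent End_Q_eq in auto)

text \<open>
  The element \<open>(1 + \<surd>2) + 2 i + \<surd>2 j\<close> has reduced norm \<open>1\<close> and reduced trace \<open>2 (1 \<plusminus> \<surd>2)\<close>.
  Its eigenvalues at the second place lie on the unit circle, while those at the first place
  are real and different from \<open>\<plusminus>1\<close>; by division, a root of unity among the former would make
  the latter roots of unity as well.
\<close>

definition salem :: "complex mat" where
  "salem = rho (Complex (1 + sqrt 2) 2) (of_real (sqrt 2)) (Complex (1 - sqrt 2) 2) (- of_real (sqrt 2))"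

lemma salem_int: "salem \<in> quaternions \<int>"
proof -
  have "(1 + sqrt 2, 1 - sqrt 2) \<in> quad \<int>" using quadI[of 1 \<int> 1] by simp
  moreover have "(2, 2) \<in> quad \<int>" using quad_const[of 2 \<int>] by simp
  moreover have "(sqrt 2, - sqrt 2) \<in> quad \<int>" "(0, 0) \<in> quad \<int>" using quad_sqrt2[of \<int>] quad_const[of 0 \<int>] by simp_all
  ultimately show ?thesis by (simp add: salem_def rho_quaternions_iff gauss_def)
qed

lemma salem_mats: "salem \<in> lattice_mats"
  using salem_int quaternions_int_lattice_mats by blast

lemma salem_unit_eigenvalue:
  obtains z w where "eigenvector salem w z" "cmod z = 1"
proof
  let ?a = "1 - sqrt 2"
  \<comment> \<open>A root of \<open>x^2 - 2 (1 - \<surd>2) x + 1\<close>, the reduced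
    characteristic polynomial at the second place, whose discriminant is negative.\<close>
  let ?z = "Complex ?a (sqrt (1 - ?a\<^sup>2))"
  have a1: "?a\<^sup>2 \<le> 1" using sqrt_2_bounds by (intro abs_square_le_1[THEN iffD2]) auto
  show "cmod ?z = 1" using a1 by (simp add: cmod_def)
  \<comment> \<open>For a two-by-two block with first row \<open>(s, b)\<close> and eigenvalue
    \<open>z\<close>, the vector \<open>(b, z - s)\<close> is an eigenvector if \<open>b\<close> is
    nonzero.\<close>
  let ?w = "vec4 0 0 (- of_real (\<beta>2 * sqrt 2)) (?z - Complex ?a 2)"
  show "eigenvector salem ?w ?z"
    unfolding eigenvector_def
  proof (intro conjI)
    show "?w \<in> carrier_vec (dim_row salem)" by (simp add: salem_def rho_def vec4_def)
    have "sqrt 2 \<noteq> 0" by simp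
    then show "?w \<noteq> 0\<^sub>v (dim_row salem)" using \<beta>_pos by (simp add: salem_def rho_def vec4_zero vec4_eq_iff)
    have sq: "(sqrt (1 - ?a\<^sup>2))\<^sup>2 = 1 - ?a\<^sup>2" using a1 by simp
    show "salem *\<^sub>v ?w = ?z \<cdot>\<^sub>v ?w"
      unfolding salem_def rho_vec4 vec4_smult vec4_eq_iff
      using sq by (auto simp: complex_eq_iff \<beta>2_def power2_eq_square algebra_simps)
  qed
qed

lemma salem_real_eigenvalue:
  obtains y w where "eigenvector salem w (complex_of_real y)" "y > 1"
proof
  let ?a = "1 + sqrt 2"
  \<comment> \<open>The larger root of \<open>x^2 - 2 (1 + \<surd>2) x + 1\<close>, the reduced
    characteristic polynomial at the first place.\<close>
  let ?y = "?a + sqrt (?a\<^sup>2 - 1)"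
  have "1 * 1 \<le> ?a * ?a" using sqrt_2_bounds by (intro mult_mono) auto
  then have a1: "1 \<le> ?a\<^sup>2" by (simp add: power2_eq_square)
  then have "0 \<le> sqrt (?a\<^sup>2 - 1)" by simp
  then show "?y > 1" using sqrt_2_bounds by linarith
  let ?w = "vec4 (of_real (\<beta>1 * sqrt 2)) (of_real ?y - Complex ?a 2) 0 0"
  show "eigenvector salem ?w (complex_of_real ?y)"
    unfolding eigenvector_def
  proof (intro conjI)
    show "?w \<in> carrier_vec (dim_row salem)" by (simp add: salem_def rho_def vec4_def)
    have "sqrt 2 \<noteq> 0" by simp
    then show "?w \<noteq> 0\<^sub>v (dim_row salem)" using \<beta>_pos by (simp add: salem_def rho_def vec4_zero vec4_eq_iff)
    have sq: "(sqrt (?a\<^sup>2 - 1))\<^sup>2 = ?a\<^sup>2 - 1" using a1 by simp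
    show "salem *\<^sub>v ?w = complex_of_real ?y \<cdot>\<^sub>v ?w"
      unfolding salem_def rho_vec4 vec4_smult vec4_eq_iff
      using sq by (auto simp: complex_eq_iff \<beta>1_def power2_eq_square algebra_simps)
  qed
qed

lemma unit_eigenvalue_not_root_of_unity:
  assumes w: "eigenvector salem w z" shows "\<not> root_of_unity z"
proof
  assume "root_of_unity z"
  then obtain k where k: "k \<ge> 1" "z ^ k = 1" by (auto simp: root_of_unity_def)
  have Sc: "salem \<in> carrier_mat 4 4" by (simp add: salem_def)
  have Sk: "salem ^\<^sub>m k \<in> carrier_mat 4 4" using Sc by simp
  have dr: "dim_row salem = 4" using Sc by simp
  have wc: "w \<in> carrier_vec 4" "w \<noteq> 0\<^sub>v 4" using w by (auto simp: eigenvector_def dr)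
  let ?D = "1\<^sub>m 4 - salem ^\<^sub>m k"
  have D: "?D \<in> quaternions \<rat>"
    using minus_lattice_mats[OF one_lattice_mats pow_lattice_mats[OF salem_mats]] lattice_mats_End_Q End_Q_eq by blast
  have kill: "?D *\<^sub>v x = (1 - c ^ k) \<cdot>\<^sub>v x" if x: "eigenvector salem x c" for x c
  proof -
    have xc: "x \<in> carrier_vec 4" using x by (auto simp: eigenvector_def dr)
    have "?D *\<^sub>v x = x - c ^ k \<cdot>\<^sub>v x"
      using eigenvector_pow[OF Sc x, of k] xc by (simp add: minus_mult_distrib_mat_vec[OF one_carrier_mat Sk xc])
    then show ?thesis using xc by (auto simp: algebra_simps)
  qed
  have "?D *\<^sub>v w = 0\<^sub>v 4" using kill[OF w] k(2) wc by auto
  \<comment> \<open>A singular element of the division algebra is zero, so the eigenvalue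
    \<open>y > 1\<close> would be a \<open>k\<close>-th root of unity too.\<close>
  then have D0: "?D = 0\<^sub>m 4 4" using quaternion_kernel[OF D _ wc(1)] wc(2) by blast
  obtain y x where y: "eigenvector salem x (complex_of_real y)" "y > 1" by (rule salem_real_eigenvalue)
  have xc: "x \<in> carrier_vec 4" "x \<noteq> 0\<^sub>v 4" using y by (auto simp: eigenvector_def dr)
  have "(1 - complex_of_real y ^ k) \<cdot>\<^sub>v x = 0\<^sub>m 4 4 *\<^sub>v x" using kill[OF y(1)] D0 by simp
  also have "\<dots> = 0\<^sub>v 4" using xc(1) by auto
  finally have z: "(1 - complex_of_real y ^ k) \<cdot>\<^sub>v x = 0\<^sub>v 4" .
  obtain i where i: "i < 4" "x $ i \<noteq> 0" using xc by (metis carrier_vecD eq_vecI index_zero_vec(1) index_zero_vec(2))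
  have "((1 - complex_of_real y ^ k) \<cdot>\<^sub>v x) $ i = 0" using z i by simp
  then have "complex_of_real (y ^ k) = complex_of_real 1" using i xc by simp
  then have "y ^ k = 1" by (simp only: of_real_eq_iff)
  moreover have "y ^ k > 1" using y(2) k(1) by (intro one_less_power) auto
  ultimately show False by simp
qed

end

lemma indefinite_example:
  "\<exists>(g::nat) (L :: complex vec set). simple_abelian_variety g L \<and>
     (\<exists>F i j. totally_indefinite_quaternion_algebra (End_Q g L) F i j) \<and>
     (\<exists>f \<in> carrier (End_ring g L). \<exists>z. analytic_eigenvalue g L f z \<and> cmod z = 1 \<and> \<not> root_of_unity z)"
proof -
  obtain \<xi> :: real where "0 < \<xi>" "\<xi> < 1 / 2"
    "\<And>a b c d. a \<in> fst ` quad \<rat> \<Longrightarrow> b \<in> fst ` quad \<rat> \<Longrightarrow> c \<in> fst ` quad \<rat> \<Longrightarrow> d \<in> fst ` quad \<rat> \<Longrightarrow>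
       a + b * \<xi> + c * \<xi> ^ 2 + d * \<xi> ^ 4 = 0 \<Longrightarrow> a = 0 \<and> b = 0 \<and> c = 0 \<and> d = 0"
    by (rule exists_generic_parameter) blast
  then interpret quaternionic_lattice \<xi> by unfold_locales
  obtain z w where z: "eigenvector salem w z" "cmod z = 1" by (rule salem_unit_eigenvalue)
  have "analytic_eigenvalue 4 L (endo salem) z"
    unfolding analytic_rep_endo[OF salem_mats] eigenvalue_def using z(1) by blast
  then show ?thesis
    using simple_variety totally_indefinite_K endo_End[OF salem_mats] z(2) unit_eigenvalue_not_root_of_unity[OF z(1)]
    by blast
qed

theorem theorem1:
  shows
   "(\<forall>(g::nat) (L :: complex vec set) f.
       simple_abelian_variety g L \<and>
       (totally_real_field (End_Q g L) \<or>
        (\<exists>F i j. totally_definite_quaternion_algebra (End_Q g L) F i j) \<or>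
        CM_field (End_Q g L)) \<and>
       f \<in> carrier (End_ring g L) \<and> f \<noteq> \<zero>\<^bsub>End_ring g L\<^esub>
     \<longrightarrow>
       (totally_real_field (End_Q g L) \<longrightarrow>
          (if f = \<one>\<^bsub>End_ring g L\<^esub> \<or> f = \<ominus>\<^bsub>End_ring g L\<^esub> \<one>\<^bsub>End_ring g L\<^esub>
           then periodic_fun (fix_fun g L f)
           else grows_exponentially (fix_fun g L f))) \<and>
       (\<forall>F i j a b c d (\<sigma> :: complex mat \<Rightarrow> real) t s.
          totally_definite_quaternion_algebra (End_Q g L) F i j \<and>
          a \<in> F \<and> b \<in> F \<and> c \<in> F \<and> d \<in> F \<and>
          analytic_rep g L f =
            a \<oplus>\<^bsub>End_Q g L\<^esub> b \<otimes>\<^bsub>End_Q g L\<^esub> i \<oplus>\<^bsub>End_Q g L\<^esub> c \<otimes>\<^bsub>End_Q g L\<^esub> j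
              \<oplus>\<^bsub>End_Q g L\<^esub> d \<otimes>\<^bsub>End_Q g L\<^esub> (i \<otimes>\<^bsub>End_Q g L\<^esub> j) \<and>
          t = b [^]\<^bsub>End_Q g L\<^esub> (2::nat) \<otimes>\<^bsub>End_Q g L\<^esub> (i \<otimes>\<^bsub>End_Q g L\<^esub> i)
                \<oplus>\<^bsub>End_Q g L\<^esub> c [^]\<^bsub>End_Q g L\<^esub> (2::nat) \<otimes>\<^bsub>End_Q g L\<^esub> (j \<otimes>\<^bsub>End_Q g L\<^esub> j)
                \<ominus>\<^bsub>End_Q g L\<^esub> d [^]\<^bsub>End_Q g L\<^esub> (2::nat)
                  \<otimes>\<^bsub>End_Q g L\<^esub> (i \<otimes>\<^bsub>End_Q g L\<^esub> i) \<otimes>\<^bsub>End_Q g L\<^esub> (j \<otimes>\<^bsub>End_Q g L\<^esub> j) \<and>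
          \<sigma> \<in> real_embeddings (End_Q g L\<lparr>carrier := F\<rparr>) \<and>
          s ^ 2 = complex_of_real (\<sigma> t) \<longrightarrow>
          (if cmod (complex_of_real (\<sigma> a) + s) = 1
           then periodic_fun (fix_fun g L f)
           else grows_exponentially (fix_fun g L f))) \<and>
       (\<forall>\<sigma>. CM_field (End_Q g L) \<and> \<sigma> \<in> complex_embeddings (End_Q g L) \<longrightarrow>
          (if cmod (\<sigma> (analytic_rep g L f)) = 1
           then periodic_fun (fix_fun g L f)
           else grows_exponentially (fix_fun g L f))) \<and>
       (periodic_fun (fix_fun g L f) \<longrightarrow>
          (\<forall>z. analytic_eigenvalue g L f z \<longrightarrow> root_of_unity z)) \<and>
       (grows_exponentially (fix_fun g L f) \<longrightarrow>
          (\<forall>z. analytic_eigenvalue g L f z \<longrightarrow> cmod z \<noteq> 1)))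
    \<and>
    (\<exists>(g::nat) (L :: complex vec set).
       simple_abelian_variety g L \<and>
       (\<exists>F i j. totally_indefinite_quaternion_algebra (End_Q g L) F i j) \<and>
       (\<exists>f \<in> carrier (End_ring g L). \<exists>z.
          analytic_eigenvalue g L f z \<and> cmod z = 1 \<and> \<not> root_of_unity z))"
proof (rule conjI[OF _ indefinite_example], intro allI impI, elim conjE, intro conjI)
  fix g L and f :: "complex vec set \<Rightarrow> complex vec set"
  assume "simple_abelian_variety g L"
    and "totally_real_field (End_Q g L) \<or>
      (\<exists>F i j. totally_definite_quaternion_algebra (End_Q g L) F i j) \<or> CM_field (End_Q g L)"
    and "f \<in> carrier (End_ring g L)" "f \<noteq> \<zero>\<^bsub>End_ring g L\<^esub>"
  note fix_fun = fix_fun_cases[OF this]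
  show "totally_real_field (End_Q g L) \<longrightarrow>
      (if f = \<one>\<^bsub>End_ring g L\<^esub> \<or> f = \<ominus>\<^bsub>End_ring g L\<^esub> \<one>\<^bsub>End_ring g L\<^esub>
       then periodic_fun (fix_fun g L f) else grows_exponentially (fix_fun g L f))"
    by (rule fix_fun(1))
  show "\<forall>\<sigma>. CM_field (End_Q g L) \<and> \<sigma> \<in> complex_embeddings (End_Q g L) \<longrightarrow>
      (if cmod (\<sigma> (analytic_rep g L f)) = 1
       then periodic_fun (fix_fun g L f) else grows_exponentially (fix_fun g L f))"
    by (intro allI impI, rule fix_fun(3))
  show "periodic_fun (fix_fun g L f) \<longrightarrow> (\<forall>z. analytic_eigenvalue g L f z \<longrightarrow> root_of_unity z)"
    by (rule fix_fun(4))
  show "grows_exponentially (fix_fun g L f) \<longrightarrow> (\<forall>z. analytic_eigenvalue g L f z \<longrightarrow> cmod z \<noteq> 1)"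
    by (rule fix_fun(5))
qed (intro allI impI, erule (3) fix_fun_cases(2))

end
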